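(* Let $q\in(0,1]$ and let $F_1$ and $F_2$ be non-bipartite graphs, each of which contains a critical edge, such that $\chi(F_1)+\chi(F_2)\geq 7$. Then there exists $t_0=t_0(F_1,F_2,q)$ such that if $H_1$ is a $t_1$-hairy $F_1$ and $H_2$ is a $t_2$-hairy $F_2$ with $t_1,t_2\geq t_0$ and \[\min\{v(H_1),v(H_2)\}\geq q\cdot\max\{v(H_1),v(H_2)\},\] then $(H_1,H_2)$ is a bonbon pair.
   Context: All graphs are finite and simple; $v(H)=|V(H)|$, $e(H)=|E(H)|$, $k(H)$ is the number of connected components of $H$, $\chi(H)$ is the chromatic number, and $\overline{G}$ is the complement of $G$. An edge $e$ of a graph $F$ is critical if $\chi(F-e)<\chi(F)$ (removing the edge but not its endpoints). For $t\geq 0$, a $t$-hairy $F$ is a graph obtained from $F$ by adding $t$ edges, one at a time, such that each added edge has exactly one endpoint in $V(F)$ (the other endpoint being a new vertex). For graphs $H,G$ with $v(H)\le v(G)$, the injective homomorphism density $t_{\mathrm{inj}}(H,G)$ is the probability that a uniformly random injective map $V(H)\to V(G)$ maps every edge of $H$ to an edge of $G$. A Turán graph with $r$ parts on $n$ vertices is the complete $r$-partite graph whose parts have sizes $\lfloor n/r\rfloor$ or $\lceil n/r\rceil$. A pair $(H_1,H_2)$ of non-empty graphs is a bonbon pair if there exists $n_0$ such that for every $n\ge n_0$, every $n$-vertex graph $G$ minimizing \[(\chi(H_2)-1)^{v(H_1)-k(H_1)}\, t_{\mathrm{inj}}(H_1,G)+(\chi(H_1)-1)^{v(H_2)-k(H_2)}\,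 t_{\mathrm{inj}}(H_2,\overline{G})\] over all $n$-vertex graphs satisfies: either $G$ is a Turán graph with $\chi(H_1)-1$ parts or $\overline{G}$ is a Turán graph with $\chi(H_2)-1$ parts. *)

theory Defs
  imports Complex_Main "HOL-Library.FuncSet" "HOL-Library.Ramsey"
begin

datatype 'a ugraph = Graph (verts: "'a set") (edges: "'a set set")

definition fin_simple_graph :: "'a ugraph \<Rightarrow> bool" where
  "fin_simple_graph G \<longleftrightarrow> finite (verts G) \<and> edges G \<subseteq> [verts G]\<^bsup>2\<^esup>"

definition num_verts :: "'a ugraph \<Rightarrow> nat" where
  "num_verts G = card (verts G)"

definition complement :: "'a ugraph \<Rightarrow> 'a ugraph" where
  "complement G = Graph (verts G) ([verts G]\<^bsup>2\<^esup> - edges G)"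

definition reachable :: "'a ugraph \<Rightarrow> ('a \<times> 'a) set" where
  "reachable G = {(u, w). {u, w} \<in> edges G}\<^sup>* \<inter> (verts G \<times> verts G)"

definition num_components :: "'a ugraph \<Rightarrow> nat" where
  "num_components G = card (verts G // reachable G)"

definition proper_coloring :: "'a ugraph \<Rightarrow> nat \<Rightarrow> ('a \<Rightarrow> nat) \<Rightarrow> bool" where
  "proper_coloring G k c \<longleftrightarrow>
     (\<forall>v\<in>verts G. c v < k) \<and> (\<forall>u w. {u, w} \<in> edges G \<longrightarrow> c u \<noteq> c w)"

definition chromatic_number :: "'a ugraph \<Rightarrow> nat" where
  "chromatic_number G = (LEAST k. \<exists>c. proper_coloring G k c)"

definition bipartite :: "'a ugraph \<Rightarrow> bool" where
  "bipartite G \<longleftrightarrow>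
     (\<exists>A B. A \<union> B = verts G \<and> A \<inter> B = {} \<and> (\<forall>e\<in>edges G. e \<inter> A \<noteq> {} \<and> e \<inter> B \<noteq> {}))"

definition delete_edge :: "'a ugraph \<Rightarrow> 'a set \<Rightarrow> 'a ugraph" where
  "delete_edge G e = Graph (verts G) (edges G - {e})"

definition critical_edge :: "'a ugraph \<Rightarrow> 'a set \<Rightarrow> bool" where
  "critical_edge G e \<longleftrightarrow>
     e \<in> edges G \<and> chromatic_number (delete_edge G e) < chromatic_number G"

(* hairy F t H: H is a t-hairy F.  Each hair gets its own leaf, new to the graph built so far. *)
inductive hairy :: "'a ugraph \<Rightarrow> nat \<Rightarrow> 'a ugraph \<Rightarrow> bool" for F where
  hairy_0: "hairy F 0 F"
| hairy_Suc: "hairy F t H \<Longrightarrow> u \<in> verts F \<Longrightarrow> w \<notin> verts H \<Longrightarrow>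
    hairy F (Suc t) (Graph (insert w (verts H)) (insert {u, w} (edges H)))"

definition inj_maps :: "'a ugraph \<Rightarrow> 'b ugraph \<Rightarrow> ('a \<Rightarrow> 'b) set" where
  "inj_maps H G = {f \<in> verts H \<rightarrow>\<^sub>E verts G. inj_on f (verts H)}"

(* The intended domain is num_verts H \<le> num_verts G; otherwise the quotient is 0 / 0 = 0. *)
definition t_inj :: "'a ugraph \<Rightarrow> 'b ugraph \<Rightarrow> real" where
  "t_inj H G =
     real (card {f \<in> inj_maps H G. \<forall>e\<in>edges H. f ` e \<in> edges G}) / real (card (inj_maps H G))"

definition turan_graph :: "nat \<Rightarrow> 'a ugraph \<Rightarrow> bool" where
  "turan_graph r G \<longleftrightarrow>
     (\<exists>p :: 'a \<Rightarrow> nat.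
        (\<forall>v\<in>verts G. p v < r) \<and>
        edges G = {{u, w} | u w. u \<in> verts G \<and> w \<in> verts G \<and> p u \<noteq> p w} \<and>
        (\<forall>i<r. int (card {v \<in> verts G. p v = i})
                 \<in> {\<lfloor>real (num_verts G) / real r\<rfloor>, \<lceil>real (num_verts G) / real r\<rceil>}))"

(* The natural-number subtractions do not truncate: a graph has at most as many components as
   vertices, and its chromatic number is at least 2 once it has an edge. *)
definition bonbon_objective :: "'a ugraph \<Rightarrow> 'b ugraph \<Rightarrow> 'c ugraph \<Rightarrow> real" where
  "bonbon_objective H1 H2 G =
     real (chromatic_number H2 - 1) ^ (num_verts H1 - num_components H1) * t_inj H1 G
     + real (chromatic_number H1 - 1) ^ (num_verts H2 - num_components H2) * t_inj H2 (complement G)"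

(* As every finite graph is isomorphic to one with vertices in nat, the competing n-vertex
   graphs are taken there.  A non-empty graph is one with at least one edge. *)
definition n_vertex_graphs :: "nat \<Rightarrow> nat ugraph set" where
  "n_vertex_graphs n = {G. fin_simple_graph G \<and> num_verts G = n}"

definition bonbon_pair :: "'a ugraph \<Rightarrow> 'b ugraph \<Rightarrow> bool" where
  "bonbon_pair H1 H2 \<longleftrightarrow>
     fin_simple_graph H1 \<and> edges H1 \<noteq> {} \<and> fin_simple_graph H2 \<and> edges H2 \<noteq> {} \<and>
     (\<exists>n0. \<forall>n\<ge>n0. \<forall>G\<in>n_vertex_graphs n.
        (\<forall>G'\<in>n_vertex_graphs n. bonbon_objective H1 H2 G \<le> bonbon_objective H1 H2 G') \<longrightarrow>
        turan_graph (chromatic_number H1 - 1) G \<or>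
        turan_graph (chromatic_number H2 - 1) (complement G))"

end

theory Submission
  imports Defs
begin

text \<open>
  Write \<open>r = \<chi>(F\<^sub>1) - 1\<close> and \<open>s = \<chi>(F\<^sub>2) - 1\<close>. A copy of \<open>H\<^sub>1\<close> is a copy of \<open>F\<^sub>1\<close> whose hairs
  contribute a factor of about the degree of the vertex that they are attached to. In the normalisation
  of the objective each hair has weight \<open>s/n\<close>, so for many hairs copies of \<open>F\<^sub>1\<close> on the set \<open>A\<close> of
  vertices of degree at least \<open>(1 + \<epsilon>)n/s\<close> are exponentially expensive, and likewise copies of \<open>F\<^sub>2\<close> in
  the complement on the set \<open>B\<close> of vertices of codegree at least \<open>(1 + \<epsilon>)n/r\<close>. A Turan graph has
  bounded objective; hence a minimiser spans few \<open>(r+1)\<close>-cliques on \<open>A\<close> and few independent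
  \<open>(s+1)\<close>-sets on \<open>B\<close>. Since \<open>r + s \<ge> 5\<close>, the sets \<open>A\<close> and \<open>B\<close> cover all vertices; a counting form of
  Ramsey's theorem bounds \<open>A \<inter> B\<close>, and supersaturation in Turan's theorem excludes that both sets are
  substantial.

  Say that \<open>B\<close> is small. Then almost all vertices have codegree at most \<open>(1 + \<epsilon>)n/r\<close> with few
  \<open>(r+1)\<close>-cliques, which yields a partition into \<open>r\<close> parts with few inside edges. Replacing a vertex by a
  clone of another one shows that the copies through any vertex have weight \<open>O(1/n)\<close>. This forces every
  codegree to be small and every inside degree to be small. An inside edge plays the role of
  the critical edge of \<open>F\<^sub>1\<close> in so many copies of \<open>H\<^sub>1\<close> that deleting it would decrease the objective. So
  \<open>G\<close> is complete \<open>r\<close>-partite, and convexity of the number of copies of \<open>H\<^sub>2\<close> in a disjoint union of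
  cliques, as a function of their sizes, makes the parts balanced.
\<close>

section \<open>Counting cliques\<close>

text \<open>Constants are fixed in this order: those depending on \<open>F1\<close>,
  \<open>F2\<close>, \<open>q\<close>; then the number of hairs; then, once \<open>H1\<close> and
  \<open>H2\<close> are known, the number n of vertices. Each contradiction about hairs compares two
  growth rates in their number, so the larger base must be available beforehand. The degree
  thresholds n/s and n/r add up to at most 5n/6 because r + s \<ge> 5; hence the two sets cover. The
  same hypothesis gives s (1 - 1/r) > 5/4: near a Turan graph with r parts each hair of a copy of
  \<open>H1\<close> costs a factor 5/4, while a hair of \<open>H2\<close> in the complement costs
  about 1. Deleting an inside edge therefore weighs (5/4)^t1 against (1 + 2 \<epsilon>')^t2, and
  \<open>q\<close> bounds t2 linearly in t1, so a small \<epsilon>' decides. The main obstacle is a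
  small set of exceptional vertices that averages do not reach: the cloning bound holds at every
  vertex and is what excludes them. A second one is that the hairs may be spread unevenly over F;
  where one vertex of the graph has to be exploited, it receives the vertex of F with the most
  hairs, at least the average number.\<close>

definition cliq :: "('v \<Rightarrow> 'v \<Rightarrow> bool) \<Rightarrow> 'i set \<Rightarrow> 'v set \<Rightarrow> ('i \<Rightarrow> 'v) set" where
  "cliq E I X = {x \<in> I \<rightarrow>\<^sub>E X. \<forall>i\<in>I. \<forall>j\<in>I. i \<noteq> j \<longrightarrow> E (x i) (x j)}"

definition extn :: "('v \<Rightarrow> 'v \<Rightarrow> bool) \<Rightarrow> 'v set \<Rightarrow> 'i set \<Rightarrow> ('i \<Rightarrow> 'v) \<Rightarrow> 'v set" where
  "extn E X J x = {w \<in> X. \<forall>j\<in>J. E w (x j)}"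

text \<open>Ordered cliques: for a symmetric irreflexive relation a clique of size k counts k!
  times. Tuples grow one coordinate at a time without corrections for symmetry.\<close>

primrec kcount :: "('v \<Rightarrow> 'v \<Rightarrow> bool) \<Rightarrow> nat \<Rightarrow> 'v set \<Rightarrow> nat" where
  "kcount E 0 X = 1"
| "kcount E (Suc k) X = (\<Sum>a\<in>X. kcount E k {w \<in> X. E a w})"

lemma finite_cliq: "finite I \<Longrightarrow> finite X \<Longrightarrow> finite (cliq E I X)"
  unfolding cliq_def by (rule finite_subset[OF _ finite_PiE[of I "\<lambda>_. X"]]) auto

lemma finite_extn: "finite X \<Longrightarrow> finite (extn E X J x)"
  unfolding extn_def by auto

lemma extn_fun_upd: "i \<notin> J \<Longrightarrow> extn E X J (y(i := a)) = extn E X J y"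
  unfolding extn_def by auto

text \<open>The last vertex runs through the common neighbours of the others. The free function
  \<open>h\<close> admits weights that depend on the whole clique, such as its number of
  extensions.\<close>

lemma sum_cliq_insert:
  assumes fI: "finite I" and fX: "finite X" and i: "i \<notin> I" and sym: "symp E"
  shows "(\<Sum>x\<in>cliq E (insert i I) X. h x) = (\<Sum>y\<in>cliq E I X. \<Sum>a\<in>extn E X I y. h (y(i := a)))"
proof -
  have bij: "bij_betw (\<lambda>(y, a). y(i := a)) (Sigma (cliq E I X) (extn E X I)) (cliq E (insert i I) X)"
    using i sym
    by (intro bij_betw_byWitness[where f' = "\<lambda>x. (x(i := undefined), x i)"])
      (auto simp: cliq_def extn_def PiE_def extensional_def Pi_def intro: sympD)
  have "(\<Sum>y\<in>cliq E I X. \<Sum>a\<in>extn E X I y. h (y(i := a)))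
      = (\<Sum>(y, a)\<in>Sigma (cliq E I X) (extn E X I). h (y(i := a)))"
    by (rule sum.Sigma) (auto simp: finite_cliq finite_extn fI fX)
  also have "\<dots> = (\<Sum>x\<in>cliq E (insert i I) X. h x)"
    using sum.reindex_bij_betw[OF bij, of h] by (simp add: case_prod_unfold)
  finally show ?thesis by simp
qed

lemma card_cliq_insert:
  assumes "finite I" and "finite X" and "i \<notin> I" and "symp E"
  shows "card (cliq E (insert i I) X) = (\<Sum>y\<in>cliq E I X. card (extn E X I y))"
  using sum_cliq_insert[OF assms, of "\<lambda>_. 1::nat"] by simp

text \<open>Here the new vertex is chosen first and the others inside its neighbourhood, which is
  the shape of the recursion of \<open>kcount\<close>.\<close>

lemma card_cliq_insert':
  assumes fI: "finite I" and fX: "finite X" and i: "i \<notin> I" and sym: "symp E"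
  shows "card (cliq E (insert i I) X) = (\<Sum>a\<in>X. card (cliq E I {w \<in> X. E a w}))"
proof -
  have "bij_betw (\<lambda>(a, y). y(i := a)) (Sigma X (\<lambda>a. cliq E I {w \<in> X. E a w})) (cliq E (insert i I) X)"
    using i sym
    by (intro bij_betw_byWitness[where f' = "\<lambda>x. (x i, x(i := undefined))"])
      (auto simp: cliq_def PiE_def extensional_def Pi_def dest: sympD)
  from bij_betw_same_card[OF this] show ?thesis
    using fX fI by (simp add: finite_cliq)
qed

lemma card_cliq:
  assumes "finite I" and "finite X" and "symp E"
  shows "card (cliq E I X) = kcount E (card I) X"
  using assms
proof (induction I arbitrary: X rule: finite_induct)
  case empty
  then show ?case by (simp add: cliq_def)
next
  case (insert i I)
  then show ?case by (simp add: card_cliq_insert')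
qed

lemma kcount_mono:
  assumes "X \<subseteq> Y" and "finite Y" shows "kcount E k X \<le> kcount E k Y"
  using assms
proof (induction k arbitrary: X Y)
  case (Suc k)
  have "(\<Sum>a\<in>X. kcount E k {w \<in> X. E a w}) \<le> (\<Sum>a\<in>X. kcount E k {w \<in> Y. E a w})"
    using Suc by (intro sum_mono Suc.IH) auto
  also have "\<dots> \<le> (\<Sum>a\<in>Y. kcount E k {w \<in> Y. E a w})"
    using Suc by (intro sum_mono2) auto
  finally show ?case by simp
qed simp

text \<open>A vertex that misses exactly one \<open>x j\<close> lies in a single set of the sum, and
  one that misses none lies in all \<open>card I\<close> of them. So the excess of the sum over the
  union comes from the common neighbours of the whole tuple.\<close>

lemma sum_card_extn_remove:
  assumes fI: "finite I" and fX: "finite X"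
  shows "(\<Sum>i\<in>I. card (extn E X (I - {i}) x))
          \<le> card (\<Union>i\<in>I. extn E X (I - {i}) x) + (card I - 1) * card (extn E X I x)"
proof -
  let ?U = "\<Union>i\<in>I. extn E X (I - {i}) x"
  have fU: "finite ?U" using fI fX by (auto simp: finite_extn)
  have point: "card {i \<in> I. w \<in> extn E X (I - {i}) x} \<le> 1 + (if w \<in> extn E X I x then card I - 1 else 0)"
    if w: "w \<in> ?U" for w
  proof (cases "w \<in> extn E X I x")
    case True
    then have "{i \<in> I. w \<in> extn E X (I - {i}) x} = I" by (auto simp: extn_def)
    with True show ?thesis using w fI by (auto simp: extn_def card_gt_0_iff)
  next
    case False
    then obtain j where j: "j \<in> I" "\<not> E w (x j)" using w by (auto simp: extn_def)
    then have "{i \<in> I. w \<in> extn E X (I - {i}) x} \<subseteq> {j}" by (auto simp: extn_def)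
    from card_mono[OF _ this] False show ?thesis by simp
  qed
  have "(\<Sum>i\<in>I. card (extn E X (I - {i}) x)) = (\<Sum>i\<in>I. \<Sum>w\<in>?U. if w \<in> extn E X (I - {i}) x then 1 else 0)"
  proof (rule sum.cong[OF refl])
    fix i assume "i \<in> I"
    then have "{w \<in> ?U. w \<in> extn E X (I - {i}) x} = extn E X (I - {i}) x" by auto
    then show "card (extn E X (I - {i}) x) = (\<Sum>w\<in>?U. if w \<in> extn E X (I - {i}) x then 1 else 0)"
      using fU by (simp add: sum.If_cases Int_def conj_commute)
  qed
  also have "\<dots> = (\<Sum>w\<in>?U. card {i \<in> I. w \<in> extn E X (I - {i}) x})"
    using fI by (subst sum.swap) (simp add: sum.If_cases Int_def)
  also have "\<dots> \<le> (\<Sum>w\<in>?U. 1 + (if w \<in> extn E X I x then card I - 1 else 0))"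
    by (intro sum_mono point)
  also have "\<dots> = card ?U + (card I - 1) * card (?U \<inter> extn E X I x)"
    using fU by (simp only: sum.distrib) (simp add: sum.If_cases Int_def)
  also have "\<dots> \<le> card ?U + (card I - 1) * card (extn E X I x)"
    using fX by (intro add_left_mono mult_left_mono card_mono) (auto simp: finite_extn)
  finally show ?thesis .
qed

section \<open>The Moon-Moser inequality and supersaturation in Turan's theorem\<close>

lemma cauchy_schwarz_card:
  fixes e :: "'i \<Rightarrow> real"
  shows "(\<Sum>y\<in>Y. e y)\<^sup>2 \<le> real (card Y) * (\<Sum>y\<in>Y. (e y)\<^sup>2)"
proof (cases "finite Y \<and> Y \<noteq> {}")
  case True
  let ?S = "\<Sum>y\<in>Y. e y" and ?c = "real (card Y)"
  have c: "?c > 0" using True by (simp add: card_gt_0_iff)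
  have expand: "(\<Sum>y\<in>Y. (e y - m)\<^sup>2) = (\<Sum>y\<in>Y. (e y)\<^sup>2) - 2 * m * ?S + ?c * m\<^sup>2" for m
    by (simp add: power2_diff sum.distrib sum_subtractf sum_distrib_left[symmetric] sum_distrib_right[symmetric]
        mult.assoc mult.left_commute[of 2])
  have "0 \<le> (\<Sum>y\<in>Y. (e y - ?S / ?c)\<^sup>2)" by (intro sum_nonneg) auto
  also have "\<dots> = (\<Sum>y\<in>Y. (e y)\<^sup>2) - 2 * (?S / ?c) * ?S + ?c * (?S / ?c)\<^sup>2"
    by (rule expand)
  also have "\<dots> = (\<Sum>y\<in>Y. (e y)\<^sup>2) - ?S\<^sup>2 / ?c"
    using c by (simp add: field_simps power2_eq_square)
  finally show ?thesis using c by (simp add: field_simps)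
qed auto

text \<open>Cauchy-Schwarz is applied to the number of extensions of the cliques of size m. The sum
  of squares counts the extensions of the cliques of size m + 1 with one coordinate removed; adding
  this up over the removed coordinate, \<open>sum_card_extn_remove\<close> bounds it by
  \<open>card X\<close> plus m times the full extensions.\<close>

lemma moon_moser:
  fixes m :: nat
  assumes fX: "finite X" and sym: "symp E"
  defines "k \<equiv> \<lambda>j. real (kcount E j X)"
  shows "real (m + 1) * (k (m + 1))\<^sup>2 \<le> k m * (real (card X) * k (m + 1) + real m * k (m + 2))"
proof -
  let ?I = "{..m}"
  have I: "finite ?I" "card ?I = m + 1" by auto
  \<comment> \<open>Of the two factors in a square, one is spent on choosing coordinate i of the
    larger clique Q; the other one, which does not depend on that coordinate, remains as the
    summand.\<close>
  have one: "(k (m + 1))\<^sup>2 \<le> k m * (\<Sum>Q\<in>cliq E ?I X. real (card (extn E X (?I - {i}) Q)))"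
    if i: "i \<in> ?I" for i
  proof -
    let ?J = "?I - {i}"
    have J: "insert i ?J = ?I" "finite ?J" "i \<notin> ?J" "card ?J = m" using i by auto
    have "k (m + 1) = (\<Sum>y\<in>cliq E ?J X. real (card (extn E X ?J y)))"
      using card_cliq_insert[OF J(2) fX J(3) sym] card_cliq[OF I(1) fX sym] J(1) I(2)
      by (simp add: k_def)
    then have "(k (m + 1))\<^sup>2 \<le> real (card (cliq E ?J X)) * (\<Sum>y\<in>cliq E ?J X. (real (card (extn E X ?J y)))\<^sup>2)"
      using cauchy_schwarz_card by metis
    also have "real (card (cliq E ?J X)) = k m" using card_cliq[OF J(2) fX sym] J(4) by (simp add: k_def)
    also have "(\<Sum>y\<in>cliq E ?J X. (real (card (extn E X ?J y)))\<^sup>2)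
        = (\<Sum>Q\<in>cliq E (insert i ?J) X. real (card (extn E X ?J Q)))"
      by (subst sum_cliq_insert[OF J(2) fX J(3) sym]) (simp add: extn_fun_upd power2_eq_square)
    finally show ?thesis using J(1) by simp
  qed
  have "real (m + 1) * (k (m + 1))\<^sup>2 = (\<Sum>i\<in>?I. (k (m + 1))\<^sup>2)" by simp
  also have "\<dots> \<le> (\<Sum>i\<in>?I. k m * (\<Sum>Q\<in>cliq E ?I X. real (card (extn E X (?I - {i}) Q))))"
    by (intro sum_mono one)
  also have "\<dots> = k m * (\<Sum>Q\<in>cliq E ?I X. real (\<Sum>i\<in>?I. card (extn E X (?I - {i}) Q)))"
    by (subst sum_distrib_left[symmetric], subst sum.swap) simp
  also have "\<dots> \<le> k m * (\<Sum>Q\<in>cliq E ?I X. real (card X) + real m * real (card (extn E X ?I Q)))"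
  proof (intro mult_left_mono sum_mono)
    fix Q assume "Q \<in> cliq E ?I X"
    have "card (\<Union>i\<in>?I. extn E X (?I - {i}) Q) \<le> card X"
      using fX by (intro card_mono) (auto simp: extn_def)
    then have "(\<Sum>i\<in>?I. card (extn E X (?I - {i}) Q)) \<le> card X + m * card (extn E X ?I Q)"
      using sum_card_extn_remove[OF I(1) fX, of E Q] I(2) by simp
    then show "real (\<Sum>i\<in>?I. card (extn E X (?I - {i}) Q)) \<le> real (card X) + real m * real (card (extn E X ?I Q))"
      by (metis of_nat_add of_nat_le_iff of_nat_mult)
  qed (simp add: k_def)
  also have "\<dots> = k m * (real (card X) * k (m + 1) + real m * (\<Sum>Q\<in>cliq E ?I X. real (card (extn E X ?I Q))))"
  proof -
    have "real (card (cliq E ?I X)) = k (m + 1)" using card_cliq[OF I(1) fX sym] I(2) by (simp only: k_def)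
    then show ?thesis by (simp add: sum.distrib sum_distrib_left[symmetric] del: kcount.simps)
  qed
  also have "(\<Sum>Q\<in>cliq E ?I X. real (card (extn E X ?I Q))) = k (m + 2)"
    using card_cliq_insert[OF I(1) fX _ sym, of "Suc m"] card_cliq[of "insert (Suc m) ?I" X E] fX sym
    by (simp add: k_def)
  finally show ?thesis .
qed

text \<open>Moon-Moser turns the density of edges into a lower bound on each ratio of consecutive
  clique counts. With \<open>\<theta> = (1 - \<eta>) / r\<close> the s-th ratio is at least (1 - s
  \<theta>) N, and 1 - r \<theta> = \<eta>, so each of the r ratios is at least \<eta> N. The
  diagonal is counted among the non-adjacent pairs, so a Turan graph has about N^2 / r of
  them.\<close>

lemma turan_supersaturation:
  fixes r :: nat and \<eta> :: real
  assumes fX: "finite X" and sym: "symp E" and r: "r \<ge> 1" and \<eta>: "0 < \<eta>" "\<eta> \<le> 1"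
    and nonadj: "real (card {(x, y) \<in> X \<times> X. \<not> E x y}) < (1 - \<eta>) * (real (card X))\<^sup>2 / r"
  shows "\<eta> ^ r * real (card X) ^ (r + 1) \<le> real (kcount E (r + 1) X)"
proof -
  define N where "N = real (card X)"
  define k where "k = (\<lambda>j. real (kcount E j X))"
  define \<theta> where "\<theta> = (1 - \<eta>) / r"
  have mm: "real (m + 1) * (k (m + 1))\<^sup>2 \<le> k m * (N * k (m + 1) + real m * k (m + 2))" for m
    unfolding k_def N_def by (rule moon_moser[OF fX sym])
  have k0: "k j \<ge> 0" for j by (simp add: k_def)
  have N0: "N > 0"
  proof (rule ccontr)
    assume "\<not> N > 0"
    then have "N = 0" by (simp add: N_def)
    with nonadj show False by (simp add: N_def)
  qed
  have th: "1 - real s * \<theta> \<ge> \<eta>" if "s \<le> r" for s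
  proof -
    have "real s * \<theta> \<le> real r * \<theta>" using that \<eta> by (intro mult_right_mono) (auto simp: \<theta>_def)
    also have "\<dots> = 1 - \<eta>" using r by (simp add: \<theta>_def)
    finally show ?thesis by simp
  qed
  have th0: "\<theta> \<ge> 0" using \<eta> by (simp add: \<theta>_def)
  have k1: "k 1 = N" by (simp add: k_def N_def)
  have "real (kcount E 2 X) = (\<Sum>a\<in>X. real (card {w \<in> X. E a w}))" by (simp add: numeral_2_eq_2)
  also have "\<dots> = real (card (Sigma X (\<lambda>a. {w \<in> X. E a w})))" using fX by simp
  also have "Sigma X (\<lambda>a. {w \<in> X. E a w}) = X \<times> X - {(x, y) \<in> X \<times> X. \<not> E x y}" by auto
  also have "real (card \<dots>) = real (card (X \<times> X)) - real (card {(x, y) \<in> X \<times> X. \<not> E x y})"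
  proof -
    have sub: "{(x, y) \<in> X \<times> X. \<not> E x y} \<subseteq> X \<times> X" by auto
    have fin: "finite (X \<times> X)" using fX by simp
    show ?thesis
      using card_Diff_subset[OF finite_subset[OF sub fin] sub] card_mono[OF fin sub] by (simp only: of_nat_diff)
  qed
  finally have "k 2 \<ge> N\<^sup>2 - \<theta> * N\<^sup>2"
    using nonadj by (simp add: k_def N_def \<theta>_def power2_eq_square card_cartesian_product)
  then have k2: "k 2 \<ge> (1 - \<theta>) * N * N" by (simp add: power2_eq_square algebra_simps)
  \<comment> \<open>Substituting the previous ratio for \<open>k s\<close> in Moon-Moser makes every
    term divisible by \<open>k (s + 1)\<close>. What is left is linear and gives the next
    ratio.\<close>
  have step: "k (s + 1) \<ge> (1 - real s * \<theta>) * N * k s" if "1 \<le> s" "s \<le> r" for s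
    using that
  proof (induction s rule: dec_induct)
    case base
    then show ?case using k2 k1 by (simp add: numeral_2_eq_2)
  next
    case (step s)
    then have IH: "k (s + 1) \<ge> (1 - real s * \<theta>) * N * k s" by simp
    define c where "c = 1 - real s * \<theta>"
    have c: "c > 0" using th[of s] step.prems \<eta> by (simp add: c_def)
    show ?case
    proof (cases "k (s + 1) = 0")
      case True
      then show ?thesis using k0[of "Suc s + 1"] by simp
    next
      case False
      then have kp: "k (s + 1) > 0" using k0[of "s + 1"] by simp
      have "c * N * (real (s + 1) * (k (s + 1))\<^sup>2) \<le> c * N * (k s * (N * k (s + 1) + real s * k (s + 2)))"
        using mm[of s] c N0 by (intro mult_left_mono) auto
      also have "\<dots> = (c * N * k s) * (N * k (s + 1) + real s * k (s + 2))" by simp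
      also have "\<dots> \<le> k (s + 1) * (N * k (s + 1) + real s * k (s + 2))"
        using IH k0 N0 unfolding c_def by (intro mult_right_mono) auto
      finally have "k (s + 1) * (c * N * real (s + 1) * k (s + 1)) \<le> k (s + 1) * (N * k (s + 1) + real s * k (s + 2))"
        by (simp add: power2_eq_square algebra_simps)
      then have "c * N * real (s + 1) * k (s + 1) \<le> N * k (s + 1) + real s * k (s + 2)"
        using kp by simp
      then have "real s * ((1 - real (s + 1) * \<theta>) * N * k (s + 1)) \<le> real s * k (s + 2)"
        by (simp add: c_def algebra_simps)
      then show ?thesis using \<open>1 \<le> s\<close> by simp
    qed
  qed
  have "\<eta> ^ s * N ^ (s + 1) \<le> k (s + 1)" if "s \<le> r" for s
    using that
  proof (induction s)
    case 0
    then show ?case using k1 by simp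
  next
    case (Suc s)
    have "\<eta> ^ Suc s * N ^ (Suc s + 1) = \<eta> * N * (\<eta> ^ s * N ^ (s + 1))" by simp
    also have "\<dots> \<le> \<eta> * N * k (s + 1)" using Suc N0 \<eta> by (intro mult_left_mono) auto
    also have "\<dots> \<le> (1 - real (s + 1) * \<theta>) * N * k (s + 1)"
      using th[of "s + 1"] Suc.prems N0 k0 by (intro mult_right_mono) auto
    also have "\<dots> \<le> k (Suc s + 1)" using step[of "s + 1"] Suc.prems by simp
    finally show ?case .
  qed
  from this[of r] show ?thesis by (simp add: k_def N_def)
qed


text \<open>The Erdos-Szekeres recursion with counts. Each vertex has at least a third of X as
  neighbours or as non-neighbours, and one of the two cases occurs for at least half of the
  vertices.\<close>

lemma ramsey_counting:
  fixes a b :: nat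
  shows "\<exists>c>0. \<exists>M. \<forall>(X :: 'v set) E. finite X \<longrightarrow> (\<forall>x. \<not> E x x) \<longrightarrow> card X \<ge> M \<longrightarrow>
           c * real (card X) ^ a \<le> real (kcount E a X) \<or>
           c * real (card X) ^ b \<le> real (kcount (\<lambda>x y. x \<noteq> y \<and> \<not> E x y) b X)"
proof (induction "a + b" arbitrary: a b)
  case 0
  then show ?case by (intro exI[of _ 1]) auto
next
  case (Suc k)
  show ?case
  proof (cases "a = 0 \<or> b = 0")
    case True
    then show ?thesis by (intro exI[of _ 1]) auto
  next
    case False
    then obtain a' b' where ab: "a = Suc a'" "b = Suc b'" by (metis not0_implies_Suc)
    have k1: "k = a' + b" and k2: "k = a + b'" using Suc(2) ab by auto
    from Suc(1)[OF k1] obtain c1 M1 where c1: "c1 > 0"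
      and R1: "\<And>(X :: 'v set) E. finite X \<Longrightarrow> (\<forall>x. \<not> E x x) \<Longrightarrow> card X \<ge> M1 \<Longrightarrow>
           c1 * real (card X) ^ a' \<le> real (kcount E a' X) \<or>
           c1 * real (card X) ^ b \<le> real (kcount (\<lambda>x y. x \<noteq> y \<and> \<not> E x y) b X)"
      by meson
    from Suc(1)[OF k2] obtain c2 M2 where c2: "c2 > 0"
      and R2: "\<And>(X :: 'v set) E. finite X \<Longrightarrow> (\<forall>x. \<not> E x x) \<Longrightarrow> card X \<ge> M2 \<Longrightarrow>
           c2 * real (card X) ^ a \<le> real (kcount E a X) \<or>
           c2 * real (card X) ^ b' \<le> real (kcount (\<lambda>x y. x \<noteq> y \<and> \<not> E x y) b' X)"
      by meson
    \<comment> \<open>Passing to a third of X costs a factor 3 per coordinate, and tuples of either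
      kind have at most a + b coordinates.\<close>
    define c where "c = min c1 c2 / 3 ^ (a + b)"
    define M where "M = 3 * (M1 + M2) + 3"
    have c: "c > 0" using c1 c2 by (simp add: c_def)
    have cle: "c * m ^ e \<le> c1 * (m / 3) ^ e" "c * m ^ e \<le> c2 * (m / 3) ^ e"
      if "m \<ge> 0" "e \<le> a + b" for m :: real and e
    proof -
      have "c * 3 ^ e \<le> c * 3 ^ (a + b)" using c that by (intro mult_left_mono power_increasing) auto
      also have "\<dots> = min c1 c2" by (simp add: c_def)
      finally have le: "c * 3 ^ e \<le> c1" "c * 3 ^ e \<le> c2" by auto
      have eq: "c * m ^ e = (c * 3 ^ e) * (m / 3) ^ e" by (simp add: power_divide)
      show "c * m ^ e \<le> c1 * (m / 3) ^ e" "c * m ^ e \<le> c2 * (m / 3) ^ e"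
        unfolding eq using le that by (auto intro!: mult_right_mono)
    qed
    show ?thesis
    proof (intro exI[of _ c] conjI exI[of _ M] allI impI)
      fix X :: "'v set" and E :: "'v \<Rightarrow> 'v \<Rightarrow> bool"
      assume fX: "finite X" and irr: "\<forall>x. \<not> E x x" and M: "card X \<ge> M"
      define C where "C = (\<lambda>x y. x \<noteq> y \<and> \<not> E x y)"
      define m where "m = real (card X)"
      define P where "P = {x \<in> X. m / 3 \<le> real (card {w \<in> X. E x w})}"
      have m3: "m \<ge> 3" using M by (simp add: m_def M_def)
      have PX: "P \<subseteq> X" by (auto simp: P_def)
      have splt: "real (card {w \<in> X. E x w}) + real (card {w \<in> X. C x w}) = m - 1" if x: "x \<in> X" for x
      proof -
        have "X - {x} = {w \<in> X. E x w} \<union> {w \<in> X. C x w}" using irr by (auto simp: C_def)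
        moreover have "{w \<in> X. E x w} \<inter> {w \<in> X. C x w} = {}" by (auto simp: C_def)
        ultimately have "card (X - {x}) = card {w \<in> X. E x w} + card {w \<in> X. C x w}"
          using fX by (simp add: card_Un_disjoint)
        moreover have "card (X - {x}) = card X - 1" "card X \<ge> 1" using fX x by (auto simp: Suc_le_eq card_gt_0_iff)
        ultimately show ?thesis by (simp add: m_def of_nat_diff flip: of_nat_add)
      qed
      have PM: "card {w \<in> X. E x w} \<ge> M1" if "x \<in> P" for x
      proof -
        have "real M1 \<le> m / 3" using M by (simp add: m_def M_def)
        then show ?thesis using that unfolding P_def by auto
      qed
      have co: "m / 3 \<le> real (card {w \<in> X. C x w})" if "x \<in> X - P" for x
        using splt[of x] that m3 by (auto simp: P_def)
      have QM: "card {w \<in> X. C x w} \<ge> M2" if "x \<in> X - P" for x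
      proof -
        have "real M2 \<le> m / 3" using M by (simp add: m_def M_def)
        then have "real M2 \<le> real (card {w \<in> X. C x w})" using co[OF that] by linarith
        then show ?thesis by simp
      qed
      have "real (card P) + real (card (X - P)) = m"
        using PX fX by (simp add: m_def card_Diff_subset finite_subset of_nat_diff card_mono)
      then consider "real (card P) \<ge> m / 2" | "real (card (X - P)) \<ge> m / 2" by linarith
      then show "c * real (card X) ^ a \<le> real (kcount E a X) \<or>
           c * real (card X) ^ b \<le> real (kcount (\<lambda>x y. x \<noteq> y \<and> \<not> E x y) b X)"
        unfolding C_def[symmetric] m_def[symmetric]
      proof cases
        case 1
        \<comment> \<open>Either one of these neighbourhoods already holds enough independent tuples
          of size b, or each of them holds many cliques of size a - 1, and the vertices x in front
          complete these to cliques of size a.\<close>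
        show "c * m ^ a \<le> real (kcount E a X) \<or> c * m ^ b \<le> real (kcount C b X)"
        proof (cases "\<exists>x\<in>P. c1 * real (card {w \<in> X. E x w}) ^ b \<le> real (kcount C b {w \<in> X. E x w})")
          case True
          then obtain x where x: "x \<in> P" "c1 * real (card {w \<in> X. E x w}) ^ b \<le> real (kcount C b {w \<in> X. E x w})"
            by auto
          have "c * m ^ b \<le> c1 * (m / 3) ^ b" using cle m3 by simp
          also have "\<dots> \<le> c1 * real (card {w \<in> X. E x w}) ^ b"
            using x(1) c1 m3 by (intro mult_left_mono power_mono) (auto simp: P_def)
          also note x(2)
          also have "real (kcount C b {w \<in> X. E x w}) \<le> real (kcount C b X)"
            using fX by (intro of_nat_mono kcount_mono) auto
          finally show ?thesis by simp
        next
          case False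
          have each: "c1 * (m / 3) ^ a' \<le> real (kcount E a' {w \<in> X. E x w})" if x: "x \<in> P" for x
          proof -
            have "c1 * (m / 3) ^ a' \<le> c1 * real (card {w \<in> X. E x w}) ^ a'"
              using x c1 m3 by (intro mult_left_mono power_mono) (auto simp: P_def)
            also have "\<dots> \<le> real (kcount E a' {w \<in> X. E x w})"
              using R1[of "{w \<in> X. E x w}" E] fX irr PM[OF x] False x unfolding C_def by auto
            finally show ?thesis .
          qed
          have "c * m ^ a \<le> c1 * (m / 3) ^ a" using cle m3 by simp
          also have "\<dots> = (m / 3) * (c1 * (m / 3) ^ a')" using ab by simp
          also have "\<dots> \<le> real (card P) * (c1 * (m / 3) ^ a')"
            using 1 m3 c1 by (intro mult_right_mono) auto
          also have "\<dots> \<le> (\<Sum>x\<in>P. real (kcount E a' {w \<in> X. E x w}))"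
            using sum_mono[OF each, of P "\<lambda>x. x"] by simp
          also have "\<dots> \<le> (\<Sum>x\<in>X. real (kcount E a' {w \<in> X. E x w}))"
            using PX fX by (intro sum_mono2) auto
          also have "\<dots> = real (kcount E a X)" using ab by simp
          finally show ?thesis by simp
        qed
      next
        case 2
        show "c * m ^ a \<le> real (kcount E a X) \<or> c * m ^ b \<le> real (kcount C b X)"
        proof (cases "\<exists>x\<in>X - P. c2 * real (card {w \<in> X. C x w}) ^ a \<le> real (kcount E a {w \<in> X. C x w})")
          case True
          then obtain x where x: "x \<in> X - P" "c2 * real (card {w \<in> X. C x w}) ^ a \<le> real (kcount E a {w \<in> X. C x w})"
            by auto
          have "c * m ^ a \<le> c2 * (m / 3) ^ a" using cle m3 by simp
          also have "\<dots> \<le> c2 * real (card {w \<in> X. C x w}) ^ a"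
            using co[OF x(1)] c2 m3 by (intro mult_left_mono power_mono) auto
          also note x(2)
          also have "real (kcount E a {w \<in> X. C x w}) \<le> real (kcount E a X)"
            using fX by (intro of_nat_mono kcount_mono) auto
          finally show ?thesis by simp
        next
          case False
          have each: "c2 * (m / 3) ^ b' \<le> real (kcount C b' {w \<in> X. C x w})" if x: "x \<in> X - P" for x
          proof -
            have "c2 * (m / 3) ^ b' \<le> c2 * real (card {w \<in> X. C x w}) ^ b'"
              using co[OF x] c2 m3 by (intro mult_left_mono power_mono) auto
            also have "\<dots> \<le> real (kcount C b' {w \<in> X. C x w})"
              using R2[of "{w \<in> X. C x w}" E] fX irr QM[OF x] False x unfolding C_def[symmetric] by auto
            finally show ?thesis .
          qed
          have "c * m ^ b \<le> c2 * (m / 3) ^ b" using cle m3 by simp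
          also have "\<dots> = (m / 3) * (c2 * (m / 3) ^ b')" using ab by simp
          also have "\<dots> \<le> real (card (X - P)) * (c2 * (m / 3) ^ b')"
            using 2 m3 c2 by (intro mult_right_mono) auto
          also have "\<dots> \<le> (\<Sum>x\<in>X - P. real (kcount C b' {w \<in> X. C x w}))"
            using sum_mono[OF each, of "X - P" "\<lambda>x. x"] by simp
          also have "\<dots> \<le> (\<Sum>x\<in>X. real (kcount C b' {w \<in> X. C x w}))"
            using PX fX by (intro sum_mono2) auto
          also have "\<dots> = real (kcount C b X)" using ab by simp
          finally show ?thesis by simp
        qed
      qed
    qed (fact c)
  qed
qed

text \<open>The tangent to the s-th power at the mean \<mu> lies below the graph, which is
  Bernoulli's inequality for \<open>e y / \<mu> - 1\<close>. Summed over Y, the linear terms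
  cancel.\<close>

lemma power_mean_card:
  fixes e :: "'i \<Rightarrow> real"
  assumes e: "\<And>y. y \<in> Y \<Longrightarrow> e y \<ge> 0" and s: "s \<ge> 1"
  shows "(\<Sum>y\<in>Y. e y) ^ s \<le> real (card Y) ^ (s - 1) * (\<Sum>y\<in>Y. e y ^ s)"
proof (cases "finite Y \<and> (\<Sum>y\<in>Y. e y) \<noteq> 0")
  case True
  let ?S = "\<Sum>y\<in>Y. e y" and ?c = "real (card Y)"
  define \<mu> where "\<mu> = ?S / ?c"
  have S: "?S > 0" using True e by (simp add: order_less_le sum_nonneg)
  have c: "?c > 0" using True by (auto simp: card_gt_0_iff)
  have \<mu>: "\<mu> > 0" using S c by (simp add: \<mu>_def)
  have tangent: "\<mu> ^ s * (1 + real s * (e y / \<mu> - 1)) \<le> e y ^ s" if "y \<in> Y" for y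
  proof -
    have "1 + real s * (e y / \<mu> - 1) \<le> (1 + (e y / \<mu> - 1)) ^ s"
      using e[OF that] \<mu> by (intro Bernoulli_inequality) auto
    then have "\<mu> ^ s * (1 + real s * (e y / \<mu> - 1)) \<le> \<mu> ^ s * (1 + (e y / \<mu> - 1)) ^ s"
      using \<mu> by (intro mult_left_mono) auto
    also have "\<dots> = e y ^ s" using \<mu> by (simp add: power_divide)
    finally show ?thesis .
  qed
  have "(\<Sum>y\<in>Y. \<mu> ^ s * (1 + real s * (e y / \<mu> - 1))) = \<mu> ^ s * (?c + real s * (?S / \<mu> - ?c))"
    by (simp add: sum.distrib sum_distrib_left[symmetric] sum_subtractf sum_divide_distrib[symmetric])
  also have "\<dots> = \<mu> ^ s * ?c" using S c by (simp add: \<mu>_def)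
  finally have "(\<Sum>y\<in>Y. \<mu> ^ s * (1 + real s * (e y / \<mu> - 1))) = \<mu> ^ s * ?c" .
  moreover have "(\<Sum>y\<in>Y. \<mu> ^ s * (1 + real s * (e y / \<mu> - 1))) \<le> (\<Sum>y\<in>Y. e y ^ s)"
    by (intro sum_mono tangent)
  ultimately have "\<mu> ^ s * ?c \<le> (\<Sum>y\<in>Y. e y ^ s)" by simp
  then have "?c ^ (s - 1) * (\<mu> ^ s * ?c) \<le> ?c ^ (s - 1) * (\<Sum>y\<in>Y. e y ^ s)"
    using c by (intro mult_left_mono) auto
  moreover have "?c ^ (s - 1) * (\<mu> ^ s * ?c) = ?S ^ s"
  proof -
    have "?c ^ (s - 1) * ?c = ?c ^ s" using s by (metis power_minus_mult less_le_trans zero_less_one)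
    then have "?c ^ (s - 1) * (\<mu> ^ s * ?c) = (?c * \<mu>) ^ s" by (simp add: power_mult_distrib algebra_simps)
    then show ?thesis using c by (simp add: \<mu>_def)
  qed
  ultimately show ?thesis by simp
next
  case False
  then have "(\<Sum>y\<in>Y. e y) = 0" by auto
  moreover have "(\<Sum>y\<in>Y. e y ^ s) \<ge> 0" using e by (intro sum_nonneg) auto
  ultimately show ?thesis using s by (simp add: power_0_left)
qed

section \<open>Blow-ups of cliques\<close>

text \<open>Coordinate \<open>j\<close> of the copied clique holds a list of \<open>m j\<close> vertices.\<close>

definition conf :: "('v \<Rightarrow> 'v \<Rightarrow> bool) \<Rightarrow> (nat \<Rightarrow> nat) \<Rightarrow> nat set \<Rightarrow> 'v set \<Rightarrow> (nat \<Rightarrow> 'v list) set" where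
  "conf E m J X = {x \<in> Pi\<^sub>E J (\<lambda>j. {l. set l \<subseteq> X \<and> length l = m j}).
     \<forall>i\<in>J. \<forall>j\<in>J. i \<noteq> j \<longrightarrow> (\<forall>a\<in>set (x i). \<forall>b\<in>set (x j). E a b)}"

lemma finite_conf: "finite J \<Longrightarrow> finite X \<Longrightarrow> finite (conf E m J X)"
  unfolding conf_def
  by (rule finite_subset[OF _ finite_PiE[of J "\<lambda>j. {l. set l \<subseteq> X \<and> length l = m j}"]])
    (auto simp: finite_lists_length_eq)

lemma card_conf_le:
  assumes "finite J" and "finite X"
  shows "card (conf E m J X) \<le> card X ^ (\<Sum>j\<in>J. m j)"
proof -
  have "card (conf E m J X) \<le> card (Pi\<^sub>E J (\<lambda>j. {l. set l \<subseteq> X \<and> length l = m j}))"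
    using assms by (intro card_mono finite_PiE) (auto simp: conf_def finite_lists_length_eq)
  also have "\<dots> = card X ^ (\<Sum>j\<in>J. m j)"
    using assms by (simp add: card_PiE card_lists_length_eq power_sum)
  finally show ?thesis .
qed

lemma conf_cong: "(\<And>j. j \<in> J \<Longrightarrow> m j = m' j) \<Longrightarrow> conf E m J X = conf E m' J X"
  unfolding conf_def by (simp cong: PiE_cong)

text \<open>Once the other lists are fixed, the entries of the new list are chosen independently
  among the common neighbours of all their entries, repetitions allowed. Hence the power
  \<open>m j\<close>.\<close>

lemma card_conf_insert:
  assumes fJ: "finite J" and fX: "finite X" and j: "j \<notin> J" and sym: "symp E"
  shows "card (conf E m (insert j J) X)
    = (\<Sum>y\<in>conf E m J X. card {w \<in> X. \<forall>i\<in>J. \<forall>b\<in>set (y i). E w b} ^ m j)"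
proof -
  let ?e = "\<lambda>y. {w \<in> X. \<forall>i\<in>J. \<forall>b\<in>set (y i). E w b}"
  have "bij_betw (\<lambda>(y, l). y(j := l)) (Sigma (conf E m J X) (\<lambda>y. {l. set l \<subseteq> ?e y \<and> length l = m j}))
          (conf E m (insert j J) X)"
  proof (rule bij_betw_byWitness[where f' = "\<lambda>x. (x(j := undefined), x j)"])
    have upd: "y(j := undefined) = y" if "y \<in> conf E m J X" for y
      using that j by (auto simp: conf_def PiE_def extensional_def)
    then show "\<forall>a\<in>Sigma (conf E m J X) (\<lambda>y. {l. set l \<subseteq> ?e y \<and> length l = m j}).
        (\<lambda>x. (x(j := undefined), x j)) (case a of (y, l) \<Rightarrow> y(j := l)) = a" by auto
    show "\<forall>a'\<in>conf E m (insert j J) X. (case (a'(j := undefined), a' j) of (y, l) \<Rightarrow> y(j := l)) = a'" by auto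
    show "(\<lambda>(y, l). y(j := l)) ` Sigma (conf E m J X) (\<lambda>y. {l. set l \<subseteq> ?e y \<and> length l = m j}) \<subseteq> conf E m (insert j J) X"
    proof clarify
      fix y l assume y: "y \<in> conf E m J X" and l: "set l \<subseteq> ?e y" "length l = m j"
      have "y(j := l) \<in> Pi\<^sub>E (insert j J) (\<lambda>j. {l. set l \<subseteq> X \<and> length l = m j})"
        using y l by (intro PiE_fun_upd) (auto simp: conf_def)
      moreover have "E a b" if ii: "i \<in> insert j J" "i' \<in> insert j J" "i \<noteq> i'" "a \<in> set ((y(j := l)) i)" "b \<in> set ((y(j := l)) i')"
        for i i' a b
      proof -
        consider "i = j" "i' \<in> J" "i' \<noteq> j" | "i' = j" "i \<in> J" "i \<noteq> j" | "i \<in> J" "i' \<in> J" "i \<noteq> j" "i' \<noteq> j"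
          using ii(1-3) j by blast
        then show ?thesis
        proof cases
          case 1
          then show ?thesis using ii l by auto
        next
          case 2
          then have "E b a" using ii l by auto
          then show ?thesis by (rule sympD[OF sym])
        next
          case 3
          then show ?thesis using ii y by (auto simp: conf_def)
        qed
      qed
      ultimately show "y(j := l) \<in> conf E m (insert j J) X" unfolding conf_def by blast
    qed
    show "(\<lambda>x. (x(j := undefined), x j)) ` conf E m (insert j J) X
        \<subseteq> Sigma (conf E m J X) (\<lambda>y. {l. set l \<subseteq> ?e y \<and> length l = m j})"
    proof (rule image_subsetI)
      fix x assume x: "x \<in> conf E m (insert j J) X"
      let ?y = "x(j := undefined)"
      have ne: "i \<noteq> j" if "i \<in> J" for i using that j by auto
      have pi: "x \<in> Pi\<^sub>E (insert j J) (\<lambda>j. {l. set l \<subseteq> X \<and> length l = m j})"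
        and adj: "\<And>i i' a b. i \<in> insert j J \<Longrightarrow> i' \<in> insert j J \<Longrightarrow> i \<noteq> i' \<Longrightarrow> a \<in> set (x i) \<Longrightarrow> b \<in> set (x i') \<Longrightarrow> E a b"
        using x unfolding conf_def by blast+
      have "?y \<in> Pi\<^sub>E J (\<lambda>j. {l. set l \<subseteq> X \<and> length l = m j})" using fun_upd_in_PiE[OF j pi] .
      then have "?y \<in> conf E m J X" unfolding conf_def using adj ne by simp blast
      moreover have "set (x j) \<subseteq> X" "length (x j) = m j" using PiE_mem[OF pi, of j] by auto
      moreover have "set (x j) \<subseteq> ?e ?y"
      proof -
        have "E a b" if "a \<in> set (x j)" "i \<in> J" "b \<in> set (x i)" for a b i
          using adj[of j i a b] ne[of i] that by simp
        then show ?thesis using \<open>set (x j) \<subseteq> X\<close> ne by auto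
      qed
      ultimately show "(?y, x j) \<in> Sigma (conf E m J X) (\<lambda>y. {l. set l \<subseteq> ?e y \<and> length l = m j})" by blast
    qed
  qed
  from bij_betw_same_card[OF this]
  have "card (conf E m (insert j J) X) = card (Sigma (conf E m J X) (\<lambda>y. {l. set l \<subseteq> ?e y \<and> length l = m j}))"
    by simp
  also have "\<dots> = (\<Sum>y\<in>conf E m J X. card {l. set l \<subseteq> ?e y \<and> length l = m j})"
    using fJ fX by (intro card_SigmaI) (auto simp: finite_conf finite_lists_length_eq)
  also have "\<dots> = (\<Sum>y\<in>conf E m J X. card (?e y) ^ m j)"
    using fX by (intro sum.cong refl card_lists_length_eq) auto
  finally show ?thesis .
qed

text \<open>Replacing one vertex by a list of length s raises the number of its choices to the power
  s, separately for each configuration on J. There are at most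
  \<open>n ^ (\<Sum>i\<in>J. m i)\<close> of these, so by the power mean inequality the density
  falls at most to its s-th power.\<close>

lemma conf_duplicate:
  fixes n :: real and s :: nat
  assumes fJ: "finite J" and fX: "finite X" and j: "j \<notin> J" and sym: "symp E"
    and n: "n > 0" "real (card X) \<le> n" and s: "s \<ge> 1" and mj: "m j = 1"
  shows "(real (card (conf E m (insert j J) X)) / n ^ (\<Sum>i\<in>insert j J. m i)) ^ s
          \<le> real (card (conf E (m(j := s)) (insert j J) X)) / n ^ (\<Sum>i\<in>insert j J. (m(j := s)) i)"
proof -
  define e where "e = (\<lambda>y. real (card {w \<in> X. \<forall>i\<in>J. \<forall>b\<in>set (y i). E w b}))"
  let ?Y = "conf E m J X"
  let ?T = "\<Sum>i\<in>J. m i"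
  have Y: "conf E (m(j := s)) J X = ?Y" by (rule conf_cong) (use j in auto)
  have Z1: "real (card (conf E m (insert j J) X)) = (\<Sum>y\<in>?Y. e y)"
    using card_conf_insert[OF fJ fX j sym, of m] mj by (simp add: e_def)
  have Z2: "real (card (conf E (m(j := s)) (insert j J) X)) = (\<Sum>y\<in>?Y. e y ^ s)"
    using card_conf_insert[OF fJ fX j sym, of "m(j := s)"] Y by (simp add: e_def)
  have T1: "(\<Sum>i\<in>insert j J. m i) = ?T + 1" using fJ j mj by simp
  have T2: "(\<Sum>i\<in>insert j J. (m(j := s)) i) = ?T + s"
  proof -
    have "(\<Sum>i\<in>J. (m(j := s)) i) = ?T" using j by (intro sum.cong) auto
    then show ?thesis using fJ j by simp
  qed
  have "real (card ?Y) \<le> real (card X ^ ?T)" using card_conf_le[OF fJ fX, of E m] by (rule of_nat_mono)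
  also have "\<dots> \<le> n ^ ?T" using n by (simp add: power_mono)
  finally have cY: "real (card ?Y) \<le> n ^ ?T" .
  have "(\<Sum>y\<in>?Y. e y) ^ s \<le> real (card ?Y) ^ (s - 1) * (\<Sum>y\<in>?Y. e y ^ s)"
    using s by (intro power_mean_card) (auto simp: e_def)
  also have "\<dots> \<le> (n ^ ?T) ^ (s - 1) * (\<Sum>y\<in>?Y. e y ^ s)"
    using cY by (intro mult_right_mono power_mono sum_nonneg) (auto simp: e_def)
  finally have main: "(\<Sum>y\<in>?Y. e y) ^ s \<le> (n ^ ?T) ^ (s - 1) * (\<Sum>y\<in>?Y. e y ^ s)" .
  have "(n ^ (?T + 1)) ^ s = (n ^ ?T) ^ (s - 1) * n ^ (?T + s)"
  proof -
    have "(n ^ (?T + 1)) ^ s = (n ^ ?T) ^ s * n ^ s" by (simp add: power_mult_distrib mult.commute)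
    also have "(n ^ ?T) ^ s = (n ^ ?T) ^ (s - 1) * n ^ ?T"
      using s by (metis power_minus_mult less_le_trans zero_less_one)
    finally show ?thesis by (simp add: power_add)
  qed
  note eq = this
  have "(\<Sum>y\<in>?Y. e y) ^ s / (n ^ (?T + 1)) ^ s \<le> (\<Sum>y\<in>?Y. e y ^ s) / n ^ (?T + s)"
  proof -
    let ?b = "(n ^ ?T) ^ (s - 1)" and ?d = "n ^ (?T + s)"
    have pos: "?b > 0" "?d > 0" using n by auto
    have "(\<Sum>y\<in>?Y. e y) ^ s / (?b * ?d) \<le> ?b * (\<Sum>y\<in>?Y. e y ^ s) / (?b * ?d)"
      using main pos by (intro divide_right_mono) auto
    also have "\<dots> = (\<Sum>y\<in>?Y. e y ^ s) / ?d" using pos by simp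
    finally show ?thesis unfolding eq .
  qed
  then show ?thesis unfolding Z1 Z2 T1 T2 by (simp add: power_divide)
qed

lemma card_conf_ones:
  assumes "finite X"
  shows "card (conf E (\<lambda>_. 1) J X) = card (cliq E J X)"
proof -
  have sing: "\<exists>a\<in>X. x j = [a]" if "x \<in> conf E (\<lambda>_. 1) J X" "j \<in> J" for x j
  proof -
    have "length (x j) = 1" "set (x j) \<subseteq> X" using that by (auto simp: conf_def PiE_def Pi_def)
    then show ?thesis by (cases "x j") auto
  qed
  have "bij_betw (\<lambda>y. \<lambda>j\<in>J. [y j]) (cliq E J X) (conf E (\<lambda>_. 1) J X)"
  proof (rule bij_betw_byWitness[where f' = "\<lambda>x. \<lambda>j\<in>J. hd (x j)"])
    show "\<forall>a\<in>cliq E J X. (\<lambda>j\<in>J. hd ((\<lambda>j\<in>J. [a j]) j)) = a"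
      by (auto simp: cliq_def fun_eq_iff PiE_def extensional_def)
    show "\<forall>x\<in>conf E (\<lambda>_. 1) J X. (\<lambda>j\<in>J. [(\<lambda>j\<in>J. hd (x j)) j]) = x"
    proof
      fix x assume x: "x \<in> conf E (\<lambda>_. 1) J X"
      have "[hd (x j)] = x j" if "j \<in> J" for j using sing[OF x that] by auto
      then show "(\<lambda>j\<in>J. [(\<lambda>j\<in>J. hd (x j)) j]) = x"
        using x by (auto simp: fun_eq_iff conf_def PiE_def extensional_def)
    qed
    show "(\<lambda>y. \<lambda>j\<in>J. [y j]) ` cliq E J X \<subseteq> conf E (\<lambda>_. 1) J X"
      by (auto simp: cliq_def conf_def)
    show "(\<lambda>x. \<lambda>j\<in>J. hd (x j)) ` conf E (\<lambda>_. 1) J X \<subseteq> cliq E J X"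
    proof
      fix z assume "z \<in> (\<lambda>x. \<lambda>j\<in>J. hd (x j)) ` conf E (\<lambda>_. 1) J X"
      then obtain x where x: "x \<in> conf E (\<lambda>_. 1) J X" and z: "z = (\<lambda>j\<in>J. hd (x j))" by auto
      have hdx: "hd (x j) \<in> set (x j)" "hd (x j) \<in> X" if "j \<in> J" for j using sing[OF x that] by auto
      have "E (hd (x i)) (hd (x j))" if "i \<in> J" "j \<in> J" "i \<noteq> j" for i j
        using x hdx(1)[OF that(1)] hdx(1)[OF that(2)] that unfolding conf_def by blast
      then show "z \<in> cliq E J X" using hdx(2) by (auto simp: z cliq_def)
    qed
  qed
  from bij_betw_same_card[OF this] show ?thesis by simp
qed

text \<open>The coordinates of a clique are lengthened one after the other, each to the size of its
  colour class. Every lengthening raises the density to that power, so the exponent is the product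
  of the class sizes. The maps that are counted need not be injective.\<close>

lemma clique_blowup:
  fixes n :: real and col :: "'a \<Rightarrow> nat"
  assumes fX: "finite X" and sym: "symp E" and n: "n > 0" "real (card X) \<le> n"
    and fD: "finite D" and col: "col ` D = {..<k}"
  shows "(real (kcount E k X) / n ^ k) ^ (\<Prod>j<k. card {u \<in> D. col u = j})
    \<le> real (card {g \<in> D \<rightarrow>\<^sub>E X. \<forall>x\<in>D. \<forall>y\<in>D. col x \<noteq> col y \<longrightarrow> E (g x) (g y)}) / n ^ card D"
proof -
  define \<mu> where "\<mu> = (\<lambda>j. card {u \<in> D. col u = j})"
  \<comment> \<open>After t lengthenings the first t coordinates hold whole colour classes, the
    others still a single vertex.\<close>
  define m where "m = (\<lambda>t j. if j < t then \<mu> j else 1::nat)"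
  define z where "z = (\<lambda>t. real (card (conf E (m t) {..<k} X)) / n ^ (\<Sum>i<k. m t i))"
  define \<kappa> where "\<kappa> = real (kcount E k X) / n ^ k"
  let ?H = "{g \<in> D \<rightarrow>\<^sub>E X. \<forall>x\<in>D. \<forall>y\<in>D. col x \<noteq> col y \<longrightarrow> E (g x) (g y)}"
  have \<mu>1: "\<mu> j \<ge> 1" if "j < k" for j
  proof -
    have "j \<in> col ` D" using that col by simp
    then obtain u where "u \<in> D" "col u = j" by auto
    then have "{u \<in> D. col u = j} \<noteq> {}" by auto
    then show ?thesis using fD by (simp add: \<mu>_def Suc_le_eq card_gt_0_iff)
  qed
  have \<kappa>0: "\<kappa> \<ge> 0" using n by (simp add: \<kappa>_def)
  have z0: "z 0 = \<kappa>"
  proof -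
    have "m 0 = (\<lambda>_. 1)" by (auto simp: m_def)
    then show ?thesis using card_conf_ones[OF fX, of E "{..<k}"] card_cliq[OF _ fX sym, of "{..<k}"]
      by (simp add: z_def \<kappa>_def)
  qed
  have "\<kappa> ^ (\<Prod>j<t. \<mu> j) \<le> z t" if "t \<le> k" for t
    using that
  proof (induction t)
    case 0
    then show ?case using z0 by simp
  next
    case (Suc t)
    have ins: "insert t ({..<k} - {t}) = {..<k}" using Suc.prems by auto
    have m: "(m t)(t := \<mu> t) = m (Suc t)" by (auto simp: m_def fun_eq_iff)
    have "\<kappa> ^ (\<Prod>j<Suc t. \<mu> j) = (\<kappa> ^ (\<Prod>j<t. \<mu> j)) ^ \<mu> t" by (simp add: power_mult)
    also have "\<dots> \<le> z t ^ \<mu> t" using Suc \<kappa>0 by (intro power_mono) auto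
    also have "\<dots> \<le> z (Suc t)"
      using conf_duplicate[of "{..<k} - {t}" X t E n "\<mu> t" "m t"] fX sym n \<mu>1[of t] Suc.prems
      unfolding ins m z_def by (auto simp: m_def)
    finally show ?case .
  qed
  then have "\<kappa> ^ (\<Prod>j<k. \<mu> j) \<le> z k" by simp
  also have "z k \<le> real (card ?H) / n ^ card D"
  proof -
    \<comment> \<open>With an enumeration of every colour class, a configuration becomes a map on D:
      a vertex of colour j takes the entry of list j at its own position.\<close>
    have "\<forall>j. \<exists>l. distinct l \<and> set l = {u \<in> D. col u = j}"
    proof
      fix j
      have "finite {u \<in> D. col u = j}" using fD by simp
      from finite_distinct_list[OF this] show "\<exists>l. distinct l \<and> set l = {u \<in> D. col u = j}" by auto
    qed
    then obtain us where us: "\<And>j. distinct (us j)" "\<And>j. set (us j) = {u \<in> D. col u = j}" by metis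
    have len: "length (us j) = \<mu> j" for j using us distinct_card[of "us j"] by (simp add: \<mu>_def)
    have "\<forall>u\<in>D. \<exists>i. i < length (us (col u)) \<and> us (col u) ! i = u"
    proof
      fix u assume "u \<in> D"
      then have "u \<in> set (us (col u))" using us(2) by simp
      then show "\<exists>i. i < length (us (col u)) \<and> us (col u) ! i = u" by (simp add: in_set_conv_nth)
    qed
    then obtain idx where idx: "\<And>u. u \<in> D \<Longrightarrow> idx u < length (us (col u))" "\<And>u. u \<in> D \<Longrightarrow> us (col u) ! idx u = u"
      by metis
    let ?\<Phi> = "\<lambda>x. \<lambda>u\<in>D. x (col u) ! idx u"
    have cf: "conf E (m k) {..<k} X = conf E \<mu> {..<k} X" by (rule conf_cong) (auto simp: m_def)
    have colk: "col u < k" if "u \<in> D" for u using that col by auto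
    have lenx: "length (x j) = \<mu> j" "set (x j) \<subseteq> X" if "x \<in> conf E \<mu> {..<k} X" "j < k" for x j
      using that by (auto simp: conf_def PiE_def Pi_def)
    have inset: "x (col u) ! idx u \<in> set (x (col u))" if "x \<in> conf E \<mu> {..<k} X" "u \<in> D" for x u
      using lenx(1)[OF that(1) colk[OF that(2)]] idx(1)[OF that(2)] len by (intro nth_mem) simp
    have inj: "inj_on ?\<Phi> (conf E \<mu> {..<k} X)"
    proof (rule inj_onI)
      fix x y assume x: "x \<in> conf E \<mu> {..<k} X" and y: "y \<in> conf E \<mu> {..<k} X" and eq: "?\<Phi> x = ?\<Phi> y"
      have "x j = y j" if j: "j < k" for j
      proof (rule nth_equalityI)
        show "length (x j) = length (y j)" using lenx x y j by simp
        fix l assume "l < length (x j)"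
        then have l: "l < length (us j)" using lenx x j len by simp
        define u where "u = us j ! l"
        have u: "u \<in> D" "col u = j" using l us(2)[of j] nth_mem[OF l] by (auto simp: u_def)
        then have "idx u = l" using idx[OF u(1)] us(1)[of j] l by (simp add: u_def nth_eq_iff_index_eq)
        then show "x j ! l = y j ! l" using fun_cong[OF eq, of u] u by simp
      qed
      then show "x = y" using x y by (intro PiE_ext[of x "{..<k}" _ y]) (auto simp: conf_def)
    qed
    have "?\<Phi> ` conf E \<mu> {..<k} X \<subseteq> ?H"
    proof
      fix g assume "g \<in> ?\<Phi> ` conf E \<mu> {..<k} X"
      then obtain x where x: "x \<in> conf E \<mu> {..<k} X" "g = ?\<Phi> x" by auto
      have "E (x (col u) ! idx u) (x (col v) ! idx v)" if "u \<in> D" "v \<in> D" "col u \<noteq> col v" for u v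
        using x(1) inset[OF x(1) that(1)] inset[OF x(1) that(2)] colk[OF that(1)] colk[OF that(2)] that(3)
        unfolding conf_def by blast
      moreover have "x (col u) ! idx u \<in> X" if "u \<in> D" for u
        using lenx(2)[OF x(1) colk] inset[OF x(1)] that by auto
      ultimately show "g \<in> ?H" using x(2) by auto
    qed
    moreover have "finite ?H" using fD fX by (intro finite_subset[OF _ finite_PiE[of D "\<lambda>_. X"]]) auto
    ultimately have "card (conf E \<mu> {..<k} X) \<le> card ?H" using card_inj_on_le[OF inj] by simp
    moreover have "(\<Sum>i<k. m k i) = card D"
    proof -
      have "card D = (\<Sum>j\<in>{..<k}. card {u \<in> D. col u = j})"
        using sum.group[of D "{..<k}" col "\<lambda>_. 1::nat"] fD col by simp
      then show ?thesis by (simp add: m_def \<mu>_def)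
    qed
    ultimately show ?thesis unfolding z_def cf using n by (simp add: divide_right_mono)
  qed
  finally show ?thesis by (simp add: \<kappa>_def \<mu>_def)
qed

section \<open>Partitions of graphs with few large cliques\<close>

lemma card_extn_ge:
  fixes d :: real
  assumes fX: "finite X" and fJ: "finite J"
    and d: "\<And>j. j \<in> J \<Longrightarrow> real (card {w \<in> X. \<not> E w (x j)}) \<le> d"
  shows "real (card X) - real (card J) * d \<le> real (card (extn E X J x))"
proof -
  have "X - extn E X J x \<subseteq> (\<Union>j\<in>J. {w \<in> X. \<not> E w (x j)})" by (auto simp: extn_def)
  then have "card (X - extn E X J x) \<le> card (\<Union>j\<in>J. {w \<in> X. \<not> E w (x j)})"
    using fX fJ by (intro card_mono) auto
  also have "\<dots> \<le> (\<Sum>j\<in>J. card {w \<in> X. \<not> E w (x j)})" using fJ by (rule card_UN_le)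
  finally have "real (card (X - extn E X J x)) \<le> (\<Sum>j\<in>J. real (card {w \<in> X. \<not> E w (x j)}))"
    by (simp flip: of_nat_sum)
  also have "\<dots> \<le> real (card J) * d" using sum_bounded_above[of J "\<lambda>j. real (card {w \<in> X. \<not> E w (x j)})" d] d by auto
  also have "card (X - extn E X J x) = card X - card (extn E X J x)"
    using fX by (intro card_Diff_subset) (auto simp: extn_def)
  ultimately show ?thesis by linarith
qed

text \<open>A clique \<open>x\<close> of size \<open>r\<close> with few extensions yields the parts: part \<open>i\<close> consists of the
  common neighbours of all \<open>x j\<close>, \<open>j \<noteq> i\<close>.\<close>

lemma near_turan_partition:
  fixes r :: nat and \<mu> \<epsilon> \<delta> n :: real
  assumes fV: "finite V" and XV: "X \<subseteq> V" and sym: "symp E" and r: "r \<ge> 1"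
    and n: "n = real (card V)" "n > 0"
    and miss: "real (card (V - X)) \<le> \<mu> * n" and \<mu>: "0 \<le> \<mu>" and \<epsilon>: "0 \<le> \<epsilon>" and small: "\<mu> + \<epsilon> \<le> 1 / (2 * r)"
    and codeg: "\<And>v. v \<in> X \<Longrightarrow> real (card {w \<in> V. \<not> E v w}) \<le> (1 + \<epsilon>) * n / r"
    and few: "real (kcount E (r + 1) X) \<le> \<delta> * n ^ (r + 1)"
  defines "\<omega> \<equiv> real (r + 1) * (2 * r) ^ r * \<delta>"
  shows "\<exists>p. (\<forall>v\<in>V. p v < r) \<and>
    real (card {(u, w) \<in> V \<times> V. E u w \<and> p u = p w}) \<le> (\<omega> + 2 * r * (\<mu> + \<epsilon> + \<omega>)) * n\<^sup>2"
proof -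
  have fX: "finite X" using XV fV finite_subset by auto
  have cX: "real (card X) \<ge> (1 - \<mu>) * n"
    using miss XV fV card_Diff_subset[of X V] fX card_mono[of V X] by (simp add: n algebra_simps of_nat_diff)
  have cXn: "real (card X) \<le> n" using card_mono[OF fV XV] by (simp add: n)
  have symE: "E a b = E b a" for a b using sym by (meson sympD)
  have codegX: "real (card {w \<in> X. \<not> E w v}) \<le> (1 + \<epsilon>) * n / r" if "v \<in> X" for v
  proof -
    have "card {w \<in> X. \<not> E w v} \<le> card {w \<in> V. \<not> E v w}"
      using XV fV symE by (intro card_mono) auto
    then show ?thesis using codeg[OF that] by linarith
  qed
  have ext_ge: "real (card (extn E X J x)) \<ge> (1 - \<mu> - real (card J) * (1 + \<epsilon>) / r) * n"
    if "finite J" "\<And>j. j \<in> J \<Longrightarrow> x j \<in> X" for J :: "nat set" and x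
    using card_extn_ge[OF fX that(1), of E x "(1 + \<epsilon>) * n / r"] codegX that(2) cX by (auto simp: algebra_simps)
  \<comment> \<open>Removing at most r - 1 neighbourhood defects of size about n/r leaves n/r
    vertices; half of that absorbs \<mu> and \<epsilon>. This is the factor 1/(2r) in
    \<open>\<omega>\<close>.\<close>
  have dens: "1 - \<mu> - real s * (1 + \<epsilon>) / r \<ge> 1 / (2 * r)" if "s \<le> r - 1" for s
  proof -
    have "real s \<le> real r - 1" using that r by linarith
    then have "real s * (1 + \<epsilon>) / r \<le> (real r - 1) * (1 + \<epsilon>) / r"
      using \<epsilon> by (intro divide_right_mono mult_right_mono) auto
    also have "\<dots> = (1 + \<epsilon>) - (1 + \<epsilon>) / r" using r by (simp add: field_simps)
    also have "\<dots> \<le> 1 + \<epsilon> - 1 / r" using \<epsilon> r by (simp add: divide_right_mono)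
    finally show ?thesis using small by (simp add: mult.commute[of 2] flip: divide_divide_eq_left)
  qed
  have greedy: "real (card (cliq E {..<s} X)) \<ge> (n / (2 * r)) ^ s" if "s \<le> r" for s
    using that
  proof (induction s)
    case 0
    then show ?case by (simp add: cliq_def)
  next
    case (Suc s)
    have e: "n / (2 * r) \<le> real (card (extn E X {..<s} y))" if y: "y \<in> cliq E {..<s} X" for y
    proof -
      have "n / (2 * r) \<le> (1 - \<mu> - real s * (1 + \<epsilon>) / r) * n"
        using mult_right_mono[OF dens[of s], of n] Suc.prems n by simp
      moreover have "y j \<in> X" if "j < s" for j using y that by (auto simp: cliq_def)
      ultimately show ?thesis using ext_ge[of "{..<s}" y] by auto
    qed
    have "(n / (2 * r)) ^ Suc s = (n / (2 * r)) ^ s * (n / (2 * r))" by simp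
    also have "\<dots> \<le> real (card (cliq E {..<s} X)) * (n / (2 * r))"
      using Suc n(2) by (intro mult_right_mono) auto
    also have "\<dots> \<le> (\<Sum>y\<in>cliq E {..<s} X. real (card (extn E X {..<s} y)))"
      using sum_mono[OF e, of "cliq E {..<s} X" "\<lambda>y. y"] by simp
    also have "\<dots> = real (card (cliq E {..<Suc s} X))"
      using card_cliq_insert[of "{..<s}" X s E] fX sym by (simp add: lessThan_Suc)
    finally show ?case .
  qed
  let ?I = "{..<r}"
  \<comment> \<open>The inside edges, as ordered pairs, of the common neighbourhood of the
    \<open>x j\<close> with j in J. Together with a clique on r - 1 coordinates each of them forms a
    clique of size r + 1, so their total is controlled by \<open>few\<close>.\<close>
  define pr where "pr = (\<lambda>(J :: nat set) x. real (card {(u, w) \<in> extn E X J x \<times> extn E X J x. E u w}))"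
  have pr_sum: "(\<Sum>y\<in>cliq E (?I - {i}) X. pr (?I - {i}) y) = real (kcount E (r + 1) X)" if i: "i < r" for i
  proof -
    let ?J = "?I - {i}"
    have ins: "insert i ?J = ?I" "finite ?J" "i \<notin> ?J" using i by auto
    have "pr ?J y = (\<Sum>a\<in>extn E X ?J y. real (card (extn E X ?I (y(i := a)))))" for y
    proof -
      have "{(u, w) \<in> extn E X ?J y \<times> extn E X ?J y. E u w} = Sigma (extn E X ?J y) (\<lambda>a. extn E X ?I (y(i := a)))"
      proof -
        have "extn E X ?I (y(i := a)) = {w \<in> extn E X ?J y. E a w}" for a
        proof -
          have "extn E X (insert i ?J) (y(i := a)) = {w \<in> extn E X ?J y. E a w}"
            using symE by (auto simp: extn_def)
          then show ?thesis unfolding ins(1) .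
        qed
        then show ?thesis by auto
      qed
      then show ?thesis using fX by (simp add: pr_def finite_extn)
    qed
    then have "(\<Sum>y\<in>cliq E ?J X. pr ?J y) = (\<Sum>x\<in>cliq E ?I X. real (card (extn E X ?I x)))"
      using sum_cliq_insert[OF ins(2) fX ins(3) sym, of "\<lambda>x. real (card (extn E X ?I x))"]
      unfolding ins(1) by simp
    also have "\<dots> = real (kcount E (r + 1) X)"
      using card_cliq_insert[of ?I X r E] card_cliq[of "insert r ?I" X E] fX sym by simp
    finally show ?thesis .
  qed
  have pr_sum': "(\<Sum>x\<in>cliq E ?I X. pr (?I - {i}) x) \<le> n * real (kcount E (r + 1) X)" if i: "i < r" for i
  proof -
    let ?J = "?I - {i}"
    have ins: "insert i ?J = ?I" "finite ?J" "i \<notin> ?J" using i by auto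
    have "(\<Sum>x\<in>cliq E ?I X. pr ?J x) = (\<Sum>y\<in>cliq E ?J X. \<Sum>a\<in>extn E X ?J y. pr ?J (y(i := a)))"
      using sum_cliq_insert[OF ins(2) fX ins(3) sym, of "pr ?J"] unfolding ins(1) .
    also have "\<dots> = (\<Sum>y\<in>cliq E ?J X. real (card (extn E X ?J y)) * pr ?J y)"
      using ins(3) by (simp add: pr_def extn_fun_upd)
    also have "\<dots> \<le> (\<Sum>y\<in>cliq E ?J X. n * pr ?J y)"
    proof (intro sum_mono mult_right_mono)
      fix y
      have "card (extn E X ?J y) \<le> card X" using fX by (intro card_mono) (auto simp: extn_def)
      then show "real (card (extn E X ?J y)) \<le> n" using cXn by linarith
    qed (simp add: pr_def)
    also have "\<dots> = n * real (kcount E (r + 1) X)" using pr_sum[OF i] by (simp add: sum_distrib_left[symmetric])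
    finally show ?thesis .
  qed
  \<comment> \<open>The two defects of x: edges inside the intended parts, and vertices that would
    belong to all parts at once. The factor n brings the second one to the same scale, so that each
    of the r + 1 summands totals at most n times the number of cliques of size r + 1.\<close>
  define val where "val = (\<lambda>x. (\<Sum>i<r. pr (?I - {i}) x) + n * real (card (extn E X ?I x)))"
  have fC: "finite (cliq E ?I X)" using fX by (simp add: finite_cliq)
  have "(\<Sum>x\<in>cliq E ?I X. val x) = (\<Sum>i<r. \<Sum>x\<in>cliq E ?I X. pr (?I - {i}) x) + n * (\<Sum>x\<in>cliq E ?I X. real (card (extn E X ?I x)))"
    unfolding val_def by (simp add: sum.distrib sum_distrib_left sum.swap[of _ "cliq E ?I X"])
  also have "(\<Sum>x\<in>cliq E ?I X. real (card (extn E X ?I x))) = real (kcount E (r + 1) X)"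
    using card_cliq_insert[of ?I X r E] card_cliq[of "insert r ?I" X E] fX sym by simp
  also have "(\<Sum>i<r. \<Sum>x\<in>cliq E ?I X. pr (?I - {i}) x) \<le> (\<Sum>i<r. n * real (kcount E (r + 1) X))"
    using pr_sum' by (intro sum_mono) auto
  finally have "(\<Sum>x\<in>cliq E ?I X. val x) \<le> real (r + 1) * (n * real (kcount E (r + 1) X))"
    by (simp add: algebra_simps)
  also have "\<dots> \<le> real (r + 1) * (n * (\<delta> * n ^ (r + 1)))"
    using few n by (intro mult_left_mono) auto
  also have "\<dots> = \<omega> * n\<^sup>2 * (n / (2 * r)) ^ r"
    using r by (simp add: \<omega>_def power_divide power2_eq_square)
  finally have tot: "(\<Sum>x\<in>cliq E ?I X. val x) \<le> \<omega> * n\<^sup>2 * (n / (2 * r)) ^ r" .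
  have \<omega>0: "\<omega> \<ge> 0"
  proof -
    have "0 \<le> \<delta> * n ^ (r + 1)" using few by (meson of_nat_0_le_iff order_trans)
    moreover have "n ^ (r + 1) > 0" using n(2) by simp
    ultimately have "\<delta> \<ge> 0" by (simp add: zero_le_mult_iff not_less)
    then show ?thesis by (simp add: \<omega>_def)
  qed
  have pos: "(n / (2 * r)) ^ r > 0" using n r by simp
  \<comment> \<open>Averaging: \<open>greedy\<close> gives at least \<open>(n / (2 * r)) ^ r\<close>
    cliques, and \<omega> is defined so that the total of \<open>val\<close> divided by this number
    is \<omega> n^2.\<close>
  have "\<exists>x\<in>cliq E ?I X. val x \<le> \<omega> * n\<^sup>2"
  proof (rule ccontr)
    assume "\<not> ?thesis"
    then have lt: "\<omega> * n\<^sup>2 < val x" if "x \<in> cliq E ?I X" for x using that by force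
    have ne: "cliq E ?I X \<noteq> {}" using greedy[of r] pos by auto
    have "(\<Sum>x\<in>cliq E ?I X. \<omega> * n\<^sup>2) < (\<Sum>x\<in>cliq E ?I X. val x)"
      using lt ne fC by (intro sum_strict_mono) auto
    moreover have "\<omega> * n\<^sup>2 * (n / (2 * r)) ^ r \<le> \<omega> * n\<^sup>2 * real (card (cliq E ?I X))"
      using greedy[of r] \<omega>0 by (intro mult_left_mono) auto
    ultimately show False using tot by (simp add: mult.commute)
  qed
  then obtain x where x: "x \<in> cliq E ?I X" and vx: "val x \<le> \<omega> * n\<^sup>2" by auto
  have prx: "(\<Sum>i<r. pr (?I - {i}) x) \<le> \<omega> * n\<^sup>2"
  proof -
    have "n * real (card (extn E X ?I x)) \<ge> 0" using n by simp
    then show ?thesis using vx unfolding val_def by linarith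
  qed
  have exx: "real (card (extn E X ?I x)) \<le> \<omega> * n"
  proof -
    have "(\<Sum>i<r. pr (?I - {i}) x) \<ge> 0" by (intro sum_nonneg) (simp add: pr_def)
    then have "n * real (card (extn E X ?I x)) \<le> \<omega> * n\<^sup>2" using vx by (simp add: val_def)
    then have "n * real (card (extn E X ?I x)) \<le> n * (\<omega> * n)" by (simp add: power2_eq_square algebra_simps)
    then show ?thesis using n by simp
  qed
  define C where "C = (\<lambda>i. extn E X (?I - {i}) x)"
  define U where "U = V - (\<Union>i<r. C i)"
  \<comment> \<open>Vertices outside all the sets \<open>C i\<close> go to part 0, and a vertex in
    several of them to the first one.\<close>
  define p where "p = (\<lambda>v. if v \<in> U then 0 else LEAST i. i < r \<and> v \<in> C i)"
  have pC: "p v < r \<and> v \<in> C (p v)" if "v \<in> V" "v \<notin> U" for v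
  proof -
    have "\<exists>i. i < r \<and> v \<in> C i" using that by (auto simp: U_def)
    from LeastI_ex[OF this] show ?thesis using that by (simp add: p_def)
  qed
  have pr: "p v < r" if "v \<in> V" for v
    using pC[OF that] r by (cases "v \<in> U") (auto simp: p_def)
  have CV: "(\<Union>i<r. C i) \<subseteq> V" using XV by (auto simp: C_def extn_def)
  have fU: "finite U" using fV by (simp add: U_def)
  have cU: "real (card U) \<le> r * (\<mu> + \<epsilon> + \<omega>) * n"
  proof -
    \<comment> \<open>Each \<open>C i\<close> has nearly n/r vertices, and they overlap only in the
      extensions of x, which are few by \<open>exx\<close>; so their union misses little.\<close>
    have "(1 - \<mu> - (real r - 1) * (1 + \<epsilon>) / r) * n \<le> real (card (C i))" if "i < r" for i
      using ext_ge[of "?I - {i}" x] x that r by (auto simp: C_def cliq_def of_nat_diff)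
    then have "real r * ((1 - \<mu> - (real r - 1) * (1 + \<epsilon>) / r) * n) \<le> (\<Sum>i<r. real (card (C i)))"
      using sum_bounded_below[of ?I "(1 - \<mu> - (real r - 1) * (1 + \<epsilon>) / r) * n" "\<lambda>i. real (card (C i))"] by simp
    also have "\<dots> = real (\<Sum>i<r. card (C i))" by simp
    also have "\<dots> \<le> real (card (\<Union>i<r. C i) + (r - 1) * card (extn E X ?I x))"
      using sum_card_extn_remove[of ?I X E x] fX by (intro of_nat_mono) (simp add: C_def)
    also have "\<dots> \<le> real (card (\<Union>i<r. C i)) + (real r - 1) * (\<omega> * n)"
      using exx r by (simp add: of_nat_diff mult_left_mono)
    finally have "real r * ((1 - \<mu> - (real r - 1) * (1 + \<epsilon>) / r) * n) - (real r - 1) * (\<omega> * n) \<le> real (card (\<Union>i<r. C i))" by simp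
    moreover have "real (card U) = n - real (card (\<Union>i<r. C i))"
      using CV fV card_mono[OF fV CV] finite_subset[OF CV fV]
      unfolding U_def by (subst card_Diff_subset) (auto simp: n of_nat_diff)
    moreover have "real r * ((1 - \<mu> - (real r - 1) * (1 + \<epsilon>) / r) * n) = (r * (1 - \<mu>) - (real r - 1) * (1 + \<epsilon>)) * n"
      using r by (simp add: field_simps)
    ultimately have "real (card U) \<le> n - (r * (1 - \<mu>) - (real r - 1) * (1 + \<epsilon>)) * n + (real r - 1) * (\<omega> * n)"
      by linarith
    also have "\<dots> = (r * \<mu> + (real r - 1) * (\<epsilon> + \<omega>)) * n" by (simp add: algebra_simps)
    also have "\<dots> \<le> (r * \<mu> + r * (\<epsilon> + \<omega>)) * n"
      using n \<epsilon> \<omega>0 by (intro mult_right_mono add_left_mono) auto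
    finally show ?thesis by (simp add: algebra_simps)
  qed
  have "{(u, w) \<in> V \<times> V. E u w \<and> p u = p w}
      \<subseteq> (\<Union>i<r. {(u, w) \<in> C i \<times> C i. E u w}) \<union> U \<times> V \<union> V \<times> U" (is "?M \<subseteq> ?R")
  proof
    fix z assume "z \<in> ?M"
    then obtain u w where z: "z = (u, w)" and uw: "u \<in> V" "w \<in> V" "E u w" "p u = p w" by auto
    show "z \<in> ?R"
    proof (rule ccontr)
      assume nR: "z \<notin> ?R"
      then have "u \<notin> U" "w \<notin> U" using uw z by auto
      then have "p u < r" "u \<in> C (p u)" "w \<in> C (p u)" using pC[of u] pC[of w] uw by auto
      then show False using nR uw z by blast
    qed
  qed
  moreover have "finite ?R"
  proof -
    have "C i \<subseteq> X" for i by (auto simp: C_def extn_def)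
    then have "{(u, w) \<in> C i \<times> C i. E u w} \<subseteq> X \<times> X" for i by blast
    then have "finite {(u, w) \<in> C i \<times> C i. E u w}" for i
      using finite_subset finite_cartesian_product[OF fX fX] by blast
    then show ?thesis
      by (intro finite_UnI finite_UN_I finite_cartesian_product fU fV finite_lessThan)
  qed
  ultimately have "card {(u, w) \<in> V \<times> V. E u w \<and> p u = p w}
      \<le> card ((\<Union>i<r. {(u, w) \<in> C i \<times> C i. E u w}) \<union> U \<times> V \<union> V \<times> U)"
    by (intro card_mono)
  also have "\<dots> \<le> card (\<Union>i<r. {(u, w) \<in> C i \<times> C i. E u w}) + card (U \<times> V) + card (V \<times> U)"
    using card_Un_le[of "(\<Union>i<r. {(u, w) \<in> C i \<times> C i. E u w}) \<union> U \<times> V" "V \<times> U"]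
      card_Un_le[of "\<Union>i<r. {(u, w) \<in> C i \<times> C i. E u w}" "U \<times> V"] by linarith
  also have "\<dots> \<le> (\<Sum>i<r. card {(u, w) \<in> C i \<times> C i. E u w}) + card (U \<times> V) + card (V \<times> U)"
    by (intro add_right_mono card_UN_le) auto
  finally have "real (card {(u, w) \<in> V \<times> V. E u w \<and> p u = p w})
      \<le> real ((\<Sum>i<r. card {(u, w) \<in> C i \<times> C i. E u w}) + card (U \<times> V) + card (V \<times> U))"
    by (rule of_nat_mono)
  also have "\<dots> = (\<Sum>i<r. pr (?I - {i}) x) + 2 * n * real (card U)"
    by (simp add: pr_def C_def n card_cartesian_product)
  also have "\<dots> \<le> \<omega> * n\<^sup>2 + 2 * n * (r * (\<mu> + \<epsilon> + \<omega>) * n)"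
    using prx cU n by (intro add_mono mult_left_mono) auto
  also have "\<dots> = (\<omega> + 2 * r * (\<mu> + \<epsilon> + \<omega>)) * n\<^sup>2" by (simp add: power2_eq_square algebra_simps)
  finally show ?thesis using pr by (intro exI[of _ p]) auto
qed

section \<open>Embeddings of hairy graphs\<close>

definition emb :: "'a ugraph \<Rightarrow> 'b ugraph \<Rightarrow> ('a \<Rightarrow> 'b) set" where
  "emb H G = {f \<in> inj_maps H G. \<forall>e\<in>edges H. f ` e \<in> edges G}"

definition deg :: "'a ugraph \<Rightarrow> 'a \<Rightarrow> nat" where
  "deg G v = card {w \<in> verts G. {v, w} \<in> edges G}"

definition thru :: "'a ugraph \<Rightarrow> 'b ugraph \<Rightarrow> 'b \<Rightarrow> ('a \<Rightarrow> 'b) set" where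
  "thru H G v = {f \<in> emb H G. v \<in> f ` verts H}"

text \<open>The falling factorial x (x - 1) ... (x - m + 1), with a real argument so that
  differences and bounds need no truncated subtraction.\<close>

definition ff :: "real \<Rightarrow> nat \<Rightarrow> real" where
  "ff x m = (\<Prod>j<m. x - real j)"

lemma t_inj_emb: "t_inj H G = real (card (emb H G)) / real (card (inj_maps H G))"
  by (simp add: t_inj_def emb_def)

lemma fin_simple_graphD:
  assumes "fin_simple_graph G"
  shows "finite (verts G)" and "{u, w} \<in> edges G \<Longrightarrow> u \<in> verts G \<and> w \<in> verts G \<and> u \<noteq> w"
    and "e \<in> edges G \<Longrightarrow> \<exists>u w. e = {u, w} \<and> u \<in> verts G \<and> w \<in> verts G \<and> u \<noteq> w"
proof -
  have mem: "\<exists>u w. e = {u, w} \<and> u \<in> verts G \<and> w \<in> verts G \<and> u \<noteq> w" if "e \<in> edges G" for e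
  proof -
    have "e \<in> [verts G]\<^bsup>2\<^esup>" using assms that by (auto simp: fin_simple_graph_def)
    then show ?thesis by (auto simp: nsets_def card_2_iff)
  qed
  then show "e \<in> edges G \<Longrightarrow> \<exists>u w. e = {u, w} \<and> u \<in> verts G \<and> w \<in> verts G \<and> u \<noteq> w" .
  show "{u, w} \<in> edges G \<Longrightarrow> u \<in> verts G \<and> w \<in> verts G \<and> u \<noteq> w"
    using mem[of "{u, w}"] by (auto simp: doubleton_eq_iff)
  show "finite (verts G)" using assms by (simp add: fin_simple_graph_def)
qed

lemma finite_inj_maps: "finite (verts H) \<Longrightarrow> finite (verts G) \<Longrightarrow> finite (inj_maps H G)"
  unfolding inj_maps_def by (rule finite_subset[OF _ finite_PiE[of "verts H" "\<lambda>_. verts G"]]) auto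

lemma finite_emb: "finite (verts H) \<Longrightarrow> finite (verts G) \<Longrightarrow> finite (emb H G)"
  unfolding emb_def by (simp add: finite_inj_maps)

lemma mem_emb_iff:
  assumes "fin_simple_graph H"
  shows "f \<in> emb H G \<longleftrightarrow> f \<in> verts H \<rightarrow>\<^sub>E verts G \<and> inj_on f (verts H) \<and>
    (\<forall>x y. {x, y} \<in> edges H \<longrightarrow> {f x, f y} \<in> edges G)"
proof -
  have "(\<forall>e\<in>edges H. f ` e \<in> edges G) \<longleftrightarrow> (\<forall>x y. {x, y} \<in> edges H \<longrightarrow> {f x, f y} \<in> edges G)"
  proof (intro iffI ballI)
    fix e assume *: "\<forall>x y. {x, y} \<in> edges H \<longrightarrow> {f x, f y} \<in> edges G" and e: "e \<in> edges H"
    obtain u w where "e = {u, w}" using fin_simple_graphD(3)[OF assms e] by auto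
    then show "f ` e \<in> edges G" using * e by auto
  qed force
  then show ?thesis by (auto simp: emb_def inj_maps_def)
qed

lemma complement_simps:
  "verts (complement G) = verts G"
  "{x, y} \<in> edges (complement G) \<longleftrightarrow> x \<in> verts G \<and> y \<in> verts G \<and> x \<noteq> y \<and> {x, y} \<notin> edges G"
  by (auto simp: complement_def nsets_def card_2_iff doubleton_eq_iff)

lemma fin_simple_complement: "fin_simple_graph G \<Longrightarrow> fin_simple_graph (complement G)"
  by (auto simp: fin_simple_graph_def complement_def)

lemma complement_complement: "fin_simple_graph G \<Longrightarrow> complement (complement G) = G"
  by (cases G) (auto simp: fin_simple_graph_def complement_def)

lemma num_verts_complement: "num_verts (complement G) = num_verts G"
  by (simp add: num_verts_def complement_simps)

lemma bonbon_objective_complement: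
  "fin_simple_graph G \<Longrightarrow> bonbon_objective H2 H1 (complement G) = bonbon_objective H1 H2 G"
  by (simp add: bonbon_objective_def complement_complement)

lemma deg_complement:
  assumes "fin_simple_graph G" and "v \<in> verts G"
  shows "deg G v + deg (complement G) v + 1 = num_verts G"
proof -
  have f: "finite (verts G)" using assms fin_simple_graphD by auto
  have "verts G = insert v ({w \<in> verts G. {v, w} \<in> edges G} \<union> {w \<in> verts G. {v, w} \<in> edges (complement G)})"
    using assms fin_simple_graphD(2)[OF assms(1)] by (auto simp: complement_simps)
  moreover have "v \<notin> {w \<in> verts G. {v, w} \<in> edges G} \<union> {w \<in> verts G. {v, w} \<in> edges (complement G)}"
    using fin_simple_graphD(2)[OF assms(1), of v v] by (auto simp: complement_simps)
  moreover have "{w \<in> verts G. {v, w} \<in> edges G} \<inter> {w \<in> verts G. {v, w} \<in> edges (complement G)} = {}"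
    by (auto simp: complement_simps)
  ultimately have "card (verts G) = Suc (card {w \<in> verts G. {v, w} \<in> edges G} + card {w \<in> verts G. {v, w} \<in> edges (complement G)})"
    using f card_insert_disjoint card_Un_disjoint
    by (metis (no_types, lifting) finite_Un finite_insert)
  then show ?thesis by (simp add: deg_def num_verts_def complement_simps(1))
qed

lemma ff_bounds:
  assumes "real m \<le> x"
  shows "(x - real m) ^ m \<le> ff x m" and "ff x m \<le> x ^ m" and "0 \<le> ff x m"
proof -
  have "(\<Prod>j<m. x - real m) \<le> (\<Prod>j<m. x - real j)" using assms by (intro prod_mono) auto
  then show "(x - real m) ^ m \<le> ff x m" by (simp add: ff_def)
  have "(\<Prod>j<m. x - real j) \<le> (\<Prod>j<m. x)" using assms by (intro prod_mono) auto
  then show "ff x m \<le> x ^ m" by (simp add: ff_def)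
  show "0 \<le> ff x m" unfolding ff_def using assms by (intro prod_nonneg) auto
qed

text \<open>The vertices of D are placed one at a time. As the parts are disjoint, a new vertex only
  has to avoid the images of those sent to the same part, which yields one falling factorial per
  part.\<close>

lemma card_inj_parts:
  assumes "finite D" and fI: "finite I" and fW: "\<And>i. i \<in> I \<Longrightarrow> finite (W i)"
    and disj: "\<And>i j. i \<in> I \<Longrightarrow> j \<in> I \<Longrightarrow> i \<noteq> j \<Longrightarrow> W i \<inter> W j = {}" and "\<sigma> ` D \<subseteq> I"
  shows "real (card {f \<in> Pi\<^sub>E D (\<lambda>x. W (\<sigma> x)). inj_on f D}) = (\<Prod>i\<in>I. ff (real (card (W i))) (card {x \<in> D. \<sigma> x = i}))"
  using assms(1,5)
proof (induction D rule: finite_induct)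
  case empty
  have "{f \<in> Pi\<^sub>E {} (\<lambda>x. W (\<sigma> x)). inj_on f {}} = {\<lambda>x. undefined}" by auto
  then show ?case by (simp add: ff_def)
next
  case (insert x D)
  define S where "S = {f \<in> Pi\<^sub>E D (\<lambda>x. W (\<sigma> x)). inj_on f D}"
  let ?k = "\<sigma> x" and ?m = "card {y \<in> D. \<sigma> y = \<sigma> x}"
  have k: "?k \<in> I" using insert.prems by auto
  have fS: "finite S" unfolding S_def
    using insert fW by (intro finite_subset[OF _ finite_PiE[of D "\<lambda>x. W (\<sigma> x)"]]) auto
  have "bij_betw (\<lambda>(f, a). f(x := a)) (Sigma S (\<lambda>f. W ?k - f ` D)) {f \<in> Pi\<^sub>E (insert x D) (\<lambda>x. W (\<sigma> x)). inj_on f (insert x D)}"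
  proof (rule bij_betw_byWitness[where f' = "\<lambda>g. (g(x := undefined), g x)"])
    show "\<forall>a\<in>Sigma S (\<lambda>f. W ?k - f ` D). (\<lambda>g. (g(x := undefined), g x)) (case a of (f, a) \<Rightarrow> f(x := a)) = a"
      using insert.hyps by (auto simp: S_def PiE_def extensional_def)
    show "\<forall>a'\<in>{f \<in> Pi\<^sub>E (insert x D) (\<lambda>x. W (\<sigma> x)). inj_on f (insert x D)}.
            (case (a'(x := undefined), a' x) of (f, a) \<Rightarrow> f(x := a)) = a'" by auto
    show "(\<lambda>(f, a). f(x := a)) ` Sigma S (\<lambda>f. W ?k - f ` D) \<subseteq> {f \<in> Pi\<^sub>E (insert x D) (\<lambda>x. W (\<sigma> x)). inj_on f (insert x D)}"
    proof clarify
      fix f a assume f: "f \<in> S" and a: "a \<in> W ?k" "a \<notin> f ` D"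
      have "inj_on (f(x := a)) D" using f insert.hyps by (auto simp: S_def inj_on_def)
      moreover have "(f(x := a)) ` (D - {x}) = f ` D" using insert.hyps by auto
      ultimately show "f(x := a) \<in> Pi\<^sub>E (insert x D) (\<lambda>x. W (\<sigma> x)) \<and> inj_on (f(x := a)) (insert x D)"
        using f a insert.hyps by (auto simp: S_def intro!: PiE_fun_upd)
    qed
    show "(\<lambda>g. (g(x := undefined), g x)) ` {f \<in> Pi\<^sub>E (insert x D) (\<lambda>x. W (\<sigma> x)). inj_on f (insert x D)} \<subseteq> Sigma S (\<lambda>f. W ?k - f ` D)"
    proof (rule image_subsetI)
      fix g assume g: "g \<in> {f \<in> Pi\<^sub>E (insert x D) (\<lambda>x. W (\<sigma> x)). inj_on f (insert x D)}"
      have "g(x := undefined) \<in> Pi\<^sub>E D (\<lambda>x. W (\<sigma> x))" using g insert.hyps by (intro fun_upd_in_PiE) auto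
      moreover have "inj_on (g(x := undefined)) D" using g insert.hyps by (auto simp: inj_on_def)
      moreover have "g x \<in> W ?k" using g by auto
      moreover have "(g(x := undefined)) ` D = g ` D" using insert.hyps by auto
      moreover have "g x \<notin> g ` D" using g insert.hyps by auto
      ultimately show "(g(x := undefined), g x) \<in> Sigma S (\<lambda>f. W ?k - f ` D)" by (simp add: S_def)
    qed
  qed
  from bij_betw_same_card[OF this]
  have "card {f \<in> Pi\<^sub>E (insert x D) (\<lambda>x. W (\<sigma> x)). inj_on f (insert x D)} = card (Sigma S (\<lambda>f. W ?k - f ` D))"
    by (rule sym)
  also have "\<dots> = (\<Sum>f\<in>S. card (W ?k - f ` D))"
    using fS fW[OF k] by (intro card_SigmaI) auto
  finally have "real (card {f \<in> Pi\<^sub>E (insert x D) (\<lambda>x. W (\<sigma> x)). inj_on f (insert x D)}) = (\<Sum>f\<in>S. real (card (W ?k - f ` D)))"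
    by (simp only: of_nat_sum)
  also have "\<dots> = (\<Sum>f\<in>S. real (card (W ?k)) - real ?m)"
  proof (rule sum.cong[OF refl])
    fix f assume f: "f \<in> S"
    have eq: "W ?k - f ` D = W ?k - f ` {y \<in> D. \<sigma> y = ?k}"
    proof -
      have "f y \<notin> W ?k" if "y \<in> D" "\<sigma> y \<noteq> ?k" for y
      proof -
        have "f y \<in> W (\<sigma> y)" using f that by (auto simp: S_def)
        moreover have "W ?k \<inter> W (\<sigma> y) = {}" using that insert.prems k by (intro disj) auto
        ultimately show ?thesis by auto
      qed
      then show ?thesis by auto
    qed
    have sub: "f ` {y \<in> D. \<sigma> y = ?k} \<subseteq> W ?k"
    proof clarify
      fix y assume "y \<in> D" "\<sigma> y = ?k"
      moreover have "f y \<in> W (\<sigma> y)" using f \<open>y \<in> D\<close> by (auto simp: S_def)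
      ultimately show "f y \<in> W ?k" by simp
    qed
    have "card (f ` {y \<in> D. \<sigma> y = ?k}) = ?m"
      using f by (intro card_image) (auto simp: S_def inj_on_def)
    then show "real (card (W ?k - f ` D)) = real (card (W ?k)) - real ?m"
      unfolding eq using sub fW[OF k] card_mono[OF fW[OF k] sub] insert.hyps
      by (subst card_Diff_subset) (auto simp: of_nat_diff)
  qed
  also have "\<dots> = (\<Prod>i\<in>I. ff (real (card (W i))) (card {x \<in> D. \<sigma> x = i})) * (real (card (W ?k)) - real ?m)"
    using insert.IH insert.prems by (simp add: S_def)
  also have "\<dots> = (\<Prod>i\<in>I. ff (real (card (W i))) (card {y \<in> insert x D. \<sigma> y = i}))"
  proof -
    have new: "ff (real (card (W i))) (card {y \<in> insert x D. \<sigma> y = i})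
        = ff (real (card (W i))) (card {y \<in> D. \<sigma> y = i}) * (if i = ?k then real (card (W ?k)) - real ?m else 1)" for i
    proof (cases "i = ?k")
      case True
      have "{y \<in> insert x D. \<sigma> y = i} = insert x {y \<in> D. \<sigma> y = i}" using True by auto
      then show ?thesis using True insert.hyps by (simp add: ff_def)
    next
      case False
      then have "{y \<in> insert x D. \<sigma> y = i} = {y \<in> D. \<sigma> y = i}" by auto
      then show ?thesis using False by simp
    qed
    show ?thesis unfolding new using k fI by (simp add: prod.distrib prod.delta)
  qed
  finally show ?case .
qed

lemma card_inj_maps:
  assumes "finite (verts H)" and "finite (verts G)"
  shows "real (card (inj_maps H G)) = ff (real (num_verts G)) (num_verts H)"
  using card_inj_parts[of "verts H" "{()}" "\<lambda>_. verts G" "\<lambda>_. ()"] assms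
  by (simp add: inj_maps_def num_verts_def image_subset_iff)

lemma card_PiE_fix1:
  assumes "finite D" "finite V" "x \<in> D"
  shows "card {f \<in> D \<rightarrow>\<^sub>E V. f x = u} \<le> card V ^ (card D - 1)"
proof -
  have "{f \<in> D \<rightarrow>\<^sub>E V. f x = u} \<subseteq> Pi\<^sub>E D (\<lambda>z. if z = x then {u} else V)" by (auto simp: PiE_def Pi_def)
  then have "card {f \<in> D \<rightarrow>\<^sub>E V. f x = u} \<le> card (Pi\<^sub>E D (\<lambda>z. if z = x then {u} else V))"
    using assms by (intro card_mono finite_PiE) auto
  also have "\<dots> = (\<Prod>z\<in>D. if z = x then 1 else card V)" using assms by (simp add: card_PiE if_distrib cong: if_cong)
  also have "\<dots> = card V ^ card (D - {x})"
    using assms by (simp add: prod.If_cases prod_constant Diff_eq)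
  also have "card (D - {x}) = card D - 1" using assms by simp
  finally show ?thesis .
qed

lemma card_PiE_fix2:
  assumes "finite D" "finite V" "x \<in> D" "y \<in> D" "x \<noteq> y"
  shows "card {f \<in> D \<rightarrow>\<^sub>E V. f x = u \<and> f y = v} \<le> card V ^ (card D - 2)"
proof -
  have "{f \<in> D \<rightarrow>\<^sub>E V. f x = u \<and> f y = v} \<subseteq> Pi\<^sub>E D (\<lambda>z. if z = x then {u} else if z = y then {v} else V)"
    by (auto simp: PiE_def Pi_def)
  then have "card {f \<in> D \<rightarrow>\<^sub>E V. f x = u \<and> f y = v} \<le> card (Pi\<^sub>E D (\<lambda>z. if z = x then {u} else if z = y then {v} else V))"
    using assms by (intro card_mono finite_PiE) auto
  also have "\<dots> = (\<Prod>z\<in>D. if z \<in> {x, y} then 1 else card V)"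
    using assms by (subst card_PiE) (auto intro!: prod.cong)
  also have "\<dots> = card V ^ card (D - {x, y})"
    using assms by (simp add: prod.If_cases prod_constant Diff_eq del: insert_iff)
  also have "card (D - {x, y}) = card D - 2" using assms by simp
  finally show ?thesis .
qed

section \<open>Counting embeddings along the construction of a hairy graph\<close>

lemma hairy_graph:
  assumes "hairy F t H" and "fin_simple_graph F"
  shows "fin_simple_graph H" and "num_verts H = num_verts F + t" and "verts F \<subseteq> verts H" and "edges F \<subseteq> edges H"
  using assms
proof (induction rule: hairy.induct)
  case (hairy_Suc t H u w)
  {
    case 1
    have "u \<in> verts H" "u \<noteq> w" using hairy_Suc 1 by auto
    then show ?case using hairy_Suc 1 by (auto simp: fin_simple_graph_def nsets_def)
  next
    case 2
    then show ?case using hairy_Suc by (auto simp: num_verts_def fin_simple_graph_def)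
  next
    case 3
    then show ?case using hairy_Suc by auto
  next
    case 4
    then show ?case using hairy_Suc by auto
  }
qed auto

lemma emb_hair_bij:
  assumes H: "fin_simple_graph H" and u: "u \<in> verts H" and w: "w \<notin> verts H"
  shows "bij_betw (\<lambda>(g, a). g(w := a)) (Sigma (emb H G) (\<lambda>g. {a \<in> verts G. {g u, a} \<in> edges G} - g ` verts H))
    (emb (Graph (insert w (verts H)) (insert {u, w} (edges H))) G)"
    (is "bij_betw ?h (Sigma _ ?N) (emb ?H' G)")
proof (rule bij_betw_byWitness[where f' = "\<lambda>g. (g(w := undefined), g w)"])
  have eH: "x \<in> verts H" "y \<in> verts H" if "{x, y} \<in> edges H" for x y
    using fin_simple_graphD(2)[OF H that] by auto
  have uw: "u \<noteq> w" using u w by auto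
  have H': "fin_simple_graph ?H'" using H u uw by (auto simp: fin_simple_graph_def nsets_def)
  show "\<forall>a\<in>Sigma (emb H G) ?N. (\<lambda>g. (g(w := undefined), g w)) (case a of (g, a) \<Rightarrow> g(w := a)) = a"
    using w by (auto simp: mem_emb_iff[OF H] PiE_def extensional_def)
  show "\<forall>a'\<in>emb ?H' G. (case (a'(w := undefined), a' w) of (g, a) \<Rightarrow> g(w := a)) = a'" by auto
  show "?h ` Sigma (emb H G) ?N \<subseteq> emb ?H' G"
  proof clarify
    fix g a assume g: "g \<in> emb H G" and a: "a \<in> verts G" "{g u, a} \<in> edges G" "a \<notin> g ` verts H"
    have "g(w := a) \<in> insert w (verts H) \<rightarrow>\<^sub>E verts G" using g a by (intro PiE_fun_upd) (auto simp: mem_emb_iff[OF H])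
    moreover have "inj_on (g(w := a)) (insert w (verts H))"
    proof -
      have "inj_on (g(w := a)) (verts H)" using g w by (auto simp: mem_emb_iff[OF H] inj_on_def)
      moreover have "(g(w := a)) ` (verts H - {w}) = g ` verts H" using w by auto
      ultimately show ?thesis using a by simp
    qed
    moreover have "{(g(w := a)) x, (g(w := a)) y} \<in> edges G" if "{x, y} \<in> insert {u, w} (edges H)" for x y
    proof (cases "{x, y} = {u, w}")
      case True
      then show ?thesis using a uw by (auto simp: doubleton_eq_iff insert_commute)
    next
      case False
      then have "{x, y} \<in> edges H" using that by auto
      then show ?thesis using g eH[of x y] w by (auto simp: mem_emb_iff[OF H])
    qed
    ultimately show "g(w := a) \<in> emb ?H' G" by (simp add: mem_emb_iff[OF H'])
  qed
  show "(\<lambda>g. (g(w := undefined), g w)) ` emb ?H' G \<subseteq> Sigma (emb H G) ?N"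
  proof (rule image_subsetI)
    fix f assume "f \<in> emb ?H' G"
    then have f: "f \<in> insert w (verts H) \<rightarrow>\<^sub>E verts G" "inj_on f (insert w (verts H))"
      "\<And>x y. {x, y} \<in> insert {u, w} (edges H) \<Longrightarrow> {f x, f y} \<in> edges G"
      by (auto simp: mem_emb_iff[OF H'])
    let ?g = "f(w := undefined)"
    have "?g \<in> verts H \<rightarrow>\<^sub>E verts G" using fun_upd_in_PiE[OF w f(1)] .
    moreover have "inj_on ?g (verts H)" using f(2) w by (auto simp: inj_on_def)
    moreover have "{?g x, ?g y} \<in> edges G" if "{x, y} \<in> edges H" for x y
      using f(3)[of x y] that eH[OF that] w by auto
    ultimately have "?g \<in> emb H G" by (simp add: mem_emb_iff[OF H])
    moreover have "f w \<in> verts G" using f(1) by auto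
    moreover have "{?g u, f w} \<in> edges G" using f(3)[of u w] uw by simp
    moreover have "f w \<notin> ?g ` verts H" using f(2) w by auto
    ultimately show "(?g, f w) \<in> Sigma (emb H G) ?N" by blast
  qed
qed

text \<open>The predicate P serves to count only the embeddings that restrict to given maps on F, or
  that use a given edge.\<close>

lemma card_emb_hair:
  assumes H: "fin_simple_graph H" and u: "u \<in> verts H" and w: "w \<notin> verts H" and G: "finite (verts G)"
  shows "card {f \<in> emb (Graph (insert w (verts H)) (insert {u, w} (edges H))) G. P f}
    = (\<Sum>g\<in>emb H G. card {a \<in> {a \<in> verts G. {g u, a} \<in> edges G} - g ` verts H. P (g(w := a))})"
proof -
  let ?N = "\<lambda>g. {a \<in> verts G. {g u, a} \<in> edges G} - g ` verts H"
  let ?S = "Sigma (emb H G) (\<lambda>g. {a \<in> ?N g. P (g(w := a))})"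
  note bij = emb_hair_bij[OF H u w, of G]
  have "{f \<in> emb (Graph (insert w (verts H)) (insert {u, w} (edges H))) G. P f} = (\<lambda>(g, a). g(w := a)) ` ?S"
  proof (intro subset_antisym subsetI)
    fix f assume f: "f \<in> {f \<in> emb (Graph (insert w (verts H)) (insert {u, w} (edges H))) G. P f}"
    then have "f \<in> (\<lambda>(g, a). g(w := a)) ` Sigma (emb H G) ?N" using bij_betw_imp_surj_on[OF bij] by simp
    then obtain z where "z \<in> Sigma (emb H G) ?N" "f = (case z of (g, a) \<Rightarrow> g(w := a))" by (rule imageE) simp
    then obtain g a where "(g, a) \<in> Sigma (emb H G) ?N" "f = g(w := a)" by (cases z) auto
    then show "f \<in> (\<lambda>(g, a). g(w := a)) ` ?S" using f by (intro image_eqI[of _ _ "(g, a)"]) auto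
  next
    fix f assume "f \<in> (\<lambda>(g, a). g(w := a)) ` ?S"
    then obtain g a where "(g, a) \<in> Sigma (emb H G) ?N" "f = g(w := a)" "P f" by auto
    moreover have "f \<in> (\<lambda>(g, a). g(w := a)) ` Sigma (emb H G) ?N"
      using calculation by (intro image_eqI[of _ _ "(g, a)"]) auto
    ultimately show "f \<in> {f \<in> emb (Graph (insert w (verts H)) (insert {u, w} (edges H))) G. P f}"
      using bij_betw_imp_surj_on[OF bij] by simp
  qed
  moreover have "inj_on (\<lambda>(g, a). g(w := a)) ?S"
    using bij unfolding bij_betw_def by (rule inj_on_subset[OF conjunct1]) auto
  ultimately have "card {f \<in> emb (Graph (insert w (verts H)) (insert {u, w} (edges H))) G. P f} = card ?S"
    by (simp add: card_image)
  also have "\<dots> = (\<Sum>g\<in>emb H G. card {a \<in> ?N g. P (g(w := a))})"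
    using G fin_simple_graphD(1)[OF H] by (intro card_SigmaI) (auto simp: finite_emb)
  finally show ?thesis .
qed

text \<open>\<open>\<tau> u\<close> is the number of hairs at u, fixed before G is known. A hair at
  u can go to any neighbour of \<open>\<phi> u\<close> apart from the fewer than M vertices already
  used; if the degree is below M, truncation merely makes the factor 0.\<close>

lemma hairy_card_lower:
  assumes "hairy F t H" and F: "fin_simple_graph F"
  shows "\<exists>\<tau>. (\<Sum>u\<in>verts F. \<tau> u) = t \<and>
    (\<forall>(G :: 'v ugraph) \<phi> M. fin_simple_graph G \<longrightarrow> \<phi> \<in> emb F G \<longrightarrow> num_verts H \<le> M \<longrightarrow>
      (\<Prod>u\<in>verts F. (deg G (\<phi> u) - M) ^ \<tau> u) \<le> card {f \<in> emb H G. restrict f (verts F) = \<phi>})"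
  using assms(1)
proof (induction rule: hairy.induct)
  case hairy_0
  have "1 \<le> card {f \<in> emb F G. restrict f (verts F) = \<phi>}" if "fin_simple_graph G" "\<phi> \<in> emb F G"
    for G :: "'v ugraph" and \<phi>
  proof -
    have "restrict \<phi> (verts F) = \<phi>" using that PiE_restrict unfolding mem_emb_iff[OF F] by blast
    then have "\<phi> \<in> {f \<in> emb F G. restrict f (verts F) = \<phi>}" using that by simp
    moreover have "finite {f \<in> emb F G. restrict f (verts F) = \<phi>}"
      using that F by (simp add: finite_emb fin_simple_graphD(1))
    ultimately show ?thesis by (metis One_nat_def Suc_le_eq card_gt_0_iff empty_iff)
  qed
  note one = this
  show ?case
  proof (intro exI[of _ "\<lambda>_. 0"] conjI allI impI)
    fix G :: "'v ugraph" and \<phi> M assume "fin_simple_graph G" "\<phi> \<in> emb F G"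
    from one[OF this] show "(\<Prod>u\<in>verts F. (deg G (\<phi> u) - M) ^ 0) \<le> card {f \<in> emb F G. restrict f (verts F) = \<phi>}"
      by (simp only: power_0 prod.neutral_const)
  qed simp
next
  case (hairy_Suc t H u w)
  then obtain \<tau> where \<tau>: "(\<Sum>u\<in>verts F. \<tau> u) = t"
    and IH: "\<And>(G :: 'v ugraph) \<phi> M. fin_simple_graph G \<Longrightarrow> \<phi> \<in> emb F G \<Longrightarrow> num_verts H \<le> M \<Longrightarrow>
      (\<Prod>u\<in>verts F. (deg G (\<phi> u) - M) ^ \<tau> u) \<le> card {f \<in> emb H G. restrict f (verts F) = \<phi>}" by blast
  note H = hairy_graph[OF hairy_Suc(1) F]
  have fF: "finite (verts F)" "finite (verts H)" using F H(1) by (auto simp: fin_simple_graphD(1))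
  let ?\<tau> = "\<tau>(u := \<tau> u + 1)" and ?H' = "Graph (insert w (verts H)) (insert {u, w} (edges H))"
  have uH: "u \<in> verts H" using H(3) hairy_Suc by auto
  have "(\<Sum>x\<in>verts F. ?\<tau> x) = (\<Sum>x\<in>verts F. \<tau> x + (if x = u then 1 else 0))" by (rule sum.cong) auto
  then have sum: "(\<Sum>x\<in>verts F. ?\<tau> x) = Suc t" using \<tau> fF hairy_Suc by (simp add: sum.distrib)
  moreover have "(\<Prod>x\<in>verts F. (deg G (\<phi> x) - M) ^ ?\<tau> x) \<le> card {f \<in> emb ?H' G. restrict f (verts F) = \<phi>}"
    if G: "fin_simple_graph G" and \<phi>: "\<phi> \<in> emb F G" and M: "num_verts ?H' \<le> M" for G :: "'v ugraph" and \<phi> M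
  proof -
    have fG: "finite (verts G)" using G by (simp add: fin_simple_graphD(1))
    have MH: "num_verts H \<le> M" using M fF hairy_Suc by (simp add: num_verts_def)
    have "(\<Prod>x\<in>verts F. (deg G (\<phi> x) - M) ^ ?\<tau> x)
        = (\<Prod>x\<in>verts F. (deg G (\<phi> x) - M) ^ \<tau> x * (if x = u then deg G (\<phi> u) - M else 1))"
      by (rule prod.cong) auto
    also have "\<dots> = (\<Prod>x\<in>verts F. (deg G (\<phi> x) - M) ^ \<tau> x) * (deg G (\<phi> u) - M)"
      using fF hairy_Suc by (simp add: prod.distrib prod.delta)
    also have "\<dots> \<le> card {f \<in> emb H G. restrict f (verts F) = \<phi>} * (deg G (\<phi> u) - M)"
      using IH[OF G \<phi> MH] by (rule mult_right_mono) simp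
    also have "\<dots> = (\<Sum>g\<in>{f \<in> emb H G. restrict f (verts F) = \<phi>}. deg G (\<phi> u) - M)" by simp
    also have "\<dots> \<le> (\<Sum>g\<in>{f \<in> emb H G. restrict f (verts F) = \<phi>}.
          card {a \<in> {a \<in> verts G. {g u, a} \<in> edges G} - g ` verts H. restrict (g(w := a)) (verts F) = \<phi>})"
    proof (rule sum_mono)
      fix g assume g: "g \<in> {f \<in> emb H G. restrict f (verts F) = \<phi>}"
      then have gu: "g u = \<phi> u" using hairy_Suc by auto
      have "restrict (g(w := a)) (verts F) = \<phi>" for a
      proof -
        have "restrict (g(w := a)) (verts F) = restrict g (verts F)" using H(3) hairy_Suc by (intro restrict_ext) auto
        then show ?thesis using g by simp
      qed
      then have eq: "{a \<in> {a \<in> verts G. {g u, a} \<in> edges G} - g ` verts H. restrict (g(w := a)) (verts F) = \<phi>}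
          = {a \<in> verts G. {g u, a} \<in> edges G} - g ` verts H" by auto
      have "deg G (\<phi> u) - M \<le> deg G (g u) - card (g ` verts H)"
        using card_image_le[OF fF(2), of g] MH gu by (simp add: num_verts_def)
      also have "\<dots> \<le> card ({a \<in> verts G. {g u, a} \<in> edges G} - g ` verts H)"
        unfolding deg_def using fF by (intro diff_card_le_card_Diff) simp
      finally show "deg G (\<phi> u) - M \<le> card {a \<in> {a \<in> verts G. {g u, a} \<in> edges G} - g ` verts H. restrict (g(w := a)) (verts F) = \<phi>}"
        using eq by simp
    qed
    also have "\<dots> \<le> (\<Sum>g\<in>emb H G. card {a \<in> {a \<in> verts G. {g u, a} \<in> edges G} - g ` verts H. restrict (g(w := a)) (verts F) = \<phi>})"
      using fF fG by (intro sum_mono2) (auto simp: finite_emb)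
    also have "\<dots> = card {f \<in> emb ?H' G. restrict f (verts F) = \<phi>}"
      using card_emb_hair[OF H(1) uH \<open>w \<notin> verts H\<close> fG, of "\<lambda>f. restrict f (verts F) = \<phi>"] by simp
    finally show ?thesis .
  qed
  ultimately show ?case by blast
qed

lemma card_restrict_Phi:
  assumes "finite (verts H)" "finite (verts G)" "finite \<Phi>"
  shows "card {f \<in> emb H G. restrict f A \<in> \<Phi>} = (\<Sum>\<phi>\<in>\<Phi>. card {f \<in> emb H G. restrict f A = \<phi>})"
proof -
  have "{f \<in> emb H G. restrict f A \<in> \<Phi>} = (\<Union>\<phi>\<in>\<Phi>. {f \<in> emb H G. restrict f A = \<phi>})" by auto
  then show ?thesis using assms by (simp only:) (rule card_UN_disjoint; auto simp: finite_emb)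
qed

lemma hairy_card_upper:
  fixes G :: "'v ugraph"
  assumes "hairy F t H" and F: "fin_simple_graph F" and G: "fin_simple_graph G"
    and D: "\<And>v. v \<in> verts G \<Longrightarrow> deg G v \<le> D"
  shows "card {f \<in> emb H G. restrict f (verts F) \<in> \<Phi>} \<le> card (\<Phi> \<inter> emb F G) * D ^ t"
  using assms(1)
proof (induction rule: hairy.induct)
  case hairy_0
  have "restrict f (verts F) = f" if "f \<in> emb F G" for f
    using that PiE_restrict unfolding mem_emb_iff[OF F] by blast
  then have "{f \<in> emb F G. restrict f (verts F) \<in> \<Phi>} = \<Phi> \<inter> emb F G" by auto
  then show ?case by (simp only: power_0 mult_1_right order_refl)
next
  case (hairy_Suc t H u w)
  note H = hairy_graph[OF hairy_Suc(1) F]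
  have fin: "finite (verts F)" "finite (verts H)" "finite (verts G)" using F G H(1) by (auto simp: fin_simple_graphD(1))
  let ?H' = "Graph (insert w (verts H)) (insert {u, w} (edges H))"
  have uH: "u \<in> verts H" using H(3) hairy_Suc by auto
  have "card {f \<in> emb ?H' G. restrict f (verts F) \<in> \<Phi>}
      = (\<Sum>g\<in>emb H G. card {a \<in> {a \<in> verts G. {g u, a} \<in> edges G} - g ` verts H. restrict (g(w := a)) (verts F) \<in> \<Phi>})"
    using card_emb_hair[OF H(1) uH \<open>w \<notin> verts H\<close> fin(3)] by simp
  also have "\<dots> \<le> (\<Sum>g\<in>emb H G. if restrict g (verts F) \<in> \<Phi> then D else 0)"
  proof (rule sum_mono)
    fix g assume g: "g \<in> emb H G"
    have res: "restrict (g(w := a)) (verts F) = restrict g (verts F)" for a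
      using H(3) hairy_Suc by (intro restrict_ext) auto
    have "card {a \<in> {a \<in> verts G. {g u, a} \<in> edges G} - g ` verts H. restrict (g(w := a)) (verts F) \<in> \<Phi>} \<le> deg G (g u)"
      unfolding deg_def using fin by (intro card_mono) auto
    also have "\<dots> \<le> D" using g uH by (intro D) (auto simp: mem_emb_iff[OF H(1)])
    finally show "card {a \<in> {a \<in> verts G. {g u, a} \<in> edges G} - g ` verts H. restrict (g(w := a)) (verts F) \<in> \<Phi>}
        \<le> (if restrict g (verts F) \<in> \<Phi> then D else 0)"
      by (cases "restrict g (verts F) \<in> \<Phi>") (simp_all only: res if_True if_False simp_thms, simp_all)
  qed
  also have "\<dots> = card {g \<in> emb H G. restrict g (verts F) \<in> \<Phi>} * D"
    using fin by (simp add: sum.If_cases finite_emb Int_def)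
  also have "\<dots> \<le> card (\<Phi> \<inter> emb F G) * D ^ t * D"
    using hairy_Suc.IH by (rule mult_right_mono) simp
  finally show ?case by (simp only: power_Suc mult_ac)
qed

text \<open>An edge mapped to {u, v} is either an edge of F, which fixes two vertices of F, or a
  hair, which fixes one vertex of F and the end of the hair. The latter case loses a factor D
  instead of n, hence the hypothesis \<open>rD\<close>, and occurs for each of the t hairs.\<close>

lemma hairy_card_edge_upper:
  fixes G :: "'v ugraph" and r :: real
  assumes "hairy F t H" and F: "fin_simple_graph F" and f2: "num_verts F \<ge> 2" and G: "fin_simple_graph G"
    and D: "\<And>v. v \<in> verts G \<Longrightarrow> deg G v \<le> D" and rD: "real (num_verts G) \<le> r * real D" and r: "r \<ge> 0"
    and uv: "u \<noteq> v"
  shows "real (card {f \<in> emb H G. \<exists>e\<in>edges H. f ` e = {u, v}})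
    \<le> 2 * ((num_verts F)\<^sup>2 + r * t) * real (num_verts G) ^ (num_verts F - 2) * real D ^ t"
  using assms(1)
proof (induction rule: hairy.induct)
  case hairy_0
  have fin: "finite (verts F)" "finite (verts G)" using F G by (auto simp: fin_simple_graphD(1))
  let ?P = "verts F \<times> verts F - Id"
  have "{f \<in> emb F G. \<exists>e\<in>edges F. f ` e = {u, v}} \<subseteq> (\<Union>(x, y)\<in>?P. {f \<in> verts F \<rightarrow>\<^sub>E verts G. f x = u \<and> f y = v})"
  proof
    fix f assume "f \<in> {f \<in> emb F G. \<exists>e\<in>edges F. f ` e = {u, v}}"
    then obtain e where f: "f \<in> emb F G" and e: "e \<in> edges F" "f ` e = {u, v}" by auto
    obtain x y where xy: "e = {x, y}" "x \<in> verts F" "y \<in> verts F" "x \<noteq> y" using fin_simple_graphD(3)[OF F e(1)] by auto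
    then have "f x = u \<and> f y = v \<or> f y = u \<and> f x = v" using e(2) by (auto simp: doubleton_eq_iff)
    then show "f \<in> (\<Union>(x, y)\<in>?P. {f \<in> verts F \<rightarrow>\<^sub>E verts G. f x = u \<and> f y = v})"
      using f xy by (auto simp: mem_emb_iff[OF F])
  qed
  then have "card {f \<in> emb F G. \<exists>e\<in>edges F. f ` e = {u, v}} \<le> card (\<Union>(x, y)\<in>?P. {f \<in> verts F \<rightarrow>\<^sub>E verts G. f x = u \<and> f y = v})"
    using fin by (intro card_mono finite_UN_I) (auto intro: finite_subset[OF _ finite_PiE[of "verts F" "\<lambda>_. verts G"]])
  also have "\<dots> \<le> (\<Sum>z\<in>?P. card (case z of (x, y) \<Rightarrow> {f \<in> verts F \<rightarrow>\<^sub>E verts G. f x = u \<and> f y = v}))"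
    using fin by (intro card_UN_le) auto
  also have "\<dots> \<le> (\<Sum>z\<in>?P. num_verts G ^ (num_verts F - 2))"
  proof (rule sum_mono)
    fix z assume "z \<in> ?P"
    then obtain x y where "z = (x, y)" "x \<in> verts F" "y \<in> verts F" "x \<noteq> y" by auto
    then show "card (case z of (x, y) \<Rightarrow> {f \<in> verts F \<rightarrow>\<^sub>E verts G. f x = u \<and> f y = v}) \<le> num_verts G ^ (num_verts F - 2)"
      using card_PiE_fix2[OF fin, of x y u v] by (simp add: num_verts_def)
  qed
  also have "\<dots> \<le> (num_verts F)\<^sup>2 * num_verts G ^ (num_verts F - 2)"
  proof -
    have "card ?P \<le> card (verts F \<times> verts F)" using fin by (intro card_mono) auto
    then show ?thesis by (simp add: num_verts_def power2_eq_square card_cartesian_product)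
  qed
  finally have "real (card {f \<in> emb F G. \<exists>e\<in>edges F. f ` e = {u, v}}) \<le> real ((num_verts F)\<^sup>2 * num_verts G ^ (num_verts F - 2))"
    by (rule of_nat_mono)
  then show ?case by (simp add: algebra_simps)
next
  case (hairy_Suc t H x w)
  note H = hairy_graph[OF hairy_Suc(1) F]
  have fin: "finite (verts F)" "finite (verts H)" "finite (verts G)" using F G H(1) by (auto simp: fin_simple_graphD(1))
  let ?H' = "Graph (insert w (verts H)) (insert {x, w} (edges H))"
  let ?n = "real (num_verts G)" and ?f = "num_verts F"
  have xH: "x \<in> verts H" using H(3) hairy_Suc by auto
  have wx: "w \<noteq> x" using xH hairy_Suc by auto
  let ?A = "{g \<in> emb H G. \<exists>e\<in>edges H. g ` e = {u, v}}"
  let ?B = "\<lambda>z. {g \<in> emb H G. g x = z}"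
  let ?N = "\<lambda>g. {a \<in> {a \<in> verts G. {g x, a} \<in> edges G} - g ` verts H. \<exists>e\<in>edges ?H'. (g(w := a)) ` e = {u, v}}"
  have "card {f \<in> emb ?H' G. \<exists>e\<in>edges ?H'. f ` e = {u, v}} = (\<Sum>g\<in>emb H G. card (?N g))"
    by (rule card_emb_hair[OF H(1) xH \<open>w \<notin> verts H\<close> fin(3)])
  also have "\<dots> \<le> (\<Sum>g\<in>emb H G. (if g \<in> ?A then D else 0) + (if g \<in> ?B u then 1 else 0) + (if g \<in> ?B v then 1 else 0))"
  proof (rule sum_mono)
    fix g assume g: "g \<in> emb H G"
    \<comment> \<open>Either an older edge already covers {u, v} and the new leaf is arbitrary, or
      the new hair covers it and its leaf is forced.\<close>
    have sub: "?N g \<subseteq> (if g \<in> ?A then {a \<in> verts G. {g x, a} \<in> edges G} else {}) \<union> (if g \<in> ?B u then {v} else {}) \<union> (if g \<in> ?B v then {u} else {})"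
    proof
      fix a assume a: "a \<in> ?N g"
      then obtain e where e: "e \<in> insert {x, w} (edges H)" "(g(w := a)) ` e = {u, v}"
        unfolding ugraph.sel by blast
      show "a \<in> (if g \<in> ?A then {a \<in> verts G. {g x, a} \<in> edges G} else {}) \<union> (if g \<in> ?B u then {v} else {}) \<union> (if g \<in> ?B v then {u} else {})"
      proof (cases "e = {x, w}")
        case True
        then have "{g x, a} = {u, v}" using e(2) wx by simp
        then consider "g x = u" "a = v" | "g x = v" "a = u" by (auto simp: doubleton_eq_iff)
        then show ?thesis using g by cases simp_all
      next
        case False
        then have eH: "e \<in> edges H" using e by auto
        then have "w \<notin> e" using fin_simple_graphD(3)[OF H(1) eH] hairy_Suc by auto
        then have "g ` e = (g(w := a)) ` e" by (intro image_cong) auto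
        from trans[OF this e(2)] have "g \<in> ?A" using g eH by (intro CollectI conjI bexI[of _ e])
        moreover have "a \<in> verts G" "{g x, a} \<in> edges G" using a by blast+
        ultimately show ?thesis by simp
      qed
    qed
    have "card (?N g) \<le> card ((if g \<in> ?A then {a \<in> verts G. {g x, a} \<in> edges G} else {}) \<union> (if g \<in> ?B u then {v} else {}) \<union> (if g \<in> ?B v then {u} else {}))"
      using fin by (intro card_mono[OF _ sub]) auto
    also have "\<dots> \<le> card (if g \<in> ?A then {a \<in> verts G. {g x, a} \<in> edges G} else {}) + card (if g \<in> ?B u then {v} else {}) + card (if g \<in> ?B v then {u} else {})"
      by (rule order_trans[OF card_Un_le add_right_mono[OF card_Un_le]])
    also have "\<dots> \<le> (if g \<in> ?A then D else 0) + (if g \<in> ?B u then 1 else 0) + (if g \<in> ?B v then 1 else 0)"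
    proof -
      have "g x \<in> verts G" using g xH by (auto simp: mem_emb_iff[OF H(1)])
      then have "card {a \<in> verts G. {g x, a} \<in> edges G} \<le> D" using D by (simp add: deg_def)
      then show ?thesis by (intro add_mono) auto
    qed
    finally show "card (?N g) \<le> (if g \<in> ?A then D else 0) + (if g \<in> ?B u then 1 else 0) + (if g \<in> ?B v then 1 else 0)" .
  qed
  also have "\<dots> = card ?A * D + card (?B u) + card (?B v)"
  proof -
    have int: "emb H G \<inter> ?A = ?A" "emb H G \<inter> ?B u = ?B u" "emb H G \<inter> ?B v = ?B v" by auto
    have fe: "finite (emb H G)" using fin by (simp add: finite_emb)
    show ?thesis
      by (simp only: sum.distrib sum.If_cases[OF fe] Collect_mem_eq int sum_constant) simp
  qed
  finally have "real (card {f \<in> emb ?H' G. \<exists>e\<in>edges ?H'. f ` e = {u, v}}) \<le> real (card ?A * D + card (?B u) + card (?B v))"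
    by (rule of_nat_mono)
  also have "\<dots> = real (card ?A) * real D + real (card (?B u)) + real (card (?B v))" by simp
  also have "\<dots> \<le> 2 * (?f\<^sup>2 + r * t) * ?n ^ (?f - 2) * real D ^ t * real D + ?n ^ (?f - 1) * real D ^ t + ?n ^ (?f - 1) * real D ^ t"
  proof -
    have B: "real (card (?B z)) \<le> ?n ^ (?f - 1) * real D ^ t" for z
    proof -
      let ?\<Phi> = "{\<phi>. \<phi> x = z}"
      have "?B z = {f \<in> emb H G. restrict f (verts F) \<in> ?\<Phi>}" using hairy_Suc by auto
      then have "card (?B z) \<le> card (?\<Phi> \<inter> emb F G) * D ^ t"
        using hairy_card_upper[OF hairy_Suc(1) F G D, of ?\<Phi>] by simp
      also have "card (?\<Phi> \<inter> emb F G) \<le> card {f \<in> verts F \<rightarrow>\<^sub>E verts G. f x = z}"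
        using fin by (intro card_mono) (auto simp: mem_emb_iff[OF F] intro: finite_subset[OF _ finite_PiE[of "verts F" "\<lambda>_. verts G"]])
      also have "\<dots> \<le> num_verts G ^ (?f - 1)"
        using card_PiE_fix1[OF fin(1,3)] hairy_Suc by (simp add: num_verts_def)
      finally have "card (?B z) \<le> num_verts G ^ (?f - 1) * D ^ t" by simp
      then have "real (card (?B z)) \<le> real (num_verts G ^ (?f - 1) * D ^ t)" by (rule of_nat_mono)
      then show ?thesis by simp
    qed
    have A: "real (card ?A) * real D \<le> 2 * (?f\<^sup>2 + r * t) * ?n ^ (?f - 2) * real D ^ t * real D"
      using hairy_Suc(4) by (intro mult_right_mono) auto
    show ?thesis using B[of u] B[of v] A by linarith
  qed
  \<comment> \<open>One factor n is exchanged for r D. The two directions of the new hair then add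
    2r to the coefficient, in the same shape as the bound for t hairs.\<close>
  also have "?n ^ (?f - 1) = ?n ^ (?f - 2) * ?n"
  proof -
    have "?f - 1 = Suc (?f - 2)" using f2 by simp
    then show ?thesis by simp
  qed
  also have "2 * (?f\<^sup>2 + r * t) * ?n ^ (?f - 2) * real D ^ t * real D + ?n ^ (?f - 2) * ?n * real D ^ t + ?n ^ (?f - 2) * ?n * real D ^ t
      \<le> 2 * (?f\<^sup>2 + r * t) * ?n ^ (?f - 2) * real D ^ t * real D + ?n ^ (?f - 2) * (r * D) * real D ^ t + ?n ^ (?f - 2) * (r * D) * real D ^ t"
    using rD by (intro add_mono mult_right_mono mult_left_mono) auto
  also have "\<dots> = 2 * (?f\<^sup>2 + r * Suc t) * ?n ^ (?f - 2) * real D ^ Suc t" by (simp add: algebra_simps)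
  finally show ?case .
qed


section \<open>Colourings and components\<close>

lemma proper_coloring_subgraph:
  "proper_coloring H k c \<Longrightarrow> verts F \<subseteq> verts H \<Longrightarrow> edges F \<subseteq> edges H \<Longrightarrow> proper_coloring F k c"
  by (auto simp: proper_coloring_def)

lemma proper_coloring_exists:
  assumes "fin_simple_graph G" shows "\<exists>k c. proper_coloring G k c"
proof -
  obtain c :: "'a \<Rightarrow> nat" and k where c: "c ` verts G = {i. i < k}" "inj_on c (verts G)"
    using finite_imp_inj_to_nat_seg[OF fin_simple_graphD(1)[OF assms]] by auto
  have "proper_coloring G k c"
    unfolding proper_coloring_def
  proof (intro conjI ballI allI impI)
    fix u w assume "{u, w} \<in> edges G"
    from fin_simple_graphD(2)[OF assms this] show "c u \<noteq> c w" using c(2) by (auto dest: inj_onD)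
  qed (use c(1) in auto)
  then show ?thesis by auto
qed

lemma chromatic_number_coloring:
  assumes "fin_simple_graph G" shows "\<exists>c. proper_coloring G (chromatic_number G) c"
  unfolding chromatic_number_def using proper_coloring_exists[OF assms] by (rule LeastI_ex)

lemma chromatic_number_le: "proper_coloring G k c \<Longrightarrow> chromatic_number G \<le> k"
  unfolding chromatic_number_def by (rule Least_le) auto

lemma proper_coloring_mono: "proper_coloring G k c \<Longrightarrow> k \<le> l \<Longrightarrow> proper_coloring G l c"
  by (auto simp: proper_coloring_def)

lemma not_bipartite_chromatic:
  assumes G: "fin_simple_graph G" and "\<not> bipartite G" shows "chromatic_number G \<ge> 3"
proof (rule ccontr)
  assume "\<not> ?thesis"
  then have "chromatic_number G \<le> 2" by simp
  then obtain c where c: "proper_coloring G 2 c"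
    using chromatic_number_coloring[OF G] proper_coloring_mono by blast
  have "bipartite G" unfolding bipartite_def
  proof (intro exI conjI ballI)
    show "{v \<in> verts G. c v = 0} \<union> {v \<in> verts G. c v = 1} = verts G"
      using c by (auto simp: proper_coloring_def less_2_cases_iff)
    show "{v \<in> verts G. c v = 0} \<inter> {v \<in> verts G. c v = 1} = {}" by auto
    fix e assume e: "e \<in> edges G"
    then obtain u w where uw: "e = {u, w}" "u \<in> verts G" "w \<in> verts G" using fin_simple_graphD(3)[OF G e] by auto
    then have "c u \<noteq> c w" "c u < 2" "c w < 2" using c e by (auto simp: proper_coloring_def)
    then show "e \<inter> {v \<in> verts G. c v = 0} \<noteq> {}" "e \<inter> {v \<in> verts G. c v = 1} \<noteq> {}"
      using uw by (auto simp: less_2_cases_iff)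
  qed
  with assms show False by simp
qed

text \<open>If colour j were missing, giving j to the whole last colour class would save a colour.
  Later this makes all colour classes non-empty.\<close>

lemma coloring_surj:
  assumes G: "fin_simple_graph G" and c: "proper_coloring G (chromatic_number G) c"
  shows "c ` verts G = {..<chromatic_number G}"
proof (rule ccontr)
  let ?k = "chromatic_number G"
  assume "\<not> ?thesis"
  then obtain j where j: "j < ?k" "j \<notin> c ` verts G" using c by (auto simp: proper_coloring_def)
  define c' where "c' = (\<lambda>v. if c v = ?k - 1 then j else c v)"
  have "proper_coloring G (?k - 1) c'"
    unfolding proper_coloring_def
  proof (intro conjI ballI allI impI)
    fix v assume v: "v \<in> verts G"
    then have "c v < ?k" "c v \<noteq> j" using c j by (auto simp: proper_coloring_def)
    then show "c' v < ?k - 1" using j by (auto simp: c'_def)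
  next
    fix u w assume e: "{u, w} \<in> edges G"
    then have "c u \<noteq> c w" "c u \<noteq> j" "c w \<noteq> j"
      using c j fin_simple_graphD(2)[OF G e] by (auto simp: proper_coloring_def)
    then show "c' u \<noteq> c' w" by (auto simp: c'_def)
  qed
  from chromatic_number_le[OF this] j show False by simp
qed

lemma hairy_coloring:
  assumes "hairy F t H" and "fin_simple_graph F" and "proper_coloring F k c" and "k \<ge> 2"
  shows "\<exists>c. proper_coloring H k c"
  using assms
proof (induction rule: hairy.induct)
  case (hairy_Suc t H u w)
  then obtain c where c: "proper_coloring H k c" by blast
  note H = hairy_graph[OF hairy_Suc(1) \<open>fin_simple_graph F\<close>]
  define a where "a = (if c u = 0 then 1 else 0::nat)"
  have "u \<noteq> w" using hairy_Suc H(3) by auto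
  moreover have "x \<noteq> w" "y \<noteq> w" if "{x, y} \<in> edges H" for x y
    using fin_simple_graphD(2)[OF H(1) that] hairy_Suc by auto
  ultimately have "proper_coloring (Graph (insert w (verts H)) (insert {u, w} (edges H))) k (c(w := a))"
    using c \<open>k \<ge> 2\<close> by (auto simp: proper_coloring_def a_def doubleton_eq_iff split: if_splits)
  then show ?case by blast
qed auto

lemma hairy_chromatic:
  assumes "hairy F t H" and "fin_simple_graph F" and "chromatic_number F \<ge> 2"
  shows "chromatic_number H = chromatic_number F"
proof (rule antisym)
  note H = hairy_graph[OF assms(1,2)]
  obtain c where "proper_coloring F (chromatic_number F) c" using chromatic_number_coloring[OF assms(2)] by auto
  then show "chromatic_number H \<le> chromatic_number F"
    using hairy_coloring[OF assms(1,2) _ assms(3)] chromatic_number_le by metis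
  obtain c where "proper_coloring H (chromatic_number H) c" using chromatic_number_coloring[OF H(1)] by auto
  from proper_coloring_subgraph[OF this H(3,4)] show "chromatic_number F \<le> chromatic_number H"
    by (rule chromatic_number_le)
qed

lemma equiv_reachable: "equiv (verts G) (reachable G)"
proof (rule equivI)
  show "reachable G \<subseteq> verts G \<times> verts G" by (auto simp: reachable_def)
  show "refl_on (verts G) (reachable G)" by (auto simp: refl_on_def reachable_def)
  have "sym {(u, w). {u, w} \<in> edges G}" by (auto simp: sym_def insert_commute)
  then have "sym ({(u, w). {u, w} \<in> edges G}\<^sup>*)" by (rule sym_rtrancl)
  then show "sym (reachable G)" by (auto simp: reachable_def sym_def)
  show "trans (reachable G)" by (auto simp: reachable_def trans_def intro: rtrancl_trans)
qed

text \<open>Every vertex of H is linked to F, so each component meets F. Since \<open>H\<close> has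
  \<open>num_verts F + t\<close> vertices, the exponent in the objective is at least t, which is all
  that is needed of the number of components in \<open>wt_lower\<close>.\<close>

lemma hairy_components_le:
  assumes "hairy F t H" and F: "fin_simple_graph F"
  shows "num_components H \<le> num_verts F"
proof -
  have reach: "\<forall>v\<in>verts H. \<exists>x\<in>verts F. (v, x) \<in> {(u, w). {u, w} \<in> edges H}\<^sup>*" using assms(1)
  proof (induction rule: hairy.induct)
    case (hairy_Suc t H u w)
    have mono: "{(u, w). {u, w} \<in> edges H}\<^sup>* \<subseteq> {(x, y). {x, y} \<in> insert {u, w} (edges H)}\<^sup>*"
      by (rule rtrancl_mono) auto
    have "(w, u) \<in> {(x, y). {x, y} \<in> insert {u, w} (edges H)}\<^sup>*" by (rule r_into_rtrancl) (auto simp: insert_commute)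
    then show ?case using hairy_Suc mono by auto
  qed auto
  note H = hairy_graph[OF assms]
  have "verts H // reachable H \<subseteq> (\<lambda>x. reachable H `` {x}) ` verts F"
  proof
    fix C assume "C \<in> verts H // reachable H"
    then obtain v where v: "v \<in> verts H" "C = reachable H `` {v}" by (auto elim: quotientE)
    then obtain x where x: "x \<in> verts F" "(v, x) \<in> {(u, w). {u, w} \<in> edges H}\<^sup>*" using reach by auto
    then have "(v, x) \<in> reachable H" using v H(3) by (auto simp: reachable_def)
    then have "C = reachable H `` {x}" using v equiv_class_eq[OF equiv_reachable] by metis
    then show "C \<in> (\<lambda>x. reachable H `` {x}) ` verts F" using x by auto
  qed
  then have "card (verts H // reachable H) \<le> card ((\<lambda>x. reachable H `` {x}) ` verts F)"
    using fin_simple_graphD(1)[OF F] by (intro card_mono) auto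
  also have "\<dots> \<le> card (verts F)" using fin_simple_graphD(1)[OF F] by (rule card_image_le)
  finally show ?thesis by (simp add: num_components_def num_verts_def)
qed

text \<open>A union bound over the ordered pairs of coordinates: each pair spoils at most a fraction
  \<zeta> of the choices.\<close>

lemma almost_complete_PiE:
  fixes \<zeta> :: real
  assumes fD: "finite D" and fS: "\<And>x. x \<in> D \<Longrightarrow> finite (S x)"
    and bad: "\<And>x y. x \<in> D \<Longrightarrow> y \<in> D \<Longrightarrow> x \<noteq> y \<Longrightarrow>
      real (card {(p, q) \<in> S x \<times> S y. \<not> ok x y p q}) \<le> \<zeta> * (real (card (S x)) * real (card (S y)))"
    and \<zeta>: "\<zeta> \<ge> 0"
  shows "(1 - (real (card D))\<^sup>2 * \<zeta>) * (\<Prod>x\<in>D. real (card (S x)))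
    \<le> real (card {f \<in> Pi\<^sub>E D S. \<forall>x\<in>D. \<forall>y\<in>D. x \<noteq> y \<longrightarrow> ok x y (f x) (f y)})"
proof -
  let ?P = "D \<times> D - Id" and ?prod = "\<Prod>x\<in>D. real (card (S x))"
  let ?good = "{f \<in> Pi\<^sub>E D S. \<forall>x\<in>D. \<forall>y\<in>D. x \<noteq> y \<longrightarrow> ok x y (f x) (f y)}"
  let ?B = "\<lambda>z. case z of (x, y) \<Rightarrow> {f \<in> Pi\<^sub>E D S. \<not> ok x y (f x) (f y)}"
  have fPi: "finite (Pi\<^sub>E D S)" using fD fS by (rule finite_PiE)
  have one: "real (card (?B z)) \<le> \<zeta> * ?prod" if zP: "z \<in> ?P" for z
  proof -
    obtain x y where z: "z = (x, y)" "x \<in> D" "y \<in> D" "x \<noteq> y" using zP by (cases z) auto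
    let ?R = "D - {x, y}"
    let ?h = "\<lambda>f. ((f x, f y), restrict f ?R)"
    let ?bad = "{(p, q) \<in> S x \<times> S y. \<not> ok x y p q}"
    have inj: "inj_on ?h {f \<in> Pi\<^sub>E D S. \<not> ok x y (f x) (f y)}"
    proof (rule inj_onI)
      fix f g assume f: "f \<in> {f \<in> Pi\<^sub>E D S. \<not> ok x y (f x) (f y)}" and g: "g \<in> {f \<in> Pi\<^sub>E D S. \<not> ok x y (f x) (f y)}"
        and eq: "?h f = ?h g"
      have "f i = g i" if "i \<in> D" for i
      proof (cases "i \<in> ?R")
        case True
        have "restrict f ?R i = restrict g ?R i" using eq by simp
        then show ?thesis using True by simp
      next
        case False
        then show ?thesis using eq that by auto
      qed
      then show "f = g" using f g by (intro PiE_ext[of f D S g]) auto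
    qed
    have sub: "?h ` {f \<in> Pi\<^sub>E D S. \<not> ok x y (f x) (f y)} \<subseteq> ?bad \<times> Pi\<^sub>E ?R S"
    proof (rule image_subsetI)
      fix f assume f: "f \<in> {f \<in> Pi\<^sub>E D S. \<not> ok x y (f x) (f y)}"
      then have "restrict f ?R \<in> Pi\<^sub>E ?R S" by (subst restrict_PiE_iff) auto
      moreover have "(f x, f y) \<in> ?bad" using f z by auto
      ultimately show "?h f \<in> ?bad \<times> Pi\<^sub>E ?R S" by blast
    qed
    have fb: "finite ?bad" using fS z by (intro finite_subset[of ?bad "S x \<times> S y"]) auto
    have fR: "finite (Pi\<^sub>E ?R S)" using fD fS by (intro finite_PiE) auto
    have "card (?B z) \<le> card (?bad \<times> Pi\<^sub>E ?R S)"
      using card_inj_on_le[OF inj sub] fb fR z by simp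
    also have "\<dots> = card ?bad * (\<Prod>i\<in>?R. card (S i))"
      using fD by (simp add: card_cartesian_product card_PiE)
    finally have "real (card (?B z)) \<le> real (card ?bad) * (\<Prod>i\<in>?R. real (card (S i)))"
      by (simp only: of_nat_le_iff[symmetric, where 'a = real] of_nat_mult of_nat_prod)
    also have "\<dots> \<le> \<zeta> * (real (card (S x)) * real (card (S y))) * (\<Prod>i\<in>?R. real (card (S i)))"
      using bad[OF z(2-4)] by (intro mult_right_mono prod_nonneg) auto
    also have "\<dots> = \<zeta> * ?prod"
    proof -
      have "?prod = (\<Prod>i\<in>insert x (insert y ?R). real (card (S i)))" by (rule prod.cong) (use z in auto)
      also have "\<dots> = real (card (S x)) * (real (card (S y)) * (\<Prod>i\<in>?R. real (card (S i))))"
        using z fD by simp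
      finally show ?thesis by (simp add: mult_ac)
    qed
    finally show ?thesis .
  qed
  have "Pi\<^sub>E D S \<subseteq> ?good \<union> (\<Union>z\<in>?P. ?B z)" by auto
  moreover have fin: "finite ?good" "finite (\<Union>z\<in>?P. ?B z)" using fD fPi by (auto intro: finite_subset[OF _ fPi])
  ultimately have "card (Pi\<^sub>E D S) \<le> card ?good + card (\<Union>z\<in>?P. ?B z)"
    by (intro order_trans[OF card_mono card_Un_le]) simp_all
  also have "card (\<Union>z\<in>?P. ?B z) \<le> (\<Sum>z\<in>?P. card (?B z))" using fD by (intro card_UN_le) auto
  finally have "real (card (Pi\<^sub>E D S)) \<le> real (card ?good) + (\<Sum>z\<in>?P. real (card (?B z)))"
    by (simp flip: of_nat_sum of_nat_add)
  also have "(\<Sum>z\<in>?P. real (card (?B z))) \<le> (\<Sum>z\<in>?P. \<zeta> * ?prod)" by (intro sum_mono one)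
  also have "\<dots> \<le> (real (card D))\<^sup>2 * (\<zeta> * ?prod)"
  proof -
    have "card ?P \<le> card (D \<times> D)" using fD by (intro card_mono) auto
    then have "real (card ?P) \<le> (real (card D))\<^sup>2"
      by (simp add: card_cartesian_product power2_eq_square flip: of_nat_mult)
    then show ?thesis using \<zeta> by (simp add: mult_right_mono prod_nonneg)
  qed
  finally have "real (card (Pi\<^sub>E D S)) \<le> real (card ?good) + (real (card D))\<^sup>2 * (\<zeta> * ?prod)" by simp
  then show ?thesis using fD by (simp add: card_PiE algebra_simps)
qed

section \<open>The normalised objective and its minimisers\<close>

text \<open>The weight of a single copy of H in the objective, for s one less than the chromatic
  number of the other graph; the denominator is the number of injective maps.\<close>

definition wt :: "'a ugraph \<Rightarrow> nat \<Rightarrow> nat \<Rightarrow> real" where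
  "wt H s n = real s ^ (num_verts H - num_components H) / ff (real n) (num_verts H)"

definition minimizer :: "'a ugraph \<Rightarrow> 'b ugraph \<Rightarrow> nat ugraph \<Rightarrow> bool" where
  "minimizer H1 H2 G \<longleftrightarrow> fin_simple_graph G \<and>
    (\<forall>G'\<in>n_vertex_graphs (num_verts G). bonbon_objective H1 H2 G \<le> bonbon_objective H1 H2 G')"

lemma bonbon_objective_wt:
  assumes "fin_simple_graph H1" "fin_simple_graph H2" "fin_simple_graph G"
  shows "bonbon_objective H1 H2 G = wt H1 (chromatic_number H2 - 1) (num_verts G) * real (card (emb H1 G))
    + wt H2 (chromatic_number H1 - 1) (num_verts G) * real (card (emb H2 (complement G)))"
proof -
  have "finite (verts H1)" "finite (verts H2)" "finite (verts G)" "finite (verts (complement G))"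
    using assms by (auto simp: fin_simple_graphD(1) complement_simps(1))
  then show ?thesis
    by (simp add: bonbon_objective_def t_inj_emb card_inj_maps wt_def num_verts_complement)
qed

lemma wt_nonneg: "num_verts H \<le> n \<Longrightarrow> wt H s n \<ge> 0"
  unfolding wt_def by (intro divide_nonneg_nonneg ff_bounds(3)) auto

lemma ff_pos: "real m \<le> x \<Longrightarrow> ff x m > 0"
  unfolding ff_def by (intro prod_pos) auto

lemma wt_lower:
  assumes "hairy F t H" "fin_simple_graph F" "s \<ge> 1" "num_verts H \<le> n"
  shows "real s ^ t / real n ^ num_verts H \<le> wt H s n"
proof -
  have "num_verts H - num_components H \<ge> t"
    using hairy_components_le[OF assms(1,2)] hairy_graph(2)[OF assms(1,2)] by simp
  then have "real s ^ t \<le> real s ^ (num_verts H - num_components H)"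
    using assms by (intro power_increasing) auto
  moreover have "ff (real n) (num_verts H) \<le> real n ^ num_verts H" using assms by (intro ff_bounds) auto
  moreover have "ff (real n) (num_verts H) > 0" using assms by (intro ff_pos) auto
  ultimately show ?thesis unfolding wt_def by (intro frac_le) auto
qed

text \<open>By Bernoulli's inequality (1 - v/n)^v is at least 1 - v^2/n, and the hypothesis makes
  this at least 1/2.\<close>

lemma ff_half:
  assumes "real n \<ge> 2 * (real v)\<^sup>2" "n > 0"
  shows "real n ^ v / 2 \<le> ff (real n) v"
proof -
  have vn: "v \<le> n"
  proof (cases "v = 0")
    case False
    then have "real v \<le> 2 * (real v)\<^sup>2" by (simp add: power2_eq_square self_le_ge2_pow)
    then show ?thesis using assms by linarith
  qed simp
  have "1 / 2 \<le> 1 + real v * (- real v / real n)" using assms by (simp add: field_simps power2_eq_square)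
  also have "\<dots> \<le> (1 + (- real v / real n)) ^ v" using vn assms by (intro Bernoulli_inequality) (simp add: field_simps)
  finally have "real n ^ v * (1 / 2) \<le> real n ^ v * (1 + (- real v / real n)) ^ v" by (intro mult_left_mono) auto
  also have "\<dots> = (real n * (1 + (- real v / real n))) ^ v" by (simp only: power_mult_distrib)
  also have "real n * (1 + (- real v / real n)) = real n - real v" using assms by (simp add: field_simps)
  also have "(real n - real v) ^ v \<le> ff (real n) v" using vn by (intro ff_bounds) auto
  finally show ?thesis by simp
qed

lemma wt_upper:
  assumes "s \<ge> 1" "real n \<ge> 2 * (real (num_verts H))\<^sup>2" "n > 0"
  shows "wt H s n \<le> 2 * real s ^ num_verts H / real n ^ num_verts H"
proof -
  have "wt H s n \<le> real s ^ num_verts H / (real n ^ num_verts H / 2)"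
    unfolding wt_def using assms ff_half[OF assms(2,3)] by (intro frac_le power_increasing) auto
  then show ?thesis by (simp add: mult.commute)
qed

section \<open>Copies through a vertex, cloning of vertices and deletion of edges\<close>

lemma card_filter_sum: "finite A \<Longrightarrow> card {x \<in> A. P x} = (\<Sum>x\<in>A. if P x then 1 else 0)"
  by (simp add: sum.If_cases Int_def)

lemma sum_thru:
  assumes H: "fin_simple_graph H" and fG: "finite (verts G)"
  shows "(\<Sum>v\<in>verts G. card (thru H G v)) = num_verts H * card (emb H G)"
proof -
  have fe: "finite (emb H G)" using H fG by (simp add: finite_emb fin_simple_graphD(1))
  have "(\<Sum>v\<in>verts G. card (thru H G v)) = (\<Sum>v\<in>verts G. \<Sum>f\<in>emb H G. if v \<in> f ` verts H then 1 else 0)"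
    unfolding thru_def by (intro sum.cong refl card_filter_sum fe)
  also have "\<dots> = (\<Sum>f\<in>emb H G. \<Sum>v\<in>verts G. if v \<in> f ` verts H then 1 else 0)" by (rule sum.swap)
  also have "\<dots> = (\<Sum>f\<in>emb H G. num_verts H)"
  proof (rule sum.cong[OF refl])
    fix f assume f: "f \<in> emb H G"
    have "(\<Sum>v\<in>verts G. if v \<in> f ` verts H then 1 else 0 :: nat) = card {v \<in> verts G. v \<in> f ` verts H}"
      by (rule card_filter_sum[OF fG, symmetric])
    also have "{v \<in> verts G. v \<in> f ` verts H} = f ` verts H" using f unfolding mem_emb_iff[OF H] by auto
    also have "card (f ` verts H) = num_verts H" using f unfolding mem_emb_iff[OF H] num_verts_def
      by (intro card_image) auto
    finally show "(\<Sum>v\<in>verts G. if v \<in> f ` verts H then 1 else 0) = num_verts H" .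
  qed
  finally show ?thesis by simp
qed

text \<open>v becomes a twin of u. Copies avoiding v are unchanged, copies through v but not u turn
  into copies through u when v is replaced by u, and those through both are few because two vertices
  are fixed. The adjacency of u and v in G' is left open; only the last kind of copies could notice
  it.\<close>

lemma emb_clone:
  assumes H: "fin_simple_graph H" and G: "fin_simple_graph G" and VG: "verts G' = verts G"
    and u: "u \<in> verts G" and uv: "u \<noteq> v"
    and same: "\<And>x y. x \<noteq> v \<Longrightarrow> y \<noteq> v \<Longrightarrow> {x, y} \<in> edges G' \<longleftrightarrow> {x, y} \<in> edges G"
    and clone: "\<And>x. x \<noteq> u \<Longrightarrow> x \<noteq> v \<Longrightarrow> {v, x} \<in> edges G' \<longleftrightarrow> {u, x} \<in> edges G"
  shows "card (emb H G') + card (thru H G v)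
    \<le> card (emb H G) + card (thru H G u) + (num_verts H)\<^sup>2 * num_verts G ^ (num_verts H - 2)"
proof -
  have fin: "finite (verts H)" "finite (verts G)" using H G by (auto simp: fin_simple_graphD(1))
  have fe: "finite (emb H G)" "finite (emb H G')" using fin VG by (auto simp: finite_emb)
  let ?A = "{f \<in> emb H G'. v \<notin> f ` verts H}" and ?B = "{f \<in> emb H G'. v \<in> f ` verts H \<and> u \<notin> f ` verts H}"
    and ?C = "{f \<in> emb H G'. v \<in> f ` verts H \<and> u \<in> f ` verts H}"
  have eH: "x \<in> verts H" "y \<in> verts H" "x \<noteq> y" if "{x, y} \<in> edges H" for x y
    using fin_simple_graphD(2)[OF H that] by auto
  have "emb H G' = ?A \<union> ?B \<union> ?C" by auto
  then have "card (emb H G') \<le> card ?A + card ?B + card ?C"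
    by (metis (no_types, lifting) add_right_mono card_Un_le order_trans)
  moreover have "card ?A \<le> card (emb H G) - card (thru H G v)"
  proof -
    have "?A \<subseteq> emb H G - thru H G v"
    proof
      fix f assume f: "f \<in> ?A"
      then have fe': "f \<in> emb H G'" and fv: "\<And>x. x \<in> verts H \<Longrightarrow> f x \<noteq> v" by auto
      have "{f x, f y} \<in> edges G" if e: "{x, y} \<in> edges H" for x y
      proof -
        have "{f x, f y} \<in> edges G'" using fe' e unfolding mem_emb_iff[OF H] by blast
        then show ?thesis using same[of "f x" "f y"] fv eH[OF e] by simp
      qed
      then have "f \<in> emb H G" using fe' VG unfolding mem_emb_iff[OF H] by simp
      then show "f \<in> emb H G - thru H G v" using f by (simp add: thru_def)
    qed
    then have "card ?A \<le> card (emb H G - thru H G v)" using fe by (intro card_mono) auto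
    also have "\<dots> = card (emb H G) - card (thru H G v)"
      using fe by (intro card_Diff_subset) (auto simp: thru_def)
    finally show ?thesis .
  qed
  moreover have "card (thru H G v) \<le> card (emb H G)" using fe by (intro card_mono) (auto simp: thru_def)
  moreover have "card ?B \<le> card (thru H G u)"
  proof (rule card_inj_on_le[where f = "\<lambda>f. \<lambda>x\<in>verts H. if f x = v then u else f x"])
    let ?h = "\<lambda>f. \<lambda>x\<in>verts H. if f x = v then u else f x"
    show "inj_on ?h ?B"
    proof (rule inj_onI)
      fix f g assume f: "f \<in> ?B" and g: "g \<in> ?B" and eq: "?h f = ?h g"
      have "f x = g x" if x: "x \<in> verts H" for x
      proof -
        have "(if f x = v then u else f x) = (if g x = v then u else g x)" using fun_cong[OF eq, of x] x by simp
        moreover have "f x \<noteq> u" "g x \<noteq> u" using f g x by auto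
        ultimately show ?thesis by (auto split: if_splits)
      qed
      then show "f = g" using f g unfolding mem_Collect_eq mem_emb_iff[OF H] by (intro PiE_ext[of f "verts H" _ g]) auto
    qed
    show "?h ` ?B \<subseteq> thru H G u"
    proof (rule image_subsetI)
      fix f assume f: "f \<in> ?B"
      then have fe': "f \<in> emb H G'" and vf: "v \<in> f ` verts H" and fu: "\<And>x. x \<in> verts H \<Longrightarrow> f x \<noteq> u" by auto
      have f1: "f \<in> verts H \<rightarrow>\<^sub>E verts G" and f2: "inj_on f (verts H)"
        and f3: "\<And>x y. {x, y} \<in> edges H \<Longrightarrow> {f x, f y} \<in> edges G'"
        using fe' VG unfolding mem_emb_iff[OF H] by auto
      have "?h f \<in> verts H \<rightarrow>\<^sub>E verts G" using f1 u by auto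
      moreover have "inj_on (?h f) (verts H)"
        using f2 fu by (intro inj_onI) (auto dest: inj_onD split: if_splits)
      moreover have "{?h f x, ?h f y} \<in> edges G" if e: "{x, y} \<in> edges H" for x y
      proof -
        note xy = eH[OF e]
        have ne: "f x \<noteq> f y" using f2 xy by (auto dest: inj_onD)
        consider "f x = v" | "f y = v" | "f x \<noteq> v" "f y \<noteq> v" by auto
        then show ?thesis
        proof cases
          case 1
          then have "{u, f y} \<in> edges G" using f3[OF e] clone[of "f y"] fu xy ne by auto
          then show ?thesis using 1 ne xy by simp
        next
          case 2
          then have "{u, f x} \<in> edges G" using f3[OF e] clone[of "f x"] fu xy ne by (auto simp: insert_commute)
          then show ?thesis using 2 ne xy by (simp add: insert_commute)
        next
          case 3
          then show ?thesis using f3[OF e] same xy by simp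
        qed
      qed
      ultimately have "?h f \<in> emb H G" unfolding mem_emb_iff[OF H] by blast
      moreover have "u \<in> ?h f ` verts H"
      proof -
        obtain x where "x \<in> verts H" "f x = v" using vf by auto
        then have "?h f x = u" by simp
        then show ?thesis using \<open>x \<in> verts H\<close> by (metis image_eqI)
      qed
      ultimately show "?h f \<in> thru H G u" by (simp only: thru_def mem_Collect_eq simp_thms)
    qed
    show "finite (thru H G u)" using fe by (simp add: thru_def)
  qed
  moreover have "card ?C \<le> (num_verts H)\<^sup>2 * num_verts G ^ (num_verts H - 2)"
  proof -
    let ?P = "verts H \<times> verts H - Id"
    let ?S = "\<lambda>z. {f \<in> verts H \<rightarrow>\<^sub>E verts G. f (fst z) = u \<and> f (snd z) = v}"
    have "?C \<subseteq> (\<Union>z\<in>?P. ?S z)"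
    proof
      fix f assume f: "f \<in> ?C"
      then obtain x y where xy: "x \<in> verts H" "y \<in> verts H" "f x = u" "f y = v" by auto
      have "f \<in> verts H \<rightarrow>\<^sub>E verts G" using f VG unfolding mem_Collect_eq mem_emb_iff[OF H] by simp
      then have "(x, y) \<in> ?P" "f \<in> ?S (x, y)" using xy uv by auto
      then show "f \<in> (\<Union>z\<in>?P. ?S z)" by blast
    qed
    moreover have fS: "finite (?S z)" for z
      using fin by (intro finite_subset[OF _ finite_PiE[of "verts H" "\<lambda>_. verts G"]]) auto
    ultimately have "card ?C \<le> card (\<Union>z\<in>?P. ?S z)" using fin by (intro card_mono finite_UN_I) auto
    also have "\<dots> \<le> (\<Sum>z\<in>?P. card (?S z))" using fin by (intro card_UN_le) auto
    also have "\<dots> \<le> (\<Sum>z\<in>?P. num_verts G ^ (num_verts H - 2))"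
    proof (rule sum_mono)
      fix z assume "z \<in> ?P"
      then have "fst z \<in> verts H" "snd z \<in> verts H" "fst z \<noteq> snd z" by auto
      then show "card (?S z) \<le> num_verts G ^ (num_verts H - 2)"
        using card_PiE_fix2[OF fin, of "fst z" "snd z" u v] by (simp add: num_verts_def)
    qed
    also have "\<dots> \<le> (num_verts H)\<^sup>2 * num_verts G ^ (num_verts H - 2)"
    proof -
      have "card ?P \<le> card (verts H \<times> verts H)" using fin by (intro card_mono) auto
      then show ?thesis by (simp add: num_verts_def power2_eq_square card_cartesian_product)
    qed
    finally show ?thesis .
  qed
  ultimately show ?thesis by linarith
qed

text \<open>Symmetrisation in the manner of Zykov. The weights of the copies through single vertices
  sum to at most 2 max v(H_i), so some u carries at most the average. Cloning u in place of v cannot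
  decrease the objective, so v carries at most the weight of u plus the error from copies through
  both.\<close>

lemma minimizer_thru_bound:
  fixes H1 :: "'a ugraph" and H2 :: "'b ugraph"
  assumes min: "minimizer H1 H2 G" and H1: "fin_simple_graph H1" and H2: "fin_simple_graph H2"
    and n: "n = num_verts G" "num_verts H1 \<le> n" "num_verts H2 \<le> n"
    and w: "w1 = wt H1 (chromatic_number H2 - 1) n" "w2 = wt H2 (chromatic_number H1 - 1) n"
    and obj: "bonbon_objective H1 H2 G \<le> 2"
    and err: "w1 * ((real (num_verts H1))\<^sup>2 * real n ^ (num_verts H1 - 2))
      + w2 * ((real (num_verts H2))\<^sup>2 * real n ^ (num_verts H2 - 2)) \<le> 1 / real n"
    and v: "v \<in> verts G"
  shows "w1 * real (card (thru H1 G v)) + w2 * real (card (thru H2 (complement G) v))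
    \<le> (2 * real (max (num_verts H1) (num_verts H2)) + 1) / real n"
proof -
  have G: "fin_simple_graph G" using min by (simp add: minimizer_def)
  note Gc = fin_simple_complement[OF G]
  have fG: "finite (verts G)" using G by (simp add: fin_simple_graphD(1))
  let ?m = "real (max (num_verts H1) (num_verts H2))"
  define c where "c = (\<lambda>v. w1 * real (card (thru H1 G v)) + w2 * real (card (thru H2 (complement G) v)))"
  have w0: "w1 \<ge> 0" "w2 \<ge> 0" using n w by (auto simp: wt_nonneg)
  have npos: "real n > 0" using v fG n by (auto simp: num_verts_def card_gt_0_iff)
  have objw: "bonbon_objective H1 H2 G' = w1 * real (card (emb H1 G')) + w2 * real (card (emb H2 (complement G')))"
    if "fin_simple_graph G'" "num_verts G' = n" for G' :: "nat ugraph"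
    using bonbon_objective_wt[OF H1 H2 that(1)] that(2) w by simp
  have "(\<Sum>v\<in>verts G. c v) = w1 * real (\<Sum>v\<in>verts G. card (thru H1 G v)) + w2 * real (\<Sum>v\<in>verts G. card (thru H2 (complement G) v))"
    by (simp add: c_def sum.distrib sum_distrib_left)
  also have "\<dots> = real (num_verts H1) * (w1 * real (card (emb H1 G))) + real (num_verts H2) * (w2 * real (card (emb H2 (complement G))))"
    using sum_thru[OF H1 fG] sum_thru[OF H2, of "complement G"] fG by (simp add: complement_simps(1))
  also have "\<dots> \<le> ?m * (w1 * real (card (emb H1 G))) + ?m * (w2 * real (card (emb H2 (complement G))))"
    using w0 by (intro add_mono mult_right_mono) auto
  also have "\<dots> = ?m * bonbon_objective H1 H2 G" using objw[OF G] n by (simp add: algebra_simps)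
  also have "\<dots> \<le> ?m * 2" using obj by (intro mult_left_mono) auto
  finally have tot: "(\<Sum>v\<in>verts G. c v) \<le> ?m * 2" .
  have "\<exists>u\<in>verts G. c u \<le> ?m * 2 / real n"
  proof (rule ccontr)
    assume "\<not> ?thesis"
    then have "\<And>u. u \<in> verts G \<Longrightarrow> ?m * 2 / real n < c u" by force
    then have "(\<Sum>u\<in>verts G. ?m * 2 / real n) < (\<Sum>u\<in>verts G. c u)"
      using v fG by (intro sum_strict_mono) auto
    moreover have "(\<Sum>u\<in>verts G. ?m * 2 / real n) = ?m * 2" using n npos by (simp add: num_verts_def)
    ultimately show False using tot by linarith
  qed
  then obtain u where u: "u \<in> verts G" "c u \<le> ?m * 2 / real n" by auto
  have "c v \<le> c u + 1 / real n"
  proof (cases "u = v")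
    case True
    then show ?thesis using npos by simp
  next
    case False
    \<comment> \<open>v drops all its edges and takes over the neighbours of u other than itself; in
      particular u and v end up non-adjacent.\<close>
    define G' where "G' = Graph (verts G) ({e \<in> edges G. v \<notin> e} \<union> {{v, x} | x. {u, x} \<in> edges G \<and> x \<noteq> v})"
    have VG': "verts G' = verts G" by (simp add: G'_def)
    have same: "{x, y} \<in> edges G' \<longleftrightarrow> {x, y} \<in> edges G" if "x \<noteq> v" "y \<noteq> v" for x y
      using that by (auto simp: G'_def doubleton_eq_iff)
    have clone: "{v, x} \<in> edges G' \<longleftrightarrow> {u, x} \<in> edges G" if "x \<noteq> u" "x \<noteq> v" for x
      using that by (auto simp: G'_def doubleton_eq_iff)
    have G': "fin_simple_graph G'"
    proof -
      have "e \<in> [verts G]\<^bsup>2\<^esup>" if "e \<in> edges G'" for e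
      proof (cases "e \<in> edges G")
        case True
        then show ?thesis using G by (auto simp: fin_simple_graph_def)
      next
        case False
        then obtain x where "e = {v, x}" "{u, x} \<in> edges G" "x \<noteq> v" using \<open>e \<in> edges G'\<close> by (auto simp: G'_def)
        then show ?thesis using v fin_simple_graphD(2)[OF G, of u x] by (auto simp: nsets_def)
      qed
      then show ?thesis using fG VG' by (auto simp: fin_simple_graph_def)
    qed
    have nv: "num_verts G' = n" using VG' n by (simp add: num_verts_def)
    have e1: "card (emb H1 G') + card (thru H1 G v) \<le> card (emb H1 G) + card (thru H1 G u) + (num_verts H1)\<^sup>2 * num_verts G ^ (num_verts H1 - 2)"
      using emb_clone[OF H1 G VG' u(1) False same clone] .
    have e2: "card (emb H2 (complement G')) + card (thru H2 (complement G) v)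
        \<le> card (emb H2 (complement G)) + card (thru H2 (complement G) u) + (num_verts H2)\<^sup>2 * num_verts (complement G) ^ (num_verts H2 - 2)"
    proof (rule emb_clone[OF H2 Gc])
      show "verts (complement G') = verts (complement G)" by (simp add: complement_simps VG')
      show "u \<in> verts (complement G)" using u by (simp add: complement_simps)
      show "u \<noteq> v" by fact
      show "{x, y} \<in> edges (complement G') \<longleftrightarrow> {x, y} \<in> edges (complement G)" if "x \<noteq> v" "y \<noteq> v" for x y
        using same[OF that] by (simp add: complement_simps VG')
      show "{v, x} \<in> edges (complement G') \<longleftrightarrow> {u, x} \<in> edges (complement G)" if "x \<noteq> u" "x \<noteq> v" for x
        using clone[OF that] u v that by (auto simp: complement_simps VG')
    qed
    have "w1 * real (card (emb H1 G)) + w2 * real (card (emb H2 (complement G)))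
        \<le> w1 * real (card (emb H1 G')) + w2 * real (card (emb H2 (complement G')))"
      using min G' nv n objw[OF G] objw[OF G'] by (auto simp: minimizer_def n_vertex_graphs_def)
    moreover have "w1 * (real (card (emb H1 G')) + real (card (thru H1 G v)))
        \<le> w1 * (real (card (emb H1 G)) + real (card (thru H1 G u)) + (real (num_verts H1))\<^sup>2 * real n ^ (num_verts H1 - 2))"
      using of_nat_mono[OF e1, where 'a = real] w0 n by (intro mult_left_mono) auto
    moreover have "w2 * (real (card (emb H2 (complement G'))) + real (card (thru H2 (complement G) v)))
        \<le> w2 * (real (card (emb H2 (complement G))) + real (card (thru H2 (complement G) u)) + (real (num_verts H2))\<^sup>2 * real n ^ (num_verts H2 - 2))"
      using of_nat_mono[OF e2, where 'a = real] w0 n by (intro mult_left_mono) (auto simp: num_verts_complement)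
    ultimately have "c v \<le> c u + (w1 * ((real (num_verts H1))\<^sup>2 * real n ^ (num_verts H1 - 2))
      + w2 * ((real (num_verts H2))\<^sup>2 * real n ^ (num_verts H2 - 2)))"
      unfolding c_def by (simp only: distrib_left)
    then show ?thesis using err by linarith
  qed
  then show ?thesis using u unfolding c_def by (simp add: add_divide_distrib mult.commute)
qed

text \<open>Deleting the pair destroys the copies of \<open>H1\<close> that use it and creates in
  the complement only copies of \<open>H2\<close> that use it. At a minimiser the loss cannot
  outweigh the gain.\<close>

lemma minimizer_delete_edge:
  fixes H1 :: "'a ugraph" and H2 :: "'b ugraph"
  assumes min: "minimizer H1 H2 G" and H1: "fin_simple_graph H1" and H2: "fin_simple_graph H2"
    and n: "n = num_verts G" "num_verts H1 \<le> n" "num_verts H2 \<le> n"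
    and w: "w1 = wt H1 (chromatic_number H2 - 1) n" "w2 = wt H2 (chromatic_number H1 - 1) n"
  shows "w1 * real (card {f \<in> emb H1 G. \<exists>e\<in>edges H1. f ` e = {u, v}})
    \<le> w2 * real (card {f \<in> emb H2 (complement (delete_edge G {u, v})). \<exists>e\<in>edges H2. f ` e = {u, v}})"
proof -
  have G: "fin_simple_graph G" using min by (simp add: minimizer_def)
  let ?G' = "delete_edge G {u, v}"
  have G': "fin_simple_graph ?G'" using G by (auto simp: fin_simple_graph_def delete_edge_def)
  have nv: "num_verts ?G' = n" using n by (simp add: num_verts_def delete_edge_def)
  have w0: "w1 \<ge> 0" "w2 \<ge> 0" using n w by (auto simp: wt_nonneg)
  have objw: "bonbon_objective H1 H2 G' = w1 * real (card (emb H1 G')) + w2 * real (card (emb H2 (complement G')))"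
    if "fin_simple_graph G'" "num_verts G' = n" for G' :: "nat ugraph"
    using bonbon_objective_wt[OF H1 H2 that(1)] that(2) w by simp
  have fin: "finite (emb H1 G)" "finite (emb H2 (complement G))" "finite (emb H2 (complement ?G'))"
    using G G' H1 H2 by (simp_all add: finite_emb fin_simple_graphD(1) complement_simps(1))
  let ?A = "{f \<in> emb H1 G. \<exists>e\<in>edges H1. f ` e = {u, v}}"
  let ?B = "{f \<in> emb H2 (complement ?G'). \<exists>e\<in>edges H2. f ` e = {u, v}}"
  have "emb H1 ?G' \<subseteq> emb H1 G - ?A" by (auto simp: emb_def inj_maps_def delete_edge_def)
  then have "card (emb H1 ?G') \<le> card (emb H1 G - ?A)" using fin by (intro card_mono) auto
  also have "\<dots> = card (emb H1 G) - card ?A" using fin by (intro card_Diff_subset) auto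
  finally have "card (emb H1 ?G') \<le> card (emb H1 G) - card ?A" .
  moreover have "card ?A \<le> card (emb H1 G)" using fin by (intro card_mono) auto
  ultimately have 1: "real (card (emb H1 ?G')) \<le> real (card (emb H1 G)) - real (card ?A)" by linarith
  have "emb H2 (complement ?G') \<subseteq> emb H2 (complement G) \<union> ?B"
    by (auto simp: emb_def inj_maps_def delete_edge_def complement_def)
  then have "card (emb H2 (complement ?G')) \<le> card (emb H2 (complement G) \<union> ?B)" using fin by (intro card_mono) auto
  also have "\<dots> \<le> card (emb H2 (complement G)) + card ?B" by (rule card_Un_le)
  finally have 2: "real (card (emb H2 (complement ?G'))) \<le> real (card (emb H2 (complement G))) + real (card ?B)" by linarith
  have "w1 * real (card (emb H1 G)) + w2 * real (card (emb H2 (complement G)))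
      \<le> w1 * real (card (emb H1 ?G')) + w2 * real (card (emb H2 (complement ?G')))"
    using min G' nv n objw[OF G] objw[OF G'] by (auto simp: minimizer_def n_vertex_graphs_def)
  also have "\<dots> \<le> w1 * (real (card (emb H1 G)) - real (card ?A)) + w2 * (real (card (emb H2 (complement G))) + real (card ?B))"
    using 1 2 w0 by (intro add_mono mult_left_mono) auto
  finally show ?thesis by (simp only: distrib_left right_diff_distrib)
qed

section \<open>Complete multipartite graphs\<close>

definition mpart :: "'v set \<Rightarrow> ('v \<Rightarrow> nat) \<Rightarrow> 'v ugraph" where
  "mpart V p = Graph V {{u, w} | u w. u \<in> V \<and> w \<in> V \<and> p u \<noteq> p w}"

definition cls :: "'a ugraph \<Rightarrow> 'a \<Rightarrow> 'a set" where
  "cls H x = reachable H `` {x}"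

definition asg :: "'a ugraph \<Rightarrow> nat \<Rightarrow> ('a set \<Rightarrow> nat) set" where
  "asg H r = (verts H // reachable H) \<rightarrow>\<^sub>E {..<r}"

definition cnt :: "'a ugraph \<Rightarrow> ('a set \<Rightarrow> nat) \<Rightarrow> nat \<Rightarrow> nat" where
  "cnt H s i = card {x \<in> verts H. s (cls H x) = i}"

text \<open>For natural \<open>N\<close> this is the number of embeddings of \<open>H\<close> into the disjoint union of \<open>r\<close> cliques of sizes
  \<open>N i\<close>; the assignment \<open>s\<close> tells which clique receives each component of \<open>H\<close>.\<close>

definition cliq_sum :: "'a ugraph \<Rightarrow> nat \<Rightarrow> (nat \<Rightarrow> real) \<Rightarrow> real" where
  "cliq_sum H r N = (\<Sum>s\<in>asg H r. \<Prod>i<r. ff (N i) (cnt H s i))"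

lemma mpart_simps:
  "verts (mpart V p) = V"
  "{x, y} \<in> edges (mpart V p) \<longleftrightarrow> x \<in> V \<and> y \<in> V \<and> p x \<noteq> p y"
  by (auto simp: mpart_def doubleton_eq_iff)

lemma fin_simple_mpart: "finite V \<Longrightarrow> fin_simple_graph (mpart V p)"
proof -
  assume "finite V"
  have "{u, w} \<in> [V]\<^bsup>2\<^esup>" if "u \<in> V" "w \<in> V" "p u \<noteq> p w" for u w
    using that by (cases "u = w") (auto simp: nsets_def)
  then show ?thesis using \<open>finite V\<close> by (auto simp: fin_simple_graph_def mpart_def)
qed

lemma cls_mem: "x \<in> verts H \<Longrightarrow> cls H x \<in> verts H // reachable H"
  by (simp add: cls_def quotientI)

lemma cls_edge:
  assumes "fin_simple_graph H" "{x, y} \<in> edges H" shows "cls H x = cls H y"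
proof -
  have "(x, y) \<in> reachable H" using fin_simple_graphD(2)[OF assms] assms(2) by (auto simp: reachable_def)
  then show ?thesis unfolding cls_def by (rule equiv_class_eq[OF equiv_reachable])
qed

lemma cls_eq_set:
  assumes "C \<in> verts H // reachable H" shows "{x \<in> verts H. cls H x = C} = C"
proof -
  obtain y where y: "y \<in> verts H" "C = reachable H `` {y}" using assms by (auto elim: quotientE)
  show ?thesis
  proof (intro subset_antisym subsetI)
    fix x assume "x \<in> {x \<in> verts H. cls H x = C}"
    then show "x \<in> C" using equiv_class_self[OF equiv_reachable] by (auto simp: cls_def)
  next
    fix x assume "x \<in> C"
    then have "(y, x) \<in> reachable H" using y by auto
    then have "x \<in> verts H" "reachable H `` {y} = reachable H `` {x}"
      using equiv_class_eq[OF equiv_reachable \<open>(y, x) \<in> reachable H\<close>] by (simp_all add: reachable_def)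
    then show "x \<in> {x \<in> verts H. cls H x = C}" using y by (simp add: cls_def)
  qed
qed

lemma num_components_le: "finite (verts H) \<Longrightarrow> num_components H \<le> num_verts H"
proof -
  assume f: "finite (verts H)"
  have "verts H // reachable H = (\<lambda>x. reachable H `` {x}) ` verts H" by (auto simp: quotient_def)
  then show ?thesis using card_image_le[OF f] by (simp add: num_components_def num_verts_def)
qed

lemma finite_comps: "finite (verts H) \<Longrightarrow> finite (verts H // reachable H)"
  by (rule finite_quotient) (auto simp: reachable_def)

lemma finite_asg: "finite (verts H) \<Longrightarrow> finite (asg H r)"
  unfolding asg_def by (intro finite_PiE finite_comps) auto

lemma card_asg: "finite (verts H) \<Longrightarrow> card (asg H r) = r ^ num_components H"
  unfolding asg_def num_components_def by (simp add: card_funcsetE finite_comps)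

lemma asg_lt: "s \<in> asg H r \<Longrightarrow> x \<in> verts H \<Longrightarrow> s (cls H x) < r"
  using cls_mem by (fastforce simp: asg_def)

lemma prod_cnt:
  fixes y :: "nat \<Rightarrow> real"
  assumes "finite (verts H)" "s \<in> asg H r"
  shows "(\<Prod>i<r. y i ^ cnt H s i) = (\<Prod>x\<in>verts H. y (s (cls H x)))"
    and "(\<Prod>x\<in>verts H. y (s (cls H x))) = (\<Prod>C\<in>verts H // reachable H. y (s C) ^ card C)"
proof -
  have "(\<Prod>x\<in>verts H. y (s (cls H x))) = (\<Prod>i<r. \<Prod>x\<in>{x \<in> verts H. s (cls H x) = i}. y (s (cls H x)))"
    using asg_lt[OF assms(2)] assms(1) by (intro prod.group[symmetric]) auto
  also have "\<dots> = (\<Prod>i<r. y i ^ cnt H s i)" by (simp add: cnt_def)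
  finally show "(\<Prod>i<r. y i ^ cnt H s i) = (\<Prod>x\<in>verts H. y (s (cls H x)))" by simp
  have "(\<Prod>x\<in>verts H. y (s (cls H x))) = (\<Prod>C\<in>verts H // reachable H. \<Prod>x\<in>{x \<in> verts H. cls H x = C}. y (s (cls H x)))"
    using assms(1) cls_mem by (intro prod.group[symmetric]) (auto simp: finite_comps)
  also have "\<dots> = (\<Prod>C\<in>verts H // reachable H. y (s C) ^ card C)"
  proof (rule prod.cong[OF refl])
    fix C assume "C \<in> verts H // reachable H"
    from cls_eq_set[OF this] have "card {x \<in> verts H. cls H x = C} = card C" by simp
    moreover have "(\<Prod>x\<in>{x \<in> verts H. cls H x = C}. y (s (cls H x))) = (\<Prod>x\<in>{x \<in> verts H. cls H x = C}. y (s C))"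
      by (rule prod.cong) auto
    ultimately show "(\<Prod>x\<in>{x \<in> verts H. cls H x = C}. y (s (cls H x))) = y (s C) ^ card C" by simp
  qed
  finally show "(\<Prod>x\<in>verts H. y (s (cls H x))) = (\<Prod>C\<in>verts H // reachable H. y (s C) ^ card C)" .
qed

lemma sum_cnt:
  assumes "finite (verts H)" "s \<in> asg H r" shows "(\<Sum>i<r. cnt H s i) = num_verts H"
proof -
  have "(\<Sum>x\<in>verts H. 1::nat) = (\<Sum>i<r. \<Sum>x\<in>{x \<in> verts H. s (cls H x) = i}. 1)"
    using asg_lt[OF assms(2)] assms(1) by (intro sum.group[symmetric]) auto
  then show ?thesis by (simp add: cnt_def num_verts_def)
qed

lemma cnt_le: "finite (verts H) \<Longrightarrow> cnt H s i \<le> num_verts H"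
  unfolding cnt_def num_verts_def by (intro card_mono) auto

text \<open>A component of H stays inside one clique, so an embedding determines an assignment of
  components to cliques. For a fixed assignment, embeddings are injections that respect it.\<close>

lemma card_emb_cliques:
  fixes V :: "'v set"
  assumes H: "fin_simple_graph H" and fV: "finite V" and p: "\<And>v. v \<in> V \<Longrightarrow> p v < r"
  shows "real (card (emb H (complement (mpart V p)))) = cliq_sum H r (\<lambda>i. real (card {v \<in> V. p v = i}))"
proof -
  let ?G = "complement (mpart V p)" and ?W = "\<lambda>i. {v \<in> V. p v = i}"
  let ?F = "\<lambda>s. {f \<in> Pi\<^sub>E (verts H) (\<lambda>x. ?W (s (cls H x))). inj_on f (verts H)}"
  have fH: "finite (verts H)" using H by (simp add: fin_simple_graphD(1))
  have adj: "{x, y} \<in> edges ?G \<longleftrightarrow> x \<in> V \<and> y \<in> V \<and> x \<noteq> y \<and> p x = p y" for x y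
    by (auto simp: complement_simps mpart_simps)
  have VG: "verts ?G = V" by (simp add: complement_simps mpart_simps)
  have "emb H ?G = (\<Union>s\<in>asg H r. ?F s)"
  proof (intro subset_antisym subsetI)
    fix f assume "f \<in> emb H ?G"
    then have f1: "f \<in> verts H \<rightarrow>\<^sub>E V" and f2: "inj_on f (verts H)"
      and f3: "\<And>x y. {x, y} \<in> edges H \<Longrightarrow> p (f x) = p (f y)"
      unfolding mem_emb_iff[OF H] VG adj by auto
    have const: "p (f x) = p (f y)" if "(x, y) \<in> reachable H" for x y
    proof -
      have "(x, y) \<in> {(u, w). {u, w} \<in> edges H}\<^sup>*" using that by (simp add: reachable_def)
      then show ?thesis by (induction rule: rtrancl_induct) (auto dest: f3)
    qed
    \<comment> \<open>By \<open>const\<close> the part of the image is the same for all vertices of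
      a component, so an arbitrary representative may define the assignment.\<close>
    define s where "s = (\<lambda>C\<in>verts H // reachable H. p (f (SOME x. x \<in> C)))"
    have s: "s (cls H x) = p (f x)" if x: "x \<in> verts H" for x
    proof -
      have "x \<in> cls H x" using equiv_class_self[OF equiv_reachable x] by (simp add: cls_def)
      then have "(SOME y. y \<in> cls H x) \<in> cls H x" by (rule someI)
      then have "(x, SOME y. y \<in> cls H x) \<in> reachable H" by (simp add: cls_def)
      from const[OF this] show ?thesis using cls_mem[OF x] by (simp add: s_def)
    qed
    have "s \<in> asg H r"
      unfolding asg_def s_def
    proof (subst restrict_PiE_iff, rule ballI)
      fix C assume C: "C \<in> verts H // reachable H"
      then obtain x where x: "x \<in> verts H" "C = cls H x" by (auto simp: cls_def elim: quotientE)
      have "p (f (SOME x. x \<in> C)) = p (f x)" using s[OF x(1)] C x(2) by (simp add: s_def)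
      then show "p (f (SOME x. x \<in> C)) \<in> {..<r}" using p f1 x(1) by auto
    qed
    moreover have "f \<in> ?F s"
    proof -
      have "f x \<in> ?W (s (cls H x))" if "x \<in> verts H" for x using s[OF that] f1 that by auto
      then show ?thesis using f1 f2 by (auto simp: PiE_iff)
    qed
    ultimately show "f \<in> (\<Union>s\<in>asg H r. ?F s)" by blast
  next
    fix f assume "f \<in> (\<Union>s\<in>asg H r. ?F s)"
    then obtain s where s: "s \<in> asg H r" "f \<in> ?F s" by blast
    have f1: "f x \<in> V" "p (f x) = s (cls H x)" if "x \<in> verts H" for x
    proof -
      have "f x \<in> ?W (s (cls H x))" using s(2) that by (auto simp: PiE_iff)
      then show "f x \<in> V" "p (f x) = s (cls H x)" by auto
    qed
    have "f \<in> verts H \<rightarrow>\<^sub>E V" using s(2) f1 by (auto simp: PiE_iff)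
    moreover have "inj_on f (verts H)" using s(2) by simp
    moreover have "{f x, f y} \<in> edges ?G" if e: "{x, y} \<in> edges H" for x y
    proof -
      have xy: "x \<in> verts H" "y \<in> verts H" "x \<noteq> y" using fin_simple_graphD(2)[OF H e] by auto
      moreover have "f x \<noteq> f y" using \<open>inj_on f (verts H)\<close> xy by (auto dest: inj_onD)
      ultimately show ?thesis using f1 cls_edge[OF H e] by (simp add: adj)
    qed
    ultimately show "f \<in> emb H ?G" unfolding mem_emb_iff[OF H] VG by blast
  qed
  moreover have "card (\<Union>s\<in>asg H r. ?F s) = (\<Sum>s\<in>asg H r. card (?F s))"
  proof (rule card_UN_disjoint)
    show "finite (asg H r)" using fH by (rule finite_asg)
    show "\<forall>s\<in>asg H r. finite (?F s)"
      using fH fV by (auto intro!: finite_subset[OF _ finite_PiE[of "verts H" "\<lambda>x. ?W (s (cls H x))" for s]])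
    show "\<forall>s\<in>asg H r. \<forall>s'\<in>asg H r. s \<noteq> s' \<longrightarrow> ?F s \<inter> ?F s' = {}"
    proof (intro ballI impI)
      fix s s' assume s: "s \<in> asg H r" "s' \<in> asg H r" "s \<noteq> s'"
      show "?F s \<inter> ?F s' = {}"
      proof (rule ccontr)
        assume "?F s \<inter> ?F s' \<noteq> {}"
        then obtain f where f: "f \<in> ?F s" "f \<in> ?F s'" by blast
        have "s C = s' C" if C: "C \<in> verts H // reachable H" for C
        proof -
          obtain x where x: "x \<in> verts H" "C = cls H x" using C by (auto simp: cls_def elim: quotientE)
          have "f x \<in> ?W (s (cls H x))" "f x \<in> ?W (s' (cls H x))" using f x(1) by (auto simp: PiE_iff)
          then show ?thesis using x by auto
        qed
        then have "s = s'" using s unfolding asg_def by (intro PiE_ext[of s _ _ s']) auto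
        with s show False by simp
      qed
    qed
  qed
  moreover have "real (card (?F s)) = (\<Prod>i<r. ff (real (card (?W i))) (cnt H s i))" if s: "s \<in> asg H r" for s
    unfolding cnt_def using fV fH asg_lt[OF s]
    by (intro card_inj_parts[where W = ?W and \<sigma> = "\<lambda>x. s (cls H x)" and I = "{..<r}"]) auto
  ultimately show ?thesis unfolding cliq_sum_def by simp
qed

text \<open>An embedding followed by p would be a proper colouring of H with r colours.\<close>

lemma emb_mpart_empty:
  assumes H: "fin_simple_graph H" and p: "\<And>v. v \<in> verts G \<Longrightarrow> p v < r" and chi: "chromatic_number H > r"
    and part: "\<And>x y. {x, y} \<in> edges G \<Longrightarrow> p x \<noteq> p y"
  shows "emb H G = {}"
proof (rule ccontr)
  assume "emb H G \<noteq> {}"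
  then obtain f where "f \<in> emb H G" by auto
  then have f1: "f \<in> verts H \<rightarrow>\<^sub>E verts G" and f3: "\<And>x y. {x, y} \<in> edges H \<Longrightarrow> {f x, f y} \<in> edges G"
    unfolding mem_emb_iff[OF H] by auto
  have "proper_coloring H r (p \<circ> f)" unfolding proper_coloring_def using p f1 part f3 by auto
  from chromatic_number_le[OF this] chi show False by simp
qed

lemma prod_ff_bounds:
  fixes N :: "nat \<Rightarrow> real"
  assumes "finite I" and N: "\<And>i. i \<in> I \<Longrightarrow> real v \<le> N i" and m: "\<And>i. i \<in> I \<Longrightarrow> m i \<le> v"
  shows "(\<Prod>i\<in>I. (N i - real v) ^ m i) \<le> (\<Prod>i\<in>I. ff (N i) (m i))"
    and "(\<Prod>i\<in>I. ff (N i) (m i)) \<le> (\<Prod>i\<in>I. N i ^ m i)"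
proof -
  have mN: "real (m i) \<le> N i" if "i \<in> I" for i
  proof -
    have "real (m i) \<le> real v" using m[OF that] by simp
    then show ?thesis using N[OF that] by linarith
  qed
  have "(N i - real v) ^ m i \<le> ff (N i) (m i)" if "i \<in> I" for i
  proof -
    have "(N i - real v) ^ m i \<le> (N i - real (m i)) ^ m i" using N m that by (intro power_mono) auto
    also have "\<dots> \<le> ff (N i) (m i)" by (rule ff_bounds(1)[OF mN[OF that]])
    finally show ?thesis .
  qed
  then show "(\<Prod>i\<in>I. (N i - real v) ^ m i) \<le> (\<Prod>i\<in>I. ff (N i) (m i))" using N by (intro prod_mono) auto
  show "(\<Prod>i\<in>I. ff (N i) (m i)) \<le> (\<Prod>i\<in>I. N i ^ m i)"
    using ff_bounds(2,3)[OF mN] by (intro prod_mono) auto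
qed

lemma cliq_sum_upper:
  assumes fH: "finite (verts H)" and N: "\<And>i. i < r \<Longrightarrow> real (num_verts H) \<le> N i" "\<And>i. i < r \<Longrightarrow> N i \<le> B"
  shows "cliq_sum H r N \<le> real r ^ num_components H * B ^ num_verts H"
proof -
  have "(\<Prod>i<r. ff (N i) (cnt H s i)) \<le> B ^ num_verts H" if s: "s \<in> asg H r" for s
  proof -
    have "(\<Prod>i<r. ff (N i) (cnt H s i)) \<le> (\<Prod>i<r. N i ^ cnt H s i)"
      using N(1) fH by (intro prod_ff_bounds(2)[where v = "num_verts H"]) (auto simp: cnt_le)
    also have "\<dots> \<le> (\<Prod>i<r. B ^ cnt H s i)"
    proof (rule prod_mono)
      fix i assume i: "i \<in> {..<r}"
      then have "0 \<le> N i" using N(1)[of i] by (auto intro: order_trans[of 0 "real (num_verts H)"])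
      then show "0 \<le> N i ^ cnt H s i \<and> N i ^ cnt H s i \<le> B ^ cnt H s i" using N(2)[of i] i by (auto intro: power_mono)
    qed
    also have "\<dots> = B ^ num_verts H" using sum_cnt[OF fH s] by (simp add: power_sum[symmetric])
    finally show ?thesis .
  qed
  then have "cliq_sum H r N \<le> (\<Sum>s\<in>asg H r. B ^ num_verts H)" unfolding cliq_sum_def by (rule sum_mono)
  then show ?thesis using fH by (simp add: card_asg)
qed

text \<open>The powers of \<chi> - 1 in the objective are chosen for this value: there are r^k
  assignments of the k components, each with about (n/r)^v embeddings, and the weight is about
  r^(v-k) / n^v. The limit is therefore 1.\<close>

lemma turan_objective:
  fixes H1 :: "'a ugraph" and H2 :: "'b ugraph" and \<theta> :: real
  assumes H1: "fin_simple_graph H1" and H2: "fin_simple_graph H2" and r: "r \<ge> 1" and chi: "chromatic_number H1 = r + 1"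
    and \<theta>: "\<theta> > 0"
  shows "\<exists>n0. \<forall>n\<ge>n0. \<exists>T\<in>n_vertex_graphs n. bonbon_objective H1 H2 T \<le> 1 + \<theta>"
proof -
  let ?v = "num_verts H2" and ?k = "num_components H2"
  define L where "L = ln (1 + \<theta>)"
  have L: "L > 0" using \<theta> by (simp add: L_def)
  \<comment> \<open>The last summand serves the estimate (1 + x)^v \<le> exp (v x) with x = (r + v)
    / (n - v): it makes v x at most \<open>L\<close>.\<close>
  define n0 where "n0 = r * (?v + 1) + ?v + 1 + nat \<lceil>real ?v * real (r + ?v) / L\<rceil>"
  show ?thesis
  proof (intro exI[of _ n0] allI impI)
    fix n assume n: "n \<ge> n0"
    define p where "p = (\<lambda>v::nat. v mod r)"
    let ?T = "mpart {..<n} p"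
    have fT: "fin_simple_graph ?T" by (rule fin_simple_mpart) simp
    have nT: "num_verts ?T = n" by (simp add: num_verts_def mpart_simps)
    have p: "p v < r" for v using r by (simp add: p_def)
    have nv: "?v < n" using n by (simp add: n0_def)
    have e1: "emb H1 ?T = {}"
      by (rule emb_mpart_empty[OF H1, where r = r and p = p]) (auto simp: p chi mpart_simps)
    have size: "real ?v \<le> real (card {v \<in> {..<n}. p v = i}) \<and> real (card {v \<in> {..<n}. p v = i}) \<le> real n / r + 1" if i: "i < r" for i
    proof -
      have lo: "(\<lambda>j. j * r + i) ` {..<n div r} \<subseteq> {v \<in> {..<n}. p v = i}"
      proof (rule image_subsetI)
        fix j assume "j \<in> {..<n div r}"
        then have "Suc j * r \<le> n div r * r" by (intro mult_right_mono) auto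
        also have "\<dots> \<le> n" by simp
        finally show "j * r + i \<in> {v \<in> {..<n}. p v = i}" using i by (simp add: p_def)
      qed
      have injl: "inj_on (\<lambda>j. j * r + i) A" for A using r by (auto simp: inj_on_def)
      have "n div r = card ((\<lambda>j. j * r + i) ` {..<n div r})" using card_image[OF injl] by simp
      also have "\<dots> \<le> card {v \<in> {..<n}. p v = i}" using lo by (intro card_mono) auto
      finally have lower: "n div r \<le> card {v \<in> {..<n}. p v = i}" .
      have up: "{v \<in> {..<n}. p v = i} \<subseteq> (\<lambda>j. j * r + i) ` {..n div r}"
      proof
        fix v assume "v \<in> {v \<in> {..<n}. p v = i}"
        then have "v = v div r * r + i" "v div r \<le> n div r" by (auto simp: p_def intro: div_le_mono)
        then show "v \<in> (\<lambda>j. j * r + i) ` {..n div r}" by blast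
      qed
      then have "card {v \<in> {..<n}. p v = i} \<le> card ((\<lambda>j. j * r + i) ` {..n div r})" by (intro card_mono) auto
      also have "\<dots> = n div r + 1" using card_image[OF injl] by simp
      finally have upper: "card {v \<in> {..<n}. p v = i} \<le> n div r + 1" .
      have "real (n div r * r) \<le> real n" by (simp only: of_nat_le_iff) simp
      then have "real (n div r) \<le> real n / real r" using r by (simp add: field_simps)
      moreover have "?v \<le> n div r"
      proof -
        have "?v * r \<le> n" using n by (simp add: n0_def algebra_simps)
        then show ?thesis using r by (simp add: less_eq_div_iff_mult_less_eq)
      qed
      ultimately show ?thesis using lower upper by linarith
    qed
    have "real (card (emb H2 (complement ?T))) \<le> real r ^ ?k * (real n / r + 1) ^ ?v"
      using card_emb_cliques[OF H2, of "{..<n}" p r] p size H2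
        cliq_sum_upper[of H2 r "\<lambda>i. real (card {v \<in> {..<n}. p v = i})" "real n / r + 1"]
      by (simp add: fin_simple_graphD(1))
    moreover have "bonbon_objective H1 H2 ?T = wt H2 r n * real (card (emb H2 (complement ?T)))"
      using bonbon_objective_wt[OF H1 H2 fT] e1 nT chi by simp
    ultimately have "bonbon_objective H1 H2 ?T \<le> wt H2 r n * (real r ^ ?k * (real n / r + 1) ^ ?v)"
      using wt_nonneg[of H2 n r] nv by (simp add: mult_left_mono)
    also have "\<dots> = real r ^ (?v - ?k) * real r ^ ?k * (real n / r + 1) ^ ?v / ff (real n) ?v"
      by (simp add: wt_def)
    also have "real r ^ (?v - ?k) * real r ^ ?k = real r ^ ?v"
    proof -
      have "?k \<le> ?v" using num_components_le[OF fin_simple_graphD(1)[OF H2]] .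
      then show ?thesis by (simp add: power_add[symmetric])
    qed
    also have "real r ^ ?v * (real n / r + 1) ^ ?v = (real n + real r) ^ ?v"
      using r by (simp add: power_mult_distrib[symmetric] distrib_left)
    also have "(real n + real r) ^ ?v / ff (real n) ?v \<le> (real n + real r) ^ ?v / (real n - real ?v) ^ ?v"
      using nv ff_bounds(1)[of ?v "real n"] by (intro divide_left_mono mult_pos_pos) (auto intro: ff_pos)
    also have "\<dots> = (1 + (real r + real ?v) / (real n - real ?v)) ^ ?v"
    proof -
      have "(real n + real r) / (real n - real ?v) = 1 + (real r + real ?v) / (real n - real ?v)"
        using nv by (simp add: field_simps)
      then show ?thesis by (simp add: power_divide[symmetric])
    qed
    also have "\<dots> \<le> exp ((real r + real ?v) / (real n - real ?v)) ^ ?v"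
      using nv by (intro power_mono exp_ge_add_one_self) auto
    also have "\<dots> = exp (real ?v * ((real r + real ?v) / (real n - real ?v)))" by (rule exp_of_nat_mult[symmetric])
    also have "\<dots> \<le> exp L"
    proof -
      have "real ?v * real (r + ?v) / L \<le> real n - real ?v"
        using n unfolding n0_def by linarith
      then have "real ?v * real (r + ?v) \<le> L * (real n - real ?v)" using L by (simp add: field_simps)
      then show ?thesis using nv by (simp add: field_simps)
    qed
    also have "\<dots> = 1 + \<theta>" using \<theta> by (simp add: L_def)
    finally show "\<exists>T\<in>n_vertex_graphs n. bonbon_objective H1 H2 T \<le> 1 + \<theta>"
      using fT nT by (auto simp: n_vertex_graphs_def)
  qed
qed

section \<open>Convexity of the number of embeddings into disjoint cliques\<close>

lemma ff_add1: "ff (x + 1) m = ff x m + real m * ff x (m - 1)"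
proof (cases m)
  case (Suc k)
  have "ff (x + 1) (Suc k) = (x + 1) * (\<Prod>j<k. x + 1 - real (Suc j))"
    unfolding ff_def by (subst prod.lessThan_Suc_shift) simp
  also have "(\<Prod>j<k. x + 1 - real (Suc j)) = ff x k" unfolding ff_def by (rule prod.cong) auto
  finally have "ff (x + 1) (Suc k) = (x + 1) * ff x k" .
  moreover have "ff x (Suc k) = ff x k * (x - real k)" by (simp add: ff_def)
  ultimately show ?thesis using Suc by (simp add: algebra_simps)
qed (simp add: ff_def)

lemma ff_add2: "ff (x + 2) m = ff x m + 2 * (real m * ff x (m - 1)) + real m * real (m - 1) * ff x (m - 2)"
proof -
  have "ff (x + 2) m = ff (x + 1 + 1) m" by (simp add: add.assoc)
  also have "\<dots> = ff (x + 1) m + real m * ff (x + 1) (m - 1)" by (rule ff_add1)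
  also have "\<dots> = ff x m + real m * ff x (m - 1) + real m * (ff x (m - 1) + real (m - 1) * ff x (m - 1 - 1))"
    by (simp only: ff_add1)
  also have "m - 1 - 1 = m - 2" by simp
  finally show ?thesis by (simp add: algebra_simps)
qed

text \<open>The second difference along the line on which x + y is constant. A shift by 1 acts on
  falling factorials like a derivative, so only terms of total degree m + k - 2 remain. Where m - 1
  or m - 2 is truncated, its coefficient vanishes.\<close>

lemma ff_second_difference:
  "ff (x + 2) m * ff y k + ff x m * ff (y + 2) k - 2 * (ff (x + 1) m * ff (y + 1) k)
    = real m * real (m - 1) * (ff x (m - 2) * ff y k) + real k * real (k - 1) * (ff x m * ff y (k - 2))
      - 2 * (real m * real k) * (ff x (m - 1) * ff y (k - 1))"
  unfolding ff_add2 ff_add1[of x m] ff_add1[of y k] by (simp add: algebra_simps)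

definition swp :: "nat \<Rightarrow> nat \<Rightarrow> nat \<Rightarrow> nat" where
  "swp a b i = (if i = a then b else if i = b then a else i)"

lemma swp_swp [simp]: "swp a b (swp a b i) = i" by (auto simp: swp_def)

lemma swp_lt: "a < r \<Longrightarrow> b < r \<Longrightarrow> i < r \<Longrightarrow> swp a b i < r" by (auto simp: swp_def)

text \<open>Summed over the vertices of H, this sign gives the difference of the numbers of vertices
  assigned to a and to b, and its square gives their sum.\<close>

definition sg :: "nat \<Rightarrow> nat \<Rightarrow> nat \<Rightarrow> real" where
  "sg a b i = (if i = a then 1 else if i = b then - 1 else 0)"

lemma cliq_sum_swap:
  assumes fH: "finite (verts H)" and a: "a < r" and b: "b < r"
  shows "cliq_sum H r (N \<circ> swp a b) = cliq_sum H r N"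
proof -
  define T where "T = (\<lambda>s. \<lambda>C\<in>verts H // reachable H. swp a b (s C))"
  have TT: "T (T s) = s" if "s \<in> asg H r" for s
  proof
    fix C show "T (T s) C = s C"
      using that by (cases "C \<in> verts H // reachable H") (auto simp: T_def asg_def PiE_def extensional_def)
  qed
  have TA: "T s \<in> asg H r" if s: "s \<in> asg H r" for s
    unfolding asg_def T_def
  proof (subst restrict_PiE_iff, rule ballI)
    fix C assume C: "C \<in> verts H // reachable H"
    have "s C < r" using s C by (auto simp: asg_def)
    then show "swp a b (s C) \<in> {..<r}" using swp_lt[OF a b] by simp
  qed
  have cntT: "cnt H (T s) i = cnt H s (swp a b i)" for s i
  proof -
    have "{x \<in> verts H. T s (cls H x) = i} = {x \<in> verts H. s (cls H x) = swp a b i}"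
    proof -
      have "T s (cls H x) = swp a b (s (cls H x))" if "x \<in> verts H" for x using cls_mem[OF that] by (simp add: T_def)
      moreover have "swp a b j = i \<longleftrightarrow> j = swp a b i" for j by (metis swp_swp)
      ultimately show ?thesis by auto
    qed
    then show ?thesis by (simp add: cnt_def)
  qed
  have "cliq_sum H r (N \<circ> swp a b) = (\<Sum>s\<in>asg H r. \<Prod>i<r. ff (N i) (cnt H (T s) i))"
    unfolding cliq_sum_def
  proof (rule sum.cong[OF refl])
    fix s
    show "(\<Prod>i<r. ff ((N \<circ> swp a b) i) (cnt H s i)) = (\<Prod>i<r. ff (N i) (cnt H (T s) i))"
      unfolding cntT
      by (rule prod.reindex_bij_witness[of _ "swp a b" "swp a b"]) (auto intro: swp_lt[OF a b])
  qed
  also have "\<dots> = (\<Sum>s\<in>asg H r. \<Prod>i<r. ff (N i) (cnt H s i))"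
    by (rule sum.reindex_bij_witness[of _ T T]) (auto simp: TT TA)
  finally show ?thesis by (simp add: cliq_sum_def)
qed

text \<open>Exchanging a and b in the value at C alone is an involution of the assignments that
  changes the sign. Different components are thus uncorrelated.\<close>

lemma sum_sg_zero:
  assumes a: "a < r" and b: "b < r" and C: "C \<in> verts H // reachable H" and C': "C' \<noteq> C" and ab: "a \<noteq> b"
  shows "(\<Sum>s\<in>asg H r. sg a b (s C) * sg a b (s C')) = 0"
proof -
  have neg: "sg a b (swp a b i) = - sg a b i" for i using ab by (auto simp: sg_def swp_def)
  have "(\<Sum>s\<in>asg H r. sg a b (s C) * sg a b (s C')) = (\<Sum>s\<in>asg H r. - (sg a b (s C) * sg a b (s C')))"
  proof (rule sum.reindex_bij_witness[of _ "\<lambda>s. s(C := swp a b (s C))" "\<lambda>s. s(C := swp a b (s C))"])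
    fix s assume s: "s \<in> asg H r"
    have "s C < r" using s C by (auto simp: asg_def)
    then have "swp a b (s C) < r" using swp_lt[OF a b] by simp
    then have "s(C := swp a b (s C)) \<in> insert C (verts H // reachable H) \<rightarrow>\<^sub>E {..<r}"
      using s unfolding asg_def by (intro PiE_fun_upd) auto
    then show "s(C := swp a b (s C)) \<in> asg H r" "s(C := swp a b (s C)) \<in> asg H r"
      using C by (auto simp: asg_def insert_absorb)
  qed (use C' in \<open>auto simp: neg\<close>)
  then show ?thesis by (simp add: sum_negf)
qed

lemma cnt_sum_ind:
  assumes "finite (verts H)"
  shows "real (cnt H s i) = (\<Sum>x\<in>verts H. if s (cls H x) = i then 1 else 0)"
  unfolding cnt_def using card_filter_sum[OF assms, of "\<lambda>x. s (cls H x) = i"] by (simp add: of_nat_sum if_distrib cong: if_cong)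

text \<open>The summand is the leading coefficient of the second difference. It expands into sign
  products over ordered pairs of distinct vertices. Pairs in different components cancel, pairs in
  one component give squares, and the ends of an edge contribute 1 under the assignment that is
  constantly a.\<close>

lemma sum_second_moment:
  assumes H: "fin_simple_graph H" and e: "edges H \<noteq> {}" and a: "a < r" and b: "b < r" and ab: "a \<noteq> b"
  shows "1 \<le> (\<Sum>s\<in>asg H r. (real (cnt H s a) - real (cnt H s b))\<^sup>2 - (real (cnt H s a) + real (cnt H s b)))"
proof -
  have fH: "finite (verts H)" using H by (simp add: fin_simple_graphD(1))
  let ?\<xi> = "\<lambda>s x. sg a b (s (cls H x))"
  let ?P = "\<lambda>x. verts H - {x}"
  \<comment> \<open>Subtracting the two counts removes exactly the diagonal of the squared sum of
    signs.\<close>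
  have E: "(real (cnt H s a) - real (cnt H s b))\<^sup>2 - (real (cnt H s a) + real (cnt H s b))
      = (\<Sum>x\<in>verts H. \<Sum>y\<in>?P x. ?\<xi> s x * ?\<xi> s y)" for s
  proof -
    have d: "real (cnt H s a) - real (cnt H s b) = (\<Sum>x\<in>verts H. ?\<xi> s x)"
      unfolding cnt_sum_ind[OF fH] sum_subtractf[symmetric] by (rule sum.cong) (use ab in \<open>auto simp: sg_def\<close>)
    have p: "real (cnt H s a) + real (cnt H s b) = (\<Sum>x\<in>verts H. ?\<xi> s x * ?\<xi> s x)"
      unfolding cnt_sum_ind[OF fH] sum.distrib[symmetric] by (rule sum.cong) (use ab in \<open>auto simp: sg_def\<close>)
    have "(\<Sum>x\<in>verts H. ?\<xi> s x)\<^sup>2 = (\<Sum>x\<in>verts H. \<Sum>y\<in>verts H. ?\<xi> s x * ?\<xi> s y)"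
      by (simp add: power2_eq_square sum_product)
    also have "\<dots> = (\<Sum>x\<in>verts H. ?\<xi> s x * ?\<xi> s x + (\<Sum>y\<in>?P x. ?\<xi> s x * ?\<xi> s y))"
      using fH by (intro sum.cong refl sum.remove) auto
    finally show ?thesis unfolding d p by (simp add: sum.distrib)
  qed
  obtain x0 y0 where xy: "{x0, y0} \<in> edges H" "x0 \<in> verts H" "y0 \<in> verts H" "x0 \<noteq> y0"
    using e fin_simple_graphD(3)[OF H] by blast
  have pair: "0 \<le> (\<Sum>s\<in>asg H r. ?\<xi> s x * ?\<xi> s y)" if x: "x \<in> verts H" for x y
  proof (cases "cls H x = cls H y")
    case True
    then show ?thesis by (intro sum_nonneg) simp
  next
    case False
    then show ?thesis using sum_sg_zero[OF a b cls_mem[OF x], of "cls H y"] ab by simp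
  qed
  have one: "1 \<le> (\<Sum>s\<in>asg H r. ?\<xi> s x0 * ?\<xi> s y0)"
  proof -
    define s where "s = (\<lambda>C\<in>verts H // reachable H. a)"
    have s: "s \<in> asg H r" using a by (auto simp: asg_def s_def)
    have c: "cls H x0 = cls H y0" by (rule cls_edge[OF H xy(1)])
    have "?\<xi> s x0 * ?\<xi> s y0 = 1" using cls_mem[OF xy(2)] c by (simp add: sg_def s_def)
    moreover have "?\<xi> s x0 * ?\<xi> s y0 \<le> (\<Sum>s\<in>asg H r. ?\<xi> s x0 * ?\<xi> s y0)"
      using s finite_asg[OF fH] c by (intro member_le_sum) auto
    ultimately show ?thesis by linarith
  qed
  have "1 \<le> (\<Sum>s\<in>asg H r. ?\<xi> s x0 * ?\<xi> s y0)" by (rule one)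
  also have "\<dots> \<le> (\<Sum>y\<in>?P x0. \<Sum>s\<in>asg H r. ?\<xi> s x0 * ?\<xi> s y)"
    using fH xy pair[OF xy(2)] by (intro member_le_sum[of y0 "?P x0" "\<lambda>y. \<Sum>s\<in>asg H r. ?\<xi> s x0 * ?\<xi> s y"]) auto
  also have "\<dots> \<le> (\<Sum>x\<in>verts H. \<Sum>y\<in>?P x. \<Sum>s\<in>asg H r. ?\<xi> s x * ?\<xi> s y)"
  proof (rule member_le_sum[of x0 "verts H" "\<lambda>x. \<Sum>y\<in>?P x. \<Sum>s\<in>asg H r. ?\<xi> s x * ?\<xi> s y"])
    fix x assume "x \<in> verts H - {x0}"
    then show "0 \<le> (\<Sum>y\<in>?P x. \<Sum>s\<in>asg H r. ?\<xi> s x * ?\<xi> s y)" using pair by (intro sum_nonneg[of "?P x"]) auto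
  qed (use fH xy in auto)
  also have "\<dots> = (\<Sum>s\<in>asg H r. \<Sum>x\<in>verts H. \<Sum>y\<in>?P x. ?\<xi> s x * ?\<xi> s y)"
    by (subst (2) sum.swap, subst sum.swap) (rule refl)
  finally show ?thesis unfolding E .
qed

lemma prod_two:
  fixes f :: "nat \<Rightarrow> real"
  assumes "a < r" "b < r" "a \<noteq> b"
  shows "(\<Prod>i<r. f i) = f a * (f b * (\<Prod>i\<in>{..<r} - {a, b}. f i))"
proof -
  have "(\<Prod>i<r. f i) = (\<Prod>i\<in>insert a (insert b ({..<r} - {a, b})). f i)"
    by (rule prod.cong) (use assms in auto)
  then show ?thesis using assms by simp
qed

text \<open>With nearly equal cliques, all products of degree v - 2 are close to the same Q, and k(k
  - 1) + l(l - 1) - 2kl = (k - l)^2 - (k + l). So the second difference is Q times the positive sum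
  in \<open>sum_second_moment\<close>, up to an error \<theta> Q v^2 for each of the r^k
  assignments, which \<open>small\<close> keeps below Q.\<close>

lemma cliq_sum_second_difference:
  fixes N :: "nat \<Rightarrow> real" and lo hi \<theta> Q :: real
  assumes H: "fin_simple_graph H" and e: "edges H \<noteq> {}" and a: "a < r" and b: "b < r" and ab: "a \<noteq> b"
    and N: "\<And>i. i < r \<Longrightarrow> lo + real (num_verts H) \<le> N i" "\<And>i. i < r \<Longrightarrow> N i \<le> hi"
    and lo: "0 \<le> lo" and Q: "Q > 0" and \<theta>: "0 \<le> \<theta>"
    and loQ: "(1 - \<theta>) * Q \<le> lo ^ (num_verts H - 2)" and hiQ: "hi ^ (num_verts H - 2) \<le> (1 + \<theta>) * Q"
    and small: "\<theta> * (real r ^ num_components H * (real (num_verts H))\<^sup>2) < 1"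
  shows "2 * cliq_sum H r (N(a := N a + 1, b := N b + 1))
    < cliq_sum H r (N(a := N a + 2)) + cliq_sum H r (N(b := N b + 2))"
proof -
  let ?v = "num_verts H"
  have fH: "finite (verts H)" using H by (simp add: fin_simple_graphD(1))
  have P: "(1 - \<theta>) * Q \<le> (\<Prod>i<r. ff (N i) (m i)) \<and> (\<Prod>i<r. ff (N i) (m i)) \<le> (1 + \<theta>) * Q"
    if m: "(\<Sum>i<r. m i) = ?v - 2" "\<And>i. i < r \<Longrightarrow> m i \<le> ?v" for m
  proof -
    have vN: "real ?v \<le> N i" if "i < r" for i using N(1)[OF that] lo by linarith
    have "lo ^ (?v - 2) = (\<Prod>i<r. lo ^ m i)" using m(1) by (simp add: power_sum[symmetric])
    also have "\<dots> \<le> (\<Prod>i<r. (N i - real ?v) ^ m i)"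
    proof (rule prod_mono)
      fix i assume "i \<in> {..<r}"
      then have "lo \<le> N i - real ?v" using N(1)[of i] by simp
      then show "0 \<le> lo ^ m i \<and> lo ^ m i \<le> (N i - real ?v) ^ m i" using lo by (auto intro: power_mono)
    qed
    also have "\<dots> \<le> (\<Prod>i<r. ff (N i) (m i))" using vN m(2) by (intro prod_ff_bounds(1)) auto
    finally have 1: "lo ^ (?v - 2) \<le> (\<Prod>i<r. ff (N i) (m i))" .
    have "(\<Prod>i<r. ff (N i) (m i)) \<le> (\<Prod>i<r. N i ^ m i)" using vN m(2) by (intro prod_ff_bounds(2)[where v = ?v]) auto
    also have "\<dots> \<le> (\<Prod>i<r. hi ^ m i)"
    proof (rule prod_mono)
      fix i assume i: "i \<in> {..<r}"
      then have "0 \<le> N i" using vN[of i] by (auto intro: order_trans[of 0 "real ?v"])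
      then show "0 \<le> N i ^ m i \<and> N i ^ m i \<le> hi ^ m i" using N(2)[of i] i by (auto intro: power_mono)
    qed
    also have "\<dots> = hi ^ (?v - 2)" using m(1) by (simp add: power_sum[symmetric])
    finally show ?thesis using 1 loQ hiQ by linarith
  qed
  have each: "Q * ((real (cnt H s a) - real (cnt H s b))\<^sup>2 - (real (cnt H s a) + real (cnt H s b))) - Q * (\<theta> * (real ?v)\<^sup>2)
     \<le> (\<Prod>i<r. ff ((N(a := N a + 2)) i) (cnt H s i)) + (\<Prod>i<r. ff ((N(b := N b + 2)) i) (cnt H s i))
        - 2 * (\<Prod>i<r. ff ((N(a := N a + 1, b := N b + 1)) i) (cnt H s i))"
    if s: "s \<in> asg H r" for s
  proof -
    define m where "m = cnt H s"
    define R where "R = (\<Prod>i\<in>{..<r} - {a, b}. ff (N i) (m i))"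
    define x y k l where "x = N a" and "y = N b" and "k = m a" and "l = m b"
    have sumv: "(\<Sum>i<r. m i) = ?v" using sum_cnt[OF fH s] by (simp add: m_def)
    have mv: "m i \<le> ?v" for i using cnt_le[OF fH] by (simp add: m_def)
    have two: "(\<Sum>i<r. g i) = g a + (g b + (\<Sum>i\<in>{..<r} - {a, b}. g i))" for g :: "nat \<Rightarrow> nat"
    proof -
      have "(\<Sum>i<r. g i) = (\<Sum>i\<in>insert a (insert b ({..<r} - {a, b})). g i)"
        by (rule sum.cong) (use a b in auto)
      then show ?thesis using ab by simp
    qed
    have kl: "k + l \<le> ?v" using two[of m] sumv by (simp add: k_def l_def)
    have Rst: "(\<Prod>i\<in>{..<r} - {a, b}. ff (N' i) (m' i)) = R" if "\<And>i. i \<noteq> a \<Longrightarrow> i \<noteq> b \<Longrightarrow> N' i = N i \<and> m' i = m i" for N' m'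
      unfolding R_def by (rule prod.cong) (auto simp: that)
    have T: "(\<Prod>i<r. ff (N' i) (m' i)) = ff (N' a) (m' a) * (ff (N' b) (m' b) * R)"
      if "\<And>i. i \<noteq> a \<Longrightarrow> i \<noteq> b \<Longrightarrow> N' i = N i \<and> m' i = m i" for N' m'
      using prod_two[OF a b ab, of "\<lambda>i. ff (N' i) (m' i)"] Rst[OF that] by simp
    have S: "(\<Sum>i<r. m' i) + (k + l) = ?v + (m' a + m' b)" if "\<And>i. i \<noteq> a \<Longrightarrow> i \<noteq> b \<Longrightarrow> m' i = m i" for m'
    proof -
      have "(\<Sum>i\<in>{..<r} - {a, b}. m' i) = (\<Sum>i\<in>{..<r} - {a, b}. m i)" by (rule sum.cong) (auto simp: that)
      then show ?thesis using two[of m'] two[of m] sumv by (simp add: k_def l_def)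
    qed
    have eq: "(\<Prod>i<r. ff ((N(a := N a + 2)) i) (m i)) + (\<Prod>i<r. ff ((N(b := N b + 2)) i) (m i))
        - 2 * (\<Prod>i<r. ff ((N(a := N a + 1, b := N b + 1)) i) (m i))
      = real k * real (k - 1) * (\<Prod>i<r. ff (N i) ((m(a := k - 2)) i)) + real l * real (l - 1) * (\<Prod>i<r. ff (N i) ((m(b := l - 2)) i))
        - 2 * (real k * real l) * (\<Prod>i<r. ff (N i) ((m(a := k - 1, b := l - 1)) i))" (is "?L = ?R")
    proof -
      have "?L = (ff (x + 2) k * ff y l + ff x k * ff (y + 2) l - 2 * (ff (x + 1) k * ff (y + 1) l)) * R"
        by (subst T; simp add: ab ab[symmetric] x_def y_def k_def l_def algebra_simps)+
      also have "\<dots> = (real k * real (k - 1) * (ff x (k - 2) * ff y l) + real l * real (l - 1) * (ff x k * ff y (l - 2))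
      - 2 * (real k * real l) * (ff x (k - 1) * ff y (l - 1))) * R" by (simp only: ff_second_difference)
      also have "\<dots> = ?R"
        by (subst T; simp add: ab ab[symmetric] x_def y_def k_def l_def algebra_simps)+
      finally show ?thesis .
    qed
    \<comment> \<open>For k < 2 the exponents with k - 2 do not sum to v - 2, but then the
      coefficient k (k - 1) is 0. The two bounds that follow treat small l, and k or l equal to 0,
      in the same way.\<close>
    have p1: "real k * real (k - 1) * ((1 - \<theta>) * Q) \<le> real k * real (k - 1) * (\<Prod>i<r. ff (N i) ((m(a := k - 2)) i))"
    proof (cases "k \<ge> 2")
      case True
      have "(\<Sum>i<r. (m(a := k - 2)) i) = ?v - 2" using S[of "m(a := k - 2)"] True ab kl by (simp add: l_def)
      then have "(1 - \<theta>) * Q \<le> (\<Prod>i<r. ff (N i) ((m(a := k - 2)) i))"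
        using P[of "m(a := k - 2)"] kl le_trans[OF diff_le_self mv] mv by (simp add: fun_upd_def k_def l_def del: One_nat_def)
      then show ?thesis by (intro mult_left_mono) auto
    next
      case False
      then have "k = 0 \<or> k - 1 = 0" by auto
      then show ?thesis by auto
    qed
    have p2: "real l * real (l - 1) * ((1 - \<theta>) * Q) \<le> real l * real (l - 1) * (\<Prod>i<r. ff (N i) ((m(b := l - 2)) i))"
    proof (cases "l \<ge> 2")
      case True
      have "(\<Sum>i<r. (m(b := l - 2)) i) = ?v - 2" using S[of "m(b := l - 2)"] True ab kl by (simp add: k_def)
      then have "(1 - \<theta>) * Q \<le> (\<Prod>i<r. ff (N i) ((m(b := l - 2)) i))"
        using P[of "m(b := l - 2)"] kl le_trans[OF diff_le_self mv] mv by (simp add: fun_upd_def k_def l_def del: One_nat_def)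
      then show ?thesis by (intro mult_left_mono) auto
    next
      case False
      then have "l = 0 \<or> l - 1 = 0" by auto
      then show ?thesis by auto
    qed
    have p3: "real k * real l * (\<Prod>i<r. ff (N i) ((m(a := k - 1, b := l - 1)) i)) \<le> real k * real l * ((1 + \<theta>) * Q)"
    proof (cases "k \<ge> 1 \<and> l \<ge> 1")
      case True
      have "(\<Sum>i<r. (m(a := k - 1, b := l - 1)) i) = ?v - 2" using S[of "m(a := k - 1, b := l - 1)"] True ab kl by simp
      then have "(\<Prod>i<r. ff (N i) ((m(a := k - 1, b := l - 1)) i)) \<le> (1 + \<theta>) * Q"
        using P[of "m(a := k - 1, b := l - 1)"] kl le_trans[OF diff_le_self mv] mv by (simp add: fun_upd_def k_def l_def del: One_nat_def)
      then show ?thesis by (intro mult_left_mono) auto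
    next
      case False
      then have "k = 0 \<or> l = 0" by auto
      then show ?thesis by auto
    qed
    have rk: "real k * real (k - 1) = real k * real k - real k" "real l * real (l - 1) = real l * real l - real l"
      by (cases k; cases l; simp add: algebra_simps)+
    \<comment> \<open>The left side is (k + l)^2 - (k + l): the absolute values of the three
      coefficients, each multiplied by \<theta> in the error.\<close>
    have kl2: "(real k * real k - real k) + (real l * real l - real l) + 2 * (real k * real l) \<le> (real ?v)\<^sup>2"
    proof -
      have "(real k + real l)\<^sup>2 \<le> (real ?v)\<^sup>2" using kl by (intro power_mono) (auto simp flip: of_nat_add)
      then show ?thesis by (simp add: power2_eq_square algebra_simps)
    qed
    have "Q * ((real k - real l)\<^sup>2 - (real k + real l)) - Q * (\<theta> * (real ?v)\<^sup>2)
      \<le> Q * ((real k - real l)\<^sup>2 - (real k + real l)) - Q * (\<theta> * ((real k * real k - real k) + (real l * real l - real l) + 2 * (real k * real l)))"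
      using kl2 Q \<theta> by (intro diff_left_mono mult_left_mono) auto
    also have "\<dots> = (real k * real k - real k) * ((1 - \<theta>) * Q) + (real l * real l - real l) * ((1 - \<theta>) * Q) - 2 * (real k * real l * ((1 + \<theta>) * Q))"
      by (simp add: power2_eq_square algebra_simps)
    also have "\<dots> \<le> ?L" using p1 p2 p3 unfolding eq rk by linarith
    finally show ?thesis unfolding m_def k_def l_def .
  qed
  have "0 < Q * (1 - \<theta> * (real r ^ num_components H * (real ?v)\<^sup>2))" using Q small by simp
  also have "\<dots> \<le> Q * ((\<Sum>s\<in>asg H r. (real (cnt H s a) - real (cnt H s b))\<^sup>2 - (real (cnt H s a) + real (cnt H s b))) - \<theta> * (real r ^ num_components H * (real ?v)\<^sup>2))"
    using sum_second_moment[OF H e a b ab] Q by (intro mult_left_mono diff_right_mono) auto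
  also have "\<dots> = (\<Sum>s\<in>asg H r. Q * ((real (cnt H s a) - real (cnt H s b))\<^sup>2 - (real (cnt H s a) + real (cnt H s b))) - Q * (\<theta> * (real ?v)\<^sup>2))"
    using card_asg[OF fH, of r] unfolding sum_subtractf sum_distrib_left[symmetric] sum_constant
    by (simp add: right_diff_distrib mult_ac)
  also have "\<dots> \<le> (\<Sum>s\<in>asg H r. (\<Prod>i<r. ff ((N(a := N a + 2)) i) (cnt H s i)) + (\<Prod>i<r. ff ((N(b := N b + 2)) i) (cnt H s i))
        - 2 * (\<Prod>i<r. ff ((N(a := N a + 1, b := N b + 1)) i) (cnt H s i)))"
    by (rule sum_mono[OF each])
  also have "\<dots> = cliq_sum H r (N(a := N a + 2)) + cliq_sum H r (N(b := N b + 2)) - 2 * cliq_sum H r (N(a := N a + 1, b := N b + 1))"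
    unfolding cliq_sum_def by (simp only: sum_subtractf sum.distrib sum_distrib_left)
  finally show ?thesis by linarith
qed

text \<open>The increments of g increase strictly, and symmetry makes the last one the negative of
  the first. Hence the first one is negative.\<close>

lemma strictly_convex_symmetric:
  fixes g :: "nat \<Rightarrow> real"
  assumes d: "d \<ge> 2" and conv: "\<And>j. j + 2 \<le> d \<Longrightarrow> 2 * g (j + 1) < g j + g (j + 2)"
    and s0: "g d = g 0" and s1: "g (d - 1) = g 1"
  shows "g 1 < g 0"
proof -
  have "g 1 - g 0 \<le> g (j + 1) - g j \<and> (j > 0 \<longrightarrow> g 1 - g 0 < g (j + 1) - g j)" if "j + 1 \<le> d" for j
    using that
  proof (induction j)
    case (Suc j)
    then have "g 1 - g 0 \<le> g (j + 1) - g j" "2 * g (j + 1) < g j + g (j + 2)" using conv[of j] by auto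
    then show ?case by simp
  qed simp
  from this[of "d - 1"] have "g 1 - g 0 < g d - g (d - 1)" using d by simp
  then show ?thesis using s0 s1 by linarith
qed

text \<open>Moving j vertices from clique a to clique b, for j between 0 and N a - N b, gives a
  strictly convex sequence. It is symmetric because reversing j exchanges the two cliques. So the
  first move lowers the count. All sizes on the way stay between N b and N a, where the bounds
  hold.\<close>

lemma cliq_sum_balance:
  fixes N :: "nat \<Rightarrow> nat" and lo hi \<theta> Q :: real
  assumes H: "fin_simple_graph H" and e: "edges H \<noteq> {}" and a: "a < r" and b: "b < r"
    and gap: "N b + 2 \<le> N a"
    and N: "\<And>i. i < r \<Longrightarrow> lo + real (num_verts H) \<le> real (N i)" "\<And>i. i < r \<Longrightarrow> real (N i) \<le> hi"
    and lo: "0 \<le> lo" and Q: "Q > 0" and \<theta>: "0 \<le> \<theta>"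
    and loQ: "(1 - \<theta>) * Q \<le> lo ^ (num_verts H - 2)" and hiQ: "hi ^ (num_verts H - 2) \<le> (1 + \<theta>) * Q"
    and small: "\<theta> * (real r ^ num_components H * (real (num_verts H))\<^sup>2) < 1"
  shows "cliq_sum H r (\<lambda>i. real ((N(a := N a - 1, b := N b + 1)) i)) < cliq_sum H r (\<lambda>i. real (N i))"
proof -
  have fH: "finite (verts H)" using H by (simp add: fin_simple_graphD(1))
  have ab: "a \<noteq> b" using gap by auto
  define d where "d = N a - N b"
  define M where "M = (\<lambda>j i. real ((N(a := N a - j, b := N b + j)) i))"
  define g where "g = (\<lambda>j. cliq_sum H r (M j))"
  have d: "d \<ge> 2" "N a = N b + d" using gap by (auto simp: d_def)
  have conv: "2 * g (j + 1) < g j + g (j + 2)" if j: "j + 2 \<le> d" for j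
  proof -
    \<comment> \<open>The sizes after removing j + 2 vertices from a and giving only j of them to b.
      Adding the two missing vertices to a, to b, or one to each yields three consecutive members of
      the sequence.\<close>
    define N' where "N' = (\<lambda>i. real ((N(a := N a - (j + 2), b := N b + j)) i))"
    have N'1: "lo + real (num_verts H) \<le> N' i" "N' i \<le> hi" if i: "i < r" for i
    proof -
      have "N b \<le> N a - (j + 2)" "N a - (j + 2) \<le> N a" "N b + j \<le> N a" using j d by auto
      then have "real (N b) \<le> N' a \<and> N' a \<le> real (N a)" "real (N b) \<le> N' b \<and> N' b \<le> real (N a)"
        using ab by (auto simp: N'_def)
      moreover have "N' i = real (N i)" if "i \<noteq> a" "i \<noteq> b" using that by (simp add: N'_def)
      ultimately show "lo + real (num_verts H) \<le> N' i" "N' i \<le> hi"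
        using N[OF i] N[OF a] N[OF b] by (cases "i = a"; cases "i = b"; force)+
    qed
    have "2 * cliq_sum H r (N'(a := N' a + 1, b := N' b + 1))
      < cliq_sum H r (N'(a := N' a + 2)) + cliq_sum H r (N'(b := N' b + 2))"
      by (rule cliq_sum_second_difference[OF H e a b ab N'1 lo Q \<theta> loQ hiQ small])
    moreover have "N'(a := N' a + 1, b := N' b + 1) = M (j + 1)" "N'(a := N' a + 2) = M j" "N'(b := N' b + 2) = M (j + 2)"
      using j d ab by (auto simp: N'_def M_def fun_eq_iff of_nat_diff)
    ultimately show ?thesis by (simp add: g_def)
  qed
  have sym: "g (d - j) = g j" if "j \<le> d" for j
  proof -
    have "M (d - j) = M j \<circ> swp a b"
      using that d ab by (auto simp: M_def swp_def fun_eq_iff of_nat_diff)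
    then show ?thesis using cliq_sum_swap[OF fH a b, of "M j"] by (simp add: g_def)
  qed
  have "g 1 < g 0"
    using strictly_convex_symmetric[OF d(1) conv] sym[of 0] sym[of 1] d by simp
  moreover have "M 0 = (\<lambda>i. real (N i))" "M 1 = (\<lambda>i. real ((N(a := N a - 1, b := N b + 1)) i))"
    using ab by (auto simp: M_def fun_eq_iff)
  ultimately show ?thesis by (simp add: g_def)
qed

section \<open>Near-optimal sizes are nearly equal, and optimal sizes are balanced\<close>

lemma bernoulli_square:
  fixes y :: real
  assumes "c \<ge> 2" and "- 1 \<le> y"
  shows "1 + real c * y + y\<^sup>2 \<le> (1 + y) ^ c"
  using assms(1)
proof (induction c rule: dec_induct)
  case base
  then show ?case by (simp add: power2_eq_square algebra_simps)
next
  case (step c)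
  \<comment> \<open>This is the surplus of the product in the induction step; it is non-negative
    since c + y \<ge> 1.\<close>
  have "0 \<le> y\<^sup>2 * (real c + y)" using step assms by (intro mult_nonneg_nonneg) auto
  then have "1 + real (Suc c) * y + y\<^sup>2 \<le> (1 + y) * (1 + real c * y + y\<^sup>2)"
    by (simp add: power2_eq_square algebra_simps)
  also have "\<dots> \<le> (1 + y) * (1 + y) ^ c" using step assms by (intro mult_left_mono) auto
  finally show ?case by simp
qed

text \<open>After bounding falling factorials by powers of N i - v, the sum over assignments factors
  into power sums, one for each component. A component of c vertices contributes at least r (M/r)^c,
  and one containing an edge has c \<ge> 2, so the quadratic term of \<open>bernoulli_square\<close>
  measures the imbalance of the sizes.\<close>

lemma cliq_sum_lower:
  fixes N :: "nat \<Rightarrow> real"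
  assumes H: "fin_simple_graph H" and e: "edges H \<noteq> {}" and r: "r \<ge> 1"
    and N: "\<And>i. i < r \<Longrightarrow> real (num_verts H) \<le> N i"
    and M: "M = (\<Sum>i<r. N i - real (num_verts H))" "M > 0"
  shows "real r ^ num_components H * (M / r) ^ num_verts H * (1 + (\<Sum>i<r. (r * (N i - real (num_verts H)) / M - 1)\<^sup>2) / r)
    \<le> cliq_sum H r N"
proof -
  let ?v = "num_verts H" and ?K = "verts H // reachable H"
  define z where "z = (\<lambda>i. N i - real ?v)"
  \<comment> \<open>Relative deviations from the mean. They sum to 0, so the linear terms in
    Bernoulli's inequality disappear.\<close>
  define y where "y = (\<lambda>i. r * z i / M - 1)"
  define Y where "Y = (\<Sum>i<r. (y i)\<^sup>2)"
  have fH: "finite (verts H)" using H by (simp add: fin_simple_graphD(1))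
  have z0: "z i \<ge> 0" if "i < r" for i using N[OF that] by (simp add: z_def)
  have y1: "y i \<ge> - 1" if "i < r" for i using z0[OF that] M by (simp add: y_def)
  have ysum: "(\<Sum>i<r. y i) = 0"
  proof -
    have "(\<Sum>i<r. y i) = r * (\<Sum>i<r. z i) / M - r"
      by (simp add: y_def sum_subtractf sum_distrib_left sum_divide_distrib)
    also have "(\<Sum>i<r. z i) = M" using M by (simp add: z_def)
    finally show ?thesis using M by simp
  qed
  have zy: "z i = M / r * (1 + y i)" for i using M r by (simp add: y_def)
  have Y0: "Y \<ge> 0" unfolding Y_def by (intro sum_nonneg) auto
  have pos: "M / r \<ge> 0" using M by simp
  have powsum: "(\<Sum>i<r. z i ^ c) = (M / r) ^ c * (\<Sum>i<r. (1 + y i) ^ c)" for c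
    unfolding zy by (simp only: power_mult_distrib sum_distrib_left)
  have low1: "(M / r) ^ c * r \<le> (\<Sum>i<r. z i ^ c)" for c
  proof -
    have "real r = (\<Sum>i<r. 1 + real c * y i)" using ysum by (simp add: sum.distrib sum_distrib_left[symmetric])
    also have "\<dots> \<le> (\<Sum>i<r. (1 + y i) ^ c)" using y1 by (intro sum_mono Bernoulli_inequality) auto
    finally show ?thesis unfolding powsum using pos by (intro mult_left_mono) auto
  qed
  have low2: "(M / r) ^ c * r * (1 + Y / r) \<le> (\<Sum>i<r. z i ^ c)" if "c \<ge> 2" for c
  proof -
    have "real r * (1 + Y / r) = (\<Sum>i<r. 1 + real c * y i + (y i)\<^sup>2)"
      using ysum r by (simp add: sum.distrib sum_distrib_left[symmetric] Y_def field_simps)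
    also have "\<dots> \<le> (\<Sum>i<r. (1 + y i) ^ c)" using y1 that by (intro sum_mono bernoulli_square) auto
    finally show ?thesis unfolding powsum using pos by (simp only: mult.assoc) (intro mult_left_mono, auto)
  qed
  obtain x0 y0 where xy: "{x0, y0} \<in> edges H" "x0 \<in> verts H" "y0 \<in> verts H" "x0 \<noteq> y0"
    using e fin_simple_graphD(3)[OF H] by blast
  define C0 where "C0 = cls H x0"
  have C0: "C0 \<in> ?K" using cls_mem[OF xy(2)] by (simp add: C0_def)
  have "{x0, y0} \<subseteq> {x \<in> verts H. cls H x = C0}" using xy cls_edge[OF H xy(1)] by (auto simp: C0_def)
  then have "{x0, y0} \<subseteq> C0" using cls_eq_set[OF C0] by simp
  moreover have "finite C0" using cls_eq_set[OF C0] fH by (metis finite_Collect_conjI Collect_mem_eq)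
  ultimately have card0: "card C0 \<ge> 2" using card_mono[of C0 "{x0, y0}"] xy by simp
  define bC where "bC = (\<lambda>C::'a set. (M / r) ^ card C * r)"
  have s0: "(\<lambda>C\<in>?K. 0) \<in> asg H r" using r by (auto simp: asg_def)
  have prodb: "(\<Prod>C\<in>?K. bC C) = real r ^ num_components H * (M / r) ^ ?v"
  proof -
    have "(\<Prod>C\<in>?K. (M / r) ^ card C) = (M / r) ^ ?v"
      using prod_cnt(2)[OF fH s0, of "\<lambda>_. M / r"] by (simp add: num_verts_def)
    then show ?thesis by (simp add: bC_def prod.distrib num_components_def)
  qed
  have "real r ^ num_components H * (M / r) ^ ?v * (1 + Y / r) = (\<Prod>C\<in>?K. bC C * (if C = C0 then 1 + Y / r else 1))"
    using prodb C0 finite_comps[OF fH] by (simp add: prod.distrib prod.delta)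
  also have "\<dots> \<le> (\<Prod>C\<in>?K. \<Sum>i<r. z i ^ card C)"
  proof (rule prod_mono)
    fix C assume "C \<in> ?K"
    have "0 \<le> bC C" using pos by (simp add: bC_def)
    moreover have "bC C * (if C = C0 then 1 + Y / r else 1) \<le> (\<Sum>i<r. z i ^ card C)"
      using low1[of "card C"] low2[of "card C"] card0 by (auto simp: bC_def)
    ultimately show "0 \<le> bC C * (if C = C0 then 1 + Y / r else 1) \<and> bC C * (if C = C0 then 1 + Y / r else 1) \<le> (\<Sum>i<r. z i ^ card C)"
      using Y0 by auto
  qed
  \<comment> \<open>The distributive law: expanding the product of power sums selects one part for
    each component, that is, an assignment.\<close>
  also have "\<dots> = (\<Sum>s\<in>asg H r. \<Prod>C\<in>?K. z (s C) ^ card C)"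
    unfolding asg_def by (rule prod_sum_PiE) (auto simp: finite_comps fH)
  also have "\<dots> \<le> cliq_sum H r N"
    unfolding cliq_sum_def
  proof (rule sum_mono)
    fix s assume s: "s \<in> asg H r"
    have "(\<Prod>C\<in>?K. z (s C) ^ card C) = (\<Prod>i<r. (N i - real ?v) ^ cnt H s i)"
      using prod_cnt[OF fH s, of z] by (simp add: z_def)
    also have "\<dots> \<le> (\<Prod>i<r. ff (N i) (cnt H s i))"
      using N fH by (intro prod_ff_bounds(1)) (auto simp: cnt_le)
    finally show "(\<Prod>C\<in>?K. z (s C) ^ card C) \<le> (\<Prod>i<r. ff (N i) (cnt H s i))" .
  qed
  finally show ?thesis by (simp add: Y_def y_def z_def)
qed

text \<open>A size that differs by at most 1 from every other lies strictly within 1 of the average,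
  since its difference from itself is 0. An integer at such a distance is the floor or the
  ceiling.\<close>

lemma turan_graph_mpart:
  fixes V :: "'v set"
  assumes fV: "finite V" and p: "\<And>v. v \<in> V \<Longrightarrow> p v < r" and r: "r \<ge> 1"
    and bal: "\<And>i j. i < r \<Longrightarrow> j < r \<Longrightarrow> card {v \<in> V. p v = i} \<le> card {v \<in> V. p v = j} + 1"
  shows "turan_graph r (mpart V p)"
proof -
  define N where "N = (\<lambda>i. card {v \<in> V. p v = i})"
  have sumN: "(\<Sum>i<r. N i) = card V"
  proof -
    have "(\<Sum>v\<in>V. 1::nat) = (\<Sum>i<r. \<Sum>v\<in>{v \<in> V. p v = i}. 1)" using p fV by (intro sum.group[symmetric]) auto
    then show ?thesis by (simp add: N_def)
  qed
  have "int (N i) \<in> {\<lfloor>real (card V) / real r\<rfloor>, \<lceil>real (card V) / real r\<rceil>}" if i: "i < r" for i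
  proof -
    have rest: "card V = N i + (\<Sum>j\<in>{..<r} - {i}. N j)" using sumN i by (simp add: sum.remove)
    have c: "card ({..<r} - {i}) = r - 1" using i by simp
    have "(\<Sum>j\<in>{..<r} - {i}. N j) \<le> (\<Sum>j\<in>{..<r} - {i}. N i + 1)" using bal i by (intro sum_mono) (auto simp: N_def)
    then have up: "card V \<le> N i + (r - 1) * (N i + 1)" using rest c by simp
    have "(\<Sum>j\<in>{..<r} - {i}. N i) \<le> (\<Sum>j\<in>{..<r} - {i}. N j + 1)" using bal i by (intro sum_mono) (auto simp: N_def)
    then have lo: "(r - 1) * N i \<le> (\<Sum>j\<in>{..<r} - {i}. N j) + (r - 1)"
      using c by (simp only: sum.distrib sum_constant mult_1_right of_nat_id)
    have rr: "real (r - 1) = real r - 1" using r by simp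
    have up': "real (card V) \<le> real (N i) + (real r - 1) * (real (N i) + 1)"
      using of_nat_mono[OF up, where 'a = real] unfolding of_nat_add of_nat_mult rr by simp
    have lo': "(real r - 1) * real (N i) + real (N i) \<le> real (card V) + (real r - 1)"
    proof -
      have "(r - 1) * N i + N i \<le> card V + (r - 1)" using lo rest by linarith
      from of_nat_mono[OF this, where 'a = real] show ?thesis unfolding of_nat_add of_nat_mult rr .
    qed
    have "real (card V) < (real (N i) + 1) * real r" using up' by (simp add: algebra_simps)
    then have 1: "real (card V) / real r < real (N i) + 1" using r by (simp add: divide_less_eq)
    have "(real (N i) - 1) * real r < real (card V)" using lo' by (simp add: algebra_simps)
    then have 2: "real (N i) - 1 < real (card V) / real r" using r by (simp add: less_divide_eq)
    show ?thesis
    proof (cases "real (N i) \<le> real (card V) / real r")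
      case True
      then have "\<lfloor>real (card V) / real r\<rfloor> = int (N i)" using 1 by (intro floor_unique) auto
      then show ?thesis by simp
    next
      case False
      then have "\<lceil>real (card V) / real r\<rceil> = int (N i)" using 2 by (intro ceiling_unique) auto
      then show ?thesis by simp
    qed
  qed
  then show ?thesis unfolding turan_graph_def using p
    by (intro exI[of _ p]) (auto simp: mpart_simps num_verts_def N_def mpart_def)
qed

text \<open>Two passes. Comparing the objective with its value at a Turan graph forces all parts
  into a narrow range around n/r. In that range the convexity estimate applies, and moving a single
  vertex from a larger part to one smaller by 2 or more would decrease the objective.\<close>

lemma multipartite_minimizer_turan:
  fixes H1 :: "'a ugraph" and H2 :: "'b ugraph"
  assumes H1: "fin_simple_graph H1" and H2: "fin_simple_graph H2" and e: "edges H2 \<noteq> {}"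
    and r: "r \<ge> 1" and chi: "chromatic_number H1 = r + 1"
  shows "\<exists>n0. \<forall>G p. num_verts G \<ge> n0 \<longrightarrow> minimizer H1 H2 G \<longrightarrow> (\<forall>v\<in>verts G. p v < r) \<longrightarrow>
    G = mpart (verts G) p \<longrightarrow> (\<forall>i<r. num_verts H2 \<le> card {v \<in> verts G. p v = i}) \<longrightarrow> turan_graph r G"
proof -
  let ?v = "num_verts H2" and ?k = "num_components H2"
  have fH: "finite (verts H2)" using H2 by (simp add: fin_simple_graphD(1))
  have v0: "real ?v > 0"
  proof -
    have "verts H2 \<noteq> {}" using e fin_simple_graphD(3)[OF H2] by blast
    then show ?thesis using fH by (simp add: num_verts_def card_gt_0_iff)
  qed
  define A where "A = real r ^ ?k * (real ?v)\<^sup>2"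
  have A: "A > 0" using r v0 by (simp add: A_def)
  \<comment> \<open>Half of what the condition \<open>small\<close> of
    \<open>cliq_sum_balance\<close> permits.\<close>
  define \<theta>2 where "\<theta>2 = 1 / (2 * A)"
  have \<theta>2: "\<theta>2 > 0" "\<theta>2 * A < 1" using A by (simp_all add: \<theta>2_def)
  \<comment> \<open>By Bernoulli this keeps all powers of 1 - \<eta>1 and 1 + \<eta>1 with exponent
    at most v between 1 - \<theta>2 and 1 + \<theta>2.\<close>
  define \<eta>1 where "\<eta>1 = \<theta>2 / ((1 + \<theta>2) * real ?v)"
  have \<eta>1: "\<eta>1 > 0" using \<theta>2 v0 by (simp add: \<eta>1_def)
  have v\<eta>: "real ?v * \<eta>1 = \<theta>2 / (1 + \<theta>2)" using v0 by (simp add: \<eta>1_def)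
  have v1: "real ?v \<ge> 1" using v0 by simp
  have \<eta>1l: "\<eta>1 < 1"
  proof -
    have "\<eta>1 \<le> real ?v * \<eta>1" using v1 \<eta>1 by simp
    also have "\<dots> < 1" using \<theta>2 by (simp add: v\<eta> divide_less_eq)
    finally show ?thesis .
  qed
  have pow_lo: "1 / (1 + \<theta>2) \<le> (1 - \<eta>1) ^ j" if "j \<le> ?v" for j
  proof -
    have "1 / (1 + \<theta>2) = 1 - real ?v * \<eta>1" unfolding v\<eta> using \<theta>2 by (simp add: field_simps)
    also have "\<dots> \<le> 1 + real j * (- \<eta>1)" using that \<eta>1 by simp
    also have "\<dots> \<le> (1 + (- \<eta>1)) ^ j" using \<eta>1l by (intro Bernoulli_inequality) auto
    finally show ?thesis by simp
  qed
  have pow_lo': "1 - \<theta>2 \<le> (1 - \<eta>1) ^ j" if "j \<le> ?v" for j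
  proof -
    have "1 - \<theta>2 \<le> 1 / (1 + \<theta>2)" using \<theta>2 by (simp add: field_simps)
    then show ?thesis using pow_lo[OF that] by linarith
  qed
  have pow_hi: "(1 + \<eta>1) ^ j \<le> 1 + \<theta>2" if "j \<le> ?v" for j
  proof -
    have "(1 + \<eta>1) ^ j * (1 - \<eta>1) ^ j = (1 - \<eta>1\<^sup>2) ^ j"
      by (simp add: power_mult_distrib[symmetric] power2_eq_square algebra_simps)
    also have "\<dots> \<le> 1" using \<eta>1l \<eta>1 by (intro power_le_one) (auto simp: power_le_one)
    finally have "(1 + \<eta>1) ^ j * (1 - \<eta>1) ^ j \<le> 1" .
    moreover have "(1 + \<eta>1) ^ j * (1 / (1 + \<theta>2)) \<le> (1 + \<eta>1) ^ j * (1 - \<eta>1) ^ j"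
      using pow_lo[OF that] \<eta>1 by (intro mult_left_mono) auto
    ultimately have "(1 + \<eta>1) ^ j * (1 / (1 + \<theta>2)) \<le> 1" by linarith
    then show ?thesis using \<theta>2 by (simp add: divide_le_eq)
  qed
  \<comment> \<open>One half of \<eta>1 bounds the deviation of the sizes, the other half absorbs
    the summand v in the lower bound on them.\<close>
  define \<eta> where "\<eta> = \<eta>1 / 2"
  \<comment> \<open>(1 + \<theta>)^2 \<le> 1 + 3 \<theta> will bound the sum of the squared
    deviations by 3 r \<theta>, which has to be at most \<eta>^2.\<close>
  define \<theta> where "\<theta> = min 1 (\<eta>\<^sup>2 / (3 * r))"
  have \<eta>: "\<eta> > 0" using \<eta>1 by (simp add: \<eta>_def)
  have \<theta>: "\<theta> > 0" "\<theta> \<le> 1" "3 * r * \<theta> \<le> \<eta>\<^sup>2"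
  proof -
    show "\<theta> > 0" using \<eta> r by (simp add: \<theta>_def)
    show "\<theta> \<le> 1" by (simp add: \<theta>_def)
    have "\<theta> \<le> \<eta>\<^sup>2 / (3 * r)" by (simp add: \<theta>_def)
    then show "3 * r * \<theta> \<le> \<eta>\<^sup>2" using r by (simp add: field_simps)
  qed
  obtain nT where nT: "\<And>n. n \<ge> nT \<Longrightarrow> \<exists>T\<in>n_vertex_graphs n. bonbon_objective H1 H2 T \<le> 1 + \<theta>"
    using turan_objective[OF H1 H2 r chi \<theta>(1)] by auto
  define n0 where "n0 = nT + 1 + ?v + 2 * r * ?v + nat \<lceil>real r * (real ?v)\<^sup>2 * (1 + \<theta>) / \<theta>\<rceil> + nat \<lceil>real r * real ?v / \<eta>\<rceil>"
  show ?thesis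
  proof (intro exI[of _ n0] allI impI)
    fix G :: "nat ugraph" and p :: "nat \<Rightarrow> nat"
    assume n: "num_verts G \<ge> n0" and min: "minimizer H1 H2 G" and p: "\<forall>v\<in>verts G. p v < r" and G: "G = mpart (verts G) p"
      and big: "\<forall>i<r. ?v \<le> card {v \<in> verts G. p v = i}"
    define V where "V = verts G"
    define n where "n = num_verts G"
    define N where "N = (\<lambda>i. card {v \<in> V. p v = i})"
    have fG: "fin_simple_graph G" using min by (simp add: minimizer_def)
    have fV: "finite V" using fG by (simp add: V_def fin_simple_graphD(1))
    have pV: "\<And>v. v \<in> V \<Longrightarrow> p v < r" using p by (simp add: V_def)
    have nV: "n = card V" by (simp add: n_def V_def num_verts_def)
    have nn: "n \<ge> n0" using n by (simp add: n_def)
    have npos: "real n > 0" using nn by (simp add: n0_def)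
    have objm: "bonbon_objective H1 H2 (mpart V p') = wt H2 r n * cliq_sum H2 r (\<lambda>i. real (card {v \<in> V. p' v = i}))"
      if p': "\<And>v. v \<in> V \<Longrightarrow> p' v < r" for p'
    proof -
      have f: "fin_simple_graph (mpart V p')" by (rule fin_simple_mpart[OF fV])
      have "emb H1 (mpart V p') = {}"
        by (rule emb_mpart_empty[OF H1, where r = r and p = p']) (auto simp: p' chi mpart_simps)
      then show ?thesis using bonbon_objective_wt[OF H1 H2 f] card_emb_cliques[OF H2 fV p'] chi
        by (simp add: num_verts_def mpart_simps nV)
    qed
    have objm_p: "bonbon_objective H1 H2 (mpart V p) = wt H2 r n * cliq_sum H2 r (\<lambda>i. real (card {v \<in> V. p v = i}))"
      by (rule objm) (rule pV)
    have GV: "mpart V p = G" unfolding V_def by (rule G[symmetric])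
    have wpos: "wt H2 r n > 0"
      unfolding wt_def using r nn by (intro divide_pos_pos ff_pos) (auto simp: n0_def)
    have obj: "wt H2 r n * cliq_sum H2 r (\<lambda>i. real (N i)) \<le> 1 + \<theta>"
    proof -
      obtain T where "T \<in> n_vertex_graphs n" "bonbon_objective H1 H2 T \<le> 1 + \<theta>" using nT[of n] nn by (auto simp: n0_def)
      then have "bonbon_objective H1 H2 G \<le> 1 + \<theta>" using min by (fastforce simp: minimizer_def n_def)
      then have "bonbon_objective H1 H2 (mpart V p) \<le> 1 + \<theta>" unfolding GV .
      then show ?thesis unfolding objm_p N_def .
    qed
    have sumN: "(\<Sum>i<r. N i) = n"
    proof -
      have "(\<Sum>v\<in>V. 1::nat) = (\<Sum>i<r. \<Sum>v\<in>{v \<in> V. p v = i}. 1)" using pV fV by (intro sum.group[symmetric]) auto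
      then show ?thesis by (simp add: N_def nV)
    qed
    have bigN: "real ?v \<le> real (N i)" if "i < r" for i using big that by (simp add: N_def V_def)
    define M where "M = real n - real r * real ?v"
    have Msum: "M = (\<Sum>i<r. real (N i) - real ?v)"
      using sumN by (simp add: M_def sum_subtractf flip: of_nat_sum)
    have Mpos: "M > 0"
    proof -
      have "r * ?v + 1 \<le> n" using nn by (simp add: n0_def)
      then have "real (r * ?v + 1) \<le> real n" by (rule of_nat_mono)
      then show ?thesis by (simp add: M_def)
    qed
    define y where "y = (\<lambda>i. r * (real (N i) - real ?v) / M - 1)"
    define Y where "Y = (\<Sum>i<r. (y i)\<^sup>2)"
    have Y0: "Y \<ge> 0" unfolding Y_def by (intro sum_nonneg) auto
    have lowc: "real r ^ ?k * (M / r) ^ ?v * (1 + Y / r) \<le> cliq_sum H2 r (\<lambda>i. real (N i))"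
      using cliq_sum_lower[OF H2 e r bigN Msum Mpos] by (simp add: Y_def y_def)
    \<comment> \<open>The powers of r from the weight and from the assignments combine to r^v and
      cancel against (M/r)^v, so only the imbalance and a factor close to 1 remain.\<close>
    have "(M / n) ^ ?v * (1 + Y / r) \<le> 1 + \<theta>"
    proof -
      have "?k \<le> ?v" by (rule num_components_le[OF fH])
      then have rk: "real r ^ (?v - ?k) * real r ^ ?k = real r ^ ?v" by (simp add: power_add[symmetric])
      have wl: "real r ^ (?v - ?k) / real n ^ ?v \<le> wt H2 r n"
      proof -
        have "?v \<le> n" using nn by (simp add: n0_def)
        then show ?thesis unfolding wt_def using r ff_bounds(2)[of ?v "real n"] ff_pos[of ?v "real n"]
          by (intro divide_left_mono mult_pos_pos) auto
      qed
      have "(M / n) ^ ?v * (1 + Y / r) = real r ^ (?v - ?k) * real r ^ ?k * (M / r) ^ ?v / real n ^ ?v * (1 + Y / r)"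
        using r unfolding rk by (simp add: power_divide)
      also have "\<dots> = real r ^ (?v - ?k) / real n ^ ?v * (real r ^ ?k * (M / r) ^ ?v * (1 + Y / r))" by simp
      also have "\<dots> \<le> wt H2 r n * cliq_sum H2 r (\<lambda>i. real (N i))"
        using wl lowc wpos Mpos Y0 by (intro mult_mono) auto
      finally show ?thesis using obj by linarith
    qed
    moreover have "1 / (1 + \<theta>) \<le> (M / n) ^ ?v"
    proof -
      have "real r * (real ?v)\<^sup>2 * (1 + \<theta>) / \<theta> \<le> real n" using nn unfolding n0_def by linarith
      then have "real r * (real ?v)\<^sup>2 * (1 + \<theta>) \<le> real n * \<theta>" using \<theta> by (simp add: field_simps)
      then have "1 / (1 + \<theta>) \<le> 1 + real ?v * (- (real r * real ?v) / n)"
        using npos \<theta> by (simp add: field_simps power2_eq_square)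
      also have "\<dots> \<le> (1 + (- (real r * real ?v) / n)) ^ ?v"
        using Mpos npos by (intro Bernoulli_inequality) (simp add: M_def field_simps)
      also have "1 + (- (real r * real ?v) / n) = M / n" using npos by (simp add: M_def field_simps)
      finally show ?thesis .
    qed
    ultimately have "1 / (1 + \<theta>) * (1 + Y / r) \<le> 1 + \<theta>"
      using Y0 by (meson mult_right_mono order_trans add_nonneg_nonneg divide_nonneg_nonneg of_nat_0_le_iff zero_le_one)
    then have "1 + Y / r \<le> (1 + \<theta>) * (1 + \<theta>)" using \<theta> by (simp add: field_simps)
    also have "\<dots> \<le> 1 + 3 * \<theta>" using \<theta> by (simp add: algebra_simps)
    finally have "Y \<le> 3 * r * \<theta>" using r by (simp add: field_simps)
    then have Yle: "Y \<le> \<eta>\<^sup>2" using \<theta>(3) by linarith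
    have dev: "\<bar>real (N i) - real n / r\<bar> \<le> \<eta> * (real n / r)" if i: "i < r" for i
    proof -
      have "(y i)\<^sup>2 \<le> Y" unfolding Y_def using i by (intro member_le_sum) auto
      then have "\<bar>y i\<bar> \<le> \<eta>" using Yle \<eta> abs_le_square_iff[of "y i" \<eta>] by simp
      moreover have "real (N i) - real n / r = M / r * y i"
        using r Mpos by (simp add: y_def M_def field_simps)
      moreover have "M / r \<le> real n / r" by (intro divide_right_mono) (auto simp: M_def)
      moreover have "\<bar>M / r * y i\<bar> = M / r * \<bar>y i\<bar>" using Mpos by (simp add: abs_mult)
      moreover have "M / r * \<bar>y i\<bar> \<le> real n / r * \<eta>"
        using calculation(1,3) by (intro mult_mono) auto
      ultimately have "\<bar>real (N i) - real n / r\<bar> \<le> real n / r * \<eta>" by (simp only:)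
      then show ?thesis by (simp add: mult.commute)
    qed
    have bal: "N a \<le> N b + 1" if a: "a < r" and b: "b < r" for a b
    proof (rule ccontr)
      assume "\<not> ?thesis"
      then have gap: "N b + 2 \<le> N a" by simp
      have ab: "a \<noteq> b" using gap by auto
      let ?lo = "(1 - \<eta>1) * (real n / r)" and ?hi = "(1 + \<eta>1) * (real n / r)" and ?Q = "(real n / r) ^ (?v - 2)"
      have vn: "real ?v \<le> \<eta> * (real n / r)"
      proof -
        have "real r * real ?v / \<eta> \<le> real n" using nn unfolding n0_def by linarith
        then show ?thesis using \<eta> r by (simp add: field_simps)
      qed
      have lt: "cliq_sum H2 r (\<lambda>i. real ((N(a := N a - 1, b := N b + 1)) i)) < cliq_sum H2 r (\<lambda>i. real (N i))"
      proof (rule cliq_sum_balance[OF H2 e a b gap, of ?lo ?hi ?Q \<theta>2])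
        fix i assume i: "i < r"
        have eq: "\<eta>1 * (real n / r) = \<eta> * (real n / r) + \<eta> * (real n / r)" by (simp add: \<eta>_def)
        have "0 \<le> \<eta> * (real n / r)" using \<eta> by simp
        then show "?lo + real ?v \<le> real (N i)" "real (N i) \<le> ?hi"
          using dev[OF i] vn eq unfolding left_diff_distrib distrib_right by linarith+
      next
        show "0 \<le> ?lo" using \<eta>1l by simp
        show "0 < ?Q" using npos r by simp
        show "0 \<le> \<theta>2" using \<theta>2 by simp
        show "(1 - \<theta>2) * ?Q \<le> ?lo ^ (?v - 2)"
          unfolding power_mult_distrib using pow_lo'[of "?v - 2"] by (intro mult_right_mono) auto
        show "?hi ^ (?v - 2) \<le> (1 + \<theta>2) * ?Q"
          unfolding power_mult_distrib using pow_hi[of "?v - 2"] by (intro mult_right_mono) auto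
        show "\<theta>2 * (real r ^ ?k * (real ?v)\<^sup>2) < 1" using \<theta>2(2) by (simp add: A_def)
      qed
      have "N a > 0" using gap by simp
      then have "{v \<in> V. p v = a} \<noteq> {}" by (auto simp: N_def card_gt_0_iff)
      then obtain u where u: "u \<in> V" "p u = a" by auto
      let ?p' = "p(u := b)"
      have p': "\<And>v. v \<in> V \<Longrightarrow> ?p' v < r" using pV b by auto
      have objm_p': "bonbon_objective H1 H2 (mpart V ?p') = wt H2 r n * cliq_sum H2 r (\<lambda>i. real (card {v \<in> V. ?p' v = i}))"
        by (rule objm) (rule p')
      have cards: "card {v \<in> V. ?p' v = i} = (N(a := N a - 1, b := N b + 1)) i" for i
      proof -
        consider "i = a" | "i = b" | "i \<noteq> a" "i \<noteq> b" by auto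
        then show ?thesis
        proof cases
          case 1
          then have "{v \<in> V. ?p' v = i} = {v \<in> V. p v = a} - {u}" using ab by auto
          then show ?thesis using 1 u fV ab by (simp add: N_def)
        next
          case 2
          then have "{v \<in> V. ?p' v = i} = insert u {v \<in> V. p v = b}" using u by auto
          then show ?thesis using 2 u fV ab by (simp add: N_def)
        next
          case 3
          then have "{v \<in> V. ?p' v = i} = {v \<in> V. p v = i}" using u by auto
          then show ?thesis using 3 by (simp add: N_def)
        qed
      qed
      have "mpart V ?p' \<in> n_vertex_graphs (num_verts G)"
        using fin_simple_mpart[OF fV] by (simp add: n_vertex_graphs_def num_verts_def mpart_simps V_def)
      then have "bonbon_objective H1 H2 G \<le> bonbon_objective H1 H2 (mpart V ?p')"
        using min by (simp add: minimizer_def)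
      then have "bonbon_objective H1 H2 (mpart V p) \<le> bonbon_objective H1 H2 (mpart V ?p')" unfolding GV .
      then have "wt H2 r n * cliq_sum H2 r (\<lambda>i. real (N i)) \<le> wt H2 r n * cliq_sum H2 r (\<lambda>i. real ((N(a := N a - 1, b := N b + 1)) i))"
        unfolding objm_p objm_p' cards N_def .
      then show False using lt wpos by simp
    qed
    have "turan_graph r (mpart V p)"
      using bal by (intro turan_graph_mpart[OF fV pV r]) (auto simp: N_def)
    then show "turan_graph r G" unfolding GV .
  qed
qed

section \<open>Minimisers close to a Turan graph\<close>

text \<open>The degree bound may vary with the vertex of F: this is needed when a single vertex of F
  is sent to a place of exceptional degree and its hairs are to profit from it.\<close>

lemma hairy_Phi_lower:
  assumes "hairy F t H" and F: "fin_simple_graph F"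
  shows "\<exists>\<tau>. (\<Sum>u\<in>verts F. \<tau> u) = t \<and>
    (\<forall>(G :: 'v ugraph) \<Phi> d. fin_simple_graph G \<longrightarrow> \<Phi> \<subseteq> emb F G \<longrightarrow>
      (\<forall>u\<in>verts F. 0 \<le> d u) \<longrightarrow> (\<forall>\<phi>\<in>\<Phi>. \<forall>u\<in>verts F. d u \<le> real (deg G (\<phi> u)) - real (num_verts H)) \<longrightarrow>
      real (card \<Phi>) * (\<Prod>u\<in>verts F. d u ^ \<tau> u) \<le> real (card {f \<in> emb H G. restrict f (verts F) \<in> \<Phi>}))"
proof -
  obtain \<tau> where \<tau>: "(\<Sum>u\<in>verts F. \<tau> u) = t"
    and low: "\<And>(G :: 'v ugraph) \<phi> M. fin_simple_graph G \<Longrightarrow> \<phi> \<in> emb F G \<Longrightarrow> num_verts H \<le> M \<Longrightarrow>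
      (\<Prod>u\<in>verts F. (deg G (\<phi> u) - M) ^ \<tau> u) \<le> card {f \<in> emb H G. restrict f (verts F) = \<phi>}"
    using hairy_card_lower[OF assms] by blast
  note H = hairy_graph[OF assms]
  show ?thesis
  proof (intro exI[of _ \<tau>] conjI allI impI)
    fix G :: "'v ugraph" and \<Phi> and d :: "'a \<Rightarrow> real"
    assume G: "fin_simple_graph G" and \<Phi>: "\<Phi> \<subseteq> emb F G" and d0: "\<forall>u\<in>verts F. 0 \<le> d u"
      and d: "\<forall>\<phi>\<in>\<Phi>. \<forall>u\<in>verts F. d u \<le> real (deg G (\<phi> u)) - real (num_verts H)"
    have fin: "finite (verts F)" "finite (verts H)" "finite (verts G)" using F H(1) G by (auto simp: fin_simple_graphD(1))
    have f\<Phi>: "finite \<Phi>" using \<Phi> finite_emb[OF fin(1,3)] by (rule finite_subset)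
    have each: "(\<Prod>u\<in>verts F. d u ^ \<tau> u) \<le> real (card {f \<in> emb H G. restrict f (verts F) = \<phi>})" if \<phi>: "\<phi> \<in> \<Phi>" for \<phi>
    proof -
      have "(\<Prod>u\<in>verts F. d u ^ \<tau> u) \<le> (\<Prod>u\<in>verts F. real (deg G (\<phi> u) - num_verts H) ^ \<tau> u)"
      proof (rule prod_mono)
        fix u assume u: "u \<in> verts F"
        have "d u \<le> real (deg G (\<phi> u)) - real (num_verts H)" using d \<phi> u by auto
        then have "d u \<le> real (deg G (\<phi> u) - num_verts H)" by linarith
        then show "0 \<le> d u ^ \<tau> u \<and> d u ^ \<tau> u \<le> real (deg G (\<phi> u) - num_verts H) ^ \<tau> u"
          using d0 u by (auto intro: power_mono)
      qed
      also have "\<dots> = real (\<Prod>u\<in>verts F. (deg G (\<phi> u) - num_verts H) ^ \<tau> u)" by (simp only: of_nat_prod of_nat_power)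
      also have "\<dots> \<le> real (card {f \<in> emb H G. restrict f (verts F) = \<phi>})"
        using low[OF G _ order_refl] \<phi> \<Phi> by (intro of_nat_mono) auto
      finally show ?thesis .
    qed
    have "real (card \<Phi>) * (\<Prod>u\<in>verts F. d u ^ \<tau> u) = (\<Sum>\<phi>\<in>\<Phi>. \<Prod>u\<in>verts F. d u ^ \<tau> u)" by simp
    also have "\<dots> \<le> (\<Sum>\<phi>\<in>\<Phi>. real (card {f \<in> emb H G. restrict f (verts F) = \<phi>}))" by (rule sum_mono[OF each])
    also have "\<dots> = real (card {f \<in> emb H G. restrict f (verts F) \<in> \<Phi>})"
      unfolding card_restrict_Phi[OF fin(2,3) f\<Phi>] by (simp only: of_nat_sum)
    finally show "real (card \<Phi>) * (\<Prod>u\<in>verts F. d u ^ \<tau> u) \<le> real (card {f \<in> emb H G. restrict f (verts F) \<in> \<Phi>})" .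
  qed (fact \<tau>)
qed

lemma hairy_Phi_lower_const:
  fixes G :: "'v ugraph" and d :: real
  assumes hy: "hairy F t H" and F: "fin_simple_graph F" and G: "fin_simple_graph G" and \<Phi>: "\<Phi> \<subseteq> emb F G" and d0: "0 \<le> d"
    and d: "\<And>\<phi> u. \<phi> \<in> \<Phi> \<Longrightarrow> u \<in> verts F \<Longrightarrow> d \<le> real (deg G (\<phi> u)) - real (num_verts H)"
  shows "real (card \<Phi>) * d ^ t \<le> real (card {f \<in> emb H G. restrict f (verts F) \<in> \<Phi>})"
proof -
  obtain \<tau> where \<tau>: "(\<Sum>u\<in>verts F. \<tau> u) = t"
    and low: "\<And>(G :: 'v ugraph) \<Phi> d. fin_simple_graph G \<Longrightarrow> \<Phi> \<subseteq> emb F G \<Longrightarrow>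
      \<forall>u\<in>verts F. 0 \<le> d u \<Longrightarrow> \<forall>\<phi>\<in>\<Phi>. \<forall>u\<in>verts F. d u \<le> real (deg G (\<phi> u)) - real (num_verts H) \<Longrightarrow>
      real (card \<Phi>) * (\<Prod>u\<in>verts F. d u ^ \<tau> u) \<le> real (card {f \<in> emb H G. restrict f (verts F) \<in> \<Phi>})"
    using hairy_Phi_lower[OF hy F] by blast
  have "(\<Prod>u\<in>verts F. d ^ \<tau> u) = d ^ t" using \<tau> by (simp add: power_sum[symmetric])
  then show ?thesis using low[OF G \<Phi>, of "\<lambda>_. d"] d0 d by auto
qed

text \<open>Coincidences g = h count as bad pairs, so the good choices are injective as well and
  half of all choices are embeddings.\<close>

lemma emb_of_almost_complete:
  fixes G :: "'v ugraph" and \<zeta> :: real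
  assumes F: "fin_simple_graph F" and G: "fin_simple_graph G"
    and S: "\<And>x. x \<in> verts F \<Longrightarrow> S x \<subseteq> verts G" and \<zeta>: "0 \<le> \<zeta>" "(real (num_verts F))\<^sup>2 * \<zeta> \<le> 1 / 2"
    and bad: "\<And>x y. x \<in> verts F \<Longrightarrow> y \<in> verts F \<Longrightarrow> x \<noteq> y \<Longrightarrow>
      real (card {(g, h) \<in> S x \<times> S y. g = h \<or> {x, y} \<in> edges F \<and> {g, h} \<notin> edges G}) \<le> \<zeta> * (real (card (S x)) * real (card (S y)))"
  shows "(\<Prod>x\<in>verts F. real (card (S x))) / 2 \<le> real (card {\<phi> \<in> emb F G. \<forall>x\<in>verts F. \<phi> x \<in> S x})"
proof -
  let ?ok = "\<lambda>x y g h. g \<noteq> h \<and> ({x, y} \<in> edges F \<longrightarrow> {g, h} \<in> edges G)"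
  let ?A = "{f \<in> Pi\<^sub>E (verts F) S. \<forall>x\<in>verts F. \<forall>y\<in>verts F. x \<noteq> y \<longrightarrow> ?ok x y (f x) (f y)}"
  have fin: "finite (verts F)" "finite (verts G)" using F G by (auto simp: fin_simple_graphD(1))
  have fS: "\<And>x. x \<in> verts F \<Longrightarrow> finite (S x)" using S fin finite_subset by blast
  have eq: "{(g, h) \<in> S x \<times> S y. \<not> ?ok x y g h} = {(g, h) \<in> S x \<times> S y. g = h \<or> {x, y} \<in> edges F \<and> {g, h} \<notin> edges G}" for x y
    by auto
  have "(1 - (real (card (verts F)))\<^sup>2 * \<zeta>) * (\<Prod>x\<in>verts F. real (card (S x))) \<le> real (card ?A)"
    by (rule almost_complete_PiE[OF fin(1) fS _ \<zeta>(1)]) (use bad in \<open>simp_all only: eq\<close>)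
  moreover have "1 / 2 * (\<Prod>x\<in>verts F. real (card (S x))) \<le> (1 - (real (card (verts F)))\<^sup>2 * \<zeta>) * (\<Prod>x\<in>verts F. real (card (S x)))"
    using \<zeta> by (intro mult_right_mono prod_nonneg) (auto simp: num_verts_def)
  moreover have "card ?A \<le> card {\<phi> \<in> emb F G. \<forall>x\<in>verts F. \<phi> x \<in> S x}"
  proof (rule card_mono)
    show "finite {\<phi> \<in> emb F G. \<forall>x\<in>verts F. \<phi> x \<in> S x}" using fin by (simp add: finite_emb)
    show "?A \<subseteq> {\<phi> \<in> emb F G. \<forall>x\<in>verts F. \<phi> x \<in> S x}"
    proof
      fix f assume f: "f \<in> ?A"
      then have fS': "\<And>x. x \<in> verts F \<Longrightarrow> f x \<in> S x" and ok: "\<And>x y. x \<in> verts F \<Longrightarrow> y \<in> verts F \<Longrightarrow> x \<noteq> y \<Longrightarrow> ?ok x y (f x) (f y)"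
        by (auto simp: PiE_iff)
      have "f \<in> verts F \<rightarrow>\<^sub>E verts G" using f fS' S by (auto simp: PiE_iff)
      moreover have "inj_on f (verts F)" using ok by (auto simp: inj_on_def)
      moreover have "{f x, f y} \<in> edges G" if "{x, y} \<in> edges F" for x y
        using ok[of x y] fin_simple_graphD(2)[OF F that] that by simp
      ultimately have "f \<in> emb F G" unfolding mem_emb_iff[OF F] by blast
      then show "f \<in> {\<phi> \<in> emb F G. \<forall>x\<in>verts F. \<phi> x \<in> S x}" using fS' by blast
    qed
  qed
  ultimately show ?thesis by linarith
qed

text \<open>A partition with the fewest inside edges. Moving v affects only the pairs at v, so
  minimality compares the neighbours of v in its own part with those in any other part.\<close>

lemma locally_optimal_partition:
  fixes V :: "'v set" and c :: real
  assumes fV: "finite V" and sym: "symp E" and irr: "\<And>x. \<not> E x x"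
    and p0: "\<forall>v\<in>V. p0 v < r" "real (card {(u, w) \<in> V \<times> V. E u w \<and> p0 u = p0 w}) \<le> c"
  shows "\<exists>p. (\<forall>v\<in>V. p v < (r::nat)) \<and> real (card {(u, w) \<in> V \<times> V. E u w \<and> p u = p w}) \<le> c \<and>
    (\<forall>v\<in>V. \<forall>j<r. card {w \<in> V. E v w \<and> p w = p v} \<le> card {w \<in> V. E v w \<and> p w = j})"
proof -
  let ?m = "\<lambda>p. card {(u, w) \<in> V \<times> V. E u w \<and> p u = p w}"
  obtain p where p: "\<forall>v\<in>V. p v < r" and least: "\<And>p'. \<forall>v\<in>V. p' v < r \<Longrightarrow> ?m p \<le> ?m p'"
    using ex_has_least_nat[of "\<lambda>p. \<forall>v\<in>V. p v < r" p0 ?m] p0(1) by blast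
  have symE: "E a b = E b a" for a b using sym by (meson sympD)
  have opt: "card {w \<in> V. E v w \<and> p w = p v} \<le> card {w \<in> V. E v w \<and> p w = j}" if v: "v \<in> V" and j: "j < r" for v j
  proof -
    have count: "?m p' = card {(u, w) \<in> (V - {v}) \<times> (V - {v}). E u w \<and> p' u = p' w} + 2 * card {w \<in> V. E v w \<and> p' w = p' v}" for p' :: "'v \<Rightarrow> nat"
    proof -
      let ?A = "{(u, w) \<in> (V - {v}) \<times> (V - {v}). E u w \<and> p' u = p' w}" and ?N = "{w \<in> V. E v w \<and> p' w = p' v}"
      have nv: "v \<notin> ?N" using irr by auto
      have split: "{(u, w) \<in> V \<times> V. E u w \<and> p' u = p' w} = ?A \<union> ({v} \<times> ?N \<union> ?N \<times> {v})"
        using v symE irr by auto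
      have fA: "finite ?A" by (rule finite_subset[of _ "V \<times> V"]) (use fV in auto)
      have "card ({v} \<times> ?N \<union> ?N \<times> {v}) = card ({v} \<times> ?N) + card (?N \<times> {v})"
        using fV nv by (intro card_Un_disjoint) auto
      moreover have "card (?A \<union> ({v} \<times> ?N \<union> ?N \<times> {v})) = card ?A + card ({v} \<times> ?N \<union> ?N \<times> {v})"
        using fA fV by (intro card_Un_disjoint) auto
      ultimately show ?thesis unfolding split by (simp add: card_cartesian_product)
    qed
    let ?p' = "p(v := j)"
    have "?m p \<le> ?m ?p'" using p j by (intro least) auto
    moreover have "{(u, w) \<in> (V - {v}) \<times> (V - {v}). E u w \<and> ?p' u = ?p' w} = {(u, w) \<in> (V - {v}) \<times> (V - {v}). E u w \<and> p u = p w}" by auto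
    moreover have "{w \<in> V. E v w \<and> ?p' w = ?p' v} = {w \<in> V. E v w \<and> p w = j}" using irr by auto
    ultimately show ?thesis unfolding count[of p] count[of ?p'] by simp
  qed
  have "?m p \<le> ?m p0" using p0(1) by (rule least)
  then have "real (?m p) \<le> c" using p0(2) by linarith
  then show ?thesis using p opt by blast
qed

text \<open>The colouring is a proper one of F - e. It must agree on the ends of e, for otherwise it
  would colour F with r colours.\<close>

lemma critical_coloring:
  assumes F: "fin_simple_graph F" and crit: "critical_edge F e" and chi: "chromatic_number F = r + 1"
  obtains a b c where "e = {a, b}" "a \<in> verts F" "b \<in> verts F" "a \<noteq> b" "{a, b} \<in> edges F" "c a = c b"
    "\<And>x. x \<in> verts F \<Longrightarrow> c x < r" "\<And>x y. {x, y} \<in> edges F \<Longrightarrow> {x, y} \<noteq> {a, b} \<Longrightarrow> c x \<noteq> c y"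
proof -
  have e: "e \<in> edges F" "chromatic_number (delete_edge F e) \<le> r" using crit chi by (auto simp: critical_edge_def)
  obtain a b where ab: "e = {a, b}" "a \<in> verts F" "b \<in> verts F" "a \<noteq> b" using fin_simple_graphD(3)[OF F e(1)] by auto
  have "fin_simple_graph (delete_edge F e)" using F by (auto simp: fin_simple_graph_def delete_edge_def)
  then obtain c where c: "proper_coloring (delete_edge F e) r c"
    using chromatic_number_coloring proper_coloring_mono[OF _ e(2)] by blast
  have cx: "\<And>x. x \<in> verts F \<Longrightarrow> c x < r" using c by (simp add: proper_coloring_def delete_edge_def)
  have cy: "\<And>x y. {x, y} \<in> edges F \<Longrightarrow> {x, y} \<noteq> {a, b} \<Longrightarrow> c x \<noteq> c y"
    using c ab by (simp add: proper_coloring_def delete_edge_def)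
  have "c a = c b"
  proof (rule ccontr)
    assume "c a \<noteq> c b"
    then have "proper_coloring F r c" unfolding proper_coloring_def using cx cy by (metis doubleton_eq_iff)
    from chromatic_number_le[OF this] chi show False by simp
  qed
  then show ?thesis using that ab e cx cy by blast
qed

text \<open>Weight of a copy, times a number of copies of F with k free vertices, times the normal
  number of choices for t hairs: the hair factors cancel, and the f - k fixed vertices leave the
  power of n.\<close>

lemma weight_identity:
  fixes n r c :: real
  assumes "n > 0" "r > 0" "k \<le> f"
  shows "r ^ t / n ^ (f + t) * (1 / 2 * (c * n) ^ k) * (n / r) ^ t = 1 / 2 * c ^ k / n ^ (f - k)"
proof -
  have f: "n ^ f = n ^ (f - k) * n ^ k" using assms by (simp add: power_add[symmetric])
  have "r ^ t / n ^ (f + t) * (1 / 2 * (c * n) ^ k) * (n / r) ^ t = 1 / 2 * c ^ k * n ^ k / n ^ f"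
    using assms by (simp add: power_add power_mult_distrib power_divide)
  also have "\<dots> = 1 / 2 * c ^ k / n ^ (f - k)" unfolding f using assms by simp
  finally show ?thesis .
qed

text \<open>\<open>X\<close> consists of vertices of small codegree, \<open>p\<close> is a partition
  with few inside edges that no move of one vertex improves, and \<open>K / n\<close> is the bound
  that cloning gives on the weight of the copies through a vertex. \<open>\<rho>\<close> measures
  average defects; \<open>\<epsilon>'\<close> is the deviation to be excluded for each single
  codegree.\<close>

locale near_min =
  fixes F1 :: "'a ugraph" and F2 :: "'b ugraph" and H1 :: "'a ugraph" and H2 :: "'b ugraph" and t1 t2 :: nat
    and G :: "nat ugraph" and r s n :: nat and X :: "nat set" and p :: "nat \<Rightarrow> nat" and \<rho> \<epsilon> \<epsilon>' K :: real
  assumes F1: "fin_simple_graph F1" and F2: "fin_simple_graph F2" and e2: "edges F2 \<noteq> {}"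
    and hy1: "hairy F1 t1 H1" and hy2: "hairy F2 t2 H2"
    and r: "r \<ge> 2" and s: "s \<ge> 2"
    and chi1: "chromatic_number H1 = r + 1" and chi2: "chromatic_number H2 = s + 1"
    and min: "minimizer H1 H2 G" and n: "n = num_verts G"
    and thru1: "\<And>v. v \<in> verts G \<Longrightarrow> wt H1 s n * real (card (thru H1 G v)) \<le> K / n"
    and thru2: "\<And>v. v \<in> verts G \<Longrightarrow> wt H2 r n * real (card (thru H2 (complement G) v)) \<le> K / n"
    and X: "X \<subseteq> verts G" and XV: "real (card (verts G - X)) \<le> \<epsilon> * n"
    and Xdeg: "\<And>v. v \<in> X \<Longrightarrow> real (deg (complement G) v) + 1 \<le> (1 + \<epsilon>) * n / r"
    and p: "\<And>v. v \<in> verts G \<Longrightarrow> p v < r"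
    and inside: "real (card {(u, w) \<in> verts G \<times> verts G. {u, w} \<in> edges G \<and> p u = p w}) \<le> \<rho>\<^sup>2 * (real n)\<^sup>2"
    and opt: "\<And>v j. v \<in> verts G \<Longrightarrow> j < r \<Longrightarrow>
      card {w \<in> verts G. {v, w} \<in> edges G \<and> p w = p v} \<le> card {w \<in> verts G. {v, w} \<in> edges G \<and> p w = j}"
    and \<rho>: "0 < \<rho>" "\<epsilon> \<le> \<rho>" "0 \<le> \<epsilon>" "4 * (real r)\<^sup>2 * \<rho> \<le> 1"
    and \<epsilon>': "0 < \<epsilon>'" "\<epsilon>' \<le> 1"
    and nbig: "real (num_verts H1 + num_verts H2 + 2) \<le> \<rho>\<^sup>2 * n"
    and nbig': "4 * real r * real (num_verts H1 + num_verts H2 + 2) \<le> \<epsilon>' * n"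
begin

abbreviation "V \<equiv> verts G"
abbreviation "Gc \<equiv> complement G"
definition "W i = {v \<in> V. p v = i}"
definition "idg v = card {w \<in> V. {v, w} \<in> edges G \<and> p w = p v}"
definition "Good = {v \<in> X. real (idg v) \<le> \<rho> * n}"

section \<open>Part sizes and inside degrees on average\<close>

lemma G: "fin_simple_graph G" and fV: "finite V" and Gc: "fin_simple_graph Gc"
proof -
  show G: "fin_simple_graph G" using min by (simp add: minimizer_def)
  then show "finite V" by (simp add: fin_simple_graphD(1))
  show "fin_simple_graph Gc" by (rule fin_simple_complement[OF G])
qed

lemma nV: "n = card V" by (simp add: n num_verts_def)

lemma \<rho>1: "\<rho> \<le> 1 / 16" "2 * \<rho> \<le> 1 / (2 * (real r)\<^sup>2)" "2 * \<rho> \<le> 1 / r" "2 * real r * \<rho> \<le> 1 / (2 * r)"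
proof -
  have r2: "4 \<le> (real r)\<^sup>2" using r power_mono[of 2 "real r" 2] by simp
  have "4 * 4 * \<rho> \<le> 4 * (real r)\<^sup>2 * \<rho>" using r2 \<rho> by (intro mult_right_mono) auto
  then show "\<rho> \<le> 1 / 16" using \<rho>(4) by linarith
  show "2 * \<rho> \<le> 1 / (2 * (real r)\<^sup>2)" using \<rho>(4) r by (simp add: field_simps)
  show a: "2 * real r * \<rho> \<le> 1 / (2 * r)" using \<rho>(4) r by (simp add: field_simps power2_eq_square)
  have "2 * \<rho> \<le> 2 * real r * \<rho>" using r \<rho> by simp
  also have "\<dots> \<le> 1 / r" using a r by (simp add: field_simps)
  finally show "2 * \<rho> \<le> 1 / r" .
qed

lemma npos: "real n > 0"
proof (rule ccontr)
  assume "\<not> ?thesis"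
  then have "real n = 0" by simp
  then show False using nbig by simp
qed

lemma \<rho>n: "real (num_verts H1 + num_verts H2 + 2) \<le> \<rho> * n" "num_verts H1 \<le> n" "num_verts H2 \<le> n" "1 \<le> \<rho>\<^sup>2 * n"
proof -
  have "\<rho>\<^sup>2 * n \<le> \<rho> * n" using \<rho> \<rho>1 npos by (intro mult_right_mono) (auto simp: power2_eq_square mult_left_le)
  then show a: "real (num_verts H1 + num_verts H2 + 2) \<le> \<rho> * n" using nbig by linarith
  have "\<rho> * n \<le> 1 * real n" using \<rho>1 by (intro mult_right_mono) auto
  then have "real (num_verts H1 + num_verts H2 + 2) \<le> real n" using a by linarith
  then show "num_verts H1 \<le> n" "num_verts H2 \<le> n" by auto
  show "1 \<le> \<rho>\<^sup>2 * n" using nbig by simp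
qed

text \<open>Markov's inequality: the inside degrees sum to at most \<rho>^2 n^2, so at most \<rho> n
  vertices exceed \<rho> n. The vertices outside X account for the other \<rho> n.\<close>

lemma card_not_Good: "real (card (V - Good)) \<le> 2 * \<rho> * n"
proof -
  define B where "B = {v \<in> V. \<rho> * n < real (idg v)}"
  have fB: "finite B" "B \<subseteq> V" using fV by (auto simp: B_def)
  have "(\<Sum>v\<in>V. idg v) = card (Sigma V (\<lambda>u. {w \<in> V. {u, w} \<in> edges G \<and> p w = p u}))"
    unfolding idg_def using fV by simp
  also have "Sigma V (\<lambda>u. {w \<in> V. {u, w} \<in> edges G \<and> p w = p u}) = {(u, w) \<in> V \<times> V. {u, w} \<in> edges G \<and> p u = p w}" by auto
  finally have tot: "(\<Sum>v\<in>V. real (idg v)) \<le> \<rho>\<^sup>2 * (real n)\<^sup>2" using inside by (simp flip: of_nat_sum)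
  have "real (card B) * (\<rho> * n) = (\<Sum>v\<in>B. \<rho> * n)" by simp
  also have "\<dots> \<le> (\<Sum>v\<in>B. real (idg v))" by (intro sum_mono) (auto simp: B_def)
  also have "\<dots> \<le> (\<Sum>v\<in>V. real (idg v))" using fB fV by (intro sum_mono2) auto
  finally have "real (card B) * (\<rho> * n) \<le> (\<rho> * n) * (\<rho> * n)" using tot by (simp add: power2_eq_square mult_ac)
  then have cB: "real (card B) \<le> \<rho> * n" using \<rho> npos by simp
  have "V - Good \<subseteq> (V - X) \<union> B" by (auto simp: Good_def B_def)
  then have "card (V - Good) \<le> card ((V - X) \<union> B)" using fV fB by (intro card_mono) auto
  also have "\<dots> \<le> card (V - X) + card B" by (rule card_Un_le)
  finally have "real (card (V - Good)) \<le> \<epsilon> * n + \<rho> * n" using XV cB by linarith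
  also have "\<epsilon> * n \<le> \<rho> * n" using \<rho> by (intro mult_right_mono) auto
  finally show ?thesis by simp
qed

lemma fW: "finite (W i)" "W i \<subseteq> V" using fV by (auto simp: W_def)

lemma sumW: "(\<Sum>i<r. card (W i)) = n"
proof -
  have "(\<Sum>v\<in>V. 1::nat) = (\<Sum>i<r. \<Sum>v\<in>{v \<in> V. p v = i}. 1)" using p fV by (intro sum.group[symmetric]) auto
  then show ?thesis by (simp add: W_def nV)
qed

lemma codeg_ge: "v \<in> V \<Longrightarrow> real (card (W (p v))) - real (idg v) \<le> real (deg Gc v) + 1"
proof -
  assume v: "v \<in> V"
  have "W (p v) \<subseteq> insert v {w \<in> V. {v, w} \<in> edges Gc} \<union> {w \<in> V. {v, w} \<in> edges G \<and> p w = p v}"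
    using v by (auto simp: W_def complement_simps)
  then have "card (W (p v)) \<le> card (insert v {w \<in> V. {v, w} \<in> edges Gc} \<union> {w \<in> V. {v, w} \<in> edges G \<and> p w = p v})"
    using fV by (intro card_mono) auto
  also have "\<dots> \<le> card (insert v {w \<in> V. {v, w} \<in> edges Gc}) + idg v" unfolding idg_def by (rule card_Un_le)
  also have "\<dots> \<le> deg Gc v + 1 + idg v" unfolding deg_def complement_simps(1) using card_insert_le_m1 fV
    by (simp add: card_insert_if)
  finally show ?thesis by linarith
qed

text \<open>A good vertex is non-adjacent to nearly all of its part, and its codegree is at most (1
  + \<epsilon>) n / r. A part without good vertices is small anyway.\<close>

lemma size_upper: "i < r \<Longrightarrow> real (card (W i)) \<le> n / r + 2 * \<rho> * n"
proof (cases "W i \<inter> Good = {}")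
  case True
  then have "W i \<subseteq> V - Good" using fW by auto
  then have "card (W i) \<le> card (V - Good)" using fV by (intro card_mono) auto
  moreover have "0 \<le> n / r" by simp
  ultimately show ?thesis using card_not_Good by linarith
next
  case False
  then obtain w where w: "w \<in> W i" "w \<in> Good" by auto
  have wV: "w \<in> V" "p w = i" "w \<in> X" "real (idg w) \<le> \<rho> * n" using w by (auto simp: W_def Good_def)
  have "real (card (W i)) \<le> (1 + \<epsilon>) * n / r + \<rho> * n" using codeg_ge[OF wV(1)] Xdeg[OF wV(3)] wV by simp
  also have "(1 + \<epsilon>) * n / r = n / r + \<epsilon> * n / r" by (simp add: distrib_right add_divide_distrib)
  also have "\<epsilon> * n / r \<le> \<rho> * n"
  proof -
    have "\<epsilon> * n / r \<le> \<epsilon> * n / 1" using r \<rho> by (intro divide_left_mono) auto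
    also have "\<dots> \<le> \<rho> * n" using \<rho> by (simp add: mult_right_mono)
    finally show ?thesis .
  qed
  finally show ?thesis by simp
qed

text \<open>The r - 1 other parts cannot exceed n/r by much, so they leave nearly n/r
  vertices.\<close>

lemma size_lower: "i < r \<Longrightarrow> n / r - 2 * real r * \<rho> * n \<le> real (card (W i))"
proof -
  assume i: "i < r"
  have "real n = (\<Sum>j<r. real (card (W j)))" using sumW by (simp flip: of_nat_sum)
  also have "\<dots> = real (card (W i)) + (\<Sum>j\<in>{..<r} - {i}. real (card (W j)))" using i by (intro sum.remove) auto
  also have "(\<Sum>j\<in>{..<r} - {i}. real (card (W j))) \<le> (\<Sum>j\<in>{..<r} - {i}. n / r + 2 * \<rho> * n)"
    by (intro sum_mono size_upper) auto
  also have "\<dots> = (real r - 1) * (n / r + 2 * \<rho> * n)" using i by (simp add: of_nat_diff)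
  finally have "real n \<le> real (card (W i)) + (real r - 1) * (n / r + 2 * \<rho> * n)" by simp
  also have "(real r - 1) * (n / r + 2 * \<rho> * n) = n - n / r + (real r - 1) * (2 * \<rho> * n)" using r by (simp add: field_simps)
  also have "(real r - 1) * (2 * \<rho> * n) \<le> real r * (2 * \<rho> * n)" using \<rho> by (intro mult_right_mono) auto
  finally show ?thesis by simp
qed

lemma size_half: "i < r \<Longrightarrow> n / (2 * r) \<le> real (card (W i))"
proof -
  assume i: "i < r"
  have "2 * real r * \<rho> * n \<le> 1 / (2 * r) * n" using \<rho>1(4) by (intro mult_right_mono) auto
  then have "n / r - n / (2 * r) \<le> real (card (W i))" using size_lower[OF i] by simp
  moreover have "n / r - n / (2 * r) = n / (2 * r)" by (simp add: field_simps)
  ultimately show ?thesis by simp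
qed

lemma inside_equal_pairs:
  assumes "S \<subseteq> V"
  shows "real (card {(g, h) \<in> S \<times> S. g = h \<or> {g, h} \<in> edges G \<and> p g = p h}) \<le> 2 * \<rho>\<^sup>2 * (real n)\<^sup>2"
proof -
  have "{(g, h) \<in> S \<times> S. g = h \<or> {g, h} \<in> edges G \<and> p g = p h}
      \<subseteq> (\<lambda>g. (g, g)) ` V \<union> {(u, w) \<in> V \<times> V. {u, w} \<in> edges G \<and> p u = p w}" (is "?A \<subseteq> ?B \<union> ?C")
    using assms by auto
  moreover have "finite ?B" "finite ?C" using fV by (auto intro: finite_subset[of _ "V \<times> V"])
  ultimately have "card ?A \<le> card (?B \<union> ?C)" by (intro card_mono) auto
  also have "\<dots> \<le> card ?B + card ?C" by (rule card_Un_le)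
  also have "card ?B \<le> n" using card_image_le[OF fV, of "\<lambda>g. (g, g)"] by (simp add: nV)
  finally have "real (card ?A) \<le> real n + \<rho>\<^sup>2 * (real n)\<^sup>2" using inside by linarith
  moreover have "1 * real n \<le> \<rho>\<^sup>2 * n * real n" using \<rho>n(4) by (intro mult_right_mono) auto
  moreover have "\<rho>\<^sup>2 * n * real n = \<rho>\<^sup>2 * (real n)\<^sup>2" by (simp add: power2_eq_square)
  ultimately show ?thesis by linarith
qed

text \<open>A vertex v of larger codegree would serve as the image of a vertex u of F2 with many
  hairs. The rest of F2 is placed on good non-neighbours of v inside one part, where the complement
  is almost complete. The hairs at u gain a factor 1 + \<epsilon>'/2 each, the others lose very
  little, and the weight through v outgrows K / n.\<close>

lemma codeg_bound:
  assumes C2: "(real (num_verts F2))\<^sup>2 * (8 * (real r) ^ 4 * \<rho>\<^sup>2) \<le> 1 / 2"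
    and C3: "1 + \<epsilon>' / 4 \<le> (1 - 4 * (real r)\<^sup>2 * \<rho>) ^ num_verts F2 * (1 + \<epsilon>' / 2)"
    and growth: "\<And>\<tau>. t2 \<le> num_verts F2 * \<tau> \<Longrightarrow> K < 1 / 2 * (1 / (2 * (real r)\<^sup>2)) ^ (num_verts F2 - 1) * (1 + \<epsilon>' / 4) ^ \<tau>"
    and v: "v \<in> V"
  shows "real (deg Gc v) < (1 + \<epsilon>') * n / r"
proof (rule ccontr)
  assume "\<not> ?thesis"
  then have big: "(1 + \<epsilon>') * n / r \<le> real (deg Gc v)" by simp
  let ?f = "num_verts F2" and ?r2 = "(real r)\<^sup>2" and ?e1 = "4 * (real r)\<^sup>2 * \<rho>"
  have rpos: "real r > 0" using r by simp
  have fF: "finite (verts F2)" using F2 by (simp add: fin_simple_graphD(1))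
  have neF: "verts F2 \<noteq> {}" using e2 fin_simple_graphD(3)[OF F2] by blast
  note H2 = hairy_graph[OF hy2 F2]
  define Nb where "Nb = {w \<in> V. {v, w} \<in> edges Gc}"
  \<comment> \<open>Otherwise the codegree of v would be at most r times n / r^2, that is n /
    r.\<close>
  have "\<exists>j<r. n / ?r2 \<le> real (card (Nb \<inter> W j))"
  proof (rule ccontr)
    assume "\<not> ?thesis"
    then have lt: "\<And>j. j < r \<Longrightarrow> real (card (Nb \<inter> W j)) \<le> n / ?r2" by force
    have "(\<Sum>w\<in>Nb. 1::nat) = (\<Sum>j<r. \<Sum>w\<in>{w \<in> Nb. p w = j}. 1)"
      using p fV by (intro sum.group[symmetric]) (auto simp: Nb_def)
    moreover have "{w \<in> Nb. p w = j} = Nb \<inter> W j" for j by (auto simp: Nb_def W_def)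
    ultimately have "card Nb = (\<Sum>j<r. card (Nb \<inter> W j))" by simp
    then have "real (card Nb) = (\<Sum>j<r. real (card (Nb \<inter> W j)))" by (simp only: of_nat_sum)
    also have "\<dots> \<le> (\<Sum>j<r. n / ?r2)" using lt by (intro sum_mono) auto
    also have "\<dots> = n / r" using rpos by (simp add: power2_eq_square)
    finally have "real (deg Gc v) \<le> n / r" by (simp add: Nb_def deg_def complement_simps(1))
    moreover have "n / r < (1 + \<epsilon>') * n / r" using \<epsilon>' npos rpos by (intro divide_strict_right_mono) auto
    ultimately show False using big by linarith
  qed
  then obtain j where j: "j < r" "n / ?r2 \<le> real (card (Nb \<inter> W j))" by blast
  define S0 where "S0 = Nb \<inter> W j \<inter> Good"
  have S0V: "S0 \<subseteq> V" using fW by (auto simp: S0_def)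
  have vS0: "v \<notin> S0" by (auto simp: S0_def Nb_def complement_simps)
  have fS0: "finite S0" using S0V fV by (rule finite_subset)
  have cS0: "n / (2 * ?r2) \<le> real (card S0)"
  proof -
    have "Nb \<inter> W j \<subseteq> S0 \<union> (V - Good)" using fW by (auto simp: S0_def)
    then have "card (Nb \<inter> W j) \<le> card (S0 \<union> (V - Good))" using fS0 fV by (intro card_mono) auto
    also have "\<dots> \<le> card S0 + card (V - Good)" by (rule card_Un_le)
    finally have "n / ?r2 \<le> real (card S0) + 2 * \<rho> * n" using j(2) card_not_Good by linarith
    moreover have "2 * \<rho> * n \<le> 1 / (2 * ?r2) * n" using \<rho>1(2) by (intro mult_right_mono) auto
    moreover have "n / ?r2 - 1 / (2 * ?r2) * n = n / (2 * ?r2)" using rpos by (simp add: field_simps)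
    ultimately show ?thesis by linarith
  qed
  obtain \<tau> where \<tau>: "(\<Sum>u\<in>verts F2. \<tau> u) = t2"
    and low: "\<And>(G :: nat ugraph) \<Phi> d. fin_simple_graph G \<Longrightarrow> \<Phi> \<subseteq> emb F2 G \<Longrightarrow>
      \<forall>u\<in>verts F2. 0 \<le> d u \<Longrightarrow> \<forall>\<phi>\<in>\<Phi>. \<forall>u\<in>verts F2. d u \<le> real (deg G (\<phi> u)) - real (num_verts H2) \<Longrightarrow>
      real (card \<Phi>) * (\<Prod>u\<in>verts F2. d u ^ \<tau> u) \<le> real (card {f \<in> emb H2 G. restrict f (verts F2) \<in> \<Phi>})"
    using hairy_Phi_lower[OF hy2 F2] by blast
  \<comment> \<open>The hairs may be spread arbitrarily over F2; some vertex has at least the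
    average number.\<close>
  have "\<exists>u\<in>verts F2. t2 \<le> ?f * \<tau> u"
  proof (rule ccontr)
    assume "\<not> ?thesis"
    then have "(\<Sum>u\<in>verts F2. ?f * \<tau> u) < (\<Sum>u\<in>verts F2. t2)"
      using fF neF by (intro sum_strict_mono) (auto simp: not_le)
    then show False using \<tau> by (simp add: sum_distrib_left[symmetric] num_verts_def)
  qed
  then obtain u where u: "u \<in> verts F2" "t2 \<le> ?f * \<tau> u" by blast
  have \<tau>u: "\<tau> u \<le> t2" using \<tau> u fF member_le_sum[of u "verts F2" \<tau>] by simp
  \<comment> \<open>All of \<open>S0\<close> is joined to v in the complement, so the edges of F2 at
    u need no attention.\<close>
  define S where "S = (\<lambda>x. if x = u then {v} else S0)"
  define \<Phi> where "\<Phi> = {\<phi> \<in> emb F2 Gc. \<forall>x\<in>verts F2. \<phi> x \<in> S x}"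
  have half: "(\<Prod>x\<in>verts F2. real (card (S x))) / 2 \<le> real (card \<Phi>)"
    unfolding \<Phi>_def
  \<comment> \<open>The value of \<zeta> is the at most 2 \<rho>^2 n^2 bad pairs inside a part,
    relative to the square of the lower bound n / (2 r^2) on the size of \<open>S0\<close>.\<close>
  proof (rule emb_of_almost_complete[OF F2 Gc, where \<zeta> = "8 * (real r) ^ 4 * \<rho>\<^sup>2"])
    fix x assume "x \<in> verts F2"
    then show "S x \<subseteq> verts Gc" using v S0V by (auto simp: S_def complement_simps)
  next
    fix x y assume xy: "x \<in> verts F2" "y \<in> verts F2" "x \<noteq> y"
    let ?bad = "{(g, h) \<in> S x \<times> S y. g = h \<or> {x, y} \<in> edges F2 \<and> {g, h} \<notin> edges Gc}"
    have z0: "0 \<le> 8 * real r ^ 4 * \<rho>\<^sup>2 * (real (card (S x)) * real (card (S y)))" by simp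
    show "real (card ?bad) \<le> 8 * real r ^ 4 * \<rho>\<^sup>2 * (real (card (S x)) * real (card (S y)))"
    proof (cases "x = u \<or> y = u")
      case True
      have "{v, h} \<in> edges Gc" if "h \<in> S0" for h using that by (auto simp: S0_def Nb_def)
      then have "?bad = {}" using True xy vS0 by (auto simp: S_def insert_commute)
      then show ?thesis using z0 by (simp only: card.empty of_nat_0)
    next
      case False
      then have Sx: "S x = S0" "S y = S0" by (auto simp: S_def)
      have "?bad \<subseteq> {(g, h) \<in> S0 \<times> S0. g = h \<or> {g, h} \<in> edges G \<and> p g = p h}"
        unfolding Sx using S0V by (auto simp: complement_simps S0_def W_def)
      moreover have "finite {(g, h) \<in> S0 \<times> S0. g = h \<or> {g, h} \<in> edges G \<and> p g = p h}"
        using fS0 by (auto intro: finite_subset[of _ "S0 \<times> S0"])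
      ultimately have "card ?bad \<le> card {(g, h) \<in> S0 \<times> S0. g = h \<or> {g, h} \<in> edges G \<and> p g = p h}"
        by (intro card_mono)
      then have "real (card ?bad) \<le> 2 * \<rho>\<^sup>2 * (real n)\<^sup>2" using inside_equal_pairs[OF S0V] by linarith
      also have "\<dots> = 8 * real r ^ 4 * \<rho>\<^sup>2 * (n / (2 * ?r2) * (n / (2 * ?r2)))"
        using rpos by (simp add: power2_eq_square power4_eq_xxxx)
      also have "\<dots> \<le> 8 * real r ^ 4 * \<rho>\<^sup>2 * (real (card S0) * real (card S0))"
        using cS0 by (intro mult_left_mono mult_mono) auto
      finally show ?thesis unfolding Sx .
    qed
  qed (use C2 in auto)
  have prodS: "(\<Prod>x\<in>verts F2. real (card (S x))) = real (card S0) ^ (?f - 1)"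
  proof -
    have "(\<Prod>x\<in>verts F2. real (card (S x))) = real (card (S u)) * (\<Prod>x\<in>verts F2 - {u}. real (card (S x)))"
      using u fF by (intro prod.remove) auto
    also have "(\<Prod>x\<in>verts F2 - {u}. real (card (S x))) = (\<Prod>x\<in>verts F2 - {u}. real (card S0))"
      by (rule prod.cong) (auto simp: S_def)
    finally show ?thesis using u fF by (simp add: S_def num_verts_def)
  qed
  have card\<Phi>: "1 / 2 * (1 / (2 * ?r2) * n) ^ (?f - 1) \<le> real (card \<Phi>)"
  proof -
    have "(1 / (2 * ?r2) * n) ^ (?f - 1) \<le> real (card S0) ^ (?f - 1)" using cS0 by (intro power_mono) auto
    then show ?thesis using half prodS by simp
  qed
  \<comment> \<open>Half of the excess \<epsilon>' at v pays for the vertices of H2 already in use.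
    At a good vertex the codegree is nearly the size of its part.\<close>
  define dd where "dd = (\<lambda>x. if x = u then (1 + \<epsilon>' / 2) * (n / r) else (1 - ?e1) * (n / r))"
  have e1: "0 \<le> 1 - ?e1" "1 - ?e1 \<le> 1" using \<rho> by auto
  have dd0: "\<forall>x\<in>verts F2. 0 \<le> dd x" using e1 \<epsilon>' by (auto simp: dd_def)
  have ddd: "\<forall>\<phi>\<in>\<Phi>. \<forall>x\<in>verts F2. dd x \<le> real (deg Gc (\<phi> x)) - real (num_verts H2)"
  proof (intro ballI)
    fix \<phi> x assume \<phi>: "\<phi> \<in> \<Phi>" and x: "x \<in> verts F2"
    then have \<phi>x: "\<phi> x \<in> S x" by (simp add: \<Phi>_def)
    show "dd x \<le> real (deg Gc (\<phi> x)) - real (num_verts H2)"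
    proof (cases "x = u")
      case True
      have "real (num_verts H2) \<le> \<epsilon>' / 2 * (n / r)"
      proof -
        have "2 * real r * real (num_verts H2) \<le> 4 * real r * real (num_verts H1 + num_verts H2 + 2)"
          by (intro mult_mono) auto
        then have "2 * real r * real (num_verts H2) \<le> \<epsilon>' * n" using nbig' by linarith
        then show ?thesis using rpos by (simp add: field_simps)
      qed
      moreover have "(1 + \<epsilon>') * n / r = (1 + \<epsilon>' / 2) * (n / r) + \<epsilon>' / 2 * (n / r)"
        using rpos by (simp add: field_simps)
      moreover have "\<phi> x = v" using \<phi>x True by (simp add: S_def)
      ultimately show ?thesis using True big by (simp add: dd_def)
    next
      case False
      then have g: "\<phi> x \<in> S0" using \<phi>x by (simp add: S_def)
      then have gV: "\<phi> x \<in> V" "p (\<phi> x) = j" "real (idg (\<phi> x)) \<le> \<rho> * n"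
        using S0V by (auto simp: S0_def W_def Good_def)
      have "n / r - 2 * real r * \<rho> * n - \<rho> * n - 1 \<le> real (deg Gc (\<phi> x))"
        using codeg_ge[OF gV(1)] size_lower[OF j(1)] gV by simp
      moreover have "real (num_verts H2) + 1 \<le> \<rho> * n" using \<rho>n(1) by simp
      moreover have "(1 - ?e1) * (n / r) = n / r - 4 * real r * \<rho> * n" using rpos by (simp add: field_simps power2_eq_square)
      moreover have "2 * \<rho> * n \<le> 2 * real r * \<rho> * n" using r \<rho> npos by simp
      ultimately show ?thesis using False by (simp add: dd_def)
    qed
  qed
  have prodd: "(\<Prod>x\<in>verts F2. dd x ^ \<tau> x) = (1 + \<epsilon>' / 2) ^ \<tau> u * (1 - ?e1) ^ (t2 - \<tau> u) * (n / r) ^ t2"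
  proof -
    have "(\<Prod>x\<in>verts F2. dd x ^ \<tau> x) = dd u ^ \<tau> u * (\<Prod>x\<in>verts F2 - {u}. dd x ^ \<tau> x)"
      using u fF by (intro prod.remove) auto
    also have "(\<Prod>x\<in>verts F2 - {u}. dd x ^ \<tau> x) = (\<Prod>x\<in>verts F2 - {u}. ((1 - ?e1) * (n / r)) ^ \<tau> x)"
      by (rule prod.cong) (auto simp: dd_def)
    also have "\<dots> = ((1 - ?e1) * (n / r)) ^ (\<Sum>x\<in>verts F2 - {u}. \<tau> x)" by (rule power_sum[symmetric])
    also have "(\<Sum>x\<in>verts F2 - {u}. \<tau> x) = t2 - \<tau> u" using \<tau> u fF by (simp add: sum.remove)
    also have "dd u ^ \<tau> u * ((1 - ?e1) * (n / r)) ^ (t2 - \<tau> u)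
        = (1 + \<epsilon>' / 2) ^ \<tau> u * (1 - ?e1) ^ (t2 - \<tau> u) * ((n / r) ^ \<tau> u * (n / r) ^ (t2 - \<tau> u))"
      by (simp only: dd_def if_True simp_thms power_mult_distrib mult_ac)
    also have "(n / r) ^ \<tau> u * (n / r) ^ (t2 - \<tau> u) = (n / r) ^ t2" using \<tau>u by (simp add: power_add[symmetric])
    finally show ?thesis .
  qed
  \<comment> \<open>At most f times as many hairs lie elsewhere as at u, so the loss of f ordinary
    hairs is charged to each hair at u. \<open>C3\<close> states that the net gain is still 1 +
    \<epsilon>'/4.\<close>
  have A: "(1 + \<epsilon>' / 4) ^ \<tau> u \<le> (1 + \<epsilon>' / 2) ^ \<tau> u * (1 - ?e1) ^ (t2 - \<tau> u)"
  proof -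
    have "(1 + \<epsilon>' / 4) ^ \<tau> u \<le> ((1 - ?e1) ^ ?f * (1 + \<epsilon>' / 2)) ^ \<tau> u" using C3 \<epsilon>' by (intro power_mono) auto
    also have "\<dots> = (1 + \<epsilon>' / 2) ^ \<tau> u * (1 - ?e1) ^ (?f * \<tau> u)" by (simp add: power_mult_distrib power_mult mult.commute)
    also have "\<dots> \<le> (1 + \<epsilon>' / 2) ^ \<tau> u * (1 - ?e1) ^ (t2 - \<tau> u)"
      using e1 u \<epsilon>' by (intro mult_left_mono power_decreasing) auto
    finally show ?thesis .
  qed
  have sub: "{f \<in> emb H2 Gc. restrict f (verts F2) \<in> \<Phi>} \<subseteq> thru H2 Gc v"
  proof
    fix f assume f: "f \<in> {f \<in> emb H2 Gc. restrict f (verts F2) \<in> \<Phi>}"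
    then have "restrict f (verts F2) u \<in> S u" using u unfolding \<Phi>_def by blast
    then have "f u = v" using u by (simp add: S_def)
    then have "v \<in> f ` verts H2" using u H2(3) by blast
    then show "f \<in> thru H2 Gc v" using f by (simp only: thru_def mem_Collect_eq simp_thms)
  qed
  have "finite (thru H2 Gc v)" using H2(1) Gc by (simp add: thru_def finite_emb fin_simple_graphD(1))
  then have cle: "real (card {f \<in> emb H2 Gc. restrict f (verts F2) \<in> \<Phi>}) \<le> real (card (thru H2 Gc v))"
    by (intro of_nat_mono card_mono sub)
  have "1 / 2 * (1 / (2 * ?r2) * n) ^ (?f - 1) * ((1 + \<epsilon>' / 4) ^ \<tau> u * (n / r) ^ t2) \<le> real (card \<Phi>) * (\<Prod>x\<in>verts F2. dd x ^ \<tau> x)"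
    unfolding prodd using card\<Phi> A \<epsilon>' by (intro mult_mono mult_right_mono) auto
  also have "\<dots> \<le> real (card (thru H2 Gc v))"
    using low[OF Gc _ dd0 ddd] cle by (force simp: \<Phi>_def)
  finally have thr: "1 / 2 * (1 / (2 * ?r2) * n) ^ (?f - 1) * ((1 + \<epsilon>' / 4) ^ \<tau> u * (n / r) ^ t2) \<le> real (card (thru H2 Gc v))" .
  have "real r ^ t2 / real n ^ (?f + t2) * (1 / 2 * (1 / (2 * ?r2) * n) ^ (?f - 1)) * (n / r) ^ t2 * (1 + \<epsilon>' / 4) ^ \<tau> u
      = real r ^ t2 / real n ^ num_verts H2 * (1 / 2 * (1 / (2 * ?r2) * n) ^ (?f - 1) * ((1 + \<epsilon>' / 4) ^ \<tau> u * (n / r) ^ t2))"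
    unfolding H2(2) by (simp only: mult_ac)
  also have "\<dots> \<le> wt H2 r n * real (card (thru H2 Gc v))"
    using wt_lower[OF hy2 F2, of r n] r \<rho>n(3) thr \<epsilon>' wt_nonneg[OF \<rho>n(3)] by (intro mult_mono) auto
  also have "\<dots> \<le> K / n" by (rule thru2[OF v])
  finally have "1 / 2 * (1 / (2 * ?r2)) ^ (?f - 1) / real n ^ (?f - (?f - 1)) * (1 + \<epsilon>' / 4) ^ \<tau> u \<le> K / n"
    unfolding weight_identity[OF npos rpos diff_le_self] .
  moreover have "?f - (?f - 1) = 1" using neF fF by (simp add: num_verts_def Suc_leI card_gt_0_iff)
  ultimately have "1 / 2 * (1 / (2 * ?r2)) ^ (?f - 1) * (1 + \<epsilon>' / 4) ^ \<tau> u / n \<le> K / n" by simp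
  then have "1 / 2 * (1 / (2 * ?r2)) ^ (?f - 1) * (1 + \<epsilon>' / 4) ^ \<tau> u \<le> K"
    using npos unfolding divide_le_cancel by blast
  then show False using growth[OF u(2)] by linarith
qed


end

text \<open>Here \<open>{a, b}\<close> is a critical edge of \<open>F1\<close> and \<open>c\<close> an \<open>r\<close>-colouring that is proper except on \<open>{a, b}\<close>.\<close>

locale near_min_codeg = near_min F1 F2 H1 H2 t1 t2 G r s n X p \<rho> \<epsilon> \<epsilon>' K
  for F1 :: "'a ugraph" and F2 :: "'b ugraph" and H1 H2 t1 t2 G and r s n :: nat and X p and \<rho> \<epsilon> \<epsilon>' K :: real +
  fixes \<eta> :: real and a b :: 'a and c :: "'a \<Rightarrow> nat"
  assumes codeg: "\<And>v. v \<in> verts G \<Longrightarrow> real (deg (complement G) v) < (1 + \<epsilon>') * n / r"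
    and \<eta>: "0 < \<eta>"
    and D1: "(real (num_verts F1))\<^sup>2 * ((\<epsilon>' + 2 * \<rho>\<^sup>2) / \<eta>\<^sup>2) \<le> 1 / 2"
    and D2: "5 / 4 \<le> real s * (1 - 1 / r - \<epsilon>')"
    and growth1: "K < 1 / 2 * \<eta> ^ (num_verts F1 - 1) * (5 / 4) ^ t1"
    and E2: "(real (num_verts F1))\<^sup>2 * (4 * (real r)\<^sup>2 * (\<epsilon>' + 2 * \<rho>\<^sup>2) + 2 * r * (2 * \<epsilon>' + 2 * r * \<rho> + \<eta>)) \<le> 1 / 2"
    and growth3: "4 * ((real (num_verts F2))\<^sup>2 + r * t2) * real r ^ num_verts F2 * (1 + 2 * \<epsilon>') ^ t2
      < 1 / 2 * (1 / (2 * r)) ^ (num_verts F1 - 2) * (5 / 4) ^ t1"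
    and n3: "2 * (real (num_verts H2))\<^sup>2 \<le> real n"
    and ab: "a \<in> verts F1" "b \<in> verts F1" "a \<noteq> b" "{a, b} \<in> edges F1" and cab: "c a = c b"
    and cr: "\<And>x. x \<in> verts F1 \<Longrightarrow> c x < r"
    and cc: "\<And>x y. {x, y} \<in> edges F1 \<Longrightarrow> {x, y} \<noteq> {a, b} \<Longrightarrow> c x \<noteq> c y"
    and t2pos: "t2 \<ge> 1"
begin

text \<open>The density of missing pairs between different parts. It is at least 1/n, so it covers
  the diagonal of V as well.\<close>

definition "\<zeta>1 = \<epsilon>' + 2 * \<rho>\<^sup>2"

lemma \<zeta>1: "\<zeta>1 > 0" "real n \<le> \<zeta>1 * (real n)\<^sup>2"
proof -
  show z: "\<zeta>1 > 0" unfolding \<zeta>1_def using \<epsilon>'(1) by (simp add: add_pos_nonneg)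
  have "\<rho>\<^sup>2 * n \<le> \<zeta>1 * n" unfolding \<zeta>1_def using \<epsilon>' by (intro mult_right_mono) auto
  then have "1 \<le> \<zeta>1 * n" using \<rho>n(4) by linarith
  then have "1 * real n \<le> \<zeta>1 * n * n" using npos by (intro mult_right_mono) auto
  then show "real n \<le> \<zeta>1 * (real n)\<^sup>2" by (simp add: power2_eq_square)
qed

text \<open>The codegrees allow about n^2 / r non-adjacent ordered pairs. The pairs inside parts
  number at least n^2 / r by Cauchy-Schwarz and are almost all non-adjacent, so little is left for
  pairs across parts.\<close>

lemma cross_pairs: "real (card {(u, w) \<in> V \<times> V. p u \<noteq> p w \<and> {u, w} \<notin> edges G}) \<le> \<zeta>1 * (real n)\<^sup>2"
proof -
  let ?N = "{(u, w) \<in> V \<times> V. {u, w} \<notin> edges G}" and ?C = "{(u, w) \<in> V \<times> V. p u \<noteq> p w \<and> {u, w} \<notin> edges G}"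
    and ?I = "{(u, w) \<in> V \<times> V. p u = p w}" and ?J = "{(u, w) \<in> V \<times> V. {u, w} \<in> edges G \<and> p u = p w}"
  have fin: "finite A" if "A \<subseteq> V \<times> V" for A using that fV by (auto intro: finite_subset)
  have rpos: "real r > 0" using r by simp
  have "?N = Sigma V (\<lambda>u. {w \<in> V. {u, w} \<notin> edges G})" by auto
  then have "card ?N = (\<Sum>u\<in>V. card {w \<in> V. {u, w} \<notin> edges G})" using fV by simp
  also have "\<dots> = (\<Sum>u\<in>V. deg Gc u + 1)"
  proof (rule sum.cong[OF refl])
    fix u assume u: "u \<in> V"
    have "{w \<in> V. {u, w} \<notin> edges G} = insert u {w \<in> V. {u, w} \<in> edges Gc}"
      using u fin_simple_graphD(2)[OF G, of u u] by (auto simp: complement_simps)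
    moreover have "u \<notin> {w \<in> V. {u, w} \<in> edges Gc}" by (auto simp: complement_simps)
    ultimately show "card {w \<in> V. {u, w} \<notin> edges G} = deg Gc u + 1" using fV by (simp add: deg_def complement_simps(1))
  qed
  finally have "real (card ?N) = (\<Sum>u\<in>V. real (deg Gc u) + 1)" by (simp only: of_nat_sum of_nat_add of_nat_1)
  also have "\<dots> \<le> (\<Sum>u\<in>V. (1 + \<epsilon>') * n / r + 1)" using codeg by (intro sum_mono) (auto intro: less_imp_le)
  also have "\<dots> = n * ((1 + \<epsilon>') * n / r + 1)" by (simp add: nV)
  finally have N: "real (card ?N) \<le> n * ((1 + \<epsilon>') * n / r + 1)" .
  have I: "(real n)\<^sup>2 / r \<le> real (card ?I)"
  proof -
    have "?I = (\<Union>i<r. W i \<times> W i)" using p by (auto simp: W_def)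
    moreover have "card (\<Union>i<r. W i \<times> W i) = (\<Sum>i<r. card (W i \<times> W i))"
      using fW by (intro card_UN_disjoint) (auto simp: W_def)
    ultimately have "real (card ?I) = (\<Sum>i<r. (real (card (W i)))\<^sup>2)" by (simp add: card_cartesian_product power2_eq_square)
    moreover have "(\<Sum>i<r. real (card (W i)))\<^sup>2 \<le> real (card {..<r}) * (\<Sum>i<r. (real (card (W i)))\<^sup>2)"
      by (rule cauchy_schwarz_card)
    moreover have "(\<Sum>i<r. real (card (W i))) = n" using sumW by (simp flip: of_nat_sum)
    ultimately show ?thesis using rpos by (simp add: divide_le_eq mult.commute)
  qed
  have "?I \<subseteq> (?N - ?C) \<union> ?J" by auto
  then have "card ?I \<le> card ((?N - ?C) \<union> ?J)" by (intro card_mono fin) auto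
  also have "\<dots> \<le> card (?N - ?C) + card ?J" by (rule card_Un_le)
  also have "card (?N - ?C) = card ?N - card ?C" by (intro card_Diff_subset fin) auto
  finally have "card ?I \<le> card ?N - card ?C + card ?J" .
  moreover have "card ?C \<le> card ?N" by (intro card_mono fin) auto
  ultimately have "real (card ?C) \<le> real (card ?N) + real (card ?J) - real (card ?I)" by linarith
  also have "\<dots> \<le> n * ((1 + \<epsilon>') * n / r + 1) + \<rho>\<^sup>2 * (real n)\<^sup>2 - (real n)\<^sup>2 / r" using N I inside by linarith
  also have "\<dots> = \<epsilon>' * (real n)\<^sup>2 / r + n + \<rho>\<^sup>2 * (real n)\<^sup>2"
    using rpos by (simp add: field_simps power2_eq_square)
  also have "\<dots> \<le> \<epsilon>' * (real n)\<^sup>2 + \<rho>\<^sup>2 * (real n)\<^sup>2 + \<rho>\<^sup>2 * (real n)\<^sup>2"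
  proof -
    have "\<epsilon>' * (real n)\<^sup>2 / r \<le> \<epsilon>' * (real n)\<^sup>2 / 1" using r \<epsilon>' by (intro divide_left_mono) auto
    moreover have "1 * real n \<le> \<rho>\<^sup>2 * n * n" using \<rho>n(4) by (intro mult_right_mono) auto
    ultimately show ?thesis by (simp add: power2_eq_square)
  qed
  also have "\<dots> = \<zeta>1 * (real n)\<^sup>2" by (simp add: \<zeta>1_def algebra_simps)
  finally show ?thesis .
qed

lemma card_cross_or_equal:
  assumes "S \<subseteq> W i" "S' \<subseteq> W j" "i \<noteq> j \<or> \<not> adj"
  shows "real (card {(g, h) \<in> S \<times> S'. g = h \<or> adj \<and> {g, h} \<notin> edges G}) \<le> \<zeta>1 * (real n)\<^sup>2"
proof (cases "i \<noteq> j")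
  case True
  have "{(g, h) \<in> S \<times> S'. g = h \<or> adj \<and> {g, h} \<notin> edges G} \<subseteq> {(u, w) \<in> V \<times> V. p u \<noteq> p w \<and> {u, w} \<notin> edges G}"
    using assms True by (auto simp: W_def)
  moreover have "finite {(u, w) \<in> V \<times> V. p u \<noteq> p w \<and> {u, w} \<notin> edges G}" using fV by (auto intro: finite_subset[of _ "V \<times> V"])
  ultimately have "card {(g, h) \<in> S \<times> S'. g = h \<or> adj \<and> {g, h} \<notin> edges G} \<le> card {(u, w) \<in> V \<times> V. p u \<noteq> p w \<and> {u, w} \<notin> edges G}"
    by (intro card_mono)
  then show ?thesis using cross_pairs by linarith
next
  case False
  then have "{(g, h) \<in> S \<times> S'. g = h \<or> adj \<and> {g, h} \<notin> edges G} \<subseteq> (\<lambda>g. (g, g)) ` V"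
    using assms fW(2) by blast
  then have "card {(g, h) \<in> S \<times> S'. g = h \<or> adj \<and> {g, h} \<notin> edges G} \<le> card ((\<lambda>g. (g, g)) ` V)" using fV by (intro card_mono) auto
  also have "\<dots> \<le> n" using card_image_le[OF fV] by (simp add: nV)
  finally show ?thesis using \<zeta>1(2) by linarith
qed

lemma deg_lower:
  assumes "w \<in> V" shows "(1 - 1 / r - \<epsilon>') * n \<le> real (deg G w) - real (num_verts H1)"
proof -
  have rpos: "real r > 0" using r by simp
  have "real (deg G w) = real n - 1 - real (deg Gc w)" using deg_complement[OF G assms] n by linarith
  also have "\<dots> \<ge> real n - 1 - (1 + \<epsilon>') * n / r" using codeg[OF assms] by linarith
  finally have 1: "real n - 1 - (1 + \<epsilon>') * n / r \<le> real (deg G w)" .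
  have 2: "\<epsilon>' * n / r \<le> \<epsilon>' * n / 2" using r \<epsilon>' by (intro divide_left_mono) auto
  have 3: "(1 + \<epsilon>') * n / r = n / r + \<epsilon>' * n / r" by (simp add: distrib_right add_divide_distrib)
  have 4: "2 * (real (num_verts H1) + 1) \<le> \<epsilon>' * n"
  proof -
    have "2 * (real (num_verts H1) + 1) \<le> 4 * real r * real (num_verts H1 + num_verts H2 + 2)"
      using r by (intro mult_mono) auto
    from order_trans[OF this nbig'] show ?thesis .
  qed
  have 5: "(1 - 1 / r - \<epsilon>') * n = n - n / r - \<epsilon>' * n" by (simp add: left_diff_distrib)
  have "N - x - y \<le> d - v" if "N - 1 - (x + z) \<le> d" "z \<le> y / 2" "2 * (v + 1) \<le> y" for N x y z d v :: real
    using that by (smt (verit) field_sum_of_halves)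
  from this[OF 1[unfolded 3] 2 4] show ?thesis unfolding 5 .
qed

text \<open>All degrees are at least (1 - 1/r - \<epsilon>') n, which by \<open>D2\<close> is 5/4 of
  the normal value n/s.\<close>

lemma gpos: "0 \<le> (1 - 1 / r - \<epsilon>') * n" "(5 / 4) ^ t1 * (n / s) ^ t1 \<le> ((1 - 1 / r - \<epsilon>') * n) ^ t1"
proof -
  have spos: "real s > 0" using s by simp
  have "0 < real s * (1 - 1 / r - \<epsilon>')" using D2 by linarith
  then have "0 \<le> 1 - 1 / r - \<epsilon>'" using spos by (simp add: zero_less_mult_iff)
  then show "0 \<le> (1 - 1 / r - \<epsilon>') * n" by simp
  have "(5 / 4) ^ t1 * (n / s) ^ t1 = (5 / 4 * (n / s)) ^ t1" by (simp only: power_mult_distrib)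
  also have "\<dots> \<le> (real s * (1 - 1 / r - \<epsilon>') * (n / s)) ^ t1" using D2 by (intro power_mono mult_right_mono) auto
  also have "real s * (1 - 1 / r - \<epsilon>') * (n / s) = (1 - 1 / r - \<epsilon>') * n" using spos by simp
  finally show "(5 / 4) ^ t1 * (n / s) ^ t1 \<le> ((1 - 1 / r - \<epsilon>') * n) ^ t1" .
qed

text \<open>Every hair of a copy of H1 has 5/4 times the normal number of choices, so any family of
  copies of F1 of the expected order of magnitude is too heavy by (5/4)^t1.\<close>

lemma F1_weight:
  fixes k :: nat and cc :: real
  assumes \<Phi>: "\<Phi> \<subseteq> emb F1 G" and card\<Phi>: "1 / 2 * (cc * n) ^ k \<le> real (card \<Phi>)" and c0: "0 \<le> cc" and k: "k \<le> num_verts F1"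
    and sub: "{f \<in> emb H1 G. restrict f (verts F1) \<in> \<Phi>} \<subseteq> Y" and fY: "finite Y"
  shows "1 / 2 * cc ^ k / n ^ (num_verts F1 - k) * (5 / 4) ^ t1 \<le> wt H1 s n * real (card Y)"
proof -
  let ?f = "num_verts F1"
  have spos: "real s > 0" using s by simp
  note H1 = hairy_graph[OF hy1 F1]
  have "real (card \<Phi>) * ((1 - 1 / r - \<epsilon>') * n) ^ t1 \<le> real (card {f \<in> emb H1 G. restrict f (verts F1) \<in> \<Phi>})"
  proof (rule hairy_Phi_lower_const[OF hy1 F1 G \<Phi> gpos(1)])
    fix \<phi> x assume "\<phi> \<in> \<Phi>" "x \<in> verts F1"
    then have "\<phi> x \<in> V" using \<Phi> unfolding subset_iff mem_emb_iff[OF F1] by auto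
    then show "(1 - 1 / r - \<epsilon>') * n \<le> real (deg G (\<phi> x)) - real (num_verts H1)" by (rule deg_lower)
  qed
  also have "\<dots> \<le> real (card Y)" by (intro of_nat_mono card_mono fY sub)
  finally have 1: "real (card \<Phi>) * ((1 - 1 / r - \<epsilon>') * n) ^ t1 \<le> real (card Y)" .
  have "1 / 2 * (cc * n) ^ k * ((5 / 4) ^ t1 * (n / s) ^ t1) \<le> real (card \<Phi>) * ((1 - 1 / r - \<epsilon>') * n) ^ t1"
    using card\<Phi> gpos(2) c0 by (intro mult_mono) auto
  with 1 have 2: "1 / 2 * (cc * n) ^ k * ((5 / 4) ^ t1 * (n / s) ^ t1) \<le> real (card Y)" by linarith
  have "1 / 2 * cc ^ k / n ^ (?f - k) * (5 / 4) ^ t1 = real s ^ t1 / real n ^ (?f + t1) * (1 / 2 * (cc * n) ^ k) * (n / s) ^ t1 * (5 / 4) ^ t1"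
    using weight_identity[OF npos spos k, of t1 cc] by simp
  also have "\<dots> = real s ^ t1 / real n ^ num_verts H1 * (1 / 2 * (cc * n) ^ k * ((5 / 4) ^ t1 * (n / s) ^ t1))"
    unfolding H1(2) by (simp only: mult_ac)
  also have "\<dots> \<le> wt H1 s n * real (card Y)"
    using wt_lower[OF hy1 F1, of s n] s \<rho>n(2) 2 c0 wt_nonneg[OF \<rho>n(2)] by (intro mult_mono) auto
  finally show ?thesis .
qed

text \<open>By local optimality, many inside neighbours of v mean many neighbours of v in every
  part. Put v at the end b of the critical edge and each other vertex of F1 among the neighbours of
  v in the part given by its colour. The critical edge is then realised at v, all other edges run
  across parts, and the weight through v exceeds K / n.\<close>

lemma idg_small:
  assumes v: "v \<in> V" shows "real (idg v) < \<eta> * n"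
proof (rule ccontr)
  assume "\<not> ?thesis"
  then have big: "\<eta> * n \<le> real (idg v)" by simp
  let ?f = "num_verts F1"
  note H1 = hairy_graph[OF hy1 F1]
  have fF: "finite (verts F1)" using F1 by (simp add: fin_simple_graphD(1))
  define Nv where "Nv = (\<lambda>j. {w \<in> V. {v, w} \<in> edges G \<and> p w = j})"
  have cN: "\<eta> * n \<le> real (card (Nv j))" if "j < r" for j
    using opt[OF v that] big by (simp add: Nv_def idg_def)
  have NW: "Nv j \<subseteq> W j" "finite (Nv j)" for j using fV by (auto simp: Nv_def W_def)
  have vN: "v \<notin> Nv j" for j using fin_simple_graphD(2)[OF G, of v v] by (auto simp: Nv_def)
  define S where "S = (\<lambda>x. if x = b then {v} else Nv (c x))"
  define \<Phi> where "\<Phi> = {\<phi> \<in> emb F1 G. \<forall>x\<in>verts F1. \<phi> x \<in> S x}"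
  have half: "(\<Prod>x\<in>verts F1. real (card (S x))) / 2 \<le> real (card \<Phi>)"
    unfolding \<Phi>_def
  proof (rule emb_of_almost_complete[OF F1 G, where \<zeta> = "\<zeta>1 / \<eta>\<^sup>2"])
    fix x assume "x \<in> verts F1"
    then show "S x \<subseteq> V" using v by (auto simp: S_def Nv_def)
  next
    fix x y assume xy: "x \<in> verts F1" "y \<in> verts F1" "x \<noteq> y"
    let ?bad = "{(g, h) \<in> S x \<times> S y. g = h \<or> {x, y} \<in> edges F1 \<and> {g, h} \<notin> edges G}"
    show "real (card ?bad) \<le> \<zeta>1 / \<eta>\<^sup>2 * (real (card (S x)) * real (card (S y)))"
    proof (cases "x = b \<or> y = b")
      case True
      have "{v, h} \<in> edges G" if "h \<in> Nv j" for h j using that by (auto simp: Nv_def)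
      then have "?bad = {}" using True xy vN by (auto simp: S_def insert_commute)
      then have "real (card ?bad) = 0" by (simp only: card.empty of_nat_0)
      then show ?thesis using \<zeta>1(1) by simp
    next
      case False
      then have Sx: "S x = Nv (c x)" "S y = Nv (c y)" by (auto simp: S_def)
      have "c x \<noteq> c y \<or> {x, y} \<notin> edges F1" using cc[of x y] False by (auto simp: doubleton_eq_iff)
      then have "real (card ?bad) \<le> \<zeta>1 * (real n)\<^sup>2" unfolding Sx by (rule card_cross_or_equal[OF NW(1) NW(1)])
      also have "\<dots> = \<zeta>1 / \<eta>\<^sup>2 * ((\<eta> * n) * (\<eta> * n))" using \<eta> by (simp add: power2_eq_square)
      also have "\<dots> \<le> \<zeta>1 / \<eta>\<^sup>2 * (real (card (S x)) * real (card (S y)))"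
        unfolding Sx using cN cr xy \<zeta>1(1) \<eta> by (intro mult_left_mono mult_mono) auto
      finally show ?thesis .
    qed
  qed (use D1 \<zeta>1(1) in \<open>auto simp: \<zeta>1_def\<close>)
  have "(\<eta> * n) ^ (?f - 1) \<le> (\<Prod>x\<in>verts F1. real (card (S x)))"
  proof -
    have "(\<eta> * n) ^ (?f - 1) = (\<Prod>x\<in>verts F1 - {b}. \<eta> * n)" using ab fF by (simp add: num_verts_def)
    also have "\<dots> \<le> (\<Prod>x\<in>verts F1 - {b}. real (card (S x)))"
      using cN cr \<eta> by (intro prod_mono) (auto simp: S_def)
    also have "\<dots> = (\<Prod>x\<in>verts F1. real (card (S x)))" using ab fF by (subst prod.remove[of "verts F1" b]) (auto simp: S_def)
    finally show ?thesis .
  qed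
  then have card\<Phi>: "1 / 2 * (\<eta> * n) ^ (?f - 1) \<le> real (card \<Phi>)" using half by linarith
  have sub: "{f \<in> emb H1 G. restrict f (verts F1) \<in> \<Phi>} \<subseteq> thru H1 G v"
  proof
    fix f assume f: "f \<in> {f \<in> emb H1 G. restrict f (verts F1) \<in> \<Phi>}"
    then have "restrict f (verts F1) b \<in> S b" using ab unfolding \<Phi>_def by blast
    then have "f b = v" using ab by (simp add: S_def)
    then have "v \<in> f ` verts H1" using ab H1(3) by blast
    then show "f \<in> thru H1 G v" using f by (simp only: thru_def mem_Collect_eq simp_thms)
  qed
  have "finite (thru H1 G v)" using H1(1) G by (simp add: thru_def finite_emb fin_simple_graphD(1))
  then have "1 / 2 * \<eta> ^ (?f - 1) / n ^ (?f - (?f - 1)) * (5 / 4) ^ t1 \<le> wt H1 s n * real (card (thru H1 G v))"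
    using \<eta> by (intro F1_weight[OF _ card\<Phi> _ _ sub]) (auto simp: \<Phi>_def)
  also have "\<dots> \<le> K / n" by (rule thru1[OF v])
  also have "?f - (?f - 1) = 1"
  proof -
    have "?f > 0" using ab fF by (auto simp: num_verts_def card_gt_0_iff)
    then show ?thesis by simp
  qed
  finally have "1 / 2 * \<eta> ^ (?f - 1) * (5 / 4) ^ t1 / n \<le> K / n" by simp
  then have "1 / 2 * \<eta> ^ (?f - 1) * (5 / 4) ^ t1 \<le> K" using npos unfolding divide_le_cancel by blast
  then show False using growth1 by linarith
qed


text \<open>With few inside neighbours, u misses nearly its whole part. That already exhausts the
  codegree allowed by \<open>codeg\<close>.\<close>

lemma nonadjacent_outside:
  assumes u: "u \<in> V" shows "real (card {w \<in> V. p w \<noteq> p u \<and> {u, w} \<notin> edges G}) \<le> (2 * \<epsilon>' + 2 * r * \<rho> + \<eta>) * n"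
proof -
  have rpos: "real r > 0" using r by simp
  let ?O = "{w \<in> V. p w \<noteq> p u \<and> {u, w} \<notin> edges G}" and ?I = "{w \<in> V. {u, w} \<in> edges G \<and> p w = p u}"
  have "W (p u) \<union> ?O \<subseteq> insert u {w \<in> V. {u, w} \<in> edges Gc} \<union> ?I"
    using u by (auto simp: W_def complement_simps)
  then have "card (W (p u) \<union> ?O) \<le> card (insert u {w \<in> V. {u, w} \<in> edges Gc} \<union> ?I)" using fV by (intro card_mono) auto
  also have "\<dots> \<le> card (insert u {w \<in> V. {u, w} \<in> edges Gc}) + idg u" unfolding idg_def by (rule card_Un_le)
  also have "card (insert u {w \<in> V. {u, w} \<in> edges Gc}) \<le> deg Gc u + 1"
    unfolding deg_def complement_simps(1) using fV by (simp add: card_insert_if)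
  finally have "card (W (p u) \<union> ?O) \<le> deg Gc u + 1 + idg u" by simp
  moreover have "card (W (p u) \<union> ?O) = card (W (p u)) + card ?O"
    using fV by (intro card_Un_disjoint) (auto simp: W_def)
  ultimately have "real (card ?O) \<le> real (deg Gc u) + 1 + real (idg u) - real (card (W (p u)))" by linarith
  also have "\<dots> \<le> (1 + \<epsilon>') * n / r + 1 + \<eta> * n - (n / r - 2 * real r * \<rho> * n)"
    using codeg[OF u] idg_small[OF u] size_lower[OF p[OF u]] by linarith
  also have "(1 + \<epsilon>') * n / r = n / r + \<epsilon>' * n / r" by (simp add: distrib_right add_divide_distrib)
  also have "n / r + \<epsilon>' * n / r + 1 + \<eta> * n - (n / r - 2 * real r * \<rho> * n) \<le> \<epsilon>' * n + \<epsilon>' * n + \<eta> * n + 2 * real r * \<rho> * n"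
  proof -
    have "\<epsilon>' * n / r \<le> \<epsilon>' * n / 1" using r \<epsilon>' by (intro divide_left_mono) auto
    moreover have "1 \<le> \<epsilon>' * n"
    proof -
      have "1 * 1 \<le> 4 * real r * real (num_verts H1 + num_verts H2 + 2)" using r by (intro mult_mono) auto
      from order_trans[OF this nbig'] show ?thesis by simp
    qed
    ultimately show ?thesis by linarith
  qed
  finally show ?thesis by (simp add: algebra_simps)
qed

text \<open>The critical edge goes to {u, v}, the other vertices anywhere in the parts of their
  colours. Since u and v are fixed vertices, averages do not suffice for them: this is why codegrees
  and inside degrees had to be bounded at every vertex.\<close>

lemma inside_edge_many:
  assumes uv: "{u, v} \<in> edges G" "p u = p v"
  shows "1 / 2 * (1 / (2 * r)) ^ (num_verts F1 - 2) / (real n)\<^sup>2 * (5 / 4) ^ t1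
    \<le> wt H1 s n * real (card {f \<in> emb H1 G. \<exists>e\<in>edges H1. f ` e = {u, v}})"
proof -
  let ?f = "num_verts F1"
  have rpos: "real r > 0" using r by simp
  have uvV: "u \<in> V" "v \<in> V" "u \<noteq> v" using fin_simple_graphD(2)[OF G uv(1)] by auto
  note H1 = hairy_graph[OF hy1 F1]
  have fF: "finite (verts F1)" using F1 by (simp add: fin_simple_graphD(1))
  have f2: "?f \<ge> 2"
  proof -
    have "card {a, b} \<le> card (verts F1)" using ab fF by (intro card_mono) auto
    then show ?thesis using ab by (simp add: num_verts_def)
  qed
  \<comment> \<open>A renaming of the colours that sends the common colour of a and b to the part of
    u and v.\<close>
  define \<pi> where "\<pi> = swp (c a) (p u)"
  have \<pi>a: "\<pi> (c a) = p u" "\<pi> (c b) = p u" using cab by (auto simp: \<pi>_def swp_def)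
  have \<pi>inj: "\<pi> i \<noteq> \<pi> j" if "i \<noteq> j" for i j using that unfolding \<pi>_def by (metis swp_swp)
  have \<pi>r: "\<pi> (c x) < r" if "x \<in> verts F1" for x
    unfolding \<pi>_def by (intro swp_lt cr ab p uvV that)
  define S where "S = (\<lambda>x. if x = a then {u} else if x = b then {v} else W (\<pi> (c x)))"
  define \<Phi> where "\<Phi> = {\<phi> \<in> emb F1 G. \<forall>x\<in>verts F1. \<phi> x \<in> S x}"
  define \<zeta>2 where "\<zeta>2 = 2 * \<epsilon>' + 2 * r * \<rho> + \<eta>"
  \<comment> \<open>The first summand measures the missing cross pairs against two parts of size n /
    (2r), the second the non-neighbours of u or v against one such part.\<close>
  define \<zeta> where "\<zeta> = 4 * (real r)\<^sup>2 * \<zeta>1 + 2 * r * \<zeta>2"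
  have \<zeta>2: "\<zeta>2 > 0" unfolding \<zeta>2_def using \<epsilon>' \<rho> \<eta> by (intro add_pos_pos add_pos_nonneg) auto
  have \<zeta>0: "0 \<le> \<zeta>" unfolding \<zeta>_def using \<zeta>1(1) \<zeta>2 by (intro add_nonneg_nonneg) auto
  have SW: "S x \<subseteq> W (\<pi> (c x))" for x using uvV uv(2) \<pi>a ab by (auto simp: S_def W_def)
  have one: "real (card {(g, h) \<in> {z} \<times> W j. g = h \<or> A \<and> {g, h} \<notin> edges G}) \<le> \<zeta> * (1 * real (card (W j)))"
    if z: "z \<in> V" "p z = p u" and j: "j < r" "j \<noteq> p u \<or> \<not> A" for z j A
  proof -
    have "real (card {(g, h) \<in> {z} \<times> W j. g = h \<or> A \<and> {g, h} \<notin> edges G}) \<le> \<zeta>2 * n"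
    proof (cases "j = p u")
      case True
      then have "{(g, h) \<in> {z} \<times> W j. g = h \<or> A \<and> {g, h} \<notin> edges G} \<subseteq> {(z, z)}" using j by auto
      then have "card {(g, h) \<in> {z} \<times> W j. g = h \<or> A \<and> {g, h} \<notin> edges G} \<le> card {(z, z)}" by (intro card_mono) auto
      then have "real (card {(g, h) \<in> {z} \<times> W j. g = h \<or> A \<and> {g, h} \<notin> edges G}) \<le> 1" by simp
      also have "1 \<le> 2 * \<epsilon>' * n"
      proof -
        have "1 * 1 \<le> 4 * real r * real (num_verts H1 + num_verts H2 + 2)" using r by (intro mult_mono) auto
        from order_trans[OF this nbig'] show ?thesis by simp
      qed
      also have "\<dots> \<le> \<zeta>2 * n" unfolding \<zeta>2_def using \<eta> \<rho> by (intro mult_right_mono) auto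
      finally show ?thesis .
    next
      case False
      have "{(g, h) \<in> {z} \<times> W j. g = h \<or> A \<and> {g, h} \<notin> edges G} \<subseteq> Pair z ` {w \<in> V. p w \<noteq> p z \<and> {z, w} \<notin> edges G}"
        using False z by (auto simp: W_def)
      then have "card {(g, h) \<in> {z} \<times> W j. g = h \<or> A \<and> {g, h} \<notin> edges G} \<le> card (Pair z ` {w \<in> V. p w \<noteq> p z \<and> {z, w} \<notin> edges G})"
        using fV by (intro card_mono) auto
      also have "\<dots> \<le> card {w \<in> V. p w \<noteq> p z \<and> {z, w} \<notin> edges G}" using fV by (intro card_image_le) auto
      finally show ?thesis using nonadjacent_outside[OF z(1)] unfolding \<zeta>2_def by linarith
    qed
    also have "\<zeta>2 * n = 2 * r * \<zeta>2 * (n / (2 * r))" using rpos by simp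
    also have "\<dots> \<le> 2 * r * \<zeta>2 * real (card (W j))" using size_half[OF j(1)] \<zeta>2 by (intro mult_left_mono) auto
    also have "\<dots> \<le> \<zeta> * real (card (W j))" unfolding \<zeta>_def using \<zeta>1(1) by (intro mult_right_mono) auto
    finally show ?thesis by simp
  qed
  have half: "(\<Prod>x\<in>verts F1. real (card (S x))) / 2 \<le> real (card \<Phi>)"
    unfolding \<Phi>_def
  proof (rule emb_of_almost_complete[OF F1 G _ \<zeta>0])
    fix x assume "x \<in> verts F1"
    then show "S x \<subseteq> V" using SW[of x] fW(2) by blast
  next
    fix x y assume xy: "x \<in> verts F1" "y \<in> verts F1" "x \<noteq> y"
    let ?A = "{x, y} \<in> edges F1"
    let ?bad = "{(g, h) \<in> S x \<times> S y. g = h \<or> ?A \<and> {g, h} \<notin> edges G}"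
    have cxy: "\<pi> (c x) \<noteq> \<pi> (c y) \<or> \<not> ?A" if "{x, y} \<noteq> {a, b}" using cc[of x y] that \<pi>inj by blast
    show "real (card ?bad) \<le> \<zeta> * (real (card (S x)) * real (card (S y)))"
    proof (cases "{x, y} = {a, b}")
      case True
      then have "S x = {u} \<and> S y = {v} \<or> S x = {v} \<and> S y = {u}" using ab by (auto simp: S_def doubleton_eq_iff)
      then have "?bad = {}" using uv(1) uvV by (auto simp: insert_commute)
      then have "real (card ?bad) = 0" by (simp only: card.empty of_nat_0)
      then show ?thesis using \<zeta>0 by simp
    next
      case ne: False
      show ?thesis
      proof (cases "x \<in> {a, b}")
        case True
        then obtain z where z: "S x = {z}" "z \<in> V" "p z = p u" using ab uvV uv(2) by (auto simp: S_def)
        have "y \<notin> {a, b}" using ne True xy by auto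
        then have Sy: "S y = W (\<pi> (c y))" by (auto simp: S_def)
        have "\<pi> (c x) = p u" using True \<pi>a by auto
        then have "\<pi> (c y) \<noteq> p u \<or> \<not> ?A" using cxy[OF ne] by auto
        from one[OF z(2,3) \<pi>r[OF xy(2)] this] show ?thesis unfolding z(1) Sy by simp
      next
        case xn: False
        then have Sx: "S x = W (\<pi> (c x))" by (auto simp: S_def)
        show ?thesis
        proof (cases "y \<in> {a, b}")
          case True
          then obtain z where z: "S y = {z}" "z \<in> V" "p z = p u" using ab uvV uv(2) by (auto simp: S_def)
          have "\<pi> (c y) = p u" using True \<pi>a by auto
          then have A: "\<pi> (c x) \<noteq> p u \<or> \<not> ?A" using cxy[OF ne] by auto
          have "?bad = prod.swap ` {(g, h) \<in> {z} \<times> W (\<pi> (c x)). g = h \<or> ?A \<and> {g, h} \<notin> edges G}"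
            unfolding z(1) Sx by (auto simp: insert_commute image_iff)
          then have "card ?bad \<le> card {(g, h) \<in> {z} \<times> W (\<pi> (c x)). g = h \<or> ?A \<and> {g, h} \<notin> edges G}"
            using fW by (simp only:) (rule card_image_le, auto intro: finite_subset[of _ "{z} \<times> W (\<pi> (c x))"])
          then show ?thesis using one[OF z(2,3) \<pi>r[OF xy(1)] A] unfolding z(1) Sx by simp
        next
          case False
          then have Sy: "S y = W (\<pi> (c y))" by (auto simp: S_def)
          have "real (card ?bad) \<le> \<zeta>1 * (real n)\<^sup>2"
            by (rule card_cross_or_equal[OF SW SW cxy[OF ne]])
          also have "\<dots> = 4 * (real r)\<^sup>2 * \<zeta>1 * (n / (2 * r) * (n / (2 * r)))" using rpos by (simp add: power2_eq_square)
          also have "\<dots> \<le> 4 * (real r)\<^sup>2 * \<zeta>1 * (real (card (S x)) * real (card (S y)))"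
            unfolding Sx Sy using size_half \<pi>r xy \<zeta>1(1) by (intro mult_left_mono mult_mono) auto
          also have "\<dots> \<le> \<zeta> * (real (card (S x)) * real (card (S y)))"
            unfolding \<zeta>_def using \<zeta>2 by (intro mult_right_mono) auto
          finally show ?thesis .
        qed
      qed
    qed
  qed (use E2 in \<open>simp add: \<zeta>_def \<zeta>1_def \<zeta>2_def\<close>)
  have "(1 / (2 * r) * n) ^ (?f - 2) \<le> (\<Prod>x\<in>verts F1. real (card (S x)))"
  proof -
    have "card (verts F1 - {a, b}) = ?f - 2" using ab fF by (simp add: num_verts_def)
    then have "(1 / (2 * r) * n) ^ (?f - 2) = (\<Prod>x\<in>verts F1 - {a, b}. 1 / (2 * r) * n)" by simp
    also have "\<dots> \<le> (\<Prod>x\<in>verts F1 - {a, b}. real (card (S x)))"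
      using size_half \<pi>r by (intro prod_mono) (auto simp: S_def)
    also have "\<dots> = (\<Prod>x\<in>insert a (insert b (verts F1 - {a, b})). real (card (S x)))"
      using ab fF by (simp add: S_def)
    also have "\<dots> = (\<Prod>x\<in>verts F1. real (card (S x)))" by (rule prod.cong) (use ab in auto)
    finally show ?thesis .
  qed
  then have card\<Phi>: "1 / 2 * (1 / (2 * r) * n) ^ (?f - 2) \<le> real (card \<Phi>)" using half by linarith
  let ?Y = "{f \<in> emb H1 G. \<exists>e\<in>edges H1. f ` e = {u, v}}"
  have sub: "{f \<in> emb H1 G. restrict f (verts F1) \<in> \<Phi>} \<subseteq> ?Y"
  proof
    fix f assume f: "f \<in> {f \<in> emb H1 G. restrict f (verts F1) \<in> \<Phi>}"
    then have "restrict f (verts F1) a \<in> S a" "restrict f (verts F1) b \<in> S b" using ab unfolding \<Phi>_def by blast+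
    then have "f ` {a, b} = {u, v}" using ab by (simp add: S_def)
    moreover have "{a, b} \<in> edges H1" using ab H1(4) by auto
    ultimately show "f \<in> ?Y" using f by blast
  qed
  have "finite ?Y" using H1(1) G by (simp add: finite_emb fin_simple_graphD(1))
  then have "1 / 2 * (1 / (2 * r)) ^ (?f - 2) / n ^ (?f - (?f - 2)) * (5 / 4) ^ t1 \<le> wt H1 s n * real (card ?Y)"
    by (intro F1_weight[OF _ card\<Phi> _ _ sub]) (auto simp: \<Phi>_def)
  moreover have "?f - (?f - 2) = 2" using f2 by simp
  ultimately show ?thesis by simp
qed

text \<open>Deleting the edge removes weight of order (5/4)^t1 / n^2 and adds at most a multiple,
  linear in t2, of (1 + 2 \<epsilon>')^t2 / n^2. \<open>growth3\<close> makes the former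
  larger.\<close>

lemma no_inside_edge:
  assumes "{u, v} \<in> edges G" shows "p u \<noteq> p v"
proof
  assume pe: "p u = p v"
  have rpos: "real r > 0" using r by simp
  have uvV: "u \<in> V" "v \<in> V" "u \<noteq> v" using fin_simple_graphD(2)[OF G assms] by auto
  let ?G' = "complement (delete_edge G {u, v})" and ?f = "num_verts F2"
  note H1 = hairy_graph[OF hy1 F1] note H2 = hairy_graph[OF hy2 F2]
  have dG: "fin_simple_graph (delete_edge G {u, v})" using G by (auto simp: fin_simple_graph_def delete_edge_def)
  have G': "fin_simple_graph ?G'" by (rule fin_simple_complement[OF dG])
  have VG': "verts ?G' = V" by (simp add: complement_simps delete_edge_def)
  \<comment> \<open>The deletion raises the codegrees of u and v by 1; this and the rounding are
    absorbed when \<epsilon>' is doubled.\<close>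
  define D where "D = nat \<lceil>(1 + \<epsilon>') * n / r\<rceil> + 1"
  have D0: "(1 + \<epsilon>') * n / r + 1 \<le> real D" unfolding D_def by linarith
  have D1: "real D \<le> (1 + \<epsilon>') * n / r + 2"
  proof -
    have "0 \<le> (1 + \<epsilon>') * n / r" using \<epsilon>' by simp
    then show ?thesis unfolding D_def by linarith
  qed
  have D2: "real D \<le> (1 + 2 * \<epsilon>') * (n / r)"
  proof -
    have "2 * real r \<le> \<epsilon>' * n"
    proof -
      have "2 * real r * 1 \<le> 4 * real r * real (num_verts H1 + num_verts H2 + 2)" by (intro mult_mono) auto
      from order_trans[OF this nbig'] show ?thesis by simp
    qed
    then have "2 \<le> \<epsilon>' * (n / r)" using rpos by (simp add: field_simps)
    moreover have "(1 + 2 * \<epsilon>') * (n / r) = (1 + \<epsilon>') * n / r + \<epsilon>' * (n / r)" using rpos by (simp add: field_simps)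
    ultimately show ?thesis using D1 by linarith
  qed
  have degD: "deg ?G' w \<le> D" if w: "w \<in> verts ?G'" for w
  proof -
    have wV: "w \<in> V" using w VG' by simp
    have "{x \<in> V. {w, x} \<in> edges ?G'} \<subseteq> insert (if w = u then v else u) {x \<in> V. {w, x} \<in> edges Gc}"
      by (auto simp: complement_simps delete_edge_def doubleton_eq_iff)
    then have "card {x \<in> V. {w, x} \<in> edges ?G'} \<le> card (insert (if w = u then v else u) {x \<in> V. {w, x} \<in> edges Gc})"
      using fV by (intro card_mono) auto
    also have "\<dots> \<le> Suc (card {x \<in> V. {w, x} \<in> edges Gc})" using fV by (subst card_insert_if) auto
    finally have "deg ?G' w \<le> deg Gc w + 1" using VG' by (simp add: deg_def complement_simps(1))
    then have "real (deg ?G' w) \<le> real D" using codeg[OF wV] D0 by linarith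
    then show ?thesis by simp
  qed
  have f2: "?f \<ge> 2"
  proof -
    obtain e where "e \<in> edges F2" using e2 by auto
    then obtain x y where "x \<in> verts F2" "y \<in> verts F2" "x \<noteq> y" using fin_simple_graphD(3)[OF F2] by blast
    then have "card {x, y} \<le> card (verts F2)" using F2 by (intro card_mono) (auto simp: fin_simple_graphD(1))
    then show ?thesis using \<open>x \<noteq> y\<close> by (simp add: num_verts_def)
  qed
  have nG': "num_verts ?G' = n" using VG' by (simp add: num_verts_def nV)
  have rD: "real (num_verts ?G') \<le> real r * real D"
  proof -
    have "real r * (n / r) \<le> real r * real D"
    proof (rule mult_left_mono)
      have "1 * real n \<le> (1 + \<epsilon>') * n" using \<epsilon>' by (intro mult_right_mono) auto
      then have "n / r \<le> (1 + \<epsilon>') * n / r" by (intro divide_right_mono) auto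
      then show "n / r \<le> real D" using D0 by linarith
    qed simp
    then show ?thesis using rpos nG' by simp
  qed
  let ?Z = "{f \<in> emb H2 ?G'. \<exists>e\<in>edges H2. f ` e = {u, v}}"
  have "real (card ?Z) \<le> 2 * (?f\<^sup>2 + real r * t2) * real (num_verts ?G') ^ (?f - 2) * real D ^ t2"
    by (rule hairy_card_edge_upper[OF hy2 F2 f2 G' degD rD _ uvV(3)]) simp_all
  also have "\<dots> \<le> 2 * (?f\<^sup>2 + real r * t2) * real n ^ (?f - 2) * ((1 + 2 * \<epsilon>') * (n / r)) ^ t2"
    unfolding nG' using D2 by (intro mult_left_mono power_mono) auto
  finally have Z: "real (card ?Z) \<le> 2 * (?f\<^sup>2 + real r * t2) * real n ^ (?f - 2) * ((1 + 2 * \<epsilon>') * (n / r)) ^ t2" .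
  have "wt H1 (chromatic_number H2 - 1) n * real (card {f \<in> emb H1 G. \<exists>e\<in>edges H1. f ` e = {u, v}})
    \<le> wt H2 (chromatic_number H1 - 1) n * real (card ?Z)"
    by (rule minimizer_delete_edge[OF min H1(1) H2(1) n \<rho>n(2,3) refl refl])
  then have "wt H1 s n * real (card {f \<in> emb H1 G. \<exists>e\<in>edges H1. f ` e = {u, v}}) \<le> wt H2 r n * real (card ?Z)"
    using chi1 chi2 by simp
  also have "\<dots> \<le> (2 * real r ^ num_verts H2 / real n ^ num_verts H2) * (2 * (?f\<^sup>2 + real r * t2) * real n ^ (?f - 2) * ((1 + 2 * \<epsilon>') * (n / r)) ^ t2)"
    using wt_upper[of r H2 n] r n3 npos Z wt_nonneg[OF \<rho>n(3)] by (intro mult_mono) auto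
  also have "\<dots> = 4 * (?f\<^sup>2 + real r * t2) * real r ^ ?f * (1 + 2 * \<epsilon>') ^ t2 / (real n)\<^sup>2"
  proof -
    have nf: "real n ^ ?f = real n ^ (?f - 2) * (real n)\<^sup>2"
      using f2 by (simp only: power_add[symmetric] le_add_diff_inverse2)
    show ?thesis unfolding H2(2) power_add nf power_mult_distrib power_divide using npos rpos by (simp add: field_simps)
  qed
  also have "\<dots> < 1 / 2 * (1 / (2 * r)) ^ (num_verts F1 - 2) * (5 / 4) ^ t1 / (real n)\<^sup>2"
    using growth3 npos by (intro divide_strict_right_mono) (auto simp: algebra_simps)
  finally have "wt H1 s n * real (card {f \<in> emb H1 G. \<exists>e\<in>edges H1. f ` e = {u, v}}) < 1 / 2 * (1 / (2 * r)) ^ (num_verts F1 - 2) * (5 / 4) ^ t1 / (real n)\<^sup>2" .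
  moreover have "1 / 2 * (1 / (2 * r)) ^ (num_verts F1 - 2) * (5 / 4) ^ t1 / (real n)\<^sup>2 = 1 / 2 * (1 / (2 * r)) ^ (num_verts F1 - 2) / (real n)\<^sup>2 * (5 / 4) ^ t1" by simp
  ultimately show False using inside_edge_many[OF assms pe] by linarith
qed

end

context near_min_codeg
begin

text \<open>Neither filling in the cross pairs nor the resulting graph creates a copy of H1, by the
  chromatic number. It remains to see that a missing cross pair {u, w} really carries a copy of H2
  in the complement, so that the comparison is strict: the graph without its last hair fits into the
  part of u, and that hair goes to w.\<close>

lemma G_mpart: "G = mpart V p"
proof -
  note H1 = hairy_graph[OF hy1 F1] note H2 = hairy_graph[OF hy2 F2]
  have sub: "edges G \<subseteq> edges (mpart V p)"
  proof
    fix e assume e: "e \<in> edges G"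
    obtain u w where uw: "e = {u, w}" "u \<in> V" "w \<in> V" using fin_simple_graphD(3)[OF G e] by auto
    then have "p u \<noteq> p w" using no_inside_edge e by simp
    then show "e \<in> edges (mpart V p)" using uw by (simp add: mpart_simps)
  qed
  have adj: "{u, w} \<in> edges G" if uw: "u \<in> V" "w \<in> V" "p u \<noteq> p w" for u w
  proof (rule ccontr)
    assume nadj: "{u, w} \<notin> edges G"
    let ?C = "complement (mpart V p)"
    obtain t H x l where t: "t2 = Suc t" and H2eq: "H2 = Graph (insert l (verts H)) (insert {x, l} (edges H))"
      and hyH: "hairy F2 t H" and x: "x \<in> verts F2" and l: "l \<notin> verts H"
      using hy2 t2pos by (cases rule: hairy.cases) auto
    note H = hairy_graph[OF hyH F2]
    have fH: "finite (verts H)" using H(1) by (simp add: fin_simple_graphD(1))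
    have xH: "x \<in> verts H" using x H(3) by auto
    have uW: "u \<in> W (p u)" using uw by (simp add: W_def)
    have "card (verts H) \<le> card (W (p u))"
    proof -
      have "real (card (verts H)) \<le> real (num_verts H1 + num_verts H2 + 2)"
        using H(2) H2(2) t by (simp add: num_verts_def)
      also have "\<dots> \<le> \<rho> * n" by (rule \<rho>n(1))
      also have "\<dots> \<le> 1 / (2 * r) * n"
      proof (rule mult_right_mono)
        have "\<rho> \<le> 2 * real r * \<rho>" using r \<rho> by simp
        then show "\<rho> \<le> 1 / (2 * r)" using \<rho>1(4) by linarith
      qed simp
      also have "\<dots> \<le> real (card (W (p u)))" using size_half[OF p[OF uw(1)]] by simp
      finally show ?thesis by simp
    qed
    then obtain h where h: "inj_on h (verts H)" "h ` verts H \<subseteq> W (p u)"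
      using inj_on_iff_card_le[OF fH fW(1)] by blast
    \<comment> \<open>An injection into the part, altered so that the base x of the last hair goes
      to u; if u was already an image, the two images are exchanged.\<close>
    define g where "g = (\<lambda>y\<in>verts H. if y = x then u else if h y = u then h x else h y)"
    have gx: "g x = u" using xH by (simp add: g_def)
    have gW: "g y \<in> W (p u)" if "y \<in> verts H" for y using that h(2) uW xH by (auto simp: g_def)
    have ginj: "inj_on g (verts H)"
    proof (rule inj_onI)
      fix y z assume yz: "y \<in> verts H" "z \<in> verts H" "g y = g z"
      then show "y = z" using h(1) xH by (auto simp: g_def inj_on_def split: if_splits)
    qed
    have gE: "g \<in> emb H Gc"
      unfolding mem_emb_iff[OF H(1)]
    proof (intro conjI allI impI)
      show "g \<in> verts H \<rightarrow>\<^sub>E verts Gc"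
      proof (rule PiE_I)
        fix y assume "y \<in> verts H" then show "g y \<in> verts Gc" using gW fW(2) by (auto simp: complement_simps)
      qed (simp add: g_def)
      show "inj_on g (verts H)" by (rule ginj)
      fix y z assume e: "{y, z} \<in> edges H"
      have yz: "y \<in> verts H" "z \<in> verts H" "y \<noteq> z" using fin_simple_graphD(2)[OF H(1) e] by auto
      have "g y \<noteq> g z" using ginj yz by (auto dest: inj_onD)
      moreover have "g y \<in> V" "g z \<in> V" "p (g y) = p (g z)" using gW[OF yz(1)] gW[OF yz(2)] by (auto simp: W_def)
      ultimately show "{g y, g z} \<in> edges Gc" using no_inside_edge by (auto simp: complement_simps)
    qed
    define f where "f = g(l := w)"
    have fE: "f \<in> emb H2 Gc"
    proof -
      have uwc: "{g x, w} \<in> edges Gc" using uw nadj gx by (auto simp: complement_simps)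
      moreover have "w \<notin> g ` verts H" using gW uw by (auto simp: W_def)
      moreover have "w \<in> verts Gc" using uw by (simp add: complement_simps)
      ultimately have "(g, w) \<in> Sigma (emb H Gc) (\<lambda>g. {a \<in> verts Gc. {g x, a} \<in> edges Gc} - g ` verts H)" using gE by blast
      then have "(\<lambda>(g, a). g(l := a)) (g, w) \<in> emb H2 Gc"
        unfolding H2eq using bij_betw_imp_surj_on[OF emb_hair_bij[OF H(1) xH l, of Gc]] by blast
      then show ?thesis by (simp add: f_def)
    qed
    have fnC: "f \<notin> emb H2 ?C"
    proof
      assume "f \<in> emb H2 ?C"
      then have "f ` {x, l} \<in> edges ?C" using H2eq by (auto simp: emb_def)
      moreover have "f ` {x, l} = {u, w}" using gx xH l by (auto simp: f_def)
      ultimately have "{u, w} \<in> edges ?C" by (simp only:)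
      then show False using uw by (simp add: complement_simps mpart_simps)
    qed
    have "emb H2 ?C \<subseteq> emb H2 Gc"
    proof
      fix f' assume "f' \<in> emb H2 ?C"
      moreover have "edges ?C \<subseteq> edges Gc" using sub by (auto simp: complement_def mpart_simps(1))
      ultimately show "f' \<in> emb H2 Gc" by (auto simp: emb_def inj_maps_def complement_simps(1) mpart_simps(1))
    qed
    then have "emb H2 ?C \<subset> emb H2 Gc" using fE fnC by blast
    moreover have "finite (emb H2 Gc)" using H2(1) Gc by (simp add: finite_emb fin_simple_graphD(1))
    ultimately have lt: "card (emb H2 ?C) < card (emb H2 Gc)" by (rule psubset_card_mono[rotated])
    have fm: "fin_simple_graph (mpart V p)" by (rule fin_simple_mpart[OF fV])
    have nm: "num_verts (mpart V p) = n" by (simp add: num_verts_def mpart_simps nV)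
    have "emb H1 (mpart V p) = {}"
      by (rule emb_mpart_empty[OF H1(1), where r = r and p = p]) (auto simp: p chi1 mpart_simps)
    then have om: "bonbon_objective H1 H2 (mpart V p) = wt H2 r n * real (card (emb H2 ?C))"
      using bonbon_objective_wt[OF H1(1) H2(1) fm] nm chi1 by simp
    have oG: "bonbon_objective H1 H2 G = wt H1 s n * real (card (emb H1 G)) + wt H2 r n * real (card (emb H2 Gc))"
      using bonbon_objective_wt[OF H1(1) H2(1) G] n chi1 chi2 by simp
    have "bonbon_objective H1 H2 G \<le> bonbon_objective H1 H2 (mpart V p)"
      using min fm nm n by (simp add: minimizer_def n_vertex_graphs_def)
    moreover have "0 \<le> wt H1 s n * real (card (emb H1 G))" using wt_nonneg[OF \<rho>n(2)] by simp
    ultimately have "wt H2 r n * real (card (emb H2 Gc)) \<le> wt H2 r n * real (card (emb H2 ?C))"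
      using om oG by linarith
    moreover have "wt H2 r n > 0"
      unfolding wt_def using r \<rho>n(3) by (intro divide_pos_pos ff_pos) auto
    ultimately show False using lt by simp
  qed
  have "edges (mpart V p) \<subseteq> edges G"
  proof
    fix e assume "e \<in> edges (mpart V p)"
    then obtain u w where "e = {u, w}" "u \<in> V" "w \<in> V" "p u \<noteq> p w" by (auto simp: mpart_def)
    then show "e \<in> edges G" using adj by simp
  qed
  then have "edges G = edges (mpart V p)" using sub by auto
  moreover have "verts G = verts (mpart V p)" by (simp add: mpart_simps)
  ultimately show ?thesis by (rule ugraph.expand[OF conjI, rotated])
qed

lemma part_sizes: "i < r \<Longrightarrow> num_verts H2 \<le> card {v \<in> V. p v = i}"
proof -
  assume i: "i < r"
  have "real (num_verts H2) \<le> real (num_verts H1 + num_verts H2 + 2)" by simp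
  also have "\<dots> \<le> \<rho> * n" by (rule \<rho>n(1))
  also have "\<dots> \<le> 1 / (2 * r) * n"
  proof (rule mult_right_mono)
    have "\<rho> \<le> 2 * real r * \<rho>" using r \<rho> by simp
    then show "\<rho> \<le> 1 / (2 * r)" using \<rho>1(4) by linarith
  qed simp
  also have "\<dots> \<le> real (card (W i))" using size_half[OF i] by simp
  finally show ?thesis by (simp add: W_def)
qed

end

section \<open>Choice of the constants\<close>

lemma linear_less_exponential:
  fixes a b c x :: real
  assumes "x > 1" "c > 0"
  shows "\<exists>T::nat. \<forall>t\<ge>T. a + b * real t < c * x ^ t"
proof -
  define y where "y = inverse x"
  have y: "\<bar>y\<bar> < 1" using assms by (simp add: y_def inverse_less_1_iff)
  have 1: "(\<lambda>t. real t * y ^ t) \<longlonglongrightarrow> 0" using y by (intro powser_times_n_limit_0) auto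
  have 2: "(\<lambda>t. y ^ t) \<longlonglongrightarrow> 0" using y by (intro LIMSEQ_power_zero) auto
  have "(\<lambda>t. a * y ^ t + b * (real t * y ^ t)) \<longlonglongrightarrow> a * 0 + b * 0" by (intro tendsto_intros 1 2)
  then have "(\<lambda>t. a * y ^ t + b * (real t * y ^ t)) \<longlonglongrightarrow> 0" by simp
  from order_tendstoD(2)[OF this assms(2)] obtain T where T: "\<And>t. t \<ge> T \<Longrightarrow> a * y ^ t + b * (real t * y ^ t) < c"
    by (auto simp: eventually_sequentially)
  have "a + b * real t < c * x ^ t" if "t \<ge> T" for t
  proof -
    have xt: "x ^ t > 0" using assms by simp
    have "y ^ t * x ^ t = 1" using assms by (simp add: y_def power_mult_distrib[symmetric])
    then have "(a * y ^ t + b * (real t * y ^ t)) * x ^ t = a + b * real t" by (simp add: algebra_simps)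
    moreover have "(a * y ^ t + b * (real t * y ^ t)) * x ^ t < c * x ^ t" using T[OF that] xt by simp
    ultimately show ?thesis by simp
  qed
  then show ?thesis by blast
qed

text \<open>\<eta> comes first, then \<epsilon>' small in terms of \<eta>, then \<rho> small in
  terms of \<epsilon>'. At each stage the conditions hold strictly at 0, hence for all small
  positive values. The bound 9/8 is made to fit 5/4 = (10/9) (9/8).\<close>

lemma near_turan_constants:
  fixes r s f1 f2 Q :: nat
  assumes r: "r \<ge> 2" and s: "s \<ge> 2" and rs: "r + s \<ge> 5" and f1: "f1 \<ge> 1"
  obtains \<eta> \<epsilon>' \<rho> :: real where "0 < \<eta>" "0 < \<epsilon>'" "\<epsilon>' \<le> 1" "0 < \<rho>" "\<rho> \<le> 1" "4 * (real r)\<^sup>2 * \<rho> \<le> 1"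
    "(real f2)\<^sup>2 * (8 * (real r) ^ 4 * \<rho>\<^sup>2) \<le> 1 / 2"
    "1 + \<epsilon>' / 4 \<le> (1 - 4 * (real r)\<^sup>2 * \<rho>) ^ f2 * (1 + \<epsilon>' / 2)"
    "(real f1)\<^sup>2 * ((\<epsilon>' + 2 * \<rho>\<^sup>2) / \<eta>\<^sup>2) \<le> 1 / 2"
    "5 / 4 \<le> real s * (1 - 1 / r - \<epsilon>')"
    "(real f1)\<^sup>2 * (4 * (real r)\<^sup>2 * (\<epsilon>' + 2 * \<rho>\<^sup>2) + 2 * r * (2 * \<epsilon>' + 2 * r * \<rho> + \<eta>)) \<le> 1 / 2"
    "(1 + 2 * \<epsilon>') ^ Q \<le> 9 / 8"
proof -
  have rpos: "real r > 0" using r by simp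
  \<comment> \<open>This makes the contribution of \<eta> to the last condition on \<open>f1\<close>
    equal to 1/8, below the permitted 1/2.\<close>
  define \<eta> where "\<eta> = 1 / (16 * real r * (real f1)\<^sup>2)"
  have \<eta>: "\<eta> > 0" using rpos f1 by (simp add: \<eta>_def)
  have \<eta>2: "(real f1)\<^sup>2 * (2 * r * \<eta>) = 1 / 8" using rpos f1 by (simp add: \<eta>_def)
  \<comment> \<open>The extreme cases are r = 2, s = 3 with value 3/2 and r = 3, s = 2 with value
    4/3.\<close>
  have rs43: "5 / 4 < real s * (1 - 1 / r)"
  proof (cases "r = 2")
    case True
    then have "real s \<ge> 3" using rs by simp
    then show ?thesis using True by simp
  next
    case False
    then have "real r \<ge> 3" using r by simp
    then have "2 / 3 \<le> 1 - 1 / real r" by (simp add: field_simps)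
    then have "2 * (2 / 3) \<le> real s * (1 - 1 / r)" using s by (intro mult_mono) auto
    then show ?thesis by linarith
  qed
  \<comment> \<open>\<rho> is not chosen yet. Anticipating 2 \<rho>^2 < \<epsilon>' and 2 r \<rho> <
    \<epsilon>', the conditions are imposed with 2x for \<epsilon>' + 2 \<rho>^2 and 3x for 2
    \<epsilon>' + 2 r \<rho>.\<close>
  have "\<forall>\<^sub>F x in at_right (0::real). 0 < x" by (rule eventually_at_right_less)
  moreover have "\<forall>\<^sub>F x in at_right (0::real). x < 1"
    by (rule order_tendstoD(2)[of "\<lambda>x. x" 0]) (auto intro: tendsto_ident_at)
  moreover have "\<forall>\<^sub>F x in at_right (0::real). (real f1)\<^sup>2 * (2 * x / \<eta>\<^sup>2) < 1 / 2"
    using \<eta> by (intro order_tendstoD(2)[of _ "(real f1)\<^sup>2 * (2 * 0 / \<eta>\<^sup>2)"] tendsto_intros) auto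
  moreover have "\<forall>\<^sub>F x in at_right (0::real). 5 / 4 < real s * (1 - 1 / r - x)"
    using rs43 by (intro order_tendstoD(1)[of _ "real s * (1 - 1 / r - 0)"] tendsto_intros) auto
  moreover have "\<forall>\<^sub>F x in at_right (0::real). (real f1)\<^sup>2 * (4 * (real r)\<^sup>2 * (2 * x) + 2 * r * (3 * x + \<eta>)) < 1 / 2"
    using \<eta>2 by (intro order_tendstoD(2)[of _ "(real f1)\<^sup>2 * (4 * (real r)\<^sup>2 * (2 * 0) + 2 * r * (3 * 0 + \<eta>))"] tendsto_intros) auto
  moreover have "\<forall>\<^sub>F x in at_right (0::real). (1 + 2 * x) ^ Q < 9 / 8"
    by (intro order_tendstoD(2)[of _ "(1 + 2 * 0) ^ Q"] tendsto_intros) auto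
  ultimately have "\<forall>\<^sub>F x in at_right (0::real). 0 < x \<and> x < 1 \<and> (real f1)\<^sup>2 * (2 * x / \<eta>\<^sup>2) < 1 / 2 \<and>
    5 / 4 < real s * (1 - 1 / r - x) \<and> (real f1)\<^sup>2 * (4 * (real r)\<^sup>2 * (2 * x) + 2 * r * (3 * x + \<eta>)) < 1 / 2 \<and> (1 + 2 * x) ^ Q < 9 / 8"
    by eventually_elim auto
  from eventually_happens'[OF trivial_limit_at_right_real this] obtain \<epsilon>' where \<epsilon>': "0 < \<epsilon>'" "\<epsilon>' < 1" "(real f1)\<^sup>2 * (2 * \<epsilon>' / \<eta>\<^sup>2) < 1 / 2" "5 / 4 < real s * (1 - 1 / r - \<epsilon>')"
    "(real f1)\<^sup>2 * (4 * (real r)\<^sup>2 * (2 * \<epsilon>') + 2 * r * (3 * \<epsilon>' + \<eta>)) < 1 / 2" "(1 + 2 * \<epsilon>') ^ Q < 9 / 8"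
    by (elim exE conjE) blast
  have "\<forall>\<^sub>F x in at_right (0::real). 0 < x" by (rule eventually_at_right_less)
  moreover have "\<forall>\<^sub>F x in at_right (0::real). x < 1"
    by (rule order_tendstoD(2)[of "\<lambda>x. x" 0]) (auto intro: tendsto_ident_at)
  moreover have "\<forall>\<^sub>F x in at_right (0::real). 2 * x\<^sup>2 < \<epsilon>'"
    using \<epsilon>' by (intro order_tendstoD(2)[of _ "2 * 0\<^sup>2"] tendsto_intros) auto
  moreover have "\<forall>\<^sub>F x in at_right (0::real). 2 * real r * x < \<epsilon>'"
    using \<epsilon>' by (intro order_tendstoD(2)[of _ "2 * real r * 0"] tendsto_intros) auto
  moreover have "\<forall>\<^sub>F x in at_right (0::real). 4 * (real r)\<^sup>2 * x < 1"
    by (intro order_tendstoD(2)[of _ "4 * (real r)\<^sup>2 * 0"] tendsto_intros) auto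
  moreover have "\<forall>\<^sub>F x in at_right (0::real). (real f2)\<^sup>2 * (8 * (real r) ^ 4 * x\<^sup>2) < 1 / 2"
    by (intro order_tendstoD(2)[of _ "(real f2)\<^sup>2 * (8 * (real r) ^ 4 * 0\<^sup>2)"] tendsto_intros) auto
  moreover have "\<forall>\<^sub>F x in at_right (0::real). 1 + \<epsilon>' / 4 < (1 - 4 * (real r)\<^sup>2 * x) ^ f2 * (1 + \<epsilon>' / 2)"
    using \<epsilon>' by (intro order_tendstoD(1)[of _ "(1 - 4 * (real r)\<^sup>2 * 0) ^ f2 * (1 + \<epsilon>' / 2)"] tendsto_intros) auto
  ultimately have "\<forall>\<^sub>F x in at_right (0::real). 0 < x \<and> x < 1 \<and> 2 * x\<^sup>2 < \<epsilon>' \<and> 2 * real r * x < \<epsilon>' \<and> 4 * (real r)\<^sup>2 * x < 1 \<and>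
    (real f2)\<^sup>2 * (8 * (real r) ^ 4 * x\<^sup>2) < 1 / 2 \<and> 1 + \<epsilon>' / 4 < (1 - 4 * (real r)\<^sup>2 * x) ^ f2 * (1 + \<epsilon>' / 2)"
    by eventually_elim auto
  from eventually_happens'[OF trivial_limit_at_right_real this] obtain \<rho> where \<rho>: "0 < \<rho>" "\<rho> < 1" "2 * \<rho>\<^sup>2 < \<epsilon>'" "2 * real r * \<rho> < \<epsilon>'" "4 * (real r)\<^sup>2 * \<rho> < 1"
    "(real f2)\<^sup>2 * (8 * (real r) ^ 4 * \<rho>\<^sup>2) < 1 / 2" "1 + \<epsilon>' / 4 < (1 - 4 * (real r)\<^sup>2 * \<rho>) ^ f2 * (1 + \<epsilon>' / 2)"
    by (elim exE conjE) blast
  show ?thesis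
  proof (rule that[of \<eta> \<epsilon>' \<rho>])
    have "(real f1)\<^sup>2 * ((\<epsilon>' + 2 * \<rho>\<^sup>2) / \<eta>\<^sup>2) \<le> (real f1)\<^sup>2 * (2 * \<epsilon>' / \<eta>\<^sup>2)"
      using \<rho> by (intro mult_left_mono divide_right_mono) auto
    then show "(real f1)\<^sup>2 * ((\<epsilon>' + 2 * \<rho>\<^sup>2) / \<eta>\<^sup>2) \<le> 1 / 2" using \<epsilon>' by linarith
    have "(real f1)\<^sup>2 * (4 * (real r)\<^sup>2 * (\<epsilon>' + 2 * \<rho>\<^sup>2) + 2 * r * (2 * \<epsilon>' + 2 * r * \<rho> + \<eta>))
        \<le> (real f1)\<^sup>2 * (4 * (real r)\<^sup>2 * (2 * \<epsilon>') + 2 * r * (3 * \<epsilon>' + \<eta>))"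
      using \<rho> by (intro mult_left_mono add_mono) auto
    then show "(real f1)\<^sup>2 * (4 * (real r)\<^sup>2 * (\<epsilon>' + 2 * \<rho>\<^sup>2) + 2 * r * (2 * \<epsilon>' + 2 * r * \<rho> + \<eta>)) \<le> 1 / 2" using \<epsilon>' by linarith
  qed (use \<eta> \<epsilon>' \<rho> in \<open>auto intro: less_imp_le\<close>)
qed

lemma wt_pair_bound:
  assumes "z \<ge> 1" "2 * (real (num_verts H))\<^sup>2 \<le> real n" "num_verts H \<ge> 2" "n > 0"
  shows "wt H z n * ((real (num_verts H))\<^sup>2 * real n ^ (num_verts H - 2)) \<le> 2 * real z ^ num_verts H * (real (num_verts H))\<^sup>2 / (real n)\<^sup>2"
proof -
  have "wt H z n * ((real (num_verts H))\<^sup>2 * real n ^ (num_verts H - 2))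
      \<le> 2 * real z ^ num_verts H / real n ^ num_verts H * ((real (num_verts H))\<^sup>2 * real n ^ (num_verts H - 2))"
    using wt_upper[OF assms(1,2,4)] by (intro mult_right_mono) auto
  also have "real n ^ num_verts H = real n ^ (num_verts H - 2) * (real n)\<^sup>2"
    using assms(3) by (simp only: power_add[symmetric] le_add_diff_inverse2)
  finally show ?thesis using assms(4) by simp
qed

text \<open>The order of the quantifiers matters: \<epsilon> depends only on F1, F2 and q, so it can
  be fed into the degree dichotomy before the hairs are chosen. The number of vertices is bounded
  below last, in terms of H1 and H2.\<close>

lemma near_turan_minimizer:
  fixes F1 :: "'a ugraph" and F2 :: "'b ugraph" and q :: real and r s :: nat
  assumes F1: "fin_simple_graph F1" and F2: "fin_simple_graph F2"
    and crit: "\<exists>e\<in>edges F1. critical_edge F1 e" and e2: "edges F2 \<noteq> {}"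
    and chi1: "chromatic_number F1 = r + 1" and chi2: "chromatic_number F2 = s + 1"
    and r: "r \<ge> 2" and s: "s \<ge> 2" and rs: "r + s \<ge> 5" and q: "0 < q" "q \<le> 1"
  shows "\<exists>\<epsilon>::real. 0 < \<epsilon> \<and> (\<exists>t0. \<forall>t1 t2 H1 H2. t0 \<le> t1 \<longrightarrow> t0 \<le> t2 \<longrightarrow> hairy F1 t1 H1 \<longrightarrow> hairy F2 t2 H2 \<longrightarrow>
    q * real (max (num_verts H1) (num_verts H2)) \<le> real (min (num_verts H1) (num_verts H2)) \<longrightarrow>
    (\<exists>n0. \<forall>G X. n0 \<le> num_verts G \<longrightarrow> minimizer H1 H2 G \<longrightarrow> X \<subseteq> verts G \<longrightarrow>
      real (card (verts G - X)) \<le> \<epsilon> * real (num_verts G) \<longrightarrow>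
      (\<forall>v\<in>X. real (deg (complement G) v) + 1 \<le> (1 + \<epsilon>) * real (num_verts G) / r) \<longrightarrow>
      real (r + 1) * (2 * real r) ^ r * real (kcount (\<lambda>u w. {u, w} \<in> edges G) (r + 1) X) \<le> \<epsilon> * real (num_verts G) ^ (r + 1) \<longrightarrow>
      turan_graph r G))"
proof -
  let ?f1 = "num_verts F1" and ?f2 = "num_verts F2"
  obtain e where e: "critical_edge F1 e" using crit by blast
  obtain a b c where "e = {a, b}" and ab: "a \<in> verts F1" "b \<in> verts F1" "a \<noteq> b" "{a, b} \<in> edges F1" and cab: "c a = c b"
    and cr: "\<And>x. x \<in> verts F1 \<Longrightarrow> c x < r" and cc: "\<And>x y. {x, y} \<in> edges F1 \<Longrightarrow> {x, y} \<noteq> {a, b} \<Longrightarrow> c x \<noteq> c y"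
    by (rule critical_coloring[OF F1 e chi1]) (rule that)
  have f1: "?f1 \<ge> 2"
  proof -
    have "card {a, b} \<le> card (verts F1)" using ab F1 by (intro card_mono) (auto simp: fin_simple_graphD(1))
    then show ?thesis using ab by (simp add: num_verts_def)
  qed
  have f2: "?f2 \<ge> 2"
  proof -
    obtain e where "e \<in> edges F2" using e2 by auto
    then obtain x y where "x \<in> verts F2" "y \<in> verts F2" "x \<noteq> y" using fin_simple_graphD(3)[OF F2] by blast
    then have "card {x, y} \<le> card (verts F2)" using F2 by (intro card_mono) (auto simp: fin_simple_graphD(1))
    then show ?thesis using \<open>x \<noteq> y\<close> by (simp add: num_verts_def)
  qed
  \<comment> \<open>An integer version of 1/q: t2 is at most Q (f1 + t1), so powers with exponent t2
    can be compared with powers with exponent t1.\<close>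
  define Q where "Q = nat \<lceil>1 / q\<rceil>"
  have Q: "1 / q \<le> real Q" unfolding Q_def by linarith
  have f11: "?f1 \<ge> 1" using f1 by simp
  obtain \<eta> \<epsilon>' \<rho> :: real where \<eta>: "0 < \<eta>" and \<epsilon>': "0 < \<epsilon>'" "\<epsilon>' \<le> 1" and \<rho>: "0 < \<rho>" "\<rho> \<le> 1" "4 * (real r)\<^sup>2 * \<rho> \<le> 1"
    and C2: "(real ?f2)\<^sup>2 * (8 * (real r) ^ 4 * \<rho>\<^sup>2) \<le> 1 / 2"
    and C3: "1 + \<epsilon>' / 4 \<le> (1 - 4 * (real r)\<^sup>2 * \<rho>) ^ ?f2 * (1 + \<epsilon>' / 2)"
    and D1: "(real ?f1)\<^sup>2 * ((\<epsilon>' + 2 * \<rho>\<^sup>2) / \<eta>\<^sup>2) \<le> 1 / 2"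
    and D2: "5 / 4 \<le> real s * (1 - 1 / r - \<epsilon>')"
    and E2: "(real ?f1)\<^sup>2 * (4 * (real r)\<^sup>2 * (\<epsilon>' + 2 * \<rho>\<^sup>2) + 2 * r * (2 * \<epsilon>' + 2 * r * \<rho> + \<eta>)) \<le> 1 / 2"
    and E3: "(1 + 2 * \<epsilon>') ^ Q \<le> 9 / 8"
    by (rule near_turan_constants[OF r s rs f11, of ?f2 Q]) (rule that)
  \<comment> \<open>\<open>near_turan_partition\<close> will be used with all three defects equal to
    \<epsilon>, giving inside density \<epsilon> + 6 r \<epsilon> \<le> 7 r \<epsilon> =
    \<rho>^2.\<close>
  define \<epsilon> where "\<epsilon> = \<rho>\<^sup>2 / (7 * r)"
  have rpos: "real r > 0" using r by simp
  have \<epsilon>: "\<epsilon> > 0" "\<epsilon> \<le> \<rho>" "7 * r * \<epsilon> = \<rho>\<^sup>2" "\<epsilon> + \<epsilon> \<le> 1 / (2 * r)"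
  proof -
    show "\<epsilon> > 0" using \<rho> rpos by (simp add: \<epsilon>_def)
    show e7: "7 * r * \<epsilon> = \<rho>\<^sup>2" using rpos by (simp add: \<epsilon>_def)
    have r1: "\<rho>\<^sup>2 \<le> \<rho>" using \<rho> by (simp add: power2_eq_square mult_left_le)
    have "\<epsilon> \<le> 7 * r * \<epsilon>" using r \<open>\<epsilon> > 0\<close> by simp
    then show "\<epsilon> \<le> \<rho>" using e7 r1 by linarith
    have "\<rho>\<^sup>2 \<le> 1" using r1 \<rho> by linarith
    moreover have "4 * r * \<epsilon> \<le> 7 * r * \<epsilon>" using \<open>\<epsilon> > 0\<close> by (intro mult_right_mono) auto
    ultimately have "4 * r * \<epsilon> \<le> 1" using e7 by linarith
    then show "\<epsilon> + \<epsilon> \<le> 1 / (2 * r)" using rpos by (simp add: field_simps)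
  qed
  have c2pos: "0 < 1 / 2 * (1 / (2 * (real r)\<^sup>2)) ^ (?f2 - 1)" using rpos by simp
  have c1pos: "0 < 1 / 2 * \<eta> ^ (?f1 - 1)" using \<eta> by simp
  have c3pos: "0 < 1 / 2 * (1 / (2 * real r)) ^ (?f1 - 2)" using rpos by simp
  have x2: "1 < 1 + \<epsilon>' / 4" and x1: "1 < (5 / 4 :: real)" and x3: "1 < (10 / 9 :: real)" using \<epsilon>' by auto
  obtain T2 where T2: "\<And>\<tau>. \<tau> \<ge> T2 \<Longrightarrow> (2 * real ?f2 / q + 1) + (2 * real ?f2 / q) * real \<tau> < 1 / 2 * (1 / (2 * (real r)\<^sup>2)) ^ (?f2 - 1) * (1 + \<epsilon>' / 4) ^ \<tau>"
    using linear_less_exponential[OF x2 c2pos, of "2 * real ?f2 / q + 1" "2 * real ?f2 / q"] by blast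
  obtain T1 where T1: "\<And>t. t \<ge> T1 \<Longrightarrow> (2 * real ?f1 / q + 1) + (2 / q) * real t < 1 / 2 * \<eta> ^ (?f1 - 1) * (5 / 4) ^ t"
    using linear_less_exponential[OF x1 c1pos, of "2 * real ?f1 / q + 1" "2 / q"] by blast
  define A B where "A = 4 * ((real ?f2)\<^sup>2 + real r * real Q * real ?f1) * real r ^ ?f2 * (9 / 8) ^ ?f1"
    and "B = 4 * (real r * real Q) * real r ^ ?f2 * (9 / 8) ^ ?f1"
  obtain T3 where T3: "\<And>t. t \<ge> T3 \<Longrightarrow> A + B * real t < 1 / 2 * (1 / (2 * real r)) ^ (?f1 - 2) * (10 / 9) ^ t"
    using linear_less_exponential[OF x3 c3pos, of A B] by blast
  \<comment> \<open>The factor f2 in front of T2 is needed since only t2 / f2 hairs are guaranteed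
    at one vertex; the final 1 provides the last hair used in \<open>G_mpart\<close>.\<close>
  define t0 where "t0 = ?f2 * T2 + T1 + T3 + 1"
  show ?thesis
  proof (rule exI[of _ \<epsilon>], rule conjI, rule \<epsilon>(1), rule exI[of _ t0], intro allI impI)
    fix t1 t2 :: nat and H1 :: "'a ugraph" and H2 :: "'b ugraph"
    assume t1: "t0 \<le> t1" and t2: "t0 \<le> t2" and hy1: "hairy F1 t1 H1" and hy2: "hairy F2 t2 H2"
      and qq: "q * real (max (num_verts H1) (num_verts H2)) \<le> real (min (num_verts H1) (num_verts H2))"
    note H1 = hairy_graph[OF hy1 F1] note H2 = hairy_graph[OF hy2 F2]
    let ?v1 = "num_verts H1" and ?v2 = "num_verts H2"
    define m where "m = max ?v1 ?v2"
    \<comment> \<open>The numerator in \<open>minimizer_thru_bound\<close>. By the hypothesis with q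
      it is linear in t1 and also linear in t2.\<close>
    define K where "K = 2 * real m + 1"
    have m1: "real m \<le> (real ?f1 + real t1) / q"
    proof -
      have "q * real m \<le> real ?v1" using qq by (simp add: m_def)
      then show ?thesis using q H1(2) by (simp add: pos_le_divide_eq mult.commute)
    qed
    have m2: "real m \<le> (real ?f2 + real t2) / q"
    proof -
      have "q * real m \<le> real ?v2" using qq by (simp add: m_def)
      then show ?thesis using q H2(2) by (simp add: pos_le_divide_eq mult.commute)
    qed
    have cH1: "chromatic_number H1 = r + 1" using hairy_chromatic[OF hy1 F1] chi1 r by simp
    have cH2: "chromatic_number H2 = s + 1" using hairy_chromatic[OF hy2 F2] chi2 s by simp
    have growth2: "K < 1 / 2 * (1 / (2 * (real r)\<^sup>2)) ^ (?f2 - 1) * (1 + \<epsilon>' / 4) ^ \<tau>" if \<tau>: "t2 \<le> ?f2 * \<tau>" for \<tau>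
    proof -
      have "?f2 * T2 \<le> ?f2 * \<tau>" using t2 \<tau> unfolding t0_def by linarith
      then have "T2 \<le> \<tau>" using f2 by simp
      have "real t2 \<le> real ?f2 * real \<tau>" using \<tau> by (metis of_nat_le_iff of_nat_mult)
      then have "(real ?f2 + real t2) / q \<le> (real ?f2 + real ?f2 * real \<tau>) / q" using q by (intro divide_right_mono) auto
      then have "K \<le> 2 * ((real ?f2 + real ?f2 * real \<tau>) / q) + 1" unfolding K_def using m2 by linarith
      also have "\<dots> = (2 * real ?f2 / q + 1) + (2 * real ?f2 / q) * real \<tau>" by (simp add: add_divide_distrib)
      also have "\<dots> < 1 / 2 * (1 / (2 * (real r)\<^sup>2)) ^ (?f2 - 1) * (1 + \<epsilon>' / 4) ^ \<tau>" by (rule T2[OF \<open>T2 \<le> \<tau>\<close>])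
      finally show ?thesis .
    qed
    have growth1: "K < 1 / 2 * \<eta> ^ (?f1 - 1) * (5 / 4) ^ t1"
    proof -
      have "K \<le> 2 * ((real ?f1 + real t1) / q) + 1" unfolding K_def using m1 by linarith
      also have "\<dots> = (2 * real ?f1 / q + 1) + (2 / q) * real t1" by (simp add: add_divide_distrib)
      also have "\<dots> < 1 / 2 * \<eta> ^ (?f1 - 1) * (5 / 4) ^ t1" using t1 by (intro T1) (simp add: t0_def)
      finally show ?thesis .
    qed
    have growth3: "4 * ((real ?f2)\<^sup>2 + r * t2) * real r ^ ?f2 * (1 + 2 * \<epsilon>') ^ t2 < 1 / 2 * (1 / (2 * r)) ^ (?f1 - 2) * (5 / 4) ^ t1"
    proof -
      have "real t2 \<le> real m" using H2(2) by (simp add: m_def)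
      also have "\<dots> \<le> (real ?f1 + real t1) / q" by (rule m1)
      also have "\<dots> = 1 / q * (real ?f1 + real t1)" by simp
      also have "\<dots> \<le> real Q * (real ?f1 + real t1)" using Q by (intro mult_right_mono) auto
      finally have t2Q: "real t2 \<le> real Q * (real ?f1 + real t1)" .
      then have "real t2 \<le> real (Q * (?f1 + t1))" by simp
      then have t2n: "t2 \<le> Q * (?f1 + t1)" by (simp only: of_nat_le_iff)
      have "(1 + 2 * \<epsilon>') ^ t2 \<le> (1 + 2 * \<epsilon>') ^ (Q * (?f1 + t1))" using \<epsilon>' t2n by (intro power_increasing) auto
      also have "\<dots> = ((1 + 2 * \<epsilon>') ^ Q) ^ (?f1 + t1)" by (rule power_mult)
      also have "\<dots> \<le> (9 / 8) ^ (?f1 + t1)" using E3 \<epsilon>' by (intro power_mono) auto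
      finally have p: "(1 + 2 * \<epsilon>') ^ t2 \<le> (9 / 8) ^ ?f1 * (9 / 8) ^ t1" by (simp add: power_add)
      have "r * t2 = real r * real t2" by simp
      also have "\<dots> \<le> real r * (real Q * (real ?f1 + real t1))" using t2Q by (intro mult_left_mono) auto
      finally have "4 * ((real ?f2)\<^sup>2 + r * t2) * real r ^ ?f2 * (1 + 2 * \<epsilon>') ^ t2
        \<le> 4 * ((real ?f2)\<^sup>2 + real r * (real Q * (real ?f1 + real t1))) * real r ^ ?f2 * ((9 / 8) ^ ?f1 * (9 / 8) ^ t1)"
        using p \<epsilon>' by (intro mult_mono mult_left_mono mult_right_mono add_left_mono) auto
      also have "\<dots> = (A + B * real t1) * (9 / 8) ^ t1" by (simp add: A_def B_def algebra_simps)
      also have "\<dots> < 1 / 2 * (1 / (2 * real r)) ^ (?f1 - 2) * (10 / 9) ^ t1 * (9 / 8) ^ t1"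
        using T3[of t1] t1 by (intro mult_strict_right_mono) (auto simp: t0_def)
      also have "\<dots> = 1 / 2 * (1 / (2 * real r)) ^ (?f1 - 2) * (10 / 9 * (9 / 8)) ^ t1" by (simp only: power_mult_distrib mult.assoc)
      finally show ?thesis by simp
    qed
    have r1: "r \<ge> 1" using r by simp
    obtain nT where nT: "\<And>n. n \<ge> nT \<Longrightarrow> \<exists>T\<in>n_vertex_graphs n. bonbon_objective H1 H2 T \<le> 1 + 1"
      using turan_objective[OF H1(1) H2(1) r1 cH1 zero_less_one] by blast
    have eH2: "edges H2 \<noteq> {}" using H2(4) e2 by auto
    obtain nM where nM: "\<And>G p. num_verts G \<ge> nM \<Longrightarrow> minimizer H1 H2 G \<Longrightarrow> \<forall>v\<in>verts G. p v < r \<Longrightarrow>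
      G = mpart (verts G) p \<Longrightarrow> \<forall>i<r. ?v2 \<le> card {v \<in> verts G. p v = i} \<Longrightarrow> turan_graph r G"
      using multipartite_minimizer_turan[OF H1(1) H2(1) eH2 r1 cH1] by blast
    \<comment> \<open>Lower bounds on n: \<open>k1\<close> for the estimate of falling factorials,
      \<open>k2\<close> for the cloning error, \<open>k3\<close> and \<open>k4\<close> so that the
      vertices of H1 and H2 are negligible against \<rho>^2 n and \<epsilon>' n.\<close>
    define k1 where "k1 = 2 * (real ?v1)\<^sup>2 + 2 * (real ?v2)\<^sup>2"
    define k2 where "k2 = 2 * real s ^ ?v1 * (real ?v1)\<^sup>2 + 2 * real r ^ ?v2 * (real ?v2)\<^sup>2"
    define k3 where "k3 = real (?v1 + ?v2 + 2) / \<rho>\<^sup>2"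
    define k4 where "k4 = 4 * real r * real (?v1 + ?v2 + 2) / \<epsilon>'"
    define n0 where "n0 = nT + nM + nat \<lceil>k1\<rceil> + nat \<lceil>k2\<rceil> + nat \<lceil>k3\<rceil> + nat \<lceil>k4\<rceil>"
    show "\<exists>n0. \<forall>G X. n0 \<le> num_verts G \<longrightarrow> minimizer H1 H2 G \<longrightarrow> X \<subseteq> verts G \<longrightarrow>
      real (card (verts G - X)) \<le> \<epsilon> * real (num_verts G) \<longrightarrow>
      (\<forall>v\<in>X. real (deg (complement G) v) + 1 \<le> (1 + \<epsilon>) * real (num_verts G) / r) \<longrightarrow>
      real (r + 1) * (2 * real r) ^ r * real (kcount (\<lambda>u w. {u, w} \<in> edges G) (r + 1) X) \<le> \<epsilon> * real (num_verts G) ^ (r + 1) \<longrightarrow>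
      turan_graph r G"
    proof (intro exI[of _ n0] allI impI)
      fix G :: "nat ugraph" and X :: "nat set"
      assume n: "n0 \<le> num_verts G" and min: "minimizer H1 H2 G" and X: "X \<subseteq> verts G"
        and XV: "real (card (verts G - X)) \<le> \<epsilon> * real (num_verts G)"
        and Xdeg: "\<forall>v\<in>X. real (deg (complement G) v) + 1 \<le> (1 + \<epsilon>) * real (num_verts G) / r"
        and few: "real (r + 1) * (2 * real r) ^ r * real (kcount (\<lambda>u w. {u, w} \<in> edges G) (r + 1) X) \<le> \<epsilon> * real (num_verts G) ^ (r + 1)"
      define n where "n = num_verts G"
      let ?V = "verts G" and ?E = "\<lambda>u w. {u, w} \<in> edges G"
      have G: "fin_simple_graph G" using min by (simp add: minimizer_def)
      have fV: "finite ?V" using G by (simp add: fin_simple_graphD(1))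
      have nk: "k1 \<le> real n" "k2 \<le> real n" "k3 \<le> real n" "k4 \<le> real n" "nT \<le> n" "nM \<le> n"
      proof -
        have nn: "n0 \<le> n" using n by (simp add: n_def)
        show "nT \<le> n" "nM \<le> n" using nn by (simp_all add: n0_def)
        show "k1 \<le> real n" "k2 \<le> real n" "k3 \<le> real n" "k4 \<le> real n" using nn unfolding n0_def by linarith+
      qed
      have n3: "real (?v1 + ?v2 + 2) \<le> \<rho>\<^sup>2 * n" using nk(3) \<rho> by (simp add: k3_def divide_le_eq mult.commute)
      have n4: "4 * real r * real (?v1 + ?v2 + 2) \<le> \<epsilon>' * n" using nk(4) \<epsilon>' by (simp add: k4_def divide_le_eq mult.commute)
      have npos: "real n > 0"
      proof (rule ccontr)
        assume "\<not> ?thesis"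
        then have "real n = 0" by simp
        then show False using n3 by simp
      qed
      have v1n: "2 * (real ?v1)\<^sup>2 \<le> real n" "2 * (real ?v2)\<^sup>2 \<le> real n"
        using nk(1) zero_le_power2[of "real ?v1"] zero_le_power2[of "real ?v2"] unfolding k1_def by linarith+
      have vn: "?v1 \<le> n" "?v2 \<le> n"
      proof -
        have "\<rho>\<^sup>2 * n \<le> 1 * real n" using \<rho> by (intro mult_right_mono) (auto simp: power_le_one)
        then have "real (?v1 + ?v2 + 2) \<le> real n" using n3 by linarith
        then show "?v1 \<le> n" "?v2 \<le> n" by linarith+
      qed
      have obj: "bonbon_objective H1 H2 G \<le> 2"
      proof -
        obtain T where "T \<in> n_vertex_graphs n" "bonbon_objective H1 H2 T \<le> 1 + 1" using nT[OF nk(5)] by auto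
        then show ?thesis using min by (fastforce simp: minimizer_def n_def)
      qed
      have v2: "?v1 \<ge> 2" "?v2 \<ge> 2" using H1(2) H2(2) f1 f2 by auto
      have w0: "wt H1 s n \<ge> 0" "wt H2 r n \<ge> 0" using vn by (auto simp: wt_nonneg)
      have err: "wt H1 s n * ((real ?v1)\<^sup>2 * real n ^ (?v1 - 2)) + wt H2 r n * ((real ?v2)\<^sup>2 * real n ^ (?v2 - 2)) \<le> 1 / real n"
      proof -
        have "wt H1 s n * ((real ?v1)\<^sup>2 * real n ^ (?v1 - 2)) + wt H2 r n * ((real ?v2)\<^sup>2 * real n ^ (?v2 - 2)) \<le> k2 / (real n)\<^sup>2"
          unfolding k2_def add_divide_distrib using v1n v2 r s npos by (intro add_mono wt_pair_bound) auto
        also have "\<dots> \<le> real n / (real n)\<^sup>2" using nk(2) by (intro divide_right_mono) auto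
        also have "\<dots> = 1 / real n" by (simp add: power2_eq_square)
        finally show ?thesis .
      qed
      have bound: "wt H1 s n * real (card (thru H1 G v)) + wt H2 r n * real (card (thru H2 (complement G) v)) \<le> K / n"
        if "v \<in> ?V" for v
      proof -
        have w: "wt H1 s n = wt H1 (chromatic_number H2 - 1) n" "wt H2 r n = wt H2 (chromatic_number H1 - 1) n"
          using cH1 cH2 by simp_all
        show ?thesis unfolding K_def m_def
          by (rule minimizer_thru_bound[OF min H1(1) H2(1) n_def vn w obj err that])
      qed
      have thru1: "wt H1 s n * real (card (thru H1 G v)) \<le> K / n" if "v \<in> ?V" for v
      proof -
        have "0 \<le> wt H2 r n * real (card (thru H2 (complement G) v))" using w0 by simp
        then show ?thesis using bound[OF that] by linarith
      qed
      have thru2: "wt H2 r n * real (card (thru H2 (complement G) v)) \<le> K / n" if "v \<in> ?V" for v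
      proof -
        have "0 \<le> wt H1 s n * real (card (thru H1 G v))" using w0 by simp
        then show ?thesis using bound[OF that] by linarith
      qed
      have symE: "symp ?E" by (auto simp: symp_def insert_commute)
      have irr: "\<not> ?E x x" for x using fin_simple_graphD(2)[OF G, of x x] by auto
      have XV': "real (card (?V - X)) \<le> \<epsilon> * n" using XV by (simp add: n_def)
      have Xdeg': "real (deg (complement G) v) + 1 \<le> (1 + \<epsilon>) * n / r" if "v \<in> X" for v using Xdeg that by (simp add: n_def)
      have nonadj: "real (card {w \<in> ?V. \<not> ?E v w}) \<le> (1 + \<epsilon>) * n / r" if v: "v \<in> X" for v
      proof -
        have vV: "v \<in> ?V" using v X by auto
        have "{w \<in> ?V. \<not> ?E v w} = insert v {w \<in> ?V. {v, w} \<in> edges (complement G)}"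
          using vV irr by (auto simp: complement_simps)
        moreover have "v \<notin> {w \<in> ?V. {v, w} \<in> edges (complement G)}" by (auto simp: complement_simps)
        ultimately have "card {w \<in> ?V. \<not> ?E v w} = deg (complement G) v + 1" using fV by (simp add: deg_def complement_simps(1))
        then show ?thesis using Xdeg'[OF v] by simp
      qed
      define cst where "cst = real (r + 1) * (2 * real r) ^ r"
      have cst: "cst > 0" using rpos by (simp add: cst_def)
      \<comment> \<open>With \<delta> = \<epsilon> / cst the quantity \<omega> of the partition
        lemma becomes \<epsilon>.\<close>
      have few': "real (kcount ?E (r + 1) X) \<le> \<epsilon> / cst * real n ^ (r + 1)"
        using few cst by (simp add: cst_def n_def field_simps)
      obtain p0 where p0: "\<forall>v\<in>?V. p0 v < r" "real (card {(u, w) \<in> ?V \<times> ?V. ?E u w \<and> p0 u = p0 w})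
          \<le> (real (r + 1) * (2 * real r) ^ r * (\<epsilon> / cst) + 2 * r * (\<epsilon> + \<epsilon> + real (r + 1) * (2 * real r) ^ r * (\<epsilon> / cst))) * (real n)\<^sup>2"
        using near_turan_partition[OF fV X symE _ _ npos XV' _ _ \<epsilon>(4) nonadj, of "\<epsilon> / cst"] r \<epsilon> few'
        by (auto simp: n_def num_verts_def)
      have "real (r + 1) * (2 * real r) ^ r * (\<epsilon> / cst) = \<epsilon>" using cst by (simp add: cst_def)
      then have p0': "real (card {(u, w) \<in> ?V \<times> ?V. ?E u w \<and> p0 u = p0 w}) \<le> (\<epsilon> + 2 * r * (\<epsilon> + \<epsilon> + \<epsilon>)) * (real n)\<^sup>2" using p0(2) by simp
      also have "\<dots> \<le> \<rho>\<^sup>2 * (real n)\<^sup>2"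
      proof (rule mult_right_mono)
        have "\<epsilon> \<le> r * \<epsilon>" using r \<epsilon>(1) by simp
        then show "\<epsilon> + 2 * r * (\<epsilon> + \<epsilon> + \<epsilon>) \<le> \<rho>\<^sup>2" using \<epsilon>(3) by (simp add: algebra_simps)
      qed simp
      finally obtain p where p: "\<forall>v\<in>?V. p v < r" "real (card {(u, w) \<in> ?V \<times> ?V. ?E u w \<and> p u = p w}) \<le> \<rho>\<^sup>2 * (real n)\<^sup>2"
        "\<forall>v\<in>?V. \<forall>j<r. card {w \<in> ?V. ?E v w \<and> p w = p v} \<le> card {w \<in> ?V. ?E v w \<and> p w = j}"
        using locally_optimal_partition[OF fV symE irr p0(1)] by blast
      interpret near_min F1 F2 H1 H2 t1 t2 G r s n X p \<rho> \<epsilon> \<epsilon>' K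
        by unfold_locales (use F1 F2 e2 hy1 hy2 r s cH1 cH2 min thru1 thru2 X XV' Xdeg' p \<rho> \<epsilon> \<epsilon>' n3 n4 in \<open>auto simp: n_def\<close>)
      interpret near_min_codeg F1 F2 H1 H2 t1 t2 G r s n X p \<rho> \<epsilon> \<epsilon>' K \<eta> a b c
        by unfold_locales (use codeg_bound[OF C2 C3 growth2] \<eta> D1 D2 growth1 E2 growth3 v1n(2) ab cab cr cc t2 in \<open>auto simp: t0_def\<close>)
      show "turan_graph r G"
      proof (rule nM[of G p])
        show "nM \<le> num_verts G" using nk(6) by (simp add: n_def)
        show "minimizer H1 H2 G" by (rule min)
        show "\<forall>v\<in>verts G. p v < r" using p by blast
        show "G = mpart (verts G) p" by (rule G_mpart)
        show "\<forall>i<r. ?v2 \<le> card {v \<in> verts G. p v = i}" using part_sizes by blast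
      qed
    qed
  qed
qed

section \<open>The two degree regimes\<close>

text \<open>Each copy of F on X extends to at least ((1 + \<epsilon>/2) n/s)^t copies of H, the
  other half of \<epsilon> paying for vertices already used. The total weight is at most 2.\<close>

lemma few_embeddings:
  fixes G :: "nat ugraph" and \<epsilon> :: real
  assumes hy: "hairy F t H" and F: "fin_simple_graph F" and G: "fin_simple_graph G" and n: "n = num_verts G" "n > 0"
    and s: "s \<ge> 1" and obj: "wt H s n * real (card (emb H G)) \<le> 2" and \<epsilon>: "\<epsilon> > 0"
    and deg: "\<And>v. v \<in> X \<Longrightarrow> (1 + \<epsilon>) * n / s \<le> real (deg G v)"
    and nbig: "num_verts H \<le> n" "2 * real s * real (num_verts H) \<le> \<epsilon> * n"
  shows "real (card {\<phi> \<in> emb F G. \<phi> ` verts F \<subseteq> X}) / real n ^ num_verts F \<le> 2 / (1 + \<epsilon> / 2) ^ t"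
proof -
  let ?\<Phi> = "{\<phi> \<in> emb F G. \<phi> ` verts F \<subseteq> X}" and ?f = "num_verts F"
  note H = hairy_graph[OF hy F]
  have spos: "real s > 0" and npos: "real n > 0" using s n by auto
  have fin: "finite (emb H G)" using H(1) G by (simp add: finite_emb fin_simple_graphD(1))
  have "real (card ?\<Phi>) * ((1 + \<epsilon> / 2) * (n / s)) ^ t \<le> real (card {f \<in> emb H G. restrict f (verts F) \<in> ?\<Phi>})"
  proof (rule hairy_Phi_lower_const[OF hy F G])
    fix \<phi> u assume "\<phi> \<in> ?\<Phi>" "u \<in> verts F"
    then have "(1 + \<epsilon>) * n / s \<le> real (deg G (\<phi> u))" by (intro deg) auto
    moreover have "real (num_verts H) \<le> \<epsilon> / 2 * (n / s)" using nbig(2) spos by (simp add: field_simps)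
    moreover have "(1 + \<epsilon>) * n / s = (1 + \<epsilon> / 2) * (n / s) + \<epsilon> / 2 * (n / s)" using spos by (simp add: field_simps)
    ultimately show "(1 + \<epsilon> / 2) * (n / s) \<le> real (deg G (\<phi> u)) - real (num_verts H)" by linarith
  qed (use \<epsilon> in auto)
  also have "\<dots> \<le> real (card (emb H G))" using fin by (intro of_nat_mono card_mono) auto
  finally have 1: "real (card ?\<Phi>) * ((1 + \<epsilon> / 2) * (n / s)) ^ t \<le> real (card (emb H G))" .
  have "real (card ?\<Phi>) / real n ^ ?f * (1 + \<epsilon> / 2) ^ t = real s ^ t / real n ^ num_verts H * (real (card ?\<Phi>) * ((1 + \<epsilon> / 2) * (n / s)) ^ t)"
    unfolding H(2) power_add power_mult_distrib power_divide using spos npos by simp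
  also have "\<dots> \<le> wt H s n * real (card (emb H G))"
    using wt_lower[OF hy F s nbig(1)] 1 wt_nonneg[OF nbig(1)] \<epsilon> by (intro mult_mono) auto
  finally have "real (card ?\<Phi>) / real n ^ ?f * (1 + \<epsilon> / 2) ^ t \<le> 2" using obj by linarith
  then show ?thesis using \<epsilon> by (simp add: pos_le_divide_eq)
qed

lemma card_PiE_collision:
  assumes "finite D" "finite V" "x \<in> D" "y \<in> D" "x \<noteq> y"
  shows "card {g \<in> D \<rightarrow>\<^sub>E V. g x = g y} \<le> card V ^ (card D - 1)"
proof -
  have "card {g \<in> D \<rightarrow>\<^sub>E V. g x = g y} \<le> card (D - {y} \<rightarrow>\<^sub>E V)"
  proof (rule card_inj_on_le[where f = "\<lambda>g. restrict g (D - {y})"])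
    show "inj_on (\<lambda>g. restrict g (D - {y})) {g \<in> D \<rightarrow>\<^sub>E V. g x = g y}"
    proof (rule inj_onI)
      fix g h assume g: "g \<in> {g \<in> D \<rightarrow>\<^sub>E V. g x = g y}" and h: "h \<in> {g \<in> D \<rightarrow>\<^sub>E V. g x = g y}"
        and eq: "restrict g (D - {y}) = restrict h (D - {y})"
      have 1: "g z = h z" if "z \<in> D" "z \<noteq> y" for z using fun_cong[OF eq, of z] that by simp
      have "g z = h z" if "z \<in> D" for z
      proof (cases "z = y")
        case True
        have "g y = g x" "h y = h x" using g h by auto
        then show ?thesis using 1[OF assms(3,5)] True by simp
      qed (use 1 that in auto)
      then show "g = h" using g h by (intro PiE_ext[of g D _ h]) auto
    qed
    show "(\<lambda>g. restrict g (D - {y})) ` {g \<in> D \<rightarrow>\<^sub>E V. g x = g y} \<subseteq> D - {y} \<rightarrow>\<^sub>E V"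
    proof (rule image_subsetI)
      fix g assume "g \<in> {g \<in> D \<rightarrow>\<^sub>E V. g x = g y}"
      then show "restrict g (D - {y}) \<in> D - {y} \<rightarrow>\<^sub>E V" by (subst restrict_PiE_iff) auto
    qed
    show "finite (D - {y} \<rightarrow>\<^sub>E V)" using assms by (intro finite_PiE) auto
  qed
  also have "\<dots> = card V ^ (card D - 1)" using assms by (simp add: card_funcsetE)
  finally show ?thesis .
qed

text \<open>An optimal colouring places F inside a blow-up of the complete graph on k vertices. Of
  the maps from \<open>clique_blowup\<close>, those that identify two vertices of F number at most
  f^2 n^(f-1), which gives the error term.\<close>

lemma cliques_from_embeddings:
  assumes F: "fin_simple_graph F" and k: "chromatic_number F = k"
  shows "\<exists>M\<ge>1. \<forall>(G :: nat ugraph) X. fin_simple_graph G \<longrightarrow> num_verts G > 0 \<longrightarrow> X \<subseteq> verts G \<longrightarrow>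
    (real (kcount (\<lambda>u w. {u, w} \<in> edges G) k X) / real (num_verts G) ^ k) ^ M
      \<le> real (card {\<phi> \<in> emb F G. \<phi> ` verts F \<subseteq> X}) / real (num_verts G) ^ num_verts F + (real (num_verts F))\<^sup>2 / real (num_verts G)"
proof -
  obtain c where c: "proper_coloring F (chromatic_number F) c" using chromatic_number_coloring[OF F] by auto
  have surj: "c ` verts F = {..<k}" using coloring_surj[OF F c] k by simp
  have fF: "finite (verts F)" using F by (simp add: fin_simple_graphD(1))
  define M where "M = (\<Prod>j<k. card {u \<in> verts F. c u = j})"
  have "M \<ge> 1"
  proof -
    have "card {u \<in> verts F. c u = j} > 0" if "j < k" for j
    proof -
      have "j \<in> c ` verts F" using surj that by simp
      then show ?thesis using fF by (auto simp: card_gt_0_iff)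
    qed
    then have "M > 0" unfolding M_def by (intro prod_pos) auto
    then show ?thesis by simp
  qed
  show ?thesis
  proof (intro exI[of _ M] conjI allI impI)
    show "M \<ge> 1" by fact
    fix G :: "nat ugraph" and X assume G: "fin_simple_graph G" and n: "num_verts G > 0" and X: "X \<subseteq> verts G"
    let ?E = "\<lambda>u w. {u, w} \<in> edges G" and ?n = "num_verts G" and ?f = "num_verts F"
    have fV: "finite (verts G)" using G by (simp add: fin_simple_graphD(1))
    have fX: "finite X" using X fV by (rule finite_subset)
    have cX: "real (card X) \<le> real ?n" using card_mono[OF fV X] by (simp add: num_verts_def)
    let ?H = "{g \<in> verts F \<rightarrow>\<^sub>E X. \<forall>x\<in>verts F. \<forall>y\<in>verts F. c x \<noteq> c y \<longrightarrow> ?E (g x) (g y)}"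
    let ?\<Phi> = "{\<phi> \<in> emb F G. \<phi> ` verts F \<subseteq> X}" and ?P = "verts F \<times> verts F - Id"
    let ?C = "\<lambda>z. {g \<in> verts F \<rightarrow>\<^sub>E verts G. g (fst z) = g (snd z)}"
    have sym: "symp ?E" by (auto simp: symp_def insert_commute)
    have "(real (kcount ?E k X) / real ?n ^ k) ^ M \<le> real (card ?H) / real ?n ^ ?f"
      unfolding M_def num_verts_def[of F] using n cX by (intro clique_blowup[OF fX sym _ _ fF surj]) auto
    also have "real (card ?H) \<le> real (card ?\<Phi>) + (real ?f)\<^sup>2 * real ?n ^ (?f - 1)"
    proof -
      have "?H \<subseteq> ?\<Phi> \<union> (\<Union>z\<in>?P. ?C z)"
      proof
        fix g assume g: "g \<in> ?H"
        have gV: "g \<in> verts F \<rightarrow>\<^sub>E verts G" using g X by (auto simp: PiE_iff)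
        show "g \<in> ?\<Phi> \<union> (\<Union>z\<in>?P. ?C z)"
        proof (cases "inj_on g (verts F)")
          case True
          have "{g x, g y} \<in> edges G" if e: "{x, y} \<in> edges F" for x y
          proof -
            have "c x \<noteq> c y" using c e by (auto simp: proper_coloring_def)
            then show ?thesis using g fin_simple_graphD(2)[OF F e] by auto
          qed
          then have "g \<in> emb F G" unfolding mem_emb_iff[OF F] using gV True by blast
          moreover have "g ` verts F \<subseteq> X" using g by auto
          ultimately show ?thesis by blast
        next
          case False
          then obtain x y where "x \<in> verts F" "y \<in> verts F" "x \<noteq> y" "g x = g y" by (auto simp: inj_on_def)
          then have "(x, y) \<in> ?P" "g \<in> ?C (x, y)" using gV by auto
          then show ?thesis by blast
        qed
      qed
      moreover have "finite ?\<Phi>" using fF fV by (simp add: finite_emb)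
      moreover have fC: "finite (?C z)" for z
        using fF fV by (intro finite_subset[OF _ finite_PiE[of "verts F" "\<lambda>_. verts G"]]) auto
      ultimately have "card ?H \<le> card (?\<Phi> \<union> (\<Union>z\<in>?P. ?C z))" using fF by (intro card_mono finite_UnI finite_UN_I) auto
      also have "\<dots> \<le> card ?\<Phi> + card (\<Union>z\<in>?P. ?C z)" by (rule card_Un_le)
      also have "card (\<Union>z\<in>?P. ?C z) \<le> (\<Sum>z\<in>?P. card (?C z))" using fF by (intro card_UN_le) auto
      also have "(\<Sum>z\<in>?P. card (?C z)) \<le> (\<Sum>z\<in>?P. ?n ^ (?f - 1))"
      proof (rule sum_mono)
        fix z assume "z \<in> ?P"
        then have "fst z \<in> verts F" "snd z \<in> verts F" "fst z \<noteq> snd z" by auto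
        then show "card (?C z) \<le> ?n ^ (?f - 1)" using card_PiE_collision[OF fF fV] by (simp add: num_verts_def)
      qed
      also have "\<dots> \<le> ?f\<^sup>2 * ?n ^ (?f - 1)"
      proof -
        have "card ?P \<le> card (verts F \<times> verts F)" using fF by (intro card_mono) auto
        then show ?thesis by (simp add: num_verts_def power2_eq_square card_cartesian_product)
      qed
      finally have "real (card ?H) \<le> real (card ?\<Phi> + ?f\<^sup>2 * ?n ^ (?f - 1))" by (simp only: of_nat_le_iff)
      then show ?thesis by simp
    qed
    finally have "(real (kcount ?E k X) / real ?n ^ k) ^ M \<le> (real (card ?\<Phi>) + (real ?f)\<^sup>2 * real ?n ^ (?f - 1)) / real ?n ^ ?f"
      using n by (simp add: divide_right_mono)
    also have "\<dots> = real (card ?\<Phi>) / real ?n ^ ?f + (real ?f)\<^sup>2 * real ?n ^ (?f - 1) / real ?n ^ ?f" by (rule add_divide_distrib)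
    also have "(real ?f)\<^sup>2 * real ?n ^ (?f - 1) / real ?n ^ ?f = (real ?f)\<^sup>2 / real ?n"
    proof (cases "?f = 0")
      case False
      then have "real ?n ^ ?f = real ?n ^ (?f - 1) * real ?n" by (metis power_minus_mult neq0_conv)
      then show ?thesis using n by simp
    qed simp
    finally show "(real (kcount ?E k X) / real ?n ^ k) ^ M \<le> real (card ?\<Phi>) / real ?n ^ ?f + (real ?f)\<^sup>2 / real ?n" .
  qed
qed

text \<open>T depends on F, \<epsilon> and \<delta> but not on H; only the bound on n does. For such
  n both the copies of F on X and the degenerate maps have density of order (1 +
  \<epsilon>/2)^(-t).\<close>

lemma few_cliques:
  fixes F :: "'a ugraph" and \<epsilon> \<delta> :: real
  assumes F: "fin_simple_graph F" and k: "chromatic_number F = k" and s: "s \<ge> 1" and \<epsilon>: "\<epsilon> > 0" and \<delta>: "\<delta> > 0"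
  shows "\<exists>T. \<forall>t\<ge>T. \<forall>H. hairy F t H \<longrightarrow> (\<exists>n0. \<forall>(G :: nat ugraph) X. num_verts G \<ge> n0 \<longrightarrow> fin_simple_graph G \<longrightarrow>
    wt H s (num_verts G) * real (card (emb H G)) \<le> 2 \<longrightarrow> X \<subseteq> verts G \<longrightarrow>
    (\<forall>v\<in>X. (1 + \<epsilon>) * num_verts G / s \<le> real (deg G v)) \<longrightarrow>
    real (kcount (\<lambda>u w. {u, w} \<in> edges G) k X) \<le> \<delta> * real (num_verts G) ^ k)"
proof -
  obtain M where M: "M \<ge> 1" and clq: "\<And>(G :: nat ugraph) X. fin_simple_graph G \<Longrightarrow> num_verts G > 0 \<Longrightarrow> X \<subseteq> verts G \<Longrightarrow>
    (real (kcount (\<lambda>u w. {u, w} \<in> edges G) k X) / real (num_verts G) ^ k) ^ M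
      \<le> real (card {\<phi> \<in> emb F G. \<phi> ` verts F \<subseteq> X}) / real (num_verts G) ^ num_verts F + (real (num_verts F))\<^sup>2 / real (num_verts G)"
    using cliques_from_embeddings[OF F k] by blast
  have x1: "1 < 1 + \<epsilon> / 2" and dM: "0 < \<delta> ^ M" using \<epsilon> \<delta> by auto
  \<comment> \<open>3 is the sum of 2 from \<open>few_embeddings\<close> and 1 for the degenerate
    maps; a linear term does not occur.\<close>
  obtain T where T: "\<And>t. t \<ge> T \<Longrightarrow> 3 + 0 * real t < \<delta> ^ M * (1 + \<epsilon> / 2) ^ t"
    using linear_less_exponential[OF x1 dM, of 3 0] by blast
  show ?thesis
  proof (rule exI[of _ T], intro allI impI)
    fix t and H :: "'a ugraph" assume t: "t \<ge> T" and hy: "hairy F t H"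
    define y where "y = (1 + \<epsilon> / 2) ^ t"
    have y: "y > 0" using \<epsilon> by (simp add: y_def)
    define k1 where "k1 = (real (num_verts F))\<^sup>2 * y"
    define k2 where "k2 = 2 * real s * real (num_verts H) / \<epsilon>"
    define n0 where "n0 = num_verts H + 1 + nat \<lceil>k1\<rceil> + nat \<lceil>k2\<rceil>"
    show "\<exists>n0. \<forall>(G :: nat ugraph) X. num_verts G \<ge> n0 \<longrightarrow> fin_simple_graph G \<longrightarrow>
      wt H s (num_verts G) * real (card (emb H G)) \<le> 2 \<longrightarrow> X \<subseteq> verts G \<longrightarrow>
      (\<forall>v\<in>X. (1 + \<epsilon>) * num_verts G / s \<le> real (deg G v)) \<longrightarrow>
      real (kcount (\<lambda>u w. {u, w} \<in> edges G) k X) \<le> \<delta> * real (num_verts G) ^ k"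
    proof (rule exI[of _ n0], intro allI impI)
      fix G :: "nat ugraph" and X
      assume n: "num_verts G \<ge> n0" and G: "fin_simple_graph G" and obj: "wt H s (num_verts G) * real (card (emb H G)) \<le> 2"
        and X: "X \<subseteq> verts G" and deg: "\<forall>v\<in>X. (1 + \<epsilon>) * num_verts G / s \<le> real (deg G v)"
      let ?n = "num_verts G" and ?\<kappa> = "real (kcount (\<lambda>u w. {u, w} \<in> edges G) k X) / real (num_verts G) ^ k"
      have npos: "?n > 0" using n by (simp add: n0_def)
      have nk: "k1 \<le> real ?n" "k2 \<le> real ?n" using n unfolding n0_def by linarith+
      have "real (card {\<phi> \<in> emb F G. \<phi> ` verts F \<subseteq> X}) / real ?n ^ num_verts F \<le> 2 / y"
        unfolding y_def
      proof (rule few_embeddings[OF hy F G refl npos s obj \<epsilon>])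
        show "num_verts H \<le> ?n" using n by (simp add: n0_def)
        show "2 * real s * real (num_verts H) \<le> \<epsilon> * ?n" using nk(2) \<epsilon> by (simp add: k2_def pos_divide_le_eq mult.commute)
      qed (use deg in blast)
      moreover have "(real (num_verts F))\<^sup>2 / real ?n \<le> 1 / y"
        using nk(1) y npos by (simp add: k1_def field_simps)
      ultimately have "?\<kappa> ^ M \<le> 2 / y + 1 / y" using clq[OF G npos X] by linarith
      also have "\<dots> = 3 / y" by (simp add: add_divide_distrib[symmetric])
      also have "3 / y < \<delta> ^ M" using T[OF t] y by (simp add: y_def divide_less_eq)
      finally have "?\<kappa> ^ M < \<delta> ^ M" .
      then have "?\<kappa> < \<delta>" by (rule power_less_imp_less_base) (use \<delta> in simp)
      then show "real (kcount (\<lambda>u w. {u, w} \<in> edges G) k X) \<le> \<delta> * real ?n ^ k" using npos by (simp add: divide_less_eq)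
    qed
  qed
qed

section \<open>Vertices of high degree and vertices of high codegree\<close>

lemma kcount_cong:
  assumes "\<And>x y. x \<in> X \<Longrightarrow> y \<in> X \<Longrightarrow> E x y = E' x y" shows "kcount E k X = kcount E' k X"
  using assms
proof (induction k arbitrary: X)
  case (Suc k)
  have "kcount E k {w \<in> X. E a w} = kcount E' k {w \<in> X. E' a w}" if "a \<in> X" for a
  proof -
    have "{w \<in> X. E a w} = {w \<in> X. E' a w}" using Suc.prems that by auto
    moreover have "kcount E k {w \<in> X. E' a w} = kcount E' k {w \<in> X. E' a w}" using Suc.prems by (intro Suc.IH) auto
    ultimately show ?thesis by simp
  qed
  then show ?case by simp
qed simp

text \<open>At most |A| d non-adjacent ordered pairs start in A, and at least L of them also end in
  A. The summand 1 next to the codegree accounts for the diagonal.\<close>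

lemma cross_nonadjacent_bound:
  fixes G :: "nat ugraph"
  assumes G: "fin_simple_graph G" and A: "A \<subseteq> verts G" and B: "B \<subseteq> verts G" and AB: "A \<inter> B = {}"
    and codeg: "\<And>v. v \<in> A \<Longrightarrow> real (deg (complement G) v) + 1 \<le> d"
    and low: "L \<le> real (card {(x, y) \<in> A \<times> A. {x, y} \<notin> edges G})"
  shows "real (card {(x, y) \<in> A \<times> B. {x, y} \<notin> edges G}) \<le> real (card A) * d - L"
proof -
  have fV: "finite (verts G)" using G by (simp add: fin_simple_graphD(1))
  have fA: "finite A" "finite B" using A B fV finite_subset by auto
  let ?AA = "{(x, y) \<in> A \<times> A. {x, y} \<notin> edges G}" and ?AB = "{(x, y) \<in> A \<times> B. {x, y} \<notin> edges G}"
  have fin: "finite ?AA" "finite ?AB" using fA by (auto intro: finite_subset[of _ "A \<times> A"] finite_subset[of _ "A \<times> B"])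
  have "card ?AA + card ?AB = card (?AA \<union> ?AB)" using fin AB by (intro card_Un_disjoint[symmetric]) auto
  also have "\<dots> \<le> card (Sigma A (\<lambda>x. {y \<in> verts G. {x, y} \<notin> edges G}))"
    using A B fV fA by (intro card_mono finite_SigmaI) auto
  also have "\<dots> = (\<Sum>x\<in>A. card {y \<in> verts G. {x, y} \<notin> edges G})" using fA fV by simp
  also have "\<dots> = (\<Sum>x\<in>A. deg (complement G) x + 1)"
  proof (rule sum.cong[OF refl])
    fix x assume x: "x \<in> A"
    have "{y \<in> verts G. {x, y} \<notin> edges G} = insert x {y \<in> verts G. {x, y} \<in> edges (complement G)}"
      using x A fin_simple_graphD(2)[OF G, of x x] by (auto simp: complement_simps)
    moreover have "x \<notin> {y \<in> verts G. {x, y} \<in> edges (complement G)}" by (auto simp: complement_simps)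
    ultimately show "card {y \<in> verts G. {x, y} \<notin> edges G} = deg (complement G) x + 1"
      using fV by (simp add: deg_def complement_simps(1))
  qed
  finally have "real (card ?AA + card ?AB) \<le> real (\<Sum>x\<in>A. deg (complement G) x + 1)" by (simp only: of_nat_le_iff)
  also have "\<dots> = (\<Sum>x\<in>A. real (deg (complement G) x) + 1)" by (simp only: of_nat_sum of_nat_add of_nat_1)
  also have "\<dots> \<le> (\<Sum>x\<in>A. d)" using codeg by (intro sum_mono) auto
  finally have "real (card ?AA) + real (card ?AB) \<le> real (card A) * d" by simp
  then show ?thesis using low by linarith
qed

text \<open>Up to errors in \<epsilon>, the left side is a (n - a) / r, and n - a is b plus the
  small c.\<close>

lemma sparse_part_bound:
  fixes n a b c \<epsilon> :: real and r :: nat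
  assumes r: "r \<ge> 1" and n: "n = a + b + c" "r \<le> \<epsilon> * n" and a: "0 \<le> a" "a \<le> n" and c: "c \<le> \<epsilon> * n" and \<epsilon>: "\<epsilon> \<ge> 0"
  shows "a * ((1 + \<epsilon>) * n / r + 1) - (1 - \<epsilon>) * a\<^sup>2 / r \<le> a / r * (b + 4 * \<epsilon> * n)"
proof -
  have rpos: "real r > 0" using r by simp
  have "1 \<le> \<epsilon> * n / r" using n(2) rpos by simp
  then have "a * ((1 + \<epsilon>) * n / r + 1) \<le> a * ((1 + \<epsilon>) * n / r + \<epsilon> * n / r)" using a by (intro mult_left_mono) auto
  also have "\<dots> = a / r * ((1 + 2 * \<epsilon>) * n)" using rpos by (simp add: field_simps)
  finally have "a * ((1 + \<epsilon>) * n / r + 1) - (1 - \<epsilon>) * a\<^sup>2 / r \<le> a / r * ((1 + 2 * \<epsilon>) * n) - (1 - \<epsilon>) * a\<^sup>2 / r" by simp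
  also have "\<dots> = a / r * ((1 + 2 * \<epsilon>) * n - (1 - \<epsilon>) * a)" using rpos by (simp add: field_simps power2_eq_square)
  also have "\<dots> \<le> a / r * (b + 4 * \<epsilon> * n)"
  proof (rule mult_left_mono)
    have "\<epsilon> * a \<le> \<epsilon> * n" using a \<epsilon> by (intro mult_left_mono) auto
    then show "(1 + 2 * \<epsilon>) * n - (1 - \<epsilon>) * a \<le> b + 4 * \<epsilon> * n" using n(1) c by (simp add: algebra_simps)
    show "0 \<le> a / r" using a by simp
  qed
  finally show ?thesis .
qed

text \<open>Let a and b be the sizes of the exclusive parts of A and B. Supersaturation puts almost
  a^2 / r non-adjacent pairs inside the first, leaving about ab/r between the two; symmetrically at
  most about ab/s adjacent pairs run between them. But all ab pairs are of one kind or the other,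
  and 1/r + 1/s \<le> 5/6. So ab is at most 12 \<epsilon> n^2, too little for two substantial
  sets.\<close>

lemma degree_dichotomy:
  fixes r s :: nat and \<epsilon> :: real
  assumes r: "r \<ge> 2" and s: "s \<ge> 2" and rs: "r + s \<ge> 5" and \<epsilon>: "0 < \<epsilon>" "\<epsilon> \<le> 1 / 12"
  shows "\<exists>\<delta>>0. \<exists>n0. \<forall>(G :: nat ugraph) n A B. fin_simple_graph G \<longrightarrow> n = num_verts G \<longrightarrow> n \<ge> n0 \<longrightarrow>
    A = {v \<in> verts G. (1 + \<epsilon>) * n / s \<le> real (deg G v)} \<longrightarrow>
    B = {v \<in> verts G. (1 + \<epsilon>) * n / r \<le> real (deg (complement G) v)} \<longrightarrow>
    real (kcount (\<lambda>u w. {u, w} \<in> edges G) (r + 1) A) \<le> \<delta> * real n ^ (r + 1) \<longrightarrow>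
    real (kcount (\<lambda>u w. {u, w} \<in> edges (complement G)) (s + 1) B) \<le> \<delta> * real n ^ (s + 1) \<longrightarrow>
    verts G - B \<subseteq> A \<and> verts G - A \<subseteq> B \<and> (real (card B) \<le> 73 * \<epsilon> * n \<or> real (card A) \<le> 73 * \<epsilon> * n)"
proof -
  obtain c M where c: "c > 0" and ram: "\<forall>(X :: nat set) E. finite X \<longrightarrow> (\<forall>x. \<not> E x x) \<longrightarrow> card X \<ge> M \<longrightarrow>
           c * real (card X) ^ (r + 1) \<le> real (kcount E (r + 1) X) \<or>
           c * real (card X) ^ (s + 1) \<le> real (kcount (\<lambda>x y. x \<noteq> y \<and> \<not> E x y) (s + 1) X)"
    using ramsey_counting[of "r + 1" "s + 1"] by (elim exE conjE) (rule that)
  have rpos: "real r > 0" and spos: "real s > 0" using r s by auto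
  have inv: "1 / real r + 1 / real s \<le> 5 / 6"
  proof -
    have "5 / 6 - 1 / real r - 1 / real s \<ge> 0"
    proof (cases "r = 2")
      case True
      then have "real s \<ge> 3" using rs by simp
      then have "1 / real s \<le> 1 / 3" by (intro divide_left_mono) auto
      then show ?thesis using True by simp
    next
      case False
      then have "real r \<ge> 3" using r by simp
      then have "1 / real r \<le> 1 / 3" by (intro divide_left_mono) auto
      moreover have "1 / real s \<le> 1 / 2" using s by (intro divide_left_mono) auto
      ultimately show ?thesis by linarith
    qed
    then show ?thesis by linarith
  qed
  \<comment> \<open>The first two terms contradict Ramsey's theorem on A \<inter> B, the last two
    supersaturation on sets of size at least \<epsilon> n. The half makes the inequalities
    strict.\<close>
  define \<delta> where "\<delta> = min (min (c * \<epsilon> ^ (r + 1)) (c * \<epsilon> ^ (s + 1))) (min (\<epsilon> ^ r * \<epsilon> ^ (r + 1)) (\<epsilon> ^ s * \<epsilon> ^ (s + 1))) / 2"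
  have \<delta>: "\<delta> > 0" "\<delta> < c * \<epsilon> ^ (r + 1)" "\<delta> < c * \<epsilon> ^ (s + 1)" "\<delta> < \<epsilon> ^ r * \<epsilon> ^ (r + 1)" "\<delta> < \<epsilon> ^ s * \<epsilon> ^ (s + 1)"
  proof -
    have pos: "0 < c * \<epsilon> ^ (r + 1)" "0 < c * \<epsilon> ^ (s + 1)" "0 < \<epsilon> ^ r * \<epsilon> ^ (r + 1)" "0 < \<epsilon> ^ s * \<epsilon> ^ (s + 1)" using c \<epsilon> by auto
    define m where "m = min (min (c * \<epsilon> ^ (r + 1)) (c * \<epsilon> ^ (s + 1))) (min (\<epsilon> ^ r * \<epsilon> ^ (r + 1)) (\<epsilon> ^ s * \<epsilon> ^ (s + 1)))"
    have m: "m > 0" "m \<le> c * \<epsilon> ^ (r + 1)" "m \<le> c * \<epsilon> ^ (s + 1)" "m \<le> \<epsilon> ^ r * \<epsilon> ^ (r + 1)" "m \<le> \<epsilon> ^ s * \<epsilon> ^ (s + 1)"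
      using pos by (auto simp: m_def)
    have d: "\<delta> = m / 2" by (simp add: \<delta>_def m_def)
    have "0 < m / 2" "m / 2 < m" using m(1) by auto
    then show "\<delta> > 0" "\<delta> < c * \<epsilon> ^ (r + 1)" "\<delta> < c * \<epsilon> ^ (s + 1)" "\<delta> < \<epsilon> ^ r * \<epsilon> ^ (r + 1)" "\<delta> < \<epsilon> ^ s * \<epsilon> ^ (s + 1)"
      unfolding d using m by linarith+
  qed
  define n0 where "n0 = 12 + nat \<lceil>real M / \<epsilon>\<rceil> + nat \<lceil>real r / \<epsilon>\<rceil> + nat \<lceil>real s / \<epsilon>\<rceil>"
  show ?thesis
  proof (rule exI[of _ \<delta>], rule conjI, rule \<delta>(1), rule exI[of _ n0], intro allI impI)
    fix G :: "nat ugraph" and n and A B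
    assume G: "fin_simple_graph G" and n: "n = num_verts G" and nn: "n \<ge> n0"
      and A: "A = {v \<in> verts G. (1 + \<epsilon>) * n / s \<le> real (deg G v)}"
      and B: "B = {v \<in> verts G. (1 + \<epsilon>) * n / r \<le> real (deg (complement G) v)}"
      and kA: "real (kcount (\<lambda>u w. {u, w} \<in> edges G) (r + 1) A) \<le> \<delta> * real n ^ (r + 1)"
      and kB: "real (kcount (\<lambda>u w. {u, w} \<in> edges (complement G)) (s + 1) B) \<le> \<delta> * real n ^ (s + 1)"
    let ?V = "verts G" and ?Gc = "complement G"
    let ?E = "\<lambda>u w. {u, w} \<in> edges G" and ?Ec = "\<lambda>u w. {u, w} \<in> edges ?Gc"
    note Gc = fin_simple_complement[OF G]
    have fV: "finite ?V" using G by (simp add: fin_simple_graphD(1))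
    have nV: "n = card ?V" using n by (simp add: num_verts_def)
    have nk: "12 \<le> real n" "real M / \<epsilon> \<le> real n" "real r / \<epsilon> \<le> real n" "real s / \<epsilon> \<le> real n"
    proof -
      show "12 \<le> real n" using nn by (simp add: n0_def)
      show "real M / \<epsilon> \<le> real n" "real r / \<epsilon> \<le> real n" "real s / \<epsilon> \<le> real n" using nn unfolding n0_def by linarith+
    qed
    have nM: "real M \<le> \<epsilon> * n" "real r \<le> \<epsilon> * n" "real s \<le> \<epsilon> * n" using nk \<epsilon> by (simp_all add: divide_le_eq mult.commute)
    have npos: "real n > 0" using nk(1) by linarith
    have fAB: "finite A" "finite B" "A \<subseteq> ?V" "B \<subseteq> ?V" using fV A B by auto
    \<comment> \<open>(13/12) (5/6) = 65/72 is less than 1, and n \<ge> 12 makes the difference at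
      least 1. The 1 is needed because degree and codegree sum to n - 1.\<close>
    have key: "(1 + \<epsilon>) * n / r + (1 + \<epsilon>) * n / s \<le> real n - 1"
    proof -
      have "(1 + \<epsilon>) * n / r + (1 + \<epsilon>) * n / s = (1 + \<epsilon>) * n * (1 / r + 1 / s)" by (simp add: distrib_left)
      also have "\<dots> \<le> (1 + \<epsilon>) * n * (5 / 6)" using inv \<epsilon> by (intro mult_left_mono) auto
      also have "\<dots> \<le> (1 + 1 / 12) * n * (5 / 6)" using \<epsilon> by (intro mult_right_mono) auto
      also have "\<dots> \<le> real n - 1" using nk(1) by simp
      finally show ?thesis .
    qed
    have VA: "?V - B \<subseteq> A"
    proof
      fix v assume v: "v \<in> ?V - B"
      then have "real (deg ?Gc v) < (1 + \<epsilon>) * n / r" using B by auto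
      moreover have "real (deg G v) = real n - 1 - real (deg ?Gc v)" using deg_complement[OF G, of v] v n by auto
      ultimately have "(1 + \<epsilon>) * n / s \<le> real (deg G v)" using key by linarith
      then show "v \<in> A" using v A by auto
    qed
    have VB: "?V - A \<subseteq> B" using VA by auto
    define C where "C = A \<inter> B"
    have fC: "finite C" "C \<subseteq> A" "C \<subseteq> B" "C \<subseteq> ?V" using fAB by (auto simp: C_def)
    \<comment> \<open>A large intersection would contain, by \<open>ramsey_counting\<close>, too
      many cliques for A or too many independent tuples for B.\<close>
    have cC: "real (card C) \<le> \<epsilon> * n"
    proof (rule ccontr)
      assume "\<not> ?thesis"
      then have big: "\<epsilon> * n \<le> real (card C)" by simp
      then have "real M \<le> real (card C)" using nM by linarith
      then have MC: "M \<le> card C" by simp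
      have irr: "\<forall>x. \<not> ?E x x" using fin_simple_graphD(2)[OF G] by blast
      have low: "c * \<epsilon> ^ j * real n ^ j \<le> c * real (card C) ^ j" for j
      proof -
        have "(\<epsilon> * n) ^ j \<le> real (card C) ^ j" using big \<epsilon> by (intro power_mono) auto
        then have "c * (\<epsilon> * n) ^ j \<le> c * real (card C) ^ j" using c by (intro mult_left_mono) auto
        then show ?thesis by (simp add: power_mult_distrib)
      qed
      have eqk: "kcount (\<lambda>x y. x \<noteq> y \<and> \<not> ?E x y) (s + 1) C = kcount ?Ec (s + 1) C"
        using fC(4) by (intro kcount_cong) (auto simp: complement_simps)
      have npow: "real n ^ j > 0" for j using npos by simp
      from ram[rule_format, OF fC(1) irr[rule_format] MC] show False
      proof
        assume "c * real (card C) ^ (r + 1) \<le> real (kcount ?E (r + 1) C)"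
        also have "\<dots> \<le> real (kcount ?E (r + 1) A)" using fC fAB by (intro of_nat_mono kcount_mono)
        also have "\<dots> \<le> \<delta> * real n ^ (r + 1)" by (rule kA)
        finally have "c * \<epsilon> ^ (r + 1) * real n ^ (r + 1) \<le> \<delta> * real n ^ (r + 1)" using low[of "r + 1"] by linarith
        then show False using \<delta>(2) mult_right_le_imp_le[OF _ npow, of "c * \<epsilon> ^ (r + 1)" "r + 1" \<delta>] by linarith
      next
        assume "c * real (card C) ^ (s + 1) \<le> real (kcount (\<lambda>x y. x \<noteq> y \<and> \<not> ?E x y) (s + 1) C)"
        also have "\<dots> = real (kcount ?Ec (s + 1) C)" by (simp only: eqk)
        also have "\<dots> \<le> real (kcount ?Ec (s + 1) B)" using fC fAB by (intro of_nat_mono kcount_mono)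
        also have "\<dots> \<le> \<delta> * real n ^ (s + 1)" by (rule kB)
        finally have "c * \<epsilon> ^ (s + 1) * real n ^ (s + 1) \<le> \<delta> * real n ^ (s + 1)" using low[of "s + 1"] by linarith
        then show False using \<delta>(3) mult_right_le_imp_le[OF _ npow, of "c * \<epsilon> ^ (s + 1)" "s + 1" \<delta>] by linarith
      qed
    qed
    \<comment> \<open>The exclusive parts: vertices of A' have codegree below the threshold,
      vertices of B' degree below theirs, which is what bounds the pairs leaving them.\<close>
    define A' where "A' = ?V - B"
    define B' where "B' = ?V - A"
    have sub: "A' \<subseteq> A" "B' \<subseteq> B" "A' \<subseteq> ?V" "B' \<subseteq> ?V" "A' \<inter> B' = {}" "finite A'" "finite B'"
      using VA VB fV by (auto simp: A'_def B'_def)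
    have cB: "card B = card B' + card C"
    proof -
      have "B = B' \<union> C" "B' \<inter> C = {}" using VB fAB by (auto simp: B'_def C_def)
      then show ?thesis using sub fC by (metis card_Un_disjoint)
    qed
    have cA: "card A = card A' + card C"
    proof -
      have "A = A' \<union> C" "A' \<inter> C = {}" using VA fAB by (auto simp: A'_def C_def)
      then show ?thesis using sub fC by (metis card_Un_disjoint)
    qed
    have cn: "n = card A' + card B' + card C"
    proof -
      have "card (?V - A) = n - card A" using fAB fV nV by (simp add: card_Diff_subset)
      moreover have "card A \<le> n" using fAB fV nV by (simp add: card_mono)
      ultimately show ?thesis using cA by (simp add: B'_def)
    qed
    have super: "(1 - \<epsilon>) * (real (card Y))\<^sup>2 / k \<le> real (card {(x, y) \<in> Y \<times> Y. \<not> E y x})"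
      if Y: "finite Y" "\<epsilon> * n \<le> real (card Y)" and E: "symp E" and k: "k \<ge> 1"
        and kc: "real (kcount E (k + 1) Y) \<le> \<delta> * real n ^ (k + 1)" and dk: "\<delta> < \<epsilon> ^ k * \<epsilon> ^ (k + 1)"
      for Y :: "nat set" and E and k :: nat
    proof (rule ccontr)
      assume "\<not> ?thesis"
      moreover have "{(x, y) \<in> Y \<times> Y. \<not> E y x} = {(x, y) \<in> Y \<times> Y. \<not> E x y}" using E by (auto dest: sympD)
      ultimately have "real (card {(x, y) \<in> Y \<times> Y. \<not> E x y}) < (1 - \<epsilon>) * (real (card Y))\<^sup>2 / k" by simp
      then have "\<epsilon> ^ k * real (card Y) ^ (k + 1) \<le> real (kcount E (k + 1) Y)"
        using \<epsilon> by (intro turan_supersaturation[OF Y(1) E k]) auto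
      also have "\<dots> \<le> \<delta> * real n ^ (k + 1)" by (rule kc)
      finally have 1: "\<epsilon> ^ k * real (card Y) ^ (k + 1) \<le> \<delta> * real n ^ (k + 1)" .
      have "(\<epsilon> * n) ^ (k + 1) \<le> real (card Y) ^ (k + 1)" using Y(2) \<epsilon> by (intro power_mono) auto
      then have "\<epsilon> ^ k * (\<epsilon> * n) ^ (k + 1) \<le> \<epsilon> ^ k * real (card Y) ^ (k + 1)" using \<epsilon> by (intro mult_left_mono) auto
      then have "\<epsilon> ^ k * \<epsilon> ^ (k + 1) * real n ^ (k + 1) \<le> \<delta> * real n ^ (k + 1)"
        using 1 unfolding power_mult_distrib mult.assoc by linarith
      moreover have "real n ^ (k + 1) > 0" using npos by simp
      ultimately have "\<epsilon> ^ k * \<epsilon> ^ (k + 1) \<le> \<delta>" by (rule mult_right_le_imp_le)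
      then show False using dk by linarith
    qed
    have "real (card B) \<le> 73 * \<epsilon> * n \<or> real (card A) \<le> 73 * \<epsilon> * n"
    proof (rule ccontr)
      assume neg: "\<not> ?thesis"
      define a b where "a = real (card A')" and "b = real (card B')"
      \<comment> \<open>The intersection takes away at most \<epsilon> n, so 73 drops to 72.\<close>
      have ab: "72 * \<epsilon> * n \<le> a" "72 * \<epsilon> * n \<le> b" using neg cA cB cC by (auto simp: a_def b_def)
      have en: "\<epsilon> * n \<ge> 0" using \<epsilon> by simp
      have sE: "symp ?E" "symp ?Ec" by (auto simp: symp_def insert_commute)
      have "real (kcount ?E (r + 1) A') \<le> real (kcount ?E (r + 1) A)" using sub fAB by (intro of_nat_mono kcount_mono)
      then have kA': "real (kcount ?E (r + 1) A') \<le> \<delta> * real n ^ (r + 1)" using kA by linarith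
      have "real (kcount ?Ec (s + 1) B') \<le> real (kcount ?Ec (s + 1) B)" using sub fAB by (intro of_nat_mono kcount_mono)
      then have kB': "real (kcount ?Ec (s + 1) B') \<le> \<delta> * real n ^ (s + 1)" using kB by linarith
      have bigA: "\<epsilon> * n \<le> real (card A')" "\<epsilon> * n \<le> real (card B')" using ab en by (auto simp: a_def b_def)
      have r1: "r \<ge> 1" "s \<ge> 1" using r s by auto
      have LA: "(1 - \<epsilon>) * a\<^sup>2 / r \<le> real (card {(x, y) \<in> A' \<times> A'. {x, y} \<notin> edges G})"
        using super[OF sub(6) bigA(1) sE(1) r1(1) kA' \<delta>(4)] by (simp add: a_def insert_commute)
      have LB: "(1 - \<epsilon>) * b\<^sup>2 / s \<le> real (card {(x, y) \<in> B' \<times> B'. {x, y} \<notin> edges ?Gc})"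
        using super[OF sub(7) bigA(2) sE(2) r1(2) kB' \<delta>(5)] by (simp add: b_def insert_commute)
      have P: "real (card {(x, y) \<in> A' \<times> B'. {x, y} \<notin> edges G}) \<le> a * ((1 + \<epsilon>) * n / r + 1) - (1 - \<epsilon>) * a\<^sup>2 / r"
        unfolding a_def
      proof (rule cross_nonadjacent_bound[OF G sub(3,4,5) _ LA[unfolded a_def]])
        fix v assume "v \<in> A'"
        then show "real (deg ?Gc v) + 1 \<le> (1 + \<epsilon>) * n / r + 1" using B by (auto simp: A'_def)
      qed
      have BA: "B' \<inter> A' = {}" using sub(5) by auto
      have Q: "real (card {(x, y) \<in> B' \<times> A'. {x, y} \<notin> edges ?Gc}) \<le> b * ((1 + \<epsilon>) * n / s + 1) - (1 - \<epsilon>) * b\<^sup>2 / s"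
        unfolding b_def
      proof (rule cross_nonadjacent_bound[OF Gc _ _ BA _ LB[unfolded b_def]])
        show "B' \<subseteq> verts ?Gc" "A' \<subseteq> verts ?Gc" using sub by (auto simp: complement_simps)
        fix v assume "v \<in> B'"
        then show "real (deg (complement ?Gc) v) + 1 \<le> (1 + \<epsilon>) * n / s + 1"
          using A by (auto simp: B'_def complement_complement[OF G])
      qed
      have "a * b = real (card {(x, y) \<in> A' \<times> B'. {x, y} \<notin> edges G}) + real (card {(x, y) \<in> B' \<times> A'. {x, y} \<notin> edges ?Gc})"
      proof -
        let ?S = "{(x, y) \<in> A' \<times> B'. {x, y} \<notin> edges G}" and ?T = "{(x, y) \<in> A' \<times> B'. {x, y} \<in> edges G}"
        have "{(x, y) \<in> B' \<times> A'. {x, y} \<notin> edges ?Gc} = prod.swap ` ?T"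
          using sub by (auto simp: complement_simps insert_commute image_iff)
        then have "card {(x, y) \<in> B' \<times> A'. {x, y} \<notin> edges ?Gc} = card ?T" by (simp only: card_image[OF inj_swap])
        moreover have "A' \<times> B' = ?S \<union> ?T" by auto
        moreover have "card (?S \<union> ?T) = card ?S + card ?T"
          using sub by (intro card_Un_disjoint) (auto intro: finite_subset[of _ "A' \<times> B'"])
        ultimately have "card (A' \<times> B') = card ?S + card {(x, y) \<in> B' \<times> A'. {x, y} \<notin> edges ?Gc}" by (simp only:)
        then show ?thesis by (simp add: a_def b_def card_cartesian_product flip: of_nat_mult of_nat_add)
      qed
      also have "\<dots> \<le> a / r * (b + 4 * \<epsilon> * n) + b / s * (a + 4 * \<epsilon> * n)"
      proof -
        have cn1: "real n = a + b + real (card C)" "real n = b + a + real (card C)" using cn by (simp_all add: a_def b_def)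
        have ab0: "0 \<le> a" "a \<le> n" "0 \<le> b" "b \<le> n" "0 \<le> \<epsilon>" using cn \<epsilon> by (simp_all add: a_def b_def)
        have "a * ((1 + \<epsilon>) * n / r + 1) - (1 - \<epsilon>) * a\<^sup>2 / r \<le> a / r * (b + 4 * \<epsilon> * n)"
          by (rule sparse_part_bound[OF r1(1) cn1(1) nM(2) ab0(1,2) cC ab0(5)])
        moreover have "b * ((1 + \<epsilon>) * n / s + 1) - (1 - \<epsilon>) * b\<^sup>2 / s \<le> b / s * (a + 4 * \<epsilon> * n)"
          by (rule sparse_part_bound[OF r1(2) cn1(2) nM(3) ab0(3,4) cC ab0(5)])
        ultimately show ?thesis using P Q by linarith
      qed
      also have "\<dots> = a * b * (1 / r + 1 / s) + 4 * (\<epsilon> * n) * (a / r + b / s)"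
        by (simp add: distrib_left mult_ac)
      also have "\<dots> \<le> a * b * (5 / 6) + 4 * (\<epsilon> * n) * (n / 2)"
      proof (intro add_mono mult_left_mono)
        show "1 / real r + 1 / real s \<le> 5 / 6" by (rule inv)
        have "a / r \<le> a / 2" using r by (intro divide_left_mono) (auto simp: a_def)
        moreover have "b / s \<le> b / 2" using s by (intro divide_left_mono) (auto simp: b_def)
        moreover have "a + b \<le> n" using cn by (simp add: a_def b_def)
        then have "a / 2 + b / 2 \<le> n / 2" by (simp add: add_divide_distrib[symmetric])
        ultimately show "a / r + b / s \<le> n / 2" by linarith
      qed (use en in \<open>auto simp: a_def b_def\<close>)
      finally have up: "a * b \<le> 12 * (\<epsilon> * n) * n" by simp
      have "real n = a + b + real (card C)" using cn by (simp add: a_def b_def)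
      moreover have "\<epsilon> * n \<le> 1 / 12 * n" using \<epsilon> by (intro mult_right_mono) auto
      \<comment> \<open>The intersection has at most n/12 vertices, so the larger exclusive part has
        at least n/4. Together with 72 \<epsilon> n for the other this gives 18 \<epsilon> n^2, more
        than 12 \<epsilon> n^2.\<close>
      ultimately have "n \<le> 4 * a \<or> n \<le> 4 * b" using cC npos by linarith
      then have "18 * (\<epsilon> * n) * n \<le> a * b"
      proof
        assume "n \<le> 4 * a"
        then have "(n / 4) * (72 * \<epsilon> * n) \<le> a * b" using ab en by (intro mult_mono) auto
        then show ?thesis by (simp add: algebra_simps)
      next
        assume "n \<le> 4 * b"
        then have "(72 * \<epsilon> * n) * (n / 4) \<le> a * b" using ab en by (intro mult_mono) (auto simp: a_def)
        then show ?thesis by (simp add: algebra_simps)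
      qed
      moreover have "12 * (\<epsilon> * n) * n < 18 * (\<epsilon> * n) * n" using \<epsilon> npos by simp
      ultimately show False using up by linarith
    qed
    then show "?V - B \<subseteq> A \<and> ?V - A \<subseteq> B \<and> (real (card B) \<le> 73 * \<epsilon> * n \<or> real (card A) \<le> 73 * \<epsilon> * n)" using VA VB by blast
  qed
qed

section \<open>Exchanging a graph with its complement\<close>

lemma minimizer_complement:
  assumes H1: "fin_simple_graph H1" and H2: "fin_simple_graph H2" and min: "minimizer H1 H2 G"
  shows "minimizer H2 H1 (complement G)"
proof -
  have G: "fin_simple_graph G" using min by (simp add: minimizer_def)
  have "bonbon_objective H2 H1 (complement G) \<le> bonbon_objective H2 H1 G'" if "G' \<in> n_vertex_graphs (num_verts (complement G))" for G'
  proof -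
    have G': "fin_simple_graph G'" "num_verts G' = num_verts G" using that by (auto simp: n_vertex_graphs_def num_verts_complement)
    then have "complement G' \<in> n_vertex_graphs (num_verts G)"
      by (simp add: n_vertex_graphs_def fin_simple_complement num_verts_complement)
    then have "bonbon_objective H1 H2 G \<le> bonbon_objective H1 H2 (complement G')" using min by (simp add: minimizer_def)
    then show ?thesis using bonbon_objective_complement[OF G, of H2 H1] bonbon_objective_complement[OF G'(1), of H1 H2] by simp
  qed
  then show ?thesis using fin_simple_complement[OF G] by (simp add: minimizer_def)
qed

text \<open>Stated for one side only, to be applied to the graph and to its complement. The set X of
  the near-Turan case is the complement of B, which is contained in A and hence has few
  cliques.\<close>

lemma low_degree_part_turan:
  fixes G :: "nat ugraph" and \<epsilon> \<epsilon>1 \<delta> :: real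
  assumes nt: "\<forall>G X. n0 \<le> num_verts G \<longrightarrow> minimizer H1 H2 G \<longrightarrow> X \<subseteq> verts G \<longrightarrow>
      real (card (verts G - X)) \<le> \<epsilon>1 * real (num_verts G) \<longrightarrow>
      (\<forall>v\<in>X. real (deg (complement G) v) + 1 \<le> (1 + \<epsilon>1) * real (num_verts G) / r) \<longrightarrow>
      real (r + 1) * (2 * real r) ^ r * real (kcount (\<lambda>u w. {u, w} \<in> edges G) (r + 1) X) \<le> \<epsilon>1 * real (num_verts G) ^ (r + 1) \<longrightarrow>
      turan_graph r G"
    and G: "fin_simple_graph G" and n: "n = num_verts G" "n0 \<le> n" and min: "minimizer H1 H2 G" and r: "r \<ge> 1"
    and B: "B = {v \<in> verts G. (1 + \<epsilon>) * n / r \<le> real (deg (complement G) v)}" and BA: "verts G - B \<subseteq> A" "finite A"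
    and kA: "real (kcount (\<lambda>u w. {u, w} \<in> edges G) (r + 1) A) \<le> \<delta> * real n ^ (r + 1)"
    and cB: "real (card B) \<le> 73 * \<epsilon> * n" and \<epsilon>: "0 < \<epsilon>" "73 * \<epsilon> \<le> \<epsilon>1" and nr: "real r \<le> \<epsilon> * n"
    and \<delta>: "real (r + 1) * (2 * real r) ^ r * \<delta> \<le> \<epsilon>1"
  shows "turan_graph r G"
proof -
  let ?X = "verts G - B"
  have rpos: "real r > 0" using r by simp
  have "verts G - ?X = B" using B by auto
  then have 1: "real (card (verts G - ?X)) \<le> \<epsilon>1 * real (num_verts G)"
    using cB mult_right_mono[OF \<epsilon>(2), of "real n"] n by simp
  have 2: "\<forall>v\<in>?X. real (deg (complement G) v) + 1 \<le> (1 + \<epsilon>1) * real (num_verts G) / r"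
  proof
    fix v assume "v \<in> ?X"
    then have "real (deg (complement G) v) < (1 + \<epsilon>) * n / r" using B by auto
    moreover have "1 \<le> \<epsilon> * n / r" using nr rpos by simp
    ultimately have "real (deg (complement G) v) + 1 \<le> (1 + \<epsilon>) * n / r + \<epsilon> * n / r" by linarith
    also have "\<dots> = (1 + 2 * \<epsilon>) * n / r" using rpos by (simp add: field_simps)
    also have "\<dots> \<le> (1 + \<epsilon>1) * n / r" using \<epsilon> by (intro divide_right_mono mult_right_mono) auto
    finally show "real (deg (complement G) v) + 1 \<le> (1 + \<epsilon>1) * real (num_verts G) / r" using n by simp
  qed
  have "kcount (\<lambda>u w. {u, w} \<in> edges G) (r + 1) ?X \<le> kcount (\<lambda>u w. {u, w} \<in> edges G) (r + 1) A" by (rule kcount_mono[OF BA])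
  then have "real (kcount (\<lambda>u w. {u, w} \<in> edges G) (r + 1) ?X) \<le> \<delta> * real n ^ (r + 1)" using kA by linarith
  then have "real (r + 1) * (2 * real r) ^ r * real (kcount (\<lambda>u w. {u, w} \<in> edges G) (r + 1) ?X)
      \<le> real (r + 1) * (2 * real r) ^ r * (\<delta> * real n ^ (r + 1))" by (intro mult_left_mono) auto
  also have "\<dots> = real (r + 1) * (2 * real r) ^ r * \<delta> * real n ^ (r + 1)" by (simp only: mult.assoc)
  also have "\<dots> \<le> \<epsilon>1 * real n ^ (r + 1)" using \<delta> by (intro mult_right_mono) auto
  finally have 3: "real (r + 1) * (2 * real r) ^ r * real (kcount (\<lambda>u w. {u, w} \<in> edges G) (r + 1) ?X) \<le> \<epsilon>1 * real (num_verts G) ^ (r + 1)"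
    using n by simp
  have 4: "n0 \<le> num_verts G" using n by simp
  show ?thesis using nt 4 min 1 2 3 Diff_subset[of "verts G" B] by blast
qed

theorem theorem1p2:
  fixes F1 :: "'a ugraph" and F2 :: "'b ugraph" and q :: real
  assumes "0 < q" and "q \<le> 1"
    and "fin_simple_graph F1" and "fin_simple_graph F2"
    and "\<not> bipartite F1" and "\<not> bipartite F2"
    and "\<exists>e\<in>edges F1. critical_edge F1 e" and "\<exists>e\<in>edges F2. critical_edge F2 e"
    and "chromatic_number F1 + chromatic_number F2 \<ge> 7"
  shows "\<exists>t0::nat. \<forall>t1 t2 H1 H2.
           t1 \<ge> t0 \<longrightarrow> t2 \<ge> t0 \<longrightarrow> hairy F1 t1 H1 \<longrightarrow> hairy F2 t2 H2 \<longrightarrow>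
           real (min (num_verts H1) (num_verts H2)) \<ge> q * real (max (num_verts H1) (num_verts H2)) \<longrightarrow>
           bonbon_pair H1 H2"
proof -
  note q = assms(1,2) and F1 = assms(3) and F2 = assms(4)
  define r s where "r = chromatic_number F1 - 1" and "s = chromatic_number F2 - 1"
  have c3: "chromatic_number F1 \<ge> 3" "chromatic_number F2 \<ge> 3"
    using not_bipartite_chromatic assms by blast+
  have chi: "chromatic_number F1 = r + 1" "chromatic_number F2 = s + 1" using c3 by (auto simp: r_def s_def)
  have r: "r \<ge> 2" and s: "s \<ge> 2" and rs: "r + s \<ge> 5" "s + r \<ge> 5" using chi c3 assms(9) by auto
  have e1: "edges F1 \<noteq> {}" and e2: "edges F2 \<noteq> {}" using assms(7,8) by auto
  obtain \<epsilon>1 t01 where \<epsilon>1: "\<epsilon>1 > 0" and NT1: "\<forall>t1 t2 H1 H2. t01 \<le> t1 \<longrightarrow> t01 \<le> t2 \<longrightarrow> hairy F1 t1 H1 \<longrightarrow> hairy F2 t2 H2 \<longrightarrow>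
    q * real (max (num_verts H1) (num_verts H2)) \<le> real (min (num_verts H1) (num_verts H2)) \<longrightarrow>
    (\<exists>n0. \<forall>G X. n0 \<le> num_verts G \<longrightarrow> minimizer H1 H2 G \<longrightarrow> X \<subseteq> verts G \<longrightarrow>
      real (card (verts G - X)) \<le> \<epsilon>1 * real (num_verts G) \<longrightarrow>
      (\<forall>v\<in>X. real (deg (complement G) v) + 1 \<le> (1 + \<epsilon>1) * real (num_verts G) / r) \<longrightarrow>
      real (r + 1) * (2 * real r) ^ r * real (kcount (\<lambda>u w. {u, w} \<in> edges G) (r + 1) X) \<le> \<epsilon>1 * real (num_verts G) ^ (r + 1) \<longrightarrow>
      turan_graph r G)"
    using near_turan_minimizer[OF F1 F2 assms(7) e2 chi r s rs(1) q] by (elim exE conjE) (rule that)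
  obtain \<epsilon>2 t02 where \<epsilon>2: "\<epsilon>2 > 0" and NT2: "\<forall>t1 t2 H1 H2. t02 \<le> t1 \<longrightarrow> t02 \<le> t2 \<longrightarrow> hairy F2 t1 H1 \<longrightarrow> hairy F1 t2 H2 \<longrightarrow>
    q * real (max (num_verts H1) (num_verts H2)) \<le> real (min (num_verts H1) (num_verts H2)) \<longrightarrow>
    (\<exists>n0. \<forall>G X. n0 \<le> num_verts G \<longrightarrow> minimizer H1 H2 G \<longrightarrow> X \<subseteq> verts G \<longrightarrow>
      real (card (verts G - X)) \<le> \<epsilon>2 * real (num_verts G) \<longrightarrow>
      (\<forall>v\<in>X. real (deg (complement G) v) + 1 \<le> (1 + \<epsilon>2) * real (num_verts G) / s) \<longrightarrow>
      real (s + 1) * (2 * real s) ^ s * real (kcount (\<lambda>u w. {u, w} \<in> edges G) (s + 1) X) \<le> \<epsilon>2 * real (num_verts G) ^ (s + 1) \<longrightarrow>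
      turan_graph s G)"
    using near_turan_minimizer[OF F2 F1 assms(8) e1 chi(2,1) s r rs(2) q] by (elim exE conjE) (rule that)
  \<comment> \<open>876 = 73 * 12, so both \<epsilon> \<le> 1/12 and 73 \<epsilon> \<le>
    \<epsilon>1, \<epsilon>2 follow.\<close>
  define \<epsilon> where "\<epsilon> = min (min \<epsilon>1 \<epsilon>2) 1 / 876"
  have \<epsilon>: "0 < \<epsilon>" "\<epsilon> \<le> 1 / 12" "73 * \<epsilon> \<le> \<epsilon>1" "73 * \<epsilon> \<le> \<epsilon>2" using \<epsilon>1 \<epsilon>2 by (auto simp: \<epsilon>_def)
  obtain \<delta>0 nd where \<delta>0: "\<delta>0 > 0" and dich: "\<forall>(G :: nat ugraph) n A B. fin_simple_graph G \<longrightarrow> n = num_verts G \<longrightarrow> n \<ge> nd \<longrightarrow>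
    A = {v \<in> verts G. (1 + \<epsilon>) * n / s \<le> real (deg G v)} \<longrightarrow>
    B = {v \<in> verts G. (1 + \<epsilon>) * n / r \<le> real (deg (complement G) v)} \<longrightarrow>
    real (kcount (\<lambda>u w. {u, w} \<in> edges G) (r + 1) A) \<le> \<delta>0 * real n ^ (r + 1) \<longrightarrow>
    real (kcount (\<lambda>u w. {u, w} \<in> edges (complement G)) (s + 1) B) \<le> \<delta>0 * real n ^ (s + 1) \<longrightarrow>
    verts G - B \<subseteq> A \<and> verts G - A \<subseteq> B \<and> (real (card B) \<le> 73 * \<epsilon> * n \<or> real (card A) \<le> 73 * \<epsilon> * n)"
    using degree_dichotomy[OF r s rs(1) \<epsilon>(1,2)] by (elim exE conjE) (rule that)
  define k1 k2 where "k1 = real (r + 1) * (2 * real r) ^ r" and "k2 = real (s + 1) * (2 * real s) ^ s"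
  have k: "k1 > 0" "k2 > 0" using r s by (auto simp: k1_def k2_def)
  \<comment> \<open>Small enough for the dichotomy and, after multiplication by the clique factors
    \<open>k1\<close> and \<open>k2\<close>, for both near-Turan cases.\<close>
  define \<delta> where "\<delta> = min \<delta>0 (min (\<epsilon>1 / k1) (\<epsilon>2 / k2))"
  have \<delta>: "\<delta> > 0" "\<delta> \<le> \<delta>0" "k1 * \<delta> \<le> \<epsilon>1" "k2 * \<delta> \<le> \<epsilon>2"
  proof -
    show "\<delta> > 0" "\<delta> \<le> \<delta>0" using \<delta>0 \<epsilon>1 \<epsilon>2 k by (auto simp: \<delta>_def)
    have "\<delta> \<le> \<epsilon>1 / k1" "\<delta> \<le> \<epsilon>2 / k2" by (auto simp: \<delta>_def)
    then show "k1 * \<delta> \<le> \<epsilon>1" "k2 * \<delta> \<le> \<epsilon>2" using k by (auto simp: pos_le_divide_eq mult.commute)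
  qed
  have r1: "r \<ge> 1" "s \<ge> 1" using r s by auto
  obtain T1 where T1: "\<forall>t\<ge>T1. \<forall>H. hairy F1 t H \<longrightarrow> (\<exists>n0. \<forall>(G :: nat ugraph) X. num_verts G \<ge> n0 \<longrightarrow> fin_simple_graph G \<longrightarrow>
    wt H s (num_verts G) * real (card (emb H G)) \<le> 2 \<longrightarrow> X \<subseteq> verts G \<longrightarrow>
    (\<forall>v\<in>X. (1 + \<epsilon>) * num_verts G / s \<le> real (deg G v)) \<longrightarrow>
    real (kcount (\<lambda>u w. {u, w} \<in> edges G) (r + 1) X) \<le> \<delta> * real (num_verts G) ^ (r + 1))"
    using few_cliques[OF F1 chi(1) r1(2) \<epsilon>(1) \<delta>(1)] by (elim exE) (rule that)
  obtain T2 where T2: "\<forall>t\<ge>T2. \<forall>H. hairy F2 t H \<longrightarrow> (\<exists>n0. \<forall>(G :: nat ugraph) X. num_verts G \<ge> n0 \<longrightarrow> fin_simple_graph G \<longrightarrow>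
    wt H r (num_verts G) * real (card (emb H G)) \<le> 2 \<longrightarrow> X \<subseteq> verts G \<longrightarrow>
    (\<forall>v\<in>X. (1 + \<epsilon>) * num_verts G / r \<le> real (deg G v)) \<longrightarrow>
    real (kcount (\<lambda>u w. {u, w} \<in> edges G) (s + 1) X) \<le> \<delta> * real (num_verts G) ^ (s + 1))"
    using few_cliques[OF F2 chi(2) r1(1) \<epsilon>(1) \<delta>(1)] by (elim exE) (rule that)
  show ?thesis
  proof (rule exI[of _ "t01 + t02 + T1 + T2"], intro allI impI)
    fix t1 t2 and H1 :: "'a ugraph" and H2 :: "'b ugraph"
    assume t1: "t1 \<ge> t01 + t02 + T1 + T2" and t2: "t2 \<ge> t01 + t02 + T1 + T2" and hy1: "hairy F1 t1 H1" and hy2: "hairy F2 t2 H2"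
      and qq: "real (min (num_verts H1) (num_verts H2)) \<ge> q * real (max (num_verts H1) (num_verts H2))"
    note H1 = hairy_graph[OF hy1 F1] note H2 = hairy_graph[OF hy2 F2]
    have cH: "chromatic_number H1 = r + 1" "chromatic_number H2 = s + 1"
      using hairy_chromatic[OF hy1 F1] hairy_chromatic[OF hy2 F2] chi r s by auto
    have tt: "t01 \<le> t1" "t01 \<le> t2" "t02 \<le> t1" "t02 \<le> t2" "T1 \<le> t1" "T2 \<le> t2" using t1 t2 by auto
    have qq': "q * real (max (num_verts H2) (num_verts H1)) \<le> real (min (num_verts H2) (num_verts H1))"
      using qq by (simp add: max.commute min.commute)
    obtain n1 where nt1: "\<forall>G X. n1 \<le> num_verts G \<longrightarrow> minimizer H1 H2 G \<longrightarrow> X \<subseteq> verts G \<longrightarrow>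
      real (card (verts G - X)) \<le> \<epsilon>1 * real (num_verts G) \<longrightarrow>
      (\<forall>v\<in>X. real (deg (complement G) v) + 1 \<le> (1 + \<epsilon>1) * real (num_verts G) / r) \<longrightarrow>
      real (r + 1) * (2 * real r) ^ r * real (kcount (\<lambda>u w. {u, w} \<in> edges G) (r + 1) X) \<le> \<epsilon>1 * real (num_verts G) ^ (r + 1) \<longrightarrow>
      turan_graph r G"
      using NT1[rule_format, OF tt(1,2) hy1 hy2 qq] by (elim exE) (rule that)
    obtain n2 where nt2: "\<forall>G X. n2 \<le> num_verts G \<longrightarrow> minimizer H2 H1 G \<longrightarrow> X \<subseteq> verts G \<longrightarrow>
      real (card (verts G - X)) \<le> \<epsilon>2 * real (num_verts G) \<longrightarrow>
      (\<forall>v\<in>X. real (deg (complement G) v) + 1 \<le> (1 + \<epsilon>2) * real (num_verts G) / s) \<longrightarrow>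
      real (s + 1) * (2 * real s) ^ s * real (kcount (\<lambda>u w. {u, w} \<in> edges G) (s + 1) X) \<le> \<epsilon>2 * real (num_verts G) ^ (s + 1) \<longrightarrow>
      turan_graph s G"
      using NT2[rule_format, OF tt(4,3) hy2 hy1 qq'] by (elim exE) (rule that)
    obtain n3 where fc1: "\<forall>(G :: nat ugraph) X. num_verts G \<ge> n3 \<longrightarrow> fin_simple_graph G \<longrightarrow>
      wt H1 s (num_verts G) * real (card (emb H1 G)) \<le> 2 \<longrightarrow> X \<subseteq> verts G \<longrightarrow>
      (\<forall>v\<in>X. (1 + \<epsilon>) * num_verts G / s \<le> real (deg G v)) \<longrightarrow>
      real (kcount (\<lambda>u w. {u, w} \<in> edges G) (r + 1) X) \<le> \<delta> * real (num_verts G) ^ (r + 1)"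
      using T1[rule_format, OF tt(5) hy1] by (elim exE) (rule that)
    obtain n4 where fc2: "\<forall>(G :: nat ugraph) X. num_verts G \<ge> n4 \<longrightarrow> fin_simple_graph G \<longrightarrow>
      wt H2 r (num_verts G) * real (card (emb H2 G)) \<le> 2 \<longrightarrow> X \<subseteq> verts G \<longrightarrow>
      (\<forall>v\<in>X. (1 + \<epsilon>) * num_verts G / r \<le> real (deg G v)) \<longrightarrow>
      real (kcount (\<lambda>u w. {u, w} \<in> edges G) (s + 1) X) \<le> \<delta> * real (num_verts G) ^ (s + 1)"
      using T2[rule_format, OF tt(6) hy2] by (elim exE) (rule that)
    obtain nT where nT: "\<forall>n\<ge>nT. \<exists>T\<in>n_vertex_graphs n. bonbon_objective H1 H2 T \<le> 1 + 1"
      using turan_objective[OF H1(1) H2(1) r1(1) cH(1) zero_less_one] by (elim exE) (rule that)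
    define n0 where "n0 = n1 + n2 + n3 + n4 + nd + nT + num_verts H1 + num_verts H2 + nat \<lceil>real r / \<epsilon>\<rceil> + nat \<lceil>real s / \<epsilon>\<rceil>"
    show "bonbon_pair H1 H2"
      unfolding bonbon_pair_def
    proof (intro conjI)
      show "fin_simple_graph H1" "fin_simple_graph H2" using H1 H2 by auto
      show "edges H1 \<noteq> {}" "edges H2 \<noteq> {}" using H1(4) H2(4) e1 e2 by auto
      show "\<exists>n0. \<forall>n\<ge>n0. \<forall>G\<in>n_vertex_graphs n.
        (\<forall>G'\<in>n_vertex_graphs n. bonbon_objective H1 H2 G \<le> bonbon_objective H1 H2 G') \<longrightarrow>
        turan_graph (chromatic_number H1 - 1) G \<or> turan_graph (chromatic_number H2 - 1) (complement G)"
      proof (rule exI[of _ n0], intro allI ballI impI)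
        fix n and G :: "nat ugraph"
        assume nn: "n \<ge> n0" and Gn: "G \<in> n_vertex_graphs n" and opt: "\<forall>G'\<in>n_vertex_graphs n. bonbon_objective H1 H2 G \<le> bonbon_objective H1 H2 G'"
        have G: "fin_simple_graph G" and n: "n = num_verts G" using Gn by (auto simp: n_vertex_graphs_def)
        note Gc = fin_simple_complement[OF G]
        have nc: "n = num_verts (complement G)" using n by (simp add: num_verts_complement)
        have min: "minimizer H1 H2 G" using G opt n by (simp add: minimizer_def)
        note minc = minimizer_complement[OF H1(1) H2(1) min]
        have big: "n1 \<le> n" "n2 \<le> n" "n3 \<le> n" "n4 \<le> n" "nd \<le> n" "nT \<le> n" "num_verts H1 \<le> n" "num_verts H2 \<le> n"
          using nn by (auto simp: n0_def)
        have "real r / \<epsilon> \<le> real n" "real s / \<epsilon> \<le> real n" using nn unfolding n0_def by linarith+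
        then have nr: "real r \<le> \<epsilon> * n" "real s \<le> \<epsilon> * n" using \<epsilon> by (simp_all add: divide_le_eq mult.commute)
        obtain T where "T \<in> n_vertex_graphs n" "bonbon_objective H1 H2 T \<le> 1 + 1" using nT big by blast
        then have "bonbon_objective H1 H2 G \<le> 2" using opt by fastforce
        then have obj: "wt H1 s n * real (card (emb H1 G)) + wt H2 r n * real (card (emb H2 (complement G))) \<le> 2"
          using bonbon_objective_wt[OF H1(1) H2(1) G] cH n by simp
        have "0 \<le> wt H1 s n * real (card (emb H1 G))" "0 \<le> wt H2 r n * real (card (emb H2 (complement G)))"
          using wt_nonneg[OF big(7), of s] wt_nonneg[OF big(8), of r] by simp_all
        then have obj1: "wt H1 s (num_verts G) * real (card (emb H1 G)) \<le> 2"
          and obj2: "wt H2 r (num_verts (complement G)) * real (card (emb H2 (complement G))) \<le> 2"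
          using obj n nc by auto
        define A where "A = {v \<in> verts G. (1 + \<epsilon>) * n / s \<le> real (deg G v)}"
        define B where "B = {v \<in> verts G. (1 + \<epsilon>) * n / r \<le> real (deg (complement G) v)}"
        have fV: "finite (verts G)" using G by (simp add: fin_simple_graphD(1))
        have AX: "A \<subseteq> verts G" "\<forall>v\<in>A. (1 + \<epsilon>) * num_verts G / s \<le> real (deg G v)"
          unfolding A_def n by blast+
        have BX: "B \<subseteq> verts (complement G)" "\<forall>v\<in>B. (1 + \<epsilon>) * num_verts (complement G) / r \<le> real (deg (complement G) v)"
          unfolding B_def complement_simps(1) nc by blast+
        have kA: "real (kcount (\<lambda>u w. {u, w} \<in> edges G) (r + 1) A) \<le> \<delta> * real n ^ (r + 1)"
          using fc1[THEN spec, THEN spec, THEN mp, THEN mp, THEN mp, THEN mp, THEN mp, OF big(3)[unfolded n] G obj1 AX]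
          unfolding n .
        have kB: "real (kcount (\<lambda>u w. {u, w} \<in> edges (complement G)) (s + 1) B) \<le> \<delta> * real n ^ (s + 1)"
          using fc2[THEN spec, THEN spec, THEN mp, THEN mp, THEN mp, THEN mp, THEN mp, OF big(4)[unfolded nc] Gc obj2 BX]
          unfolding nc .
        have kA0: "real (kcount (\<lambda>u w. {u, w} \<in> edges G) (r + 1) A) \<le> \<delta>0 * real n ^ (r + 1)"
          using order_trans[OF kA mult_right_mono[OF \<delta>(2)]] by simp
        have kB0: "real (kcount (\<lambda>u w. {u, w} \<in> edges (complement G)) (s + 1) B) \<le> \<delta>0 * real n ^ (s + 1)"
          using order_trans[OF kB mult_right_mono[OF \<delta>(2)]] by simp
        have d: "verts G - B \<subseteq> A \<and> verts G - A \<subseteq> B \<and> (real (card B) \<le> 73 * \<epsilon> * n \<or> real (card A) \<le> 73 * \<epsilon> * n)"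
          by (rule dich[rule_format, OF G n big(5) A_def B_def kA0 kB0])
        then have sub: "verts G - B \<subseteq> A" "verts (complement G) - A \<subseteq> B" by (auto simp: complement_simps(1))
        have fin: "finite A" "finite B" using fV by (auto simp: A_def B_def)
        from d consider "real (card B) \<le> 73 * \<epsilon> * n" | "real (card A) \<le> 73 * \<epsilon> * n" by blast
        then have "turan_graph r G \<or> turan_graph s (complement G)"
        proof cases
          case 1
          have "turan_graph r G"
            by (rule low_degree_part_turan[OF nt1 G n big(1) min r1(1) B_def sub(1) fin(1) kA 1 \<epsilon>(1,3) nr(1) \<delta>(3)[unfolded k1_def]])
          then show ?thesis ..
        next
          case 2
          \<comment> \<open>For the complement, A takes the place of B: degrees in G are codegrees
            in the complement.\<close>
          have Ac: "A = {v \<in> verts (complement G). (1 + \<epsilon>) * n / s \<le> real (deg (complement (complement G)) v)}"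
            by (simp add: A_def complement_simps(1) complement_complement[OF G])
          have "turan_graph s (complement G)"
            by (rule low_degree_part_turan[OF nt2 Gc nc big(2) minc r1(2) Ac sub(2) fin(2) kB 2 \<epsilon>(1,4) nr(2) \<delta>(4)[unfolded k2_def]])
          then show ?thesis ..
        qed
        then show "turan_graph (chromatic_number H1 - 1) G \<or> turan_graph (chromatic_number H2 - 1) (complement G)"
          using cH by simp
      qed
    qed
  qed
qed

end
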